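(* Let $\gamma,D>0$, let $K$ be a kernel as in the context, and let $f,g$ satisfy $(H_1)$, $(H_2)$, $(H_3)$. Suppose that for any $c\in\mathbb{R}$ there exists some $\gamma^\#=\gamma^\#(c)\in(0,+\infty]$ such that $\chi_0(z,c)<\infty$ for each $z\in[0,\gamma^\#)$ and $\chi_0(\gamma^\#(c)-,c)=\lim_{z\uparrow\gamma^\#(c)}\chi_0(z,c)=+\infty$. Suppose that, for some $L>0$, $|g(s_1)-g(s_2)|\le L|s_1-s_2|$ for all $s_1,s_2\ge0$, and let $\chi_L$ and $c_\star$ be defined with this $L$. Then the system $$\begin{cases}u_t(t,x)=u_{xx}(t,x)-f(u(t,x))+\int_0^\infty\int_{\mathbb{R}}K(s,w)g(u(t-s,x-w))\,dw\,ds,\\ v_t(t,x)=Dv_{xx}(t,x)-\gamma v(t,x)+g(u(t,x))-\int_0^\infty\int_{\mathbb{R}}K(s,w)g(u(t-s,x-w))\,dw\,ds,\end{cases}$$ admits at most one (modulo translation) semi-wavefront solution $(u(t,x),v(t,x))=(\phi(x+ct),\psi(x+ct))$, $\phi(-\infty)=\psi(-\infty)=0$, for each admissible wave speed $c\ge c_\star$. Furthermore, the system has no semi-wavefront solution propagating with speed $c<c_*$.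
   Context: Kernel: $K\in L^1(\mathbb{R}_+\times\mathbb{R})$, $K\ge0$, $\int_0^\infty\int_{\mathbb{R}}K(s,w)\,dw\,ds=1$ ($K$ may be asymmetric in $w$). Hypotheses: $(H_1)$ $g\in C(\mathbb{R}_+,\mathbb{R}_+)$, $g(0)=0$, $g(s)>0$ for all $s>0$, $g$ is differentiable at $0$ with $g'(0)>0$. $(H_2)$ $f\in C^1(\mathbb{R}_+,\mathbb{R}_+)$, $f(0)=0$, $f$ is strictly increasing, and $f'(0)<g'(0)$. $(H_3)$ $f,g\in C^{1,\alpha}$ in some neighborhood of $0$ (in $\mathbb{R}_+$), for some $\alpha\in(0,1)$. A semi-wavefront solution with speed $c$ is a solution $(u,v)=(\phi(x+ct),\psi(x+ct))$ where $\phi,\psi$ are continuous, non-constant, bounded on $\mathbb{R}$, positive, and $\phi(-\infty)=\psi(-\infty)=0$. A real number $c$ is an admissible wave speed if a semi-wavefront solution with speed $c$ exists. "At most one modulo translation" means that any two such solutions with the same $c$ have profiles that coincide after a common shift of the argument. Characteristic functions (for real $z\ge0$, $c\in\mathbb{R}$): $$\chi_0(z,c)=z^2-cz-f'(0)+g'(0)\int_0^\infty\int_{\mathbb{R}}K(s,w)e^{-z(cs+w)}\,dw\,ds,$$ $$\chi_L(z,c)=z^2-cz-\inf_{s\ge0}f'(s)+L\int_0^\infty\int_{\mathbb{R}}K(s,w)e^{-z(cs+w)}\,dw\,ds.$$ $c_*$ (respectively $c_\star$) is the minimal value of $c$ for which $\chi_0(\cdot,c)$ (respectively $\chi_L(\cdot,c)$)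 has at least one positive root. *)

theory Defs
  imports "HOL-Analysis.Analysis"
begin

text \<open>Functions on the half-line are modelled as \<^typ>\<open>real \<Rightarrow> real\<close>; only their values on \<^term>\<open>{0::real..}\<close>
  matter. Derivatives are taken relative to the half-line, hence one-sided at 0.\<close>

definition hderiv :: "(real \<Rightarrow> real) \<Rightarrow> real \<Rightarrow> real" where
  "hderiv f s = vector_derivative f (at s within {0..})"

text \<open>The kernel is a Borel representative of an element of \<open>L\<^sup>1\<close>, so its sign is only prescribed
  almost everywhere.\<close>

definition wave_kernel :: "(real \<Rightarrow> real \<Rightarrow> real) \<Rightarrow> bool" where
  "wave_kernel K \<longleftrightarrow>
     set_integrable lborel ({0..} \<times> UNIV) (\<lambda>(s, w). K s w) \<and>
     (AE (s, w) in lborel. 0 \<le> s \<longrightarrow> 0 \<le> K s w) \<and>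
     (LBINT s:{0..}. (LBINT w. K s w)) = 1"

definition H1 :: "(real \<Rightarrow> real) \<Rightarrow> bool" where
  "H1 g \<longleftrightarrow>
     continuous_on {0..} g \<and> (\<forall>s\<ge>0. 0 \<le> g s) \<and> g 0 = 0 \<and> (\<forall>s>0. 0 < g s) \<and>
     g differentiable (at 0 within {0..}) \<and> 0 < hderiv g 0"

definition H2 :: "(real \<Rightarrow> real) \<Rightarrow> (real \<Rightarrow> real) \<Rightarrow> bool" where
  "H2 f g \<longleftrightarrow>
     f differentiable_on {0..} \<and> continuous_on {0..} (hderiv f) \<and> (\<forall>s\<ge>0. 0 \<le> f s) \<and>
     f 0 = 0 \<and> strict_mono_on {0..} f \<and> hderiv f 0 < hderiv g 0"

definition C1_holder_near_0 :: "real \<Rightarrow> (real \<Rightarrow> real) \<Rightarrow> bool" where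
  "C1_holder_near_0 \<alpha> h \<longleftrightarrow>
     (\<exists>\<delta>>0. (\<forall>s\<in>{0..<\<delta>}. h differentiable (at s within {0..})) \<and>
       (\<exists>C. \<forall>s\<in>{0..<\<delta>}. \<forall>r\<in>{0..<\<delta>}. \<bar>hderiv h s - hderiv h r\<bar> \<le> C * \<bar>s - r\<bar> powr \<alpha>))"

definition H3 :: "(real \<Rightarrow> real) \<Rightarrow> (real \<Rightarrow> real) \<Rightarrow> bool" where
  "H3 f g \<longleftrightarrow> (\<exists>\<alpha>. 0 < \<alpha> \<and> \<alpha> < 1 \<and> C1_holder_near_0 \<alpha> f \<and> C1_holder_near_0 \<alpha> g)"

text \<open>The characteristic functions may take the value \<open>+\<infinity>\<close>, so they are \<^typ>\<open>ereal\<close>-valued and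
  the integral of the (almost everywhere nonnegative) integrand is the nonnegative one.\<close>

definition char_fun :: "real \<Rightarrow> real \<Rightarrow> (real \<Rightarrow> real \<Rightarrow> real) \<Rightarrow> real \<Rightarrow> real \<Rightarrow> ereal" where
  "char_fun a b K z c =
     ereal (z\<^sup>2 - c * z - a) +
     ereal b * enn2ereal
       (\<integral>\<^sup>+s\<in>{0..}. (\<integral>\<^sup>+w. ennreal (K s w * exp (- z * (c * s + w))) \<partial>lborel) \<partial>lborel)"

definition chi_0 ::
    "(real \<Rightarrow> real \<Rightarrow> real) \<Rightarrow> (real \<Rightarrow> real) \<Rightarrow> (real \<Rightarrow> real) \<Rightarrow> real \<Rightarrow> real \<Rightarrow> ereal" where
  "chi_0 K f g = char_fun (hderiv f 0) (hderiv g 0) K"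

definition chi_L ::
    "(real \<Rightarrow> real \<Rightarrow> real) \<Rightarrow> (real \<Rightarrow> real) \<Rightarrow> real \<Rightarrow> real \<Rightarrow> real \<Rightarrow> ereal" where
  "chi_L K f L = char_fun (INF s\<in>{0..}. hderiv f s) L K"

text \<open>For both characteristic functions the hypotheses of the theorem guarantee that this minimum is
  attained, so no existence assumption is needed.\<close>

definition min_root_speed :: "(real \<Rightarrow> real \<Rightarrow> ereal) \<Rightarrow> real" where
  "min_root_speed X = (LEAST c. \<exists>z>0. X z c = 0)"

text \<open>The left limit at \<open>\<gamma>\<close> is taken in \<^typ>\<open>ereal\<close>, so that \<open>\<gamma> = \<infinity>\<close> means the limit for
  \<open>z \<rightarrow> \<infinity>\<close>; near \<open>\<gamma>\<close> from the left, \<^const>\<open>real_of_ereal\<close> only sees finite arguments.\<close>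

definition blows_up :: "(real \<Rightarrow> real \<Rightarrow> ereal) \<Rightarrow> real \<Rightarrow> bool" where
  "blows_up X c \<longleftrightarrow>
     (\<exists>\<gamma>::ereal. 0 < \<gamma> \<and> (\<forall>z\<ge>0. ereal z < \<gamma> \<longrightarrow> X z c < \<infinity>) \<and>
       ((\<lambda>z. X (real_of_ereal z) c) \<longlongrightarrow> \<infinity>) (at_left \<gamma>))"

text \<open>For bounded, continuous, positive \<open>u\<close>, continuous \<open>g\<close> and integrable \<open>K\<close> the integrals below converge
  absolutely.\<close>

definition nonlocal_birth ::
    "(real \<Rightarrow> real \<Rightarrow> real) \<Rightarrow> (real \<Rightarrow> real) \<Rightarrow> (real \<Rightarrow> real \<Rightarrow> real) \<Rightarrow> real \<Rightarrow> real \<Rightarrow> real" where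
  "nonlocal_birth K g u t x = (LBINT s:{0..}. (LBINT w. K s w * g (u (t - s) (x - w))))"

text \<open>Classical solutions for all real times; the arguments of \<open>u\<close> and \<open>v\<close> are time and space.\<close>

definition solves_system ::
    "real \<Rightarrow> real \<Rightarrow> (real \<Rightarrow> real \<Rightarrow> real) \<Rightarrow> (real \<Rightarrow> real) \<Rightarrow> (real \<Rightarrow> real) \<Rightarrow>
     (real \<Rightarrow> real \<Rightarrow> real) \<Rightarrow> (real \<Rightarrow> real \<Rightarrow> real) \<Rightarrow> bool" where
  "solves_system \<gamma> D K f g u v \<longleftrightarrow>
     (\<exists>u_t u_x u_xx v_t v_x v_xx. \<forall>t x.
        ((\<lambda>t. u t x) has_real_derivative u_t t x) (at t) \<and>
        ((\<lambda>x. u t x) has_real_derivative u_x t x) (at x) \<and>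
        ((\<lambda>x. u_x t x) has_real_derivative u_xx t x) (at x) \<and>
        ((\<lambda>t. v t x) has_real_derivative v_t t x) (at t) \<and>
        ((\<lambda>x. v t x) has_real_derivative v_x t x) (at x) \<and>
        ((\<lambda>x. v_x t x) has_real_derivative v_xx t x) (at x) \<and>
        u_t t x = u_xx t x - f (u t x) + nonlocal_birth K g u t x \<and>
        v_t t x = D * v_xx t x - \<gamma> * v t x + g (u t x) - nonlocal_birth K g u t x)"

definition semi_wave_profile :: "(real \<Rightarrow> real) \<Rightarrow> bool" where
  "semi_wave_profile \<phi> \<longleftrightarrow>
     continuous_on UNIV \<phi> \<and> \<not> \<phi> constant_on UNIV \<and> bounded (range \<phi>) \<and>
     (\<forall>x. 0 < \<phi> x) \<and> (\<phi> \<longlongrightarrow> 0) at_bot"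

definition semi_wavefront ::
    "real \<Rightarrow> real \<Rightarrow> (real \<Rightarrow> real \<Rightarrow> real) \<Rightarrow> (real \<Rightarrow> real) \<Rightarrow> (real \<Rightarrow> real) \<Rightarrow>
     real \<Rightarrow> (real \<Rightarrow> real) \<Rightarrow> (real \<Rightarrow> real) \<Rightarrow> bool" where
  "semi_wavefront \<gamma> D K f g c \<phi> \<psi> \<longleftrightarrow>
     semi_wave_profile \<phi> \<and> semi_wave_profile \<psi> \<and>
     solves_system \<gamma> D K f g (\<lambda>t x. \<phi> (x + c * t)) (\<lambda>t x. \<psi> (x + c * t))"

definition admissible_speed ::
    "real \<Rightarrow> real \<Rightarrow> (real \<Rightarrow> real \<Rightarrow> real) \<Rightarrow> (real \<Rightarrow> real) \<Rightarrow> (real \<Rightarrow> real) \<Rightarrow> real \<Rightarrow> bool" where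
  "admissible_speed \<gamma> D K f g c \<longleftrightarrow> (\<exists>\<phi> \<psi>. semi_wavefront \<gamma> D K f g c \<phi> \<psi>)"

definition unique_mod_translation ::
    "real \<Rightarrow> real \<Rightarrow> (real \<Rightarrow> real \<Rightarrow> real) \<Rightarrow> (real \<Rightarrow> real) \<Rightarrow> (real \<Rightarrow> real) \<Rightarrow> real \<Rightarrow> bool" where
  "unique_mod_translation \<gamma> D K f g c \<longleftrightarrow>
     (\<forall>\<phi>\<^sub>1 \<psi>\<^sub>1 \<phi>\<^sub>2 \<psi>\<^sub>2.
        semi_wavefront \<gamma> D K f g c \<phi>\<^sub>1 \<psi>\<^sub>1 \<and> semi_wavefront \<gamma> D K f g c \<phi>\<^sub>2 \<psi>\<^sub>2 \<longrightarrow>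
        (\<exists>h. \<forall>x. \<phi>\<^sub>2 x = \<phi>\<^sub>1 (x + h) \<and> \<psi>\<^sub>2 x = \<psi>\<^sub>1 (x + h)))"

end

theory Submission
  imports Defs
begin

text \<open>
  With \<open>\<nu>\<close> the law of \<open>c * s + w\<close> under \<open>K\<close>, a profile satisfies \<open>\<phi>'' - c \<phi>' - f \<phi> + \<integral> g (\<phi> (t - r)) d\<nu> = 0\<close>.
  As long as \<open>\<chi>\<^sub>0\<close> is positive up to an exponent, testing the equation against weights close to \<open>exp (- z t)\<close>
  shows that \<open>\<phi>\<close> decays beyond this exponent at \<open>-\<infinity>\<close>. Since \<open>\<phi>\<close> cannot decay faster than every exponential,
  \<open>\<chi>\<^sub>0\<close> has a positive root; this is the nonexistence part.

  For uniqueness let \<open>lam\<close> minimise \<open>\<chi>\<^sub>L\<close>, so that \<open>\<chi>\<^sub>L lam \<le> 0\<close>. If the difference of two profiles is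
  \<open>O(exp (lam t))\<close>, then its ratio to \<open>exp (lam t)\<close> is a bounded function whose square is subharmonic for a random
  walk without drift, hence constant, hence zero; comparing with the zero solution, no profile is itself
  \<open>O(exp (lam t))\<close>. It remains to match the leading asymptotics by a translation. Either \<open>\<chi>\<^sub>0 lam < 0\<close>, and every
  profile is asymptotic to a positive multiple of \<open>exp (l1 t)\<close> for the smaller root \<open>l1\<close> of \<open>\<chi>\<^sub>0\<close>, or
  \<open>\<chi>\<^sub>L = \<chi>\<^sub>0\<close> has the double root \<open>lam\<close>, and the coefficient of \<open>t exp (lam t)\<close> is negative for every profile.
\<close>

section \<open>Exponential moments of a measure on the line\<close>

text \<open>The obstacle is how little is known of a profile at minus infinity: testing with weights
  gives decay at every exponent strictly below a root of \<open>chi0\<close>, not at the root, so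
  the ratio of a profile to the characteristic exponential is at first only subexponential
  (\<open>slow\<close>). Asymptotics are obtained without Laplace inversion or Tauberian theorems.
  At a root the ratio w solves w'' = J w - a w' + \<rho>, where \<open>J\<close> commutes with
  differentiation and \<rho> is exponentially small by the Hoelder condition at 0. Antiderivatives
  of this equation therefore converge at an exponential rate, and w is recovered from them because
  it is nearly constant around its peaks. The constant L acts through the convex
  \<open>\<chi>\<^sub>L\<close>, whose excess over \<open>\<chi>\<^sub>0\<close> is (q - m) + (L -
  p) * lap with both terms nonnegative; this is why only two cases arise. The blow-up hypothesis
  places the minimiser of \<open>\<chi>\<^sub>L\<close> in the interior of the range of finite
  moments, where its derivative vanishes. The second component solves a linear equation whose source
  depends on the first one only, and a bounded solution of it is unique.\<close>

lemma has_real_derivative_lebesgue_integral: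
  fixes F F' :: "real \<Rightarrow> 'a \<Rightarrow> real"
  assumes t0: "t0 \<in> {a<..<b}"
    and deriv: "\<And>t r. t \<in> {a<..<b} \<Longrightarrow> r \<in> space M \<Longrightarrow> ((\<lambda>t. F t r) has_real_derivative F' t r) (at t)"
    and int: "\<And>t. t \<in> {a<..<b} \<Longrightarrow> integrable M (F t)"
    and meas: "F' t0 \<in> borel_measurable M"
    and bound: "\<And>t r. t \<in> {a<..<b} \<Longrightarrow> r \<in> space M \<Longrightarrow> \<bar>F' t r\<bar> \<le> B r"
    and intB: "integrable M B"
  shows "((\<lambda>t. \<integral>r. F t r \<partial>M) has_real_derivative (\<integral>r. F' t0 r \<partial>M)) (at t0)"
proof -
  have "((\<lambda>y. ((\<integral>r. F y r \<partial>M) - (\<integral>r. F t0 r \<partial>M)) / (y - t0)) \<longlongrightarrow> (\<integral>r. F' t0 r \<partial>M))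
      (at t0 within {a<..<b})"
    unfolding tendsto_at_iff_sequentially
  proof (intro allI impI)
    fix X assume X: "\<forall>i. X i \<in> {a<..<b} - {t0}" and lim: "X \<longlonglongrightarrow> t0"
    have "(\<lambda>i. \<integral>r. (F (X i) r - F t0 r) / (X i - t0) \<partial>M) \<longlonglongrightarrow> (\<integral>r. F' t0 r \<partial>M)"
    proof (rule integral_dominated_convergence[where w = B])
      show "AE r in M. (\<lambda>i. (F (X i) r - F t0 r) / (X i - t0)) \<longlonglongrightarrow> F' t0 r"
      proof (rule AE_I2)
        fix r assume r: "r \<in> space M"
        have "((\<lambda>y. (F y r - F t0 r) / (y - t0)) \<longlongrightarrow> F' t0 r) (at t0)"
          using deriv[OF t0 r] by (simp add: has_field_derivative_iff)
        then show "(\<lambda>i. (F (X i) r - F t0 r) / (X i - t0)) \<longlonglongrightarrow> F' t0 r"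
          using X lim unfolding tendsto_at_iff_sequentially comp_def by auto
      qed
      show "AE r in M. norm ((F (X i) r - F t0 r) / (X i - t0)) \<le> B r" for i
      proof (rule AE_I2)
        fix r assume r: "r \<in> space M"
        have "norm (F (X i) r - F t0 r) \<le> B r * norm (X i - t0)"
          by (rule field_differentiable_bound[where S = "{a<..<b}" and f' = "\<lambda>t. F' t r"])
             (use X t0 deriv r bound in \<open>auto intro: has_field_derivative_at_within\<close>)
        moreover have "X i - t0 \<noteq> 0" using X by auto
        ultimately show "norm ((F (X i) r - F t0 r) / (X i - t0)) \<le> B r"
          by (simp add: divide_simps abs_divide)
      qed
      show "(\<lambda>r. (F (X i) r - F t0 r) / (X i - t0)) \<in> borel_measurable M" for i
        using int[of "X i"] int[OF t0] X by (intro borel_measurable_divide borel_measurable_diff) auto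
    qed (use meas intB in auto)
    moreover have "(\<integral>r. (F (X i) r - F t0 r) / (X i - t0) \<partial>M) =
        ((\<integral>r. F (X i) r \<partial>M) - (\<integral>r. F t0 r \<partial>M)) / (X i - t0)" for i
      using int[of "X i"] int[OF t0] X by simp
    ultimately show "((\<lambda>y. ((\<integral>r. F y r \<partial>M) - (\<integral>r. F t0 r \<partial>M)) / (y - t0)) \<circ> X)
        \<longlonglongrightarrow> (\<integral>r. F' t0 r \<partial>M)"
      by (simp only: comp_def)
  qed
  then show ?thesis
    using t0 by (simp add: has_field_derivative_iff at_within_open[of t0 "{a<..<b}"])
qed

lemma antiderivative_exists:
  fixes X :: "real \<Rightarrow> real"
  assumes "continuous_on UNIV X"
  obtains P where "\<And>t. (P has_real_derivative X t) (at t)"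
proof -
  have "\<exists>F. \<forall>x::real. -\<infinity> < ereal x \<longrightarrow> ereal x < \<infinity> \<longrightarrow> (F has_vector_derivative X x) (at x)"
    by (rule einterval_antiderivative) (use assms in \<open>auto simp: continuous_on_eq_continuous_at\<close>)
  then show ?thesis using that by (auto simp: has_real_derivative_iff_has_vector_derivative)
qed

lemma abs_le_exp_divide: "0 < h \<Longrightarrow> \<bar>r\<bar> \<le> exp (h * \<bar>r\<bar>) / h" for r h :: real
proof -
  assume h: "0 < h"
  have "\<bar>r\<bar> * h \<le> exp (h * \<bar>r\<bar>)"
    using exp_ge_add_one_self[of "h * \<bar>r\<bar>"] by (simp only: mult.commute[of "\<bar>r\<bar>"])
  then show ?thesis using h by (simp add: pos_le_divide_eq)
qed

lemma square_le_exp_divide: "0 < h \<Longrightarrow> r\<^sup>2 \<le> 2 * exp (h * \<bar>r\<bar>) / h\<^sup>2" for r h :: real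
  using exp_lower_Taylor_quadratic[of "h * \<bar>r\<bar>"] by (simp add: field_simps power2_eq_square) 
     (smt (verit) mult_nonneg_nonneg abs_ge_zero)

locale finite_borel = finite_measure \<nu> for \<nu> :: "real measure" +
  assumes sets_nu [measurable_cong]: "sets \<nu> = sets borel"
begin

lemma space_nu [simp]: "space \<nu> = UNIV"
  using sets_eq_imp_space_eq[OF sets_nu] by simp

lemma borel_measurable_nu: "f \<in> borel_measurable borel \<Longrightarrow> f \<in> borel_measurable \<nu>"
  by (simp add: measurable_cong_sets[OF sets_nu refl])

lemma measurable_cont: "continuous_on UNIV f \<Longrightarrow> f \<in> borel_measurable \<nu>" for f :: "real \<Rightarrow> real"
  by (intro borel_measurable_nu borel_measurable_continuous_onI)

text \<open>\<open>lap\<close> is the bilateral Laplace transform of \<open>\<nu>\<close>. It is 0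
  by convention where the integral diverges, so it is meaningful only together with
  \<open>mom z\<close>.\<close>

definition "mom z \<longleftrightarrow> integrable \<nu> (\<lambda>r. exp (- z * r))" for z :: real
definition "lap z = (\<integral>r. exp (- z * r) \<partial>\<nu>)" for z :: real

lemma mom_0: "mom 0" by (simp add: mom_def)

lemma lap_0: "lap 0 = measure \<nu> UNIV" by (simp add: lap_def)

lemma lap_nonneg: "0 \<le> lap z" by (simp add: lap_def)

text \<open>One of the two endpoints already dominates, which one depending on the sign of
  \<open>r\<close>. The sum is an integrable majorant that serves the whole interval at
  once.\<close>

lemma exp_between: "a \<le> z \<Longrightarrow> z \<le> b \<Longrightarrow> exp (- z * r) \<le> exp (- a * r) + exp (- b * r)" for a z b r :: real
proof -
  assume "a \<le> z" "z \<le> b"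
  then have "- z * r \<le> - a * r \<or> - z * r \<le> - b * r"
    by (cases "r \<ge> 0") (auto simp: mult_right_mono mult_right_mono_neg)
  then have "exp (- z * r) \<le> exp (- a * r) \<or> exp (- z * r) \<le> exp (- b * r)"
    unfolding exp_le_cancel_iff .
  then show ?thesis
    using exp_ge_zero[of "- a * r"] exp_ge_zero[of "- b * r"] by linarith
qed

lemma mom_between: assumes "mom a" "mom b" "a \<le> z" "z \<le> b" shows "mom z"
  unfolding mom_def
proof (rule Bochner_Integration.integrable_bound)
  show "integrable \<nu> (\<lambda>r. exp (- a * r) + exp (- b * r))"
    using assms by (simp add: mom_def)
qed (use exp_between[OF assms(3,4)] in \<open>auto intro!: AE_I2 measurable_cont continuous_intros\<close>)

lemma continuous_on_lap: assumes "mom a" "mom b" shows "continuous_on {a..b} lap"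
  unfolding continuous_on_def lap_def tendsto_at_iff_sequentially comp_def
proof (intro ballI allI impI)
  fix z X assume z: "z \<in> {a..b}" and X: "\<forall>i. X i \<in> {a..b} - {z}" and lim: "X \<longlonglongrightarrow> z"
  show "(\<lambda>i. \<integral>r. exp (- X i * r) \<partial>\<nu>) \<longlonglongrightarrow> (\<integral>r. exp (- z * r) \<partial>\<nu>)"
  proof (rule integral_dominated_convergence[where w = "\<lambda>r. exp (- a * r) + exp (- b * r)"])
    show "AE r in \<nu>. norm (exp (- X i * r)) \<le> exp (- a * r) + exp (- b * r)" for i
      using X exp_between[of a "X i" b] by auto
    show "AE r in \<nu>. (\<lambda>i. exp (- X i * r)) \<longlonglongrightarrow> exp (- z * r)"
      by (auto intro!: tendsto_intros lim)
  qed (use assms in \<open>auto simp: mom_def intro!: measurable_cont continuous_intros\<close>)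
qed

lemma exp_abs_le: "exp (- z * r) * exp (h * \<bar>r\<bar>) \<le> exp (- (z - h) * r) + exp (- (z + h) * r)" for z r h :: real
  by (cases "r \<ge> 0") (auto simp: exp_add[symmetric] algebra_simps)

lemma exp_moment:
  assumes "mom (z - h)" "mom (z + h)"
  shows "integrable \<nu> (\<lambda>r. exp (- z * r) * exp (h * \<bar>r\<bar>))"
proof (rule Bochner_Integration.integrable_bound)
  show "integrable \<nu> (\<lambda>r. exp (- (z - h) * r) + exp (- (z + h) * r))"
    using assms unfolding mom_def by (rule Bochner_Integration.integrable_add)
qed (use exp_abs_le[of z _ h] in \<open>auto intro!: AE_I2 measurable_cont continuous_intros\<close>)

lemma first_moment:
  assumes "mom (z - h)" "mom (z + h)" "0 < h"
  shows "integrable \<nu> (\<lambda>r. r * exp (- z * r))"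
proof (rule Bochner_Integration.integrable_bound)
  show "integrable \<nu> (\<lambda>r. (exp (- z * r) * exp (h * \<bar>r\<bar>)) / h)"
    using exp_moment[OF assms(1,2)] by simp
  have "\<bar>r\<bar> * exp (- z * r) \<le> exp (- z * r) * exp (h * \<bar>r\<bar>) / h" for r
    using mult_right_mono[OF abs_le_exp_divide[OF assms(3), of r], of "exp (- z * r)"] by (simp add: mult_ac)
  then show "AE r in \<nu>. norm (r * exp (- z * r)) \<le> norm ((exp (- z * r) * exp (h * \<bar>r\<bar>)) / h)"
    using assms(3) by (auto simp: abs_mult)
qed (auto intro!: measurable_cont continuous_intros)

text \<open>The inequality 1 + x \<le> exp x, integrated against \<open>exp (- z0 * r)\<close>. This
  is the form in which convexity of \<open>chi0\<close> is used later.\<close>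

lemma lap_tangent:
  assumes "mom z" "mom z0" "integrable \<nu> (\<lambda>r. r * exp (- z0 * r))"
  shows "lap z0 - (z - z0) * (\<integral>r. r * exp (- z0 * r) \<partial>\<nu>) \<le> lap z"
proof -
  have "lap z0 - (z - z0) * (\<integral>r. r * exp (- z0 * r) \<partial>\<nu>)
      = (\<integral>r. exp (- z0 * r) - (z - z0) * (r * exp (- z0 * r)) \<partial>\<nu>)"
    using assms by (simp add: mom_def lap_def)
  also have "\<dots> \<le> lap z"
    unfolding lap_def
  proof (rule integral_mono)
    show "integrable \<nu> (\<lambda>r. exp (- z0 * r) - (z - z0) * (r * exp (- z0 * r)))"
      using assms by (auto simp: mom_def)
    fix r
    have "(1 - (z - z0) * r) * exp (- z0 * r) \<le> exp (- (z - z0) * r) * exp (- z0 * r)"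
      using exp_ge_add_one_self[of "- (z - z0) * r"] by (intro mult_right_mono) (linarith, simp)
    also have "\<dots> = exp (- z * r)" by (simp add: exp_add[symmetric] algebra_simps)
    finally show "exp (- z0 * r) - (z - z0) * (r * exp (- z0 * r)) \<le> exp (- z * r)"
      by (simp add: algebra_simps)
  qed (use assms in \<open>auto simp: mom_def\<close>)
  finally show ?thesis .
qed

lemma DERIV_lap:
  assumes "mom (z - h)" "mom (z + h)" "0 < h"
  shows "(lap has_real_derivative - (\<integral>r. r * exp (- z * r) \<partial>\<nu>)) (at z)"
proof -
  have "((\<lambda>z. \<integral>r. exp (- z * r) \<partial>\<nu>) has_real_derivative (\<integral>r. - (r * exp (- z * r)) \<partial>\<nu>)) (at z)"
  proof (rule has_real_derivative_lebesgue_integral[where a = "z - h/2" and b = "z + h/2"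
      and B = "\<lambda>r. (exp (- z * r) * exp (h * \<bar>r\<bar>)) / (h/2)" and F' = "\<lambda>z r. - (r * exp (- z * r))"])
    show "integrable \<nu> (\<lambda>r. exp (- t * r))" if "t \<in> {z - h/2<..<z + h/2}" for t
      using mom_between[OF assms(1,2), of t] that assms(3) by (auto simp: mom_def)
    show "integrable \<nu> (\<lambda>r. (exp (- z * r) * exp (h * \<bar>r\<bar>)) / (h/2))"
      using exp_moment[OF assms(1,2)] by simp
    fix t r assume t: "t \<in> {z - h/2<..<z + h/2}"
    have "\<bar>t - z\<bar> \<le> h/2" using t unfolding greaterThanLessThan_iff by linarith
    then have "\<bar>t - z\<bar> * \<bar>r\<bar> \<le> (h/2) * \<bar>r\<bar>" by (rule mult_right_mono) auto
    then have "- (t - z) * r \<le> (h/2) * \<bar>r\<bar>"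
      using abs_le_D1[of "- (t - z) * r" "\<bar>t - z\<bar> * \<bar>r\<bar>"] by (simp add: abs_mult abs_minus_commute)
    then have le: "- t * r \<le> - z * r + (h/2) * \<bar>r\<bar>" by (simp add: algebra_simps)
    \<comment> \<open>Half of \<open>h\<close> pays for the displacement from \<open>z\<close> to
      \<open>t\<close>, the other half for the factor \<open>\<bar>r\<bar>\<close>.\<close>
    have "\<bar>r\<bar> * exp (- t * r) \<le> (exp ((h/2) * \<bar>r\<bar>) / (h/2)) * exp (- z * r + (h/2) * \<bar>r\<bar>)"
      using le abs_le_exp_divide[of "h/2" r] assms(3) by (intro mult_mono) auto
    also have "\<dots> = (exp (- z * r) * exp (h * \<bar>r\<bar>)) / (h/2)"
      by (simp add: exp_add[symmetric] algebra_simps)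
    finally show "\<bar>- (r * exp (- t * r))\<bar> \<le> (exp (- z * r) * exp (h * \<bar>r\<bar>)) / (h/2)"
      by (simp add: abs_mult)
  next
    show "(\<lambda>r. - (r * exp (- z * r))) \<in> borel_measurable \<nu>"
      by (intro measurable_cont continuous_intros)
  qed (use assms(3) in \<open>auto intro!: derivative_eq_intros\<close>)
  then show ?thesis by (simp add: lap_def[abs_def])
qed

lemma lap_pos: assumes "mom z" "0 < measure \<nu> UNIV" shows "0 < lap z"
proof -
  have "lap z \<noteq> 0"
  proof
    assume "lap z = 0"
    then have "AE r in \<nu>. exp (- z * r) = 0"
      using assms integral_nonneg_eq_0_iff_AE[of \<nu> "\<lambda>r. exp (- z * r)"] by (auto simp: lap_def mom_def)
    then have "AE r in \<nu>. False" by auto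
    then have "emeasure \<nu> (space \<nu>) = 0" by (simp add: AE_iff_measurable[OF _ refl])
    then show False using assms(2) by (simp add: measure_def)
  qed
  then show ?thesis using lap_nonneg[of z] by linarith
qed

end

section \<open>Slowly growing functions and a convolution operator\<close>

lemma antiderivative_diff_le:
  fixes P X :: "real \<Rightarrow> real"
  assumes "\<And>t. (P has_real_derivative X t) (at t)" "\<And>u. \<bar>u - t\<bar> \<le> \<bar>s - t\<bar> \<Longrightarrow> \<bar>X u\<bar> \<le> C"
  shows "\<bar>P s - P t\<bar> \<le> C * \<bar>s - t\<bar>"
proof -
  have "norm (P s - P t) \<le> C * norm (s - t)"
    by (rule field_differentiable_bound[where S = "{t - \<bar>s - t\<bar>..t + \<bar>s - t\<bar>}" and f' = X])
       (use assms in \<open>auto intro: has_field_derivative_at_within\<close>)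
  then show ?thesis by simp
qed

lemma DERIV_compose_diff:
  fixes r :: real
  assumes "\<And>t. (f has_real_derivative f' t) (at t)"
  shows "((\<lambda>t. f (t - r)) has_real_derivative f' (t - r)) (at t)"
proof -
  have "((\<lambda>t. f (t - r)) has_real_derivative f' (t - r) * 1) (at t)"
    by (rule DERIV_chain2[OF assms]) (auto intro!: derivative_eq_intros)
  then show ?thesis by simp
qed

lemma DERIV_compose_uminus:
  assumes "\<And>t. (f has_real_derivative f' t) (at t)"
  shows "((\<lambda>t. f (- t)) has_real_derivative - f' (- t)) (at (t::real))"
proof -
  have "((\<lambda>t. f (- t)) has_real_derivative f' (- t) * - 1) (at t)"
    by (rule DERIV_chain2[OF assms]) (auto intro!: derivative_eq_intros)
  then show ?thesis by simp
qed

text \<open>Subexponential growth in both directions. A profile that decays at every exponent below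
  \<open>lam\<close> has a ratio to \<open>exp (lam * t)\<close> of this kind, and unlike
  boundedness the property survives taking antiderivatives.\<close>

definition slow :: "(real \<Rightarrow> real) \<Rightarrow> bool" where
  "slow X \<longleftrightarrow> continuous_on UNIV X \<and> (\<forall>\<epsilon>>0. \<exists>C. \<forall>t. \<bar>X t\<bar> \<le> C * exp (\<epsilon> * \<bar>t\<bar>))"

lemma slowD:
  assumes "slow X" "0 < \<epsilon>"
  obtains C where "0 < C" "\<And>t. \<bar>X t\<bar> \<le> C * exp (\<epsilon> * \<bar>t\<bar>)"
proof -
  obtain C where C: "\<And>t. \<bar>X t\<bar> \<le> C * exp (\<epsilon> * \<bar>t\<bar>)" using assms by (auto simp: slow_def)
  have "C * exp (\<epsilon> * \<bar>t\<bar>) \<le> (\<bar>C\<bar> + 1) * exp (\<epsilon> * \<bar>t\<bar>)" for t by (intro mult_right_mono) auto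
  then have "\<bar>X t\<bar> \<le> (\<bar>C\<bar> + 1) * exp (\<epsilon> * \<bar>t\<bar>)" for t using C[of t] by (meson order_trans)
  then show ?thesis by (intro that[of "\<bar>C\<bar> + 1"]) auto
qed

lemma slow_continuous: "slow X \<Longrightarrow> continuous_on UNIV X" by (simp add: slow_def)

lemma slow_diff: assumes "slow X" "slow Y" shows "slow (\<lambda>t. X t - Y t)"
  unfolding slow_def
proof (intro conjI allI impI)
  show "continuous_on UNIV (\<lambda>t. X t - Y t)" using assms by (auto simp: slow_def intro: continuous_intros)
  fix \<epsilon> :: real assume "0 < \<epsilon>"
  obtain C1 where C1: "\<And>t. \<bar>X t\<bar> \<le> C1 * exp (\<epsilon> * \<bar>t\<bar>)" using slowD[OF assms(1) \<open>0 < \<epsilon>\<close>] by blast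
  obtain C2 where C2: "\<And>t. \<bar>Y t\<bar> \<le> C2 * exp (\<epsilon> * \<bar>t\<bar>)" using slowD[OF assms(2) \<open>0 < \<epsilon>\<close>] by blast
  have "\<bar>X t - Y t\<bar> \<le> (C1 + C2) * exp (\<epsilon> * \<bar>t\<bar>)" for t
    using C1[of t] C2[of t] by (simp add: distrib_right)
  then show "\<exists>C. \<forall>t. \<bar>X t - Y t\<bar> \<le> C * exp (\<epsilon> * \<bar>t\<bar>)" by blast
qed

lemma slow_bounded: assumes "continuous_on UNIV X" "\<And>t. \<bar>X t\<bar> \<le> C" shows "slow X"
  unfolding slow_def
proof (intro conjI allI impI exI)
  fix \<epsilon> t :: real assume "0 < \<epsilon>"
  have "0 \<le> C" using assms(2)[of 0] by linarith
  then have "C * 1 \<le> C * exp (\<epsilon> * \<bar>t\<bar>)" using \<open>0 < \<epsilon>\<close> by (intro mult_left_mono) auto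
  then show "\<bar>X t\<bar> \<le> C * exp (\<epsilon> * \<bar>t\<bar>)" using assms(2)[of t] by simp
qed (rule assms(1))

text \<open>The length \<open>\<bar>t\<bar>\<close> of the interval of integration is absorbed by
  half of the exponent \<open>\<epsilon>\<close>.\<close>

lemma slow_antiderivative:
  assumes P: "\<And>t. (P has_real_derivative X t) (at t)" and X: "slow X"
  shows "slow P"
  unfolding slow_def
proof (intro conjI allI impI)
  show "continuous_on UNIV P" using P DERIV_isCont by (auto simp: continuous_on_eq_continuous_at)
  fix \<epsilon> :: real assume e: "0 < \<epsilon>"
  then obtain C where C: "0 < C" "\<And>t. \<bar>X t\<bar> \<le> C * exp (\<epsilon>/2 * \<bar>t\<bar>)" using slowD[OF X, of "\<epsilon>/2"] by auto
  have "\<bar>P t\<bar> \<le> (\<bar>P 0\<bar> + C / (\<epsilon>/2)) * exp (\<epsilon> * \<bar>t\<bar>)" for t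
  proof -
    have "\<bar>P t - P 0\<bar> \<le> (C * exp (\<epsilon>/2 * \<bar>t\<bar>)) * \<bar>t - 0\<bar>"
    proof (rule antiderivative_diff_le[OF P])
      fix u assume "\<bar>u - 0\<bar> \<le> \<bar>t - 0\<bar>"
      then have "C * exp (\<epsilon>/2 * \<bar>u\<bar>) \<le> C * exp (\<epsilon>/2 * \<bar>t\<bar>)" using e C(1) by simp
      then show "\<bar>X u\<bar> \<le> C * exp (\<epsilon>/2 * \<bar>t\<bar>)" using C(2)[of u] by linarith
    qed
    also have "\<dots> \<le> (C * exp (\<epsilon>/2 * \<bar>t\<bar>)) * (exp (\<epsilon>/2 * \<bar>t\<bar>) / (\<epsilon>/2))"
      using abs_le_exp_divide[of "\<epsilon>/2" t] e C(1) by (intro mult_left_mono) auto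
    also have "\<dots> = C / (\<epsilon>/2) * exp (\<epsilon> * \<bar>t\<bar>)"
      by (simp add: exp_add[symmetric] field_simps)
    finally have "\<bar>P t - P 0\<bar> \<le> C / (\<epsilon>/2) * exp (\<epsilon> * \<bar>t\<bar>)" .
    moreover have "\<bar>P 0\<bar> * 1 \<le> \<bar>P 0\<bar> * exp (\<epsilon> * \<bar>t\<bar>)" using e by (intro mult_left_mono) auto
    ultimately show ?thesis by (simp add: distrib_right)
  qed
  then show "\<exists>C. \<forall>t. \<bar>P t\<bar> \<le> C * exp (\<epsilon> * \<bar>t\<bar>)" by blast
qed

text \<open>The operator factors as (d/ds - b)(d/ds - b'). Each first-order inequality is integrated
  with its exponential factor, for \<open>U' - b' * U\<close> and then for \<open>U\<close>; the
  signs of the roots keep the constants nonnegative.\<close>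

lemma ode_comparison:
  fixes U U' U'' :: "real \<Rightarrow> real"
  assumes b: "b' < 0" "0 < b" and d: "0 \<le> \<delta>"
    and U: "\<And>s. 0 \<le> s \<Longrightarrow> s \<le> R \<Longrightarrow> (U has_real_derivative U' s) (at s)"
    and U': "\<And>s. 0 \<le> s \<Longrightarrow> s \<le> R \<Longrightarrow> (U' has_real_derivative U'' s) (at s)"
    and le: "\<And>s. 0 \<le> s \<Longrightarrow> s \<le> R \<Longrightarrow> U'' s - (b + b') * U' s + b * b' * U s \<le> \<delta>"
    and init: "U 0 = 0" "U' 0 = 0" and s: "0 \<le> s" "s \<le> R"
  shows "U s \<le> \<delta> * (exp (b * R) / (b * (b - b')))"
proof -
  have y: "U' v - b' * U v \<le> \<delta> / b * exp (b * v)" if v: "0 \<le> v" "v \<le> R" for v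
  proof -
    let ?F = "\<lambda>u. (U' u - b' * U u + \<delta> / b) * exp (- b * u)"
    have "?F v \<le> ?F 0"
    proof (rule DERIV_nonpos_imp_nonincreasing[OF v(1)])
      fix u assume u: "0 \<le> u" "u \<le> v"
      then have uR: "u \<le> R" using v by linarith
      have "(?F has_real_derivative (U'' u - (b + b') * U' u + b * b' * U u - \<delta>) * exp (- b * u)) (at u)"
        using b by (auto intro!: derivative_eq_intros U[OF u(1) uR] U'[OF u(1) uR] simp: field_simps)
      moreover have "(U'' u - (b + b') * U' u + b * b' * U u - \<delta>) * exp (- b * u) \<le> 0"
        using le[OF u(1) uR] by (intro mult_nonpos_nonneg) auto
      ultimately show "\<exists>y. (?F has_real_derivative y) (at u) \<and> y \<le> 0" by blast
    qed
    then have "(U' v - b' * U v + \<delta> / b) * exp (- b * v) * exp (b * v) \<le> \<delta> / b * exp (b * v)"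
      using init by (intro mult_right_mono) auto
    moreover have "(U' v - b' * U v + \<delta> / b) * exp (- b * v) * exp (b * v) = U' v - b' * U v + \<delta> / b"
      by (simp add: mult.assoc exp_add[symmetric])
    moreover have "0 \<le> \<delta> / b" using b d by simp
    ultimately show ?thesis by linarith
  qed
  let ?G = "\<lambda>u. U u * exp (- b' * u) - \<delta> / (b * (b - b')) * exp ((b - b') * u)"
  have "?G s \<le> ?G 0"
  proof (rule DERIV_nonpos_imp_nonincreasing[OF s(1)])
    fix u assume u: "0 \<le> u" "u \<le> s"
    then have uR: "u \<le> R" using s by linarith
    have eq: "exp ((b - b') * u) = exp (b * u) * exp (- b' * u)" by (simp add: exp_add[symmetric] algebra_simps)
    have c: "\<delta> / (b * (b - b')) * (exp ((b - b') * u) * (b - b')) = \<delta> / b * exp (b * u) * exp (- b' * u)"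
      using b unfolding eq by (simp add: field_simps)
    have "(?G has_real_derivative (U' u * exp (- b' * u) + U u * (exp (- b' * u) * - b'))
         - \<delta> / (b * (b - b')) * (exp ((b - b') * u) * (b - b'))) (at u)"
      by (rule derivative_eq_intros U[OF u(1) uR] refl | simp)+
    moreover have "(U' u * exp (- b' * u) + U u * (exp (- b' * u) * - b'))
         - \<delta> / (b * (b - b')) * (exp ((b - b') * u) * (b - b'))
       = (U' u - b' * U u - \<delta> / b * exp (b * u)) * exp (- b' * u)"
      unfolding c by (simp add: algebra_simps)
    moreover have "(U' u - b' * U u - \<delta> / b * exp (b * u)) * exp (- b' * u) \<le> 0"
      using y[OF u(1) uR] by (intro mult_nonpos_nonneg) auto
    ultimately show "\<exists>y. (?G has_real_derivative y) (at u) \<and> y \<le> 0" by auto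
  qed
  also have "?G 0 \<le> 0" using init b d by simp
  finally have "U s * exp (- b' * s) * exp (b' * s) \<le> (\<delta> / (b * (b - b')) * exp ((b - b') * s)) * exp (b' * s)"
    by (intro mult_right_mono) auto
  then have "U s \<le> \<delta> / (b * (b - b')) * exp (b * s)"
    by (simp add: mult.assoc exp_add[symmetric] algebra_simps)
  also have "\<dots> \<le> \<delta> / (b * (b - b')) * exp (b * R)"
    using b d s by (intro mult_left_mono) auto
  finally show ?thesis by simp
qed

lemma quadratic_roots:
  fixes a \<kappa> :: real assumes "0 < \<kappa>"
  obtains b b' where "b' < 0" "0 < b" "b + b' = - a" "b * b' = - \<kappa>"
proof
  define d where "d = sqrt (a\<^sup>2 + 4 * \<kappa>)"
  have d2: "d\<^sup>2 = a\<^sup>2 + 4 * \<kappa>" using assms by (simp add: d_def)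
  have "\<bar>a\<bar> < d" unfolding d_def using assms by (intro real_less_rsqrt) simp
  then show "(- a - d) / 2 < 0" "0 < (- a + d) / 2" by auto
  show "(- a + d) / 2 + (- a - d) / 2 = - a" by (simp add: field_simps)
  show "(- a + d) / 2 * ((- a - d) / 2) = - \<kappa>" using d2 by (simp add: field_simps power2_eq_square)
qed

text \<open>Reflection turns negative \<open>s\<close> into positive ones and flips the sign of
  \<open>a\<close>, hence a second pair of roots. The sum of the two constants serves both
  sides.\<close>

lemma ode_comparison_two_sided:
  fixes a \<kappa> :: real assumes k: "0 < \<kappa>"
  shows "\<exists>G>0. \<forall>U U' U'' \<delta>. 0 \<le> \<delta> \<longrightarrow> (\<forall>s. (U has_real_derivative U' s) (at s)) \<longrightarrow>
     (\<forall>s. (U' has_real_derivative U'' s) (at s)) \<longrightarrow>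
     (\<forall>s. \<bar>s\<bar> \<le> R \<longrightarrow> U'' s + a * U' s - \<kappa> * U s \<le> \<delta>) \<longrightarrow> U 0 = 0 \<longrightarrow> U' 0 = 0 \<longrightarrow>
     (\<forall>s. \<bar>s\<bar> \<le> R \<longrightarrow> U s \<le> \<delta> * G)"
proof -
  obtain b b' where b: "b' < 0" "0 < b" "b + b' = - a" "b * b' = - \<kappa>" using quadratic_roots[OF k] .
  obtain e e' where e: "e' < 0" "0 < e" "e + e' = - (- a)" "e * e' = - \<kappa>" using quadratic_roots[OF k, of "-a"] .
  let ?g1 = "exp (b * R) / (b * (b - b'))" and ?g2 = "exp (e * R) / (e * (e - e'))"
  have pos: "0 < ?g1" "0 < ?g2" using b e by auto
  show ?thesis
  proof (intro exI[of _ "?g1 + ?g2"] conjI allI impI)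
    fix U U' U'' :: "real \<Rightarrow> real" and \<delta> s :: real
    assume d: "0 \<le> \<delta>" and U: "\<forall>s. (U has_real_derivative U' s) (at s)"
      and U': "\<forall>s. (U' has_real_derivative U'' s) (at s)"
      and le: "\<forall>s. \<bar>s\<bar> \<le> R \<longrightarrow> U'' s + a * U' s - \<kappa> * U s \<le> \<delta>"
      and init: "U 0 = 0" "U' 0 = 0" and s: "\<bar>s\<bar> \<le> R"
    have 1: "\<delta> * ?g1 \<le> \<delta> * (?g1 + ?g2)" "\<delta> * ?g2 \<le> \<delta> * (?g1 + ?g2)" 
      by (rule mult_left_mono[OF _ d], use pos in linarith)+
    show "U s \<le> \<delta> * (?g1 + ?g2)"
    proof (cases "0 \<le> s")
      case True
      have "U s \<le> \<delta> * ?g1"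
        by (rule ode_comparison[where U' = U' and U'' = U'']) (use b d U U' le init s True in auto)
      then show ?thesis using 1 by linarith
    next
      case False
      have "(\<lambda>v. U (- v)) (- s) \<le> \<delta> * ?g2"
      proof (rule ode_comparison[where U = "\<lambda>v. U (- v)" and s = "- s" and U' = "\<lambda>v. - U' (- v)" and U'' = "\<lambda>v. U'' (- v)"])
        show "((\<lambda>v. U (- v)) has_real_derivative - U' (- v)) (at v)" for v
          by (rule DERIV_compose_uminus) (use U in blast)
        show "((\<lambda>v. - U' (- v)) has_real_derivative U'' (- v)) (at v)" for v
          using DERIV_minus[OF DERIV_compose_uminus[of U' U'' v]] U' by simp
        fix v assume "0 \<le> v" "v \<le> R"
        then show "U'' (- v) - (e + e') * (- U' (- v)) + e * e' * U (- v) \<le> \<delta>"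
          using le[rule_format, of "- v"] unfolding e(3,4) by simp
      qed (use e d init s False in auto)
      then show ?thesis using 1 by simp
    qed
  qed (use pos in auto)
qed

text \<open>The instances are exponential tilts of \<open>\<nu>\<close> at an interior point of its
  range of finite moments; \<open>h0\<close> is a margin by which the exponent may move either
  way.\<close>

locale exp_moments = finite_borel \<mu> for \<mu> +
  fixes h0 :: real
  assumes h0: "0 < h0" and exp_int: "integrable \<mu> (\<lambda>r. exp (h0 * \<bar>r\<bar>))"
begin

lemma integrable_exp_bounded:
  assumes "continuous_on UNIV f" "\<And>r. \<bar>f r\<bar> \<le> C * exp (h0 * \<bar>r\<bar>)"
  shows "integrable \<mu> f"
proof (rule Bochner_Integration.integrable_bound)
  show "integrable \<mu> (\<lambda>r. C * exp (h0 * \<bar>r\<bar>))" using exp_int by simp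
  show "AE r in \<mu>. norm (f r) \<le> norm (C * exp (h0 * \<bar>r\<bar>))"
    using assms(2) by (auto intro!: AE_I2 intro: order_trans[OF _ abs_ge_self])
qed (use assms(1) measurable_cont in auto)

lemma integrable_id: "integrable \<mu> (\<lambda>r. r)"
proof (rule integrable_exp_bounded)
  show "\<bar>r\<bar> \<le> 1 / h0 * exp (h0 * \<bar>r\<bar>)" for r using abs_le_exp_divide[OF h0, of r] by simp
qed (intro continuous_intros)

lemma integrable_square: "integrable \<mu> (\<lambda>r. r\<^sup>2)"
proof (rule integrable_exp_bounded)
  show "\<bar>r\<^sup>2\<bar> \<le> 2 / h0\<^sup>2 * exp (h0 * \<bar>r\<bar>)" for r using square_le_exp_divide[OF h0, of r] by simp
qed (intro continuous_intros)

definition "m1 = (\<integral>r. r \<partial>\<mu>)"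
definition "m2 = (\<integral>r. r\<^sup>2 \<partial>\<mu>)"

lemma m2_nonneg: "0 \<le> m2" by (simp add: m2_def)

lemma slow_shift_bound:
  assumes "slow X"
  shows "\<exists>C>0. \<forall>t r. \<bar>X (t - r)\<bar> \<le> C * exp (h0 * \<bar>t\<bar>) * exp (h0 * \<bar>r\<bar>)"
proof -
  obtain C where C: "0 < C" "\<And>t. \<bar>X t\<bar> \<le> C * exp (h0 * \<bar>t\<bar>)" using slowD[OF assms h0] by blast
  have "\<bar>X (t - r)\<bar> \<le> C * exp (h0 * \<bar>t\<bar>) * exp (h0 * \<bar>r\<bar>)" for t r
  proof -
    have "\<bar>X (t - r)\<bar> \<le> C * exp (h0 * \<bar>t - r\<bar>)" by (rule C)
    also have "\<dots> \<le> C * exp (h0 * (\<bar>t\<bar> + \<bar>r\<bar>))" using C(1) h0 by (intro mult_left_mono) auto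
    finally show ?thesis by (simp add: exp_add[symmetric] algebra_simps)
  qed
  then show ?thesis using C(1) by (intro exI[of _ C] conjI allI)
qed

lemma slow_shift_integrable: assumes "slow X" shows "integrable \<mu> (\<lambda>r. X (t - r))"
proof -
  obtain C where "\<forall>t r. \<bar>X (t - r)\<bar> \<le> C * exp (h0 * \<bar>t\<bar>) * exp (h0 * \<bar>r\<bar>)"
    using slow_shift_bound[OF assms] by (elim exE conjE)
  then have "\<And>r. \<bar>X (t - r)\<bar> \<le> C * exp (h0 * \<bar>t\<bar>) * exp (h0 * \<bar>r\<bar>)" by (elim allE)
  moreover have "continuous_on UNIV (\<lambda>r. X (t - r))"
    by (rule continuous_on_compose2[OF slow_continuous[OF assms], of UNIV "\<lambda>r. t - r"])
       (auto intro: continuous_on_diff continuous_on_const continuous_on_id)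
  ultimately show ?thesis by (intro integrable_exp_bounded)
qed

text \<open>Minus the generator of a walk that jumps from t to t - r with intensity
  \<open>\<mu>\<close>. Constants are annihilated and linear functions become constants.\<close>

definition "J X t = (\<integral>r. X t - X (t - r) \<partial>\<mu>)" for X :: "real \<Rightarrow> real"

lemma J_eq: "slow X \<Longrightarrow> J X t = measure \<mu> UNIV * X t - (\<integral>r. X (t - r) \<partial>\<mu>)"
  by (simp add: J_def slow_shift_integrable)

lemma J_diff: "slow X \<Longrightarrow> slow Y \<Longrightarrow> J (\<lambda>t. X t - Y t) t = J X t - J Y t"
  by (simp add: J_eq slow_diff slow_shift_integrable algebra_simps)

text \<open>This allows the equation D'' = J D - a D' + \<rho> to be integrated: \<open>J P\<close>
  is an antiderivative of \<open>J X\<close>.\<close>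

lemma J_deriv:
  assumes P: "\<And>t. (P has_real_derivative X t) (at t)" and X: "slow X"
  shows "(J P has_real_derivative J X t) (at t)"
proof -
  have sP: "slow P" by (rule slow_antiderivative[OF P X])
  obtain C where C: "0 < C" and bd: "\<forall>t r. \<bar>X (t - r)\<bar> \<le> C * exp (h0 * \<bar>t\<bar>) * exp (h0 * \<bar>r\<bar>)"
    using slow_shift_bound[OF X] by (elim exE conjE)
  note bd = bd[rule_format]
  have "((\<lambda>t. \<integral>r. P t - P (t - r) \<partial>\<mu>) has_real_derivative (\<integral>r. X t - X (t - r) \<partial>\<mu>)) (at t)"
  proof (rule has_real_derivative_lebesgue_integral[where a = "t - 1" and b = "t + 1"
      and F' = "\<lambda>t r. X t - X (t - r)" and B = "\<lambda>r. 2 * (C * exp (h0 * (\<bar>t\<bar> + 1))) * exp (h0 * \<bar>r\<bar>)"])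
    show "((\<lambda>s. P s - P (s - r)) has_real_derivative X s - X (s - r)) (at s)" for s r
      by (intro DERIV_diff P DERIV_compose_diff)
    show "integrable \<mu> (\<lambda>r. P s - P (s - r))" for s using slow_shift_integrable[OF sP] by simp
    show "(\<lambda>r. X t - X (t - r)) \<in> borel_measurable \<mu>" using slow_shift_integrable[OF X, of t] by simp
    show "integrable \<mu> (\<lambda>r. 2 * (C * exp (h0 * (\<bar>t\<bar> + 1))) * exp (h0 * \<bar>r\<bar>))" using exp_int by simp
    fix s r assume s: "s \<in> {t - 1<..<t + 1}"
    have "C * exp (h0 * \<bar>s\<bar>) \<le> C * exp (h0 * (\<bar>t\<bar> + 1))" using s C h0 by auto
    then have 1: "C * exp (h0 * \<bar>s\<bar>) * exp (h0 * \<bar>v\<bar>) \<le> C * exp (h0 * (\<bar>t\<bar> + 1)) * exp (h0 * \<bar>v\<bar>)" for v by (intro mult_right_mono) auto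
    have "C * exp (h0 * (\<bar>t\<bar> + 1)) * 1 \<le> C * exp (h0 * (\<bar>t\<bar> + 1)) * exp (h0 * \<bar>r\<bar>)"
      using C h0 by (intro mult_left_mono) auto
    then show "\<bar>X s - X (s - r)\<bar> \<le> 2 * (C * exp (h0 * (\<bar>t\<bar> + 1))) * exp (h0 * \<bar>r\<bar>)"
      using bd[of s 0] bd[of s r] 1[of 0] 1[of r] abs_triangle_ineq4[of "X s" "X (s - r)"]
      by (simp add: mult.assoc)
  qed auto
  then show ?thesis by (simp add: J_def[abs_def])
qed

lemma J_linear: "J (\<lambda>t. b * t) t = b * m1"
  by (simp add: J_def m1_def algebra_simps)

end

section \<open>Peaks of slowly growing solutions\<close>

lemma attains_max_if_small_at_infinity:
  fixes f :: "real \<Rightarrow> real"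
  assumes "continuous_on UNIV f" "\<And>t. R < \<bar>t\<bar> \<Longrightarrow> f t \<le> f s"
  obtains x where "\<And>y. f y \<le> f x"
proof -
  let ?S = "{- max R \<bar>s\<bar>..max R \<bar>s\<bar>}"
  have s: "s \<in> ?S" by auto
  have "\<exists>x\<in>?S. \<forall>y\<in>?S. f y \<le> f x"
    using s assms(1) by (intro continuous_attains_sup) (auto intro: continuous_on_subset)
  then obtain x where x: "\<forall>y\<in>?S. f y \<le> f x" by blast
  have "f y \<le> f x" for y
  proof (cases "y \<in> ?S")
    case False
    then have "R < \<bar>y\<bar>" by auto
    then show ?thesis using assms(2)[of y] x s by (meson order_trans)
  qed (use x in blast)
  then show ?thesis by (rule that)
qed

lemma cosh_add_le: "cosh (x + y) \<le> cosh x * exp \<bar>y\<bar>" for x y :: real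
proof -
  have "exp (x + y) \<le> exp (x + \<bar>y\<bar>)" "exp (- (x + y)) \<le> exp (- x + \<bar>y\<bar>)" by auto
  then have "exp (x + y) + exp (- (x + y)) \<le> (exp x + exp (- x)) * exp \<bar>y\<bar>"
    unfolding exp_add[of x "\<bar>y\<bar>"] exp_add[of "- x" "\<bar>y\<bar>"] distrib_right by linarith
  then show ?thesis by (simp add: cosh_def)
qed

lemma exp_abs_le_cosh: "exp \<bar>x\<bar> \<le> 2 * cosh x" for x :: real
  using exp_ge_zero[of x] exp_ge_zero[of "- x"] by (cases "0 \<le> x") (auto simp: cosh_def)

lemma abs_sinh_le_cosh: "\<bar>sinh x\<bar> \<le> cosh x" for x :: real
  using exp_ge_zero[of x] exp_ge_zero[of "- x"] unfolding sinh_def cosh_def by (auto simp: abs_le_iff field_simps)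

lemma continuous_if_deriv: "(\<And>t. (f has_real_derivative f' t) (at t)) \<Longrightarrow> continuous_on UNIV f"
  by (metis DERIV_isCont continuous_on_eq_continuous_at open_UNIV)

text \<open>The weight grows at twice the exponential rate allowed to \<open>D\<close>, so the
  quotient has a maximum. Centring the weight at a \<open>\<tau>\<close> far to the left keeps the
  quotient below \<open>A\<close> right of \<open>\<tau> / 2\<close>; hence the maximum point moves
  to minus infinity with \<open>\<tau>\<close>.\<close>

lemma cosh_weighted_max:
  fixes D :: "real \<Rightarrow> real"
  assumes D: "continuous_on UNIV D" and e: "0 < \<epsilon>" and C: "\<And>t. \<bar>D t\<bar> \<le> C * exp (\<epsilon>/2 * \<bar>t\<bar>)"
    and A: "0 < A" "A \<le> \<bar>D \<tau>\<bar>" and tau: "\<tau> < 0" "2 * C * exp (\<epsilon> * \<tau> / 4) < A"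
  obtains t1 where "t1 \<le> \<tau> / 2" "A \<le> \<bar>D t1\<bar>"
    "\<And>s. \<bar>D (t1 + s)\<bar> \<le> \<bar>D t1\<bar> * (cosh (\<epsilon> * (t1 + s - \<tau>)) / cosh (\<epsilon> * (t1 - \<tau>)))"
proof -
  define f where "f t = \<bar>D t\<bar> / cosh (\<epsilon> * (t - \<tau>))" for t
  have C0: "0 < C" using C[of \<tau>] A by (smt (verit) exp_gt_zero mult_nonpos_nonneg)
  have f_le: "f t \<le> 2 * C * exp (\<epsilon>/2 * \<bar>t\<bar> - \<epsilon> * \<bar>t - \<tau>\<bar>)" for t
  proof -
    have "f t \<le> C * exp (\<epsilon>/2 * \<bar>t\<bar>) / (exp (\<epsilon> * \<bar>t - \<tau>\<bar>) / 2)"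
      unfolding f_def using C[of t] exp_abs_le_cosh[of "\<epsilon> * (t - \<tau>)"] e
      by (intro frac_le) (auto simp: abs_mult)
    also have "\<dots> = 2 * C * exp (\<epsilon>/2 * \<bar>t\<bar> - \<epsilon> * \<bar>t - \<tau>\<bar>)" by (simp add: exp_diff)
    finally show ?thesis .
  qed
  have f_tau: "A \<le> f \<tau>" using A by (simp add: f_def)
  have right: "f t < A" if t: "\<tau> / 2 < t" for t
  proof -
    have "\<epsilon>/2 * \<bar>t\<bar> - \<epsilon> * \<bar>t - \<tau>\<bar> \<le> \<epsilon> * \<tau> / 4"
    proof -
      \<comment> \<open>The extreme case is \<open>t = \<tau> / 2\<close>, where equality
        holds.\<close>
      have "\<bar>t\<bar> / 2 - \<bar>t - \<tau>\<bar> \<le> \<tau> / 4" using t tau by (auto simp: abs_if)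
      from mult_left_mono[OF this, of \<epsilon>] e show ?thesis by (simp add: field_simps)
    qed
    then have "2 * C * exp (\<epsilon>/2 * \<bar>t\<bar> - \<epsilon> * \<bar>t - \<tau>\<bar>) \<le> 2 * C * exp (\<epsilon> * \<tau> / 4)" using C0 by simp
    then show ?thesis using f_le[of t] tau by linarith
  qed
  have left: "f t \<le> f \<tau>" if t: "- 3 * \<tau> < \<bar>t\<bar>" for t
  proof (cases "t \<ge> 0")
    case True
    then show ?thesis using right[of t] tau f_tau by linarith
  next
    case False
    then have t3: "t < 3 * \<tau>" using t by simp
    have "\<bar>t\<bar> / 2 - \<bar>t - \<tau>\<bar> \<le> \<tau> / 4" using t3 tau by (auto simp: abs_if)
    from mult_left_mono[OF this, of \<epsilon>] e have "\<epsilon>/2 * \<bar>t\<bar> - \<epsilon> * \<bar>t - \<tau>\<bar> \<le> \<epsilon> * \<tau> / 4" by (simp add: field_simps)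
    then have "2 * C * exp (\<epsilon>/2 * \<bar>t\<bar> - \<epsilon> * \<bar>t - \<tau>\<bar>) \<le> 2 * C * exp (\<epsilon> * \<tau> / 4)" using C0 by simp
    then show ?thesis using f_le[of t] tau f_tau by linarith
  qed
  have "continuous_on UNIV f" unfolding f_def
    using D by (auto intro!: continuous_intros)
  then obtain t1 where t1: "\<And>y. f y \<le> f t1" using attains_max_if_small_at_infinity[of f "- 3 * \<tau>" \<tau>] left by blast
  have ft1: "A \<le> f t1" using t1[of \<tau>] f_tau by linarith
  have cosh1: "1 \<le> cosh (\<epsilon> * (t - \<tau>))" for t by (rule cosh_real_ge_1)
  have "A * 1 \<le> f t1 * cosh (\<epsilon> * (t1 - \<tau>))" using ft1 A cosh1[of t1] by (intro mult_mono) auto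
  then have 2: "A \<le> \<bar>D t1\<bar>" using cosh1[of t1] by (simp add: f_def)
  have 3: "\<bar>D (t1 + s)\<bar> \<le> \<bar>D t1\<bar> * (cosh (\<epsilon> * (t1 + s - \<tau>)) / cosh (\<epsilon> * (t1 - \<tau>)))" for s
  proof -
    have "f (t1 + s) * cosh (\<epsilon> * (t1 + s - \<tau>)) \<le> f t1 * cosh (\<epsilon> * (t1 + s - \<tau>))"
      by (intro mult_right_mono t1) auto
    then show ?thesis by (simp add: f_def)
  qed
  have "t1 \<le> \<tau> / 2" using right[of t1] ft1 by linarith
  then show ?thesis using 2 3 that by blast
qed

context exp_moments
begin

text \<open>How far the weight is from being harmonic for the nonlocal part; it vanishes with
  \<open>e\<close>.\<close>

definition "excess e = (\<integral>r. exp (e * \<bar>r\<bar>) - 1 \<partial>\<mu>)"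

lemma integrable_exp_abs: assumes "0 \<le> e" "e \<le> h0" shows "integrable \<mu> (\<lambda>r. exp (e * \<bar>r\<bar>))"
proof (rule integrable_exp_bounded[where C = 1])
  show "\<bar>exp (e * \<bar>r\<bar>)\<bar> \<le> 1 * exp (h0 * \<bar>r\<bar>)" for r using assms by (auto intro!: mult_right_mono)
qed (auto intro!: continuous_intros)

lemma excess_nonneg: "0 \<le> e \<Longrightarrow> 0 \<le> excess e" by (auto simp: excess_def intro!: integral_nonneg_AE)

lemma excess_tendsto:
  assumes "\<And>n. 0 \<le> e n" "\<And>n. e n \<le> h0" "e \<longlonglongrightarrow> 0"
  shows "(\<lambda>n. excess (e n)) \<longlonglongrightarrow> 0"
proof -
  have "(\<lambda>n. excess (e n)) \<longlonglongrightarrow> (\<integral>r. 0 \<partial>\<mu>)"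
    unfolding excess_def
  proof (rule integral_dominated_convergence[where w = "\<lambda>r. exp (h0 * \<bar>r\<bar>)"])
    show "AE r in \<mu>. (\<lambda>n. exp (e n * \<bar>r\<bar>) - 1) \<longlonglongrightarrow> 0"
      using assms(3) by (auto intro!: AE_I2 tendsto_eq_intros)
    show "AE r in \<mu>. norm (exp (e n * \<bar>r\<bar>) - 1) \<le> exp (h0 * \<bar>r\<bar>)" for n
    proof (rule AE_I2)
      fix r
      have "exp (e n * \<bar>r\<bar>) \<le> exp (h0 * \<bar>r\<bar>)" "1 \<le> exp (e n * \<bar>r\<bar>)" using assms by (auto intro!: mult_right_mono)
      then show "norm (exp (e n * \<bar>r\<bar>) - 1) \<le> exp (h0 * \<bar>r\<bar>)" unfolding real_norm_def by linarith
    qed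
  qed (auto intro!: measurable_cont continuous_intros exp_int)
  then show ?thesis by simp
qed

text \<open>A comparison constant depending only on the coefficients and the radius, hence uniform along sequences of
  functions.\<close>

definition "ode_const a R = (SOME G. G > 0 \<and> (\<forall>U U' U'' \<delta>. 0 \<le> \<delta> \<longrightarrow> (\<forall>s. (U has_real_derivative U' s) (at s)) \<longrightarrow>
     (\<forall>s. (U' has_real_derivative U'' s) (at s)) \<longrightarrow>
     (\<forall>s. \<bar>s\<bar> \<le> R \<longrightarrow> U'' s + a * U' s - measure \<mu> UNIV * U s \<le> \<delta>) \<longrightarrow> U 0 = 0 \<longrightarrow> U' 0 = 0 \<longrightarrow>
     (\<forall>s. \<bar>s\<bar> \<le> R \<longrightarrow> U s \<le> \<delta> * G)))"

lemma ode_const: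
  assumes "0 < measure \<mu> UNIV"
  shows "ode_const a R > 0"
    "\<lbrakk>0 \<le> \<delta>; \<And>s. (U has_real_derivative U' s) (at s); \<And>s. (U' has_real_derivative U'' s) (at s);
      \<And>s. \<bar>s\<bar> \<le> R \<Longrightarrow> U'' s + a * U' s - measure \<mu> UNIV * U s \<le> \<delta>; U 0 = 0; U' 0 = 0; \<bar>s\<bar> \<le> R\<rbrakk>
      \<Longrightarrow> U s \<le> \<delta> * ode_const a R"
  using someI_ex[OF ode_comparison_two_sided[OF assms, of R a], folded ode_const_def] by blast+

text \<open>The normalised weight \<open>h\<close> solves \<open>h'' = e\<^sup>2 * h\<close>, and
  the average of the normalised \<open>D\<close> is at most \<open>h s\<close> times the mass plus
  \<open>excess e\<close>. This bound has the favourable sign: the mass terms cancel, and what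
  remains is the local operator applied to \<open>U = h - x\<close>, where the comparison lemma
  applies with vanishing data at 0.\<close>

lemma peak:
  assumes \<kappa>: "0 < measure \<mu> UNIV" and D: "slow D" and D1: "\<And>t. (D has_real_derivative D' t) (at t)"
    and D2: "\<And>t. (D' has_real_derivative J D t - a * D' t + \<rho> t) (at t)"
    and e: "0 < e" "e \<le> h0"
    and A: "0 < A" "A \<le> \<bar>D t1\<bar>"
    and max: "\<And>s. \<bar>D (t1 + s)\<bar> \<le> \<bar>D t1\<bar> * (cosh (e * (t1 + s - \<tau>)) / cosh (e * (t1 - \<tau>)))"
  shows "\<bar>D (t1 + s)\<bar> \<le> \<bar>D t1\<bar> * exp (e * \<bar>s\<bar>)"
    and "\<bar>D' t1\<bar> \<le> e * \<bar>D t1\<bar>"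
    and "\<lbrakk>\<And>s. \<bar>s\<bar> \<le> R \<Longrightarrow> \<bar>\<rho> (t1 + s)\<bar> / A \<le> \<delta>; \<bar>s\<bar> \<le> R\<rbrakk> \<Longrightarrow>
      \<bar>D (t1 + s) / D t1 - 1\<bar> \<le> (exp (e * R) - 1) + (exp (e * R) * (e\<^sup>2 + \<bar>a\<bar> * e + excess e) + \<delta>) * ode_const a R"
proof -
  define h where "h s = cosh (e * (t1 + s - \<tau>)) / cosh (e * (t1 - \<tau>))" for s
  define h' where "h' s = e * sinh (e * (t1 + s - \<tau>)) / cosh (e * (t1 - \<tau>))" for s
  have hpos: "0 < h s" for s by (simp add: h_def)
  have h_add: "h (s + v) \<le> h s * exp (e * \<bar>v\<bar>)" for s v
    using cosh_add_le[of "e * (t1 + s - \<tau>)" "e * v"] e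
    by (simp add: h_def divide_right_mono abs_mult algebra_simps)
  have h0': "h 0 = 1" by (simp add: h_def)
  have h_le: "h s \<le> exp (e * \<bar>s\<bar>)" for s using h_add[of 0 s] h0' by simp
  have h_ge: "exp (- (e * \<bar>s\<bar>)) \<le> h s" for s
    using h_add[of s "- s"] h0' by (simp add: exp_minus field_simps)
  have h'_le: "\<bar>h' s\<bar> \<le> e * h s" for s
    using abs_sinh_le_cosh[of "e * (t1 + s - \<tau>)"] e
    by (simp add: h_def h'_def abs_mult divide_right_mono)
  have dh: "(h has_real_derivative h' s) (at s)" for s
    unfolding h_def h'_def by (auto intro!: derivative_eq_intros)
  have dh': "(h' has_real_derivative e\<^sup>2 * h s) (at s)" for s
    unfolding h_def h'_def by (auto intro!: derivative_eq_intros simp: power2_eq_square)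
  have D0: "D t1 \<noteq> 0" using A by auto
  define x where "x s = D (t1 + s) / D t1" for s
  have x_le: "\<bar>x s\<bar> \<le> h s" for s
    using max[of s] D0 by (simp add: x_def h_def abs_divide divide_simps mult_ac)
  have x0: "x 0 = 1" using D0 by (simp add: x_def)
  show "\<bar>D (t1 + s)\<bar> \<le> \<bar>D t1\<bar> * exp (e * \<bar>s\<bar>)" for s
    using max[of s] h_le[of s] mult_left_mono[of "h s" "exp (e * \<bar>s\<bar>)" "\<bar>D t1\<bar>"] by (simp add: h_def)
  define U where "U s = h s - x s" for s
  define U' where "U' s = h' s - D' (t1 + s) / D t1" for s
  define U'' where "U'' s = e\<^sup>2 * h s - (J D (t1 + s) - a * D' (t1 + s) + \<rho> (t1 + s)) / D t1" for s
  have sh: "((\<lambda>s. f (t1 + s)) has_real_derivative f' (t1 + s)) (at s)"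
    if "\<And>t. (f has_real_derivative f' t) (at t)" for f f' :: "real \<Rightarrow> real" and s
    using DERIV_compose_diff[OF that, of "- t1" s] by (simp add: add.commute)
  have dU: "(U has_real_derivative U' s) (at s)" for s
    unfolding U_def[abs_def] U'_def x_def by (intro DERIV_diff dh DERIV_cdivide sh D1)
  have dU': "(U' has_real_derivative U'' s) (at s)" for s
    unfolding U'_def[abs_def] U''_def by (intro DERIV_diff dh' DERIV_cdivide sh[OF D2])
  have U_nonneg: "0 \<le> U s" for s using x_le[of s] by (simp add: U_def)
  have U0: "U 0 = 0" by (simp add: U_def h0' x0)
  have U'0: "U' 0 = 0"
    by (rule DERIV_local_min[OF dU[of 0], of 1]) (use U_nonneg U0 in auto)
  have "\<bar>D' t1 / D t1\<bar> = \<bar>h' 0\<bar>" using U'0 by (simp add: U'_def)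
  then have "\<bar>D' t1\<bar> / \<bar>D t1\<bar> \<le> e" using h'_le[of 0] h0' by simp
  then show "\<bar>D' t1\<bar> \<le> e * \<bar>D t1\<bar>" using D0 by (simp add: pos_divide_le_eq)
  have key: "U'' s + a * U' s - measure \<mu> UNIV * U s
      \<le> exp (e * R) * (e\<^sup>2 + \<bar>a\<bar> * e + excess e) + \<delta>"
    if s: "\<bar>s\<bar> \<le> R" and rho: "\<bar>\<rho> (t1 + s)\<bar> / A \<le> \<delta>" for s R \<delta>
  proof -
    have int_x: "integrable \<mu> (\<lambda>r. x (s - r))"
      unfolding x_def using slow_shift_integrable[OF D, of "t1 + s"] by (simp add: algebra_simps)
    have "(\<integral>r. x (s - r) \<partial>\<mu>) \<le> (\<integral>r. h s * exp (e * \<bar>r\<bar>) \<partial>\<mu>)"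
    proof (rule integral_mono[OF int_x])
      show "integrable \<mu> (\<lambda>r. h s * exp (e * \<bar>r\<bar>))" using integrable_exp_abs[of e] e by simp
      show "x (s - r) \<le> h s * exp (e * \<bar>r\<bar>)" for r
        using h_add[of s "- r"] x_le[of "s - r"] by simp
    qed
    also have "\<dots> = h s * (excess e + measure \<mu> UNIV)"
      using integrable_exp_abs[of e] e by (simp add: excess_def)
    finally have int_le: "(\<integral>r. x (s - r) \<partial>\<mu>) \<le> h s * (excess e + measure \<mu> UNIV)" .
    have Jx: "J D (t1 + s) / D t1 = measure \<mu> UNIV * x s - (\<integral>r. x (s - r) \<partial>\<mu>)"
      by (simp add: J_eq[OF D] diff_divide_distrib x_def algebra_simps)
    have eq: "U'' s + a * U' s - measure \<mu> UNIV * U s =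
        e\<^sup>2 * h s + a * h' s - measure \<mu> UNIV * h s + (\<integral>r. x (s - r) \<partial>\<mu>) - \<rho> (t1 + s) / D t1"
      using Jx by (simp add: U_def U'_def U''_def x_def algebra_simps diff_divide_distrib add_divide_distrib)
    have "a * h' s \<le> \<bar>a\<bar> * (e * h s)"
      using mult_mono[OF order_refl h'_le[of s], of "\<bar>a\<bar>"] abs_ge_self[of "a * h' s"] by (simp add: abs_mult)
    moreover have "- \<rho> (t1 + s) / D t1 \<le> \<delta>"
    proof -
      have "- \<rho> (t1 + s) / D t1 \<le> \<bar>\<rho> (t1 + s)\<bar> / \<bar>D t1\<bar>"
        using abs_ge_self[of "- \<rho> (t1 + s) / D t1"] by (simp add: abs_divide)
      also have "\<dots> \<le> \<bar>\<rho> (t1 + s)\<bar> / A" using A by (intro divide_left_mono) auto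
      finally show ?thesis using rho by linarith
    qed
    ultimately have "U'' s + a * U' s - measure \<mu> UNIV * U s \<le> h s * (e\<^sup>2 + \<bar>a\<bar> * e + excess e) + \<delta>"
      unfolding eq using int_le by (simp add: algebra_simps)
    moreover have "h s * (e\<^sup>2 + \<bar>a\<bar> * e + excess e) \<le> exp (e * R) * (e\<^sup>2 + \<bar>a\<bar> * e + excess e)"
    proof (rule mult_right_mono)
      have "exp (e * \<bar>s\<bar>) \<le> exp (e * R)" using s e by simp
      then show "h s \<le> exp (e * R)" using h_le[of s] by linarith
    qed (use e excess_nonneg[of e] in auto)
    ultimately show ?thesis by linarith
  qed
  assume rho: "\<And>s. \<bar>s\<bar> \<le> R \<Longrightarrow> \<bar>\<rho> (t1 + s)\<bar> / A \<le> \<delta>" and s: "\<bar>s\<bar> \<le> R"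
  have "0 \<le> \<bar>\<rho> (t1 + s)\<bar> / A" using A by simp
  then have d: "0 \<le> \<delta>" using rho[OF s] by linarith
  have "0 \<le> exp (e * R) * (e\<^sup>2 + \<bar>a\<bar> * e + excess e) + \<delta>"
    using d e excess_nonneg[of e] by (intro add_nonneg_nonneg mult_nonneg_nonneg) auto
  from ode_const(2)[OF \<kappa> this dU dU' key[OF _ rho] U0 U'0 s]
  have "U s \<le> (exp (e * R) * (e\<^sup>2 + \<bar>a\<bar> * e + excess e) + \<delta>) * ode_const a R" by blast
  moreover have "\<bar>h s - 1\<bar> \<le> exp (e * R) - 1"
  proof -
    have 1: "exp (e * \<bar>s\<bar>) \<le> exp (e * R)" using s e by simp
    have "1 - h s \<le> exp (e * \<bar>s\<bar>) - 1"
    proof -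
      have "2 \<le> exp (e * \<bar>s\<bar>) + exp (- (e * \<bar>s\<bar>))"
        using cosh_real_ge_1[of "e * \<bar>s\<bar>"] by (simp add: cosh_def)
      then show ?thesis using h_ge[of s] by linarith
    qed
    then show ?thesis using h_le[of s] 1 unfolding abs_le_iff by linarith
  qed
  ultimately show "\<bar>D (t1 + s) / D t1 - 1\<bar> \<le>
      (exp (e * R) - 1) + (exp (e * R) * (e\<^sup>2 + \<bar>a\<bar> * e + excess e) + \<delta>) * ode_const a R"
    using U_nonneg[of s] by (simp add: U_def x_def abs_le_iff)
qed

text \<open>At a maximum of \<open>\<bar>D t\<bar> / cosh (\<epsilon> * (t - \<tau>))\<close> the difference between the rescaled weight and the rescaled \<open>D\<close> is
  nonnegative, vanishes to first order, and is almost a supersolution. Letting \<open>\<epsilon> \<rightarrow> 0\<close>, \<open>D\<close> looks constant near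
  its peaks. This replaces a compactness argument with a strong maximum principle.\<close>

lemma slow_peaks:
  assumes \<kappa>: "0 < measure \<mu> UNIV" and D: "slow D" and D1: "\<And>t. (D has_real_derivative D' t) (at t)"
    and D2: "\<And>t. (D' has_real_derivative J D t - a * D' t + \<rho> t) (at t)"
    and rho: "(\<rho> \<longlongrightarrow> 0) at_bot" and not: "\<not> (D \<longlongrightarrow> 0) at_bot"
  shows "\<exists>A \<tau>. 0 < A \<and> (\<forall>n. A \<le> \<bar>D (\<tau> n)\<bar>) \<and> filterlim \<tau> at_bot sequentially \<and>
    (\<forall>n s. \<bar>D (\<tau> n + s)\<bar> \<le> \<bar>D (\<tau> n)\<bar> * exp (h0/2 * \<bar>s\<bar>)) \<and>
    (\<lambda>n. D' (\<tau> n) / D (\<tau> n)) \<longlonglongrightarrow> 0 \<and>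
    (\<forall>R \<eta>. 0 < \<eta> \<longrightarrow> eventually (\<lambda>n. \<forall>s. \<bar>s\<bar> \<le> R \<longrightarrow> \<bar>D (\<tau> n + s) / D (\<tau> n) - 1\<bar> \<le> \<eta>) sequentially)"
proof -
  obtain A where A: "0 < A" and freq: "\<And>N. \<exists>t\<le>N. A \<le> \<bar>D t\<bar>"
  proof -
    from not obtain A where "0 < A" "\<not> eventually (\<lambda>t. dist (D t) 0 < A) at_bot"
      unfolding tendsto_iff by auto
    then show ?thesis using that[of A] unfolding eventually_at_bot_linorder by (auto simp: not_less)
  qed
  \<comment> \<open>Staying below \<open>h0/2\<close> leaves the other half of the exponential
    moment for the powers of \<open>\<bar>r\<bar>\<close> in the dominated convergence arguments
    built on these peaks.\<close>
  define e where "e n = h0 / 2 * inverse (real (Suc n))" for n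
  have e: "0 < e n" "e n \<le> h0/2" "e n \<le> h0" for n
  proof -
    show "0 < e n" using h0 by (simp add: e_def)
    have "h0 / 2 * inverse (real (Suc n)) \<le> h0 / 2 * 1"
      using h0 by (intro mult_left_mono) (auto simp: inverse_eq_divide)
    then show "e n \<le> h0/2" by (simp add: e_def)
    then show "e n \<le> h0" using h0 by simp
  qed
  have e_lim: "e \<longlonglongrightarrow> 0"
    unfolding e_def using tendsto_mult_right_zero[OF LIMSEQ_inverse_real_of_nat, of "h0/2"]
    by (simp only: mult_zero_right)
  have "\<exists>t1 \<tau>. t1 \<le> - real n \<and> A \<le> \<bar>D t1\<bar> \<and>
     (\<forall>s. \<bar>D (t1 + s)\<bar> \<le> \<bar>D t1\<bar> * (cosh (e n * (t1 + s - \<tau>)) / cosh (e n * (t1 - \<tau>))))" for n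
  proof -
    obtain C where C: "0 < C" "\<And>t. \<bar>D t\<bar> \<le> C * exp (e n/2 * \<bar>t\<bar>)" using slowD[OF D, of "e n / 2"] e[of n] by auto
    \<comment> \<open>The second entry makes \<open>2 * C * exp (e n * \<tau> / 4)\<close> at most
      half of \<open>A\<close>; the first puts the maximum point left of \<open>- n\<close>.\<close>
    define N where "N = min (- 2 * real n - 1) (4 / e n * ln (A / (4 * C)))"
    obtain \<tau> where tau: "\<tau> \<le> N" "A \<le> \<bar>D \<tau>\<bar>" using freq by blast
    have "e n * \<tau> / 4 \<le> ln (A / (4 * C))"
    proof -
      have "\<tau> \<le> 4 / e n * ln (A / (4 * C))" using tau(1) by (simp add: N_def)
      from mult_left_mono[OF this, of "e n / 4"] e(1)[of n] show ?thesis by simp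
    qed
    then have "exp (e n * \<tau> / 4) \<le> exp (ln (A / (4 * C)))" by (simp only: exp_le_cancel_iff)
    also have "\<dots> = A / (4 * C)" using A C by (intro exp_ln) simp
    finally have "exp (e n * \<tau> / 4) \<le> A / (4 * C)" .
    then have "2 * C * exp (e n * \<tau> / 4) \<le> 2 * C * (A / (4 * C))"
      using C(1) by (intro mult_left_mono) auto
    also have "\<dots> < A" using A C by simp
    finally have small: "2 * C * exp (e n * \<tau> / 4) < A" .
    have tau0: "\<tau> < 0" "\<tau> / 2 \<le> - real n" using tau(1) by (auto simp: N_def)
    obtain t1 where "t1 \<le> \<tau> / 2" "A \<le> \<bar>D t1\<bar>"
      "\<And>s. \<bar>D (t1 + s)\<bar> \<le> \<bar>D t1\<bar> * (cosh (e n * (t1 + s - \<tau>)) / cosh (e n * (t1 - \<tau>)))"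
      using cosh_weighted_max[OF slow_continuous[OF D] e(1) C(2) A tau(2) tau0(1) small] by blast
    then show ?thesis using tau0(2) by (intro exI[of _ t1] exI[of _ \<tau>]) auto
  qed
  then obtain \<tau> \<sigma> where tau: "\<And>n. \<tau> n \<le> - real n" "\<And>n. A \<le> \<bar>D (\<tau> n)\<bar>"
    "\<And>n s. \<bar>D (\<tau> n + s)\<bar> \<le> \<bar>D (\<tau> n)\<bar> * (cosh (e n * (\<tau> n + s - \<sigma> n)) / cosh (e n * (\<tau> n - \<sigma> n)))"
    by metis
  note pk = peak[OF \<kappa> D D1 D2 e(1,3) A tau(2,3)]
  have lim: "filterlim \<tau> at_bot sequentially"
  proof (rule filterlim_at_bot_mono)
    show "filterlim (\<lambda>n. - real n) at_bot sequentially"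
      using filterlim_real_sequentially filterlim_uminus_at_top by blast
  qed (use tau(1) in auto)
  show ?thesis
  proof (intro exI[of _ A] exI[of _ \<tau>] conjI allI impI)
    fix n s
    have "exp (e n * \<bar>s\<bar>) \<le> exp (h0/2 * \<bar>s\<bar>)"
      unfolding exp_le_cancel_iff using e(2)[of n] by (intro mult_right_mono) auto
    then have "\<bar>D (\<tau> n)\<bar> * exp (e n * \<bar>s\<bar>) \<le> \<bar>D (\<tau> n)\<bar> * exp (h0/2 * \<bar>s\<bar>)" by (intro mult_left_mono) auto
    then show "\<bar>D (\<tau> n + s)\<bar> \<le> \<bar>D (\<tau> n)\<bar> * exp (h0/2 * \<bar>s\<bar>)" using pk(1)[of n s] by linarith
  next
    have "norm (D' (\<tau> n) / D (\<tau> n)) \<le> e n" for n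
      using pk(2)[of n] tau(2)[of n] A by (simp add: abs_divide pos_divide_le_eq)
    then show "(\<lambda>n. D' (\<tau> n) / D (\<tau> n)) \<longlonglongrightarrow> 0"
      by (intro Lim_null_comparison[OF _ e_lim]) auto
  next
    fix R \<eta> :: real assume eta: "0 < \<eta>"
    define G where "G = ode_const a R"
    have G: "0 < G" using ode_const(1)[OF \<kappa>] by (simp add: G_def)
    \<comment> \<open>After multiplication by \<open>G\<close> the forcing contributes at most half
      of \<open>\<eta>\<close>; the remaining terms vanish as \<open>e n\<close> tends to 0.\<close>
    define d where "d = A * (\<eta> / (2 * G))"
    have d: "0 < d" using A G eta by (simp add: d_def)
    have "eventually (\<lambda>t. \<bar>\<rho> t\<bar> < d) at_bot" using rho d unfolding tendsto_iff by auto
    then obtain N where N: "\<And>t. t \<le> N \<Longrightarrow> \<bar>\<rho> t\<bar> < d" unfolding eventually_at_bot_linorder by blast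
    have ex: "(\<lambda>n. excess (e n)) \<longlonglongrightarrow> 0"
      by (rule excess_tendsto) (use e e_lim in \<open>auto intro: less_imp_le\<close>)
    have "(\<lambda>n. (exp (e n * R) - 1) + (exp (e n * R) * ((e n)\<^sup>2 + \<bar>a\<bar> * e n + excess (e n)) + \<eta> / (2 * G)) * G)
        \<longlonglongrightarrow> (exp (0 * R) - 1) + (exp (0 * R) * (0\<^sup>2 + \<bar>a\<bar> * 0 + 0) + \<eta> / (2 * G)) * G"
      by (intro tendsto_intros e_lim ex)
    moreover have "(exp (0 * R) - 1) + (exp (0 * R) * (0\<^sup>2 + \<bar>a\<bar> * 0 + 0) + \<eta> / (2 * G)) * G < \<eta>"
      using G eta by simp
    ultimately have ev1: "eventually (\<lambda>n. (exp (e n * R) - 1) +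
        (exp (e n * R) * ((e n)\<^sup>2 + \<bar>a\<bar> * e n + excess (e n)) + \<eta> / (2 * G)) * G < \<eta>) sequentially"
      by (rule order_tendstoD)
    have ev2: "eventually (\<lambda>n. \<tau> n \<le> N - \<bar>R\<bar>) sequentially"
      using lim by (simp add: filterlim_at_bot)
    show "eventually (\<lambda>n. \<forall>s. \<bar>s\<bar> \<le> R \<longrightarrow> \<bar>D (\<tau> n + s) / D (\<tau> n) - 1\<bar> \<le> \<eta>) sequentially"
      using ev1 ev2
    proof eventually_elim
      case (elim n)
      have "\<bar>\<rho> (\<tau> n + s)\<bar> / A \<le> \<eta> / (2 * G)" if "\<bar>s\<bar> \<le> R" for s
      proof -
        have "\<bar>\<rho> (\<tau> n + s)\<bar> < d" using elim(2) that by (intro N) linarith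
        then show ?thesis using A by (simp add: d_def pos_divide_le_eq mult.commute)
      qed
      from pk(3)[of R n, OF this] elim(1) show ?case unfolding G_def by fastforce
    qed
  qed (use A tau(2) lim in auto)
qed

end

section \<open>Limits at minus infinity\<close>

text \<open>Adding or subtracting \<open>C / \<eta> * exp (\<eta> * t)\<close> makes
  \<open>Y\<close> increasing or decreasing; the limit is the infimum of the increasing function.
  The explicit rate lets the conclusion serve as the hypothesis for the next antiderivative.\<close>

lemma exponential_antiderivative_limit:
  fixes Y \<rho> :: "real \<Rightarrow> real"
  assumes Y: "\<And>t. (Y has_real_derivative \<rho> t) (at t)" and eta: "0 < \<eta>"
    and rho: "\<And>t. \<bar>\<rho> t\<bar> \<le> C * exp (\<eta> * t)"
  obtains \<beta> where "\<And>t. \<bar>Y t - \<beta>\<bar> \<le> C / \<eta> * exp (\<eta> * t)"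
proof -
  define F where "F t = Y t + C / \<eta> * exp (\<eta> * t)" for t
  define G where "G t = Y t - C / \<eta> * exp (\<eta> * t)" for t
  have C: "0 \<le> C" using rho[of 0] by simp
  have F: "F s \<le> F t" if "s \<le> t" for s t
  proof (rule DERIV_nonneg_imp_nondecreasing[OF that])
    fix x
    have "(F has_real_derivative \<rho> x + C * exp (\<eta> * x)) (at x)"
      unfolding F_def using eta by (auto intro!: derivative_eq_intros Y)
    moreover have "0 \<le> \<rho> x + C * exp (\<eta> * x)" using rho[of x] by linarith
    ultimately show "\<exists>y. (F has_real_derivative y) (at x) \<and> 0 \<le> y" by blast
  qed
  have G: "G t \<le> G s" if "s \<le> t" for s t
  proof (rule DERIV_nonpos_imp_nonincreasing[OF that])
    fix x
    have "(G has_real_derivative \<rho> x - C * exp (\<eta> * x)) (at x)"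
      unfolding G_def using eta by (auto intro!: derivative_eq_intros Y)
    moreover have "\<rho> x - C * exp (\<eta> * x) \<le> 0" using rho[of x] by linarith
    ultimately show "\<exists>y. (G has_real_derivative y) (at x) \<and> y \<le> 0" by blast
  qed
  have GF: "G t \<le> F t" for t unfolding F_def G_def using C eta by simp
  have le: "G t \<le> F s" for s t
    using F[of t s] G[of s t] GF[of s] GF[of t] by (cases "s \<le> t") auto
  have bdd: "bdd_below (range F)" using le[of 0] by (auto intro!: bdd_belowI)
  define \<beta> where "\<beta> = (INF t. F t)"
  have "\<beta> \<le> F t" for t unfolding \<beta>_def by (rule cINF_lower[OF bdd]) simp
  moreover have "G t \<le> \<beta>" for t unfolding \<beta>_def using le[of t] by (intro cINF_greatest) auto
  ultimately have "\<bar>Y t - \<beta>\<bar> \<le> C / \<eta> * exp (\<eta> * t)" for t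
    using order_refl unfolding F_def G_def abs_le_iff by (smt (verit))
  then show ?thesis by (rule that)
qed

lemma exp_tendsto_0_at_bot: "0 < \<eta> \<Longrightarrow> ((\<lambda>t::real. C * exp (\<eta> * t)) \<longlongrightarrow> 0) at_bot" for \<eta> C :: real
proof -
  assume "0 < \<eta>"
  have "filterlim (\<lambda>t. \<eta> * t) at_bot at_bot"
    by (rule filterlim_tendsto_pos_mult_at_bot[OF tendsto_const \<open>0 < \<eta>\<close> filterlim_ident])
  then have "((\<lambda>t. exp (\<eta> * t)) \<longlongrightarrow> 0) at_bot"
    by (rule filterlim_compose[OF exp_at_bot])
  then show ?thesis by (rule tendsto_mult_right_zero)
qed

lemma tendsto_0_if_exp_bound:
  fixes f :: "real \<Rightarrow> real"
  assumes "0 < \<eta>" "\<And>t. \<bar>f t\<bar> \<le> C * exp (\<eta> * t)"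
  shows "(f \<longlongrightarrow> 0) at_bot"
  by (rule Lim_null_comparison[OF _ exp_tendsto_0_at_bot[OF assms(1), of C]]) (use assms(2) in auto)

lemma slow_square: "slow (\<lambda>t. b * t\<^sup>2 / 2)"
proof (rule slow_antiderivative)
  show "slow (\<lambda>t. b * t)"
    by (rule slow_antiderivative[of _ "\<lambda>_. b"]) (auto intro!: derivative_eq_intros slow_bounded)
qed (auto intro!: derivative_eq_intros)

lemma slow_linear: "slow (\<lambda>t. b * t)"
  by (rule slow_antiderivative[of _ "\<lambda>_. b"]) (auto intro!: derivative_eq_intros slow_bounded)

text \<open>\<open>P2\<close> is convex because its derivative increases, so its graph lies above
  each tangent, for displacements of either sign.\<close>

lemma tangent_nonneg:
  fixes P2 P :: "real \<Rightarrow> real"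
  assumes P2: "\<And>t. (P2 has_real_derivative P t) (at t)" and P: "mono P"
  shows "0 \<le> P2 (t - r) - P2 t + r * P t"
proof (cases r "0 :: real" rule: linorder_cases)
  case less
  then obtain x where x: "t < x" "P2 (t - r) - P2 t = (t - r - t) * P x"
    using MVT2[of t "t - r" P2 P] P2 by auto
  have "P t \<le> P x" using x P by (simp add: monoD)
  then have "0 \<le> (- r) * (P x - P t)" using less by (intro mult_nonneg_nonneg) auto
  then show ?thesis using x by (simp add: algebra_simps)
next
  case greater
  then obtain x where x: "x < t" "P2 t - P2 (t - r) = (t - (t - r)) * P x"
    using MVT2[of "t - r" t P2 P] P2 by auto
  have "P x \<le> P t" using x P by (simp add: monoD)
  then have "0 \<le> r * (P t - P x)" using greater by (intro mult_nonneg_nonneg) auto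
  then show ?thesis using x by (simp add: algebra_simps)
qed simp

context exp_moments
begin

lemma J_square: "J (\<lambda>t. b * t\<^sup>2 / 2) t = b * (t * m1 - m2 / 2)"
proof -
  have "J (\<lambda>t. b * t\<^sup>2 / 2) t = (\<integral>r. (b * t) * r - (b / 2) * r\<^sup>2 \<partial>\<mu>)"
    unfolding J_def by (intro Bochner_Integration.integral_cong) (auto simp: power2_eq_square field_simps)
  also have "\<dots> = (b * t) * m1 - (b / 2) * m2"
    using integrable_id integrable_square by (simp add: m1_def m2_def)
  finally show ?thesis by (simp add: algebra_simps)
qed

text \<open>The right side is the first-order Taylor remainder of \<open>P2\<close> averaged over
  \<open>\<mu>\<close>. In this form its sign and its size can be read off pointwise in
  \<open>r\<close>.\<close>

lemma Z_eq:
  assumes "slow P2"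
  shows "m1 * P t - J P2 t = (\<integral>r. P2 (t - r) - P2 t + r * P t \<partial>\<mu>)"
proof -
  have "(\<integral>r. P2 (t - r) - P2 t + r * P t \<partial>\<mu>) = (\<integral>r. r * P t - (P2 t - P2 (t - r)) \<partial>\<mu>)"
    by (intro Bochner_Integration.integral_cong) auto
  also have "\<dots> = m1 * P t - J P2 t"
    using integrable_id slow_shift_integrable[OF assms, of t] by (simp add: J_def m1_def)
  finally show ?thesis ..
qed

context
  fixes D D' \<rho> P :: "real \<Rightarrow> real" and a :: real
  assumes \<kappa>: "0 < measure \<mu> UNIV" and D: "slow D" and D1: "\<And>t. (D has_real_derivative D' t) (at t)"
    and D2: "\<And>t. (D' has_real_derivative J D t - a * D' t + \<rho> t) (at t)"
    and rho: "(\<rho> \<longlongrightarrow> 0) at_bot"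
    and P: "\<And>t. (P has_real_derivative D t) (at t)"
begin

text \<open>Supplies the majorant for dominated convergence along the peaks, while
  \<open>P_increment_approx\<close> supplies the pointwise limit.\<close>

lemma P_increment_le:
  assumes "\<And>s. \<bar>D (t + s)\<bar> \<le> \<bar>D t\<bar> * exp (h0/2 * \<bar>s\<bar>)" "\<bar>u - t\<bar> \<le> \<bar>r\<bar>"
  shows "\<bar>P u - P t\<bar> \<le> \<bar>D t\<bar> * exp (h0/2 * \<bar>r\<bar>) * \<bar>r\<bar>"
proof -
  have "\<bar>P u - P t\<bar> \<le> (\<bar>D t\<bar> * exp (h0/2 * \<bar>r\<bar>)) * \<bar>u - t\<bar>"
  proof (rule antiderivative_diff_le[OF P])
    fix v assume v: "\<bar>v - t\<bar> \<le> \<bar>u - t\<bar>"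
    have "exp (h0/2 * \<bar>v - t\<bar>) \<le> exp (h0/2 * \<bar>r\<bar>)"
      unfolding exp_le_cancel_iff using v assms(2) h0 by (intro mult_left_mono) auto
    then have "\<bar>D t\<bar> * exp (h0/2 * \<bar>v - t\<bar>) \<le> \<bar>D t\<bar> * exp (h0/2 * \<bar>r\<bar>)" by (intro mult_left_mono) auto
    then show "\<bar>D v\<bar> \<le> \<bar>D t\<bar> * exp (h0/2 * \<bar>r\<bar>)" using assms(1)[of "v - t"] by simp
  qed
  also have "\<dots> \<le> (\<bar>D t\<bar> * exp (h0/2 * \<bar>r\<bar>)) * \<bar>r\<bar>" using assms(2) by (intro mult_left_mono) auto
  finally show ?thesis .
qed

lemma P_increment_approx:
  assumes "\<And>s. \<bar>s\<bar> \<le> \<bar>r\<bar> \<Longrightarrow> \<bar>D (t + s) / D t - 1\<bar> \<le> \<eta>" "D t \<noteq> 0" "\<bar>u - t\<bar> \<le> \<bar>r\<bar>"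
  shows "\<bar>P u - P t - (u - t) * D t\<bar> \<le> \<eta> * \<bar>D t\<bar> * \<bar>r\<bar>"
proof -
  have "\<bar>(\<lambda>u. P u - u * D t) u - (\<lambda>u. P u - u * D t) t\<bar> \<le> (\<eta> * \<bar>D t\<bar>) * \<bar>u - t\<bar>"
  proof (rule antiderivative_diff_le[where X = "\<lambda>u. D u - D t"])
    show "((\<lambda>u. P u - u * D t) has_real_derivative D u - D t) (at u)" for u
      by (auto intro!: derivative_eq_intros P)
    fix v assume v: "\<bar>v - t\<bar> \<le> \<bar>u - t\<bar>"
    have "\<bar>D v / D t - 1\<bar> \<le> \<eta>" using assms(1)[of "v - t"] v assms(3) by simp
    then have "\<bar>D v / D t - 1\<bar> * \<bar>D t\<bar> \<le> \<eta> * \<bar>D t\<bar>" by (rule mult_right_mono) simp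
    then show "\<bar>D v - D t\<bar> \<le> \<eta> * \<bar>D t\<bar>" using assms(2) by (simp add: abs_mult[symmetric] algebra_simps)
  qed
  moreover have "0 \<le> \<eta>" using assms(1)[of 0] assms(2) by simp
  then have "(\<eta> * \<bar>D t\<bar>) * \<bar>u - t\<bar> \<le> (\<eta> * \<bar>D t\<bar>) * \<bar>r\<bar>" using assms(3) by (intro mult_left_mono) auto
  ultimately show ?thesis by (simp add: algebra_simps)
qed

text \<open>Where \<open>D\<close> is nearly constant, \<open>D' + a * D - J P\<close> is about \<open>(a - m1) * D\<close>, so it controls \<open>D\<close> unless
  \<open>a = m1\<close> (a double characteristic root). In that case the next antiderivative, about \<open>(1 + m2 / 2) * D\<close>, does.\<close>

lemma tendsto_0_if_Y_tendsto_0: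
  assumes Y: "((\<lambda>t. D' t + a * D t - J P t) \<longlongrightarrow> 0) at_bot" and a: "a \<noteq> m1"
  shows "(D \<longlongrightarrow> 0) at_bot"
proof (rule ccontr)
  assume "\<not> (D \<longlongrightarrow> 0) at_bot"
  from slow_peaks[OF \<kappa> D D1 D2 rho this] obtain A \<tau> where A: "0 < A" and tau: "\<forall>n. A \<le> \<bar>D (\<tau> n)\<bar>"
    and lim: "filterlim \<tau> at_bot sequentially"
    and bd: "\<forall>n s. \<bar>D (\<tau> n + s)\<bar> \<le> \<bar>D (\<tau> n)\<bar> * exp (h0/2 * \<bar>s\<bar>)"
    and D'lim: "(\<lambda>n. D' (\<tau> n) / D (\<tau> n)) \<longlonglongrightarrow> 0"
    and unif: "\<forall>R \<eta>. 0 < \<eta> \<longrightarrow> eventually (\<lambda>n. \<forall>s. \<bar>s\<bar> \<le> R \<longrightarrow> \<bar>D (\<tau> n + s) / D (\<tau> n) - 1\<bar> \<le> \<eta>) sequentially"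
    by (elim exE conjE)
  note tau = tau[rule_format] and bd = bd[rule_format] and unif = unif[rule_format]
  have D0: "D (\<tau> n) \<noteq> 0" for n using tau[of n] A by auto
  \<comment> \<open>\<open>D\<close> is flat around the peaks, so the increment of \<open>P\<close>
    over a length \<open>r\<close> is about \<open>r\<close> times \<open>D\<close>; after
    integration the quotient of \<open>J P\<close> by \<open>D\<close> tends to
    \<open>m1\<close>.\<close>
  have "(\<lambda>n. \<integral>r. (P (\<tau> n) - P (\<tau> n - r)) / D (\<tau> n) \<partial>\<mu>) \<longlonglongrightarrow> (\<integral>r. r \<partial>\<mu>)"
  proof (rule integral_dominated_convergence[where w = "\<lambda>r. (2 / h0) * exp (h0 * \<bar>r\<bar>)"])
    show "AE r in \<mu>. (\<lambda>n. (P (\<tau> n) - P (\<tau> n - r)) / D (\<tau> n)) \<longlonglongrightarrow> r"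
    proof (intro AE_I2 LIMSEQ_I)
      fix r e :: real assume e: "0 < e"
      define \<eta> where "\<eta> = e / (\<bar>r\<bar> + 1)"
      have eta: "0 < \<eta>" "\<eta> * \<bar>r\<bar> < e" using e by (auto simp: \<eta>_def field_simps)
      have "eventually (\<lambda>n. norm ((P (\<tau> n) - P (\<tau> n - r)) / D (\<tau> n) - r) < e) sequentially"
        using unif[OF eta(1), of "\<bar>r\<bar>"]
      proof eventually_elim
        case (elim n)
        have "\<bar>P (\<tau> n - r) - P (\<tau> n) - (\<tau> n - r - \<tau> n) * D (\<tau> n)\<bar> \<le> \<eta> * \<bar>D (\<tau> n)\<bar> * \<bar>r\<bar>"
          by (rule P_increment_approx[OF _ D0]) (use elim in auto)
        moreover have "\<eta> * \<bar>r\<bar> * \<bar>D (\<tau> n)\<bar> < e * \<bar>D (\<tau> n)\<bar>" using eta(2) D0[of n] by (intro mult_strict_right_mono) auto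
        ultimately have "\<bar>P (\<tau> n) - P (\<tau> n - r) - r * D (\<tau> n)\<bar> < e * \<bar>D (\<tau> n)\<bar>"
          by (simp add: algebra_simps abs_minus_commute)
        moreover have "norm ((P (\<tau> n) - P (\<tau> n - r)) / D (\<tau> n) - r) = \<bar>P (\<tau> n) - P (\<tau> n - r) - r * D (\<tau> n)\<bar> / \<bar>D (\<tau> n)\<bar>"
          using D0[of n] by (simp add: abs_divide[symmetric] diff_divide_distrib)
        ultimately show ?case using D0[of n] by (simp add: pos_divide_less_eq)
      qed
      then show "\<exists>no. \<forall>n\<ge>no. norm ((P (\<tau> n) - P (\<tau> n - r)) / D (\<tau> n) - r) < e"
        by (simp add: eventually_sequentially)
    qed
    show "AE r in \<mu>. norm ((P (\<tau> n) - P (\<tau> n - r)) / D (\<tau> n)) \<le> (2 / h0) * exp (h0 * \<bar>r\<bar>)" for n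
    proof (rule AE_I2)
      fix r
      have "\<bar>P (\<tau> n - r) - P (\<tau> n)\<bar> \<le> \<bar>D (\<tau> n)\<bar> * exp (h0/2 * \<bar>r\<bar>) * \<bar>r\<bar>"
        by (rule P_increment_le[OF bd]) auto
      also have "\<dots> \<le> \<bar>D (\<tau> n)\<bar> * exp (h0/2 * \<bar>r\<bar>) * (exp (h0/2 * \<bar>r\<bar>) / (h0/2))"
        using abs_le_exp_divide[of "h0/2" r] h0 by (intro mult_left_mono) auto
      also have "\<dots> = \<bar>D (\<tau> n)\<bar> * ((2 / h0) * exp (h0 * \<bar>r\<bar>))" by (simp add: exp_add[symmetric] field_simps)
      finally show "norm ((P (\<tau> n) - P (\<tau> n - r)) / D (\<tau> n)) \<le> (2 / h0) * exp (h0 * \<bar>r\<bar>)"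
        using D0[of n] by (simp add: abs_divide pos_divide_le_eq abs_minus_commute mult.commute)
    qed
    show "(\<lambda>r. (P (\<tau> n) - P (\<tau> n - r)) / D (\<tau> n)) \<in> borel_measurable \<mu>" for n
      using slow_shift_integrable[OF slow_antiderivative[OF P D], of "\<tau> n"] by simp
  qed (auto intro!: measurable_cont exp_int continuous_intros)
  then have JP: "(\<lambda>n. J P (\<tau> n) / D (\<tau> n)) \<longlonglongrightarrow> m1" by (simp add: J_def m1_def)
  have "(\<lambda>n. D' (\<tau> n) / D (\<tau> n) + a - J P (\<tau> n) / D (\<tau> n)) \<longlonglongrightarrow> 0 + a - m1"
    by (intro tendsto_intros D'lim JP)
  \<comment> \<open>Dividing by \<open>D\<close> is harmless because the peaks have height at least
    \<open>A\<close>.\<close>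
  moreover have "(\<lambda>n. D' (\<tau> n) / D (\<tau> n) + a - J P (\<tau> n) / D (\<tau> n)) \<longlonglongrightarrow> 0"
  proof (rule Lim_null_comparison)
    have "(\<lambda>n. (D' (\<tau> n) + a * D (\<tau> n) - J P (\<tau> n)) / A) \<longlonglongrightarrow> 0 / A"
      by (intro tendsto_divide filterlim_compose[OF Y lim] tendsto_const) (use A in auto)
    then show "(\<lambda>n. norm ((D' (\<tau> n) + a * D (\<tau> n) - J P (\<tau> n)) / A)) \<longlonglongrightarrow> 0"
      using tendsto_norm by fastforce
    have "norm (D' (\<tau> n) / D (\<tau> n) + a - J P (\<tau> n) / D (\<tau> n)) \<le> norm ((D' (\<tau> n) + a * D (\<tau> n) - J P (\<tau> n)) / A)" for n
    proof -
      have "D' (\<tau> n) / D (\<tau> n) + a - J P (\<tau> n) / D (\<tau> n) = (D' (\<tau> n) + a * D (\<tau> n) - J P (\<tau> n)) / D (\<tau> n)"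
        using D0[of n] by (simp add: field_simps)
      then show ?thesis using A tau[of n] by (simp add: abs_divide divide_left_mono)
    qed
    then show "eventually (\<lambda>n. norm (D' (\<tau> n) / D (\<tau> n) + a - J P (\<tau> n) / D (\<tau> n)) \<le>
        norm ((D' (\<tau> n) + a * D (\<tau> n) - J P (\<tau> n)) / A)) sequentially" by simp
  qed
  ultimately have "0 + a - m1 = 0" by (rule LIMSEQ_unique)
  then show False using a by simp
qed

text \<open>Relative to \<open>D\<close>, the Taylor remainder of the second antiderivative tends to
  \<open>r\<^sup>2 / 2\<close> along the peaks. The resulting factor \<open>1 + m2 / 2\<close> is at
  least 1, so no further degeneration can occur.\<close>

lemma tendsto_0_if_Z_tendsto_0:
  assumes Q: "\<And>t. (Q has_real_derivative P t) (at t)" and a: "a = m1"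
    and Z: "((\<lambda>t. D t + a * P t - J Q t) \<longlongrightarrow> 0) at_bot"
  shows "(D \<longlongrightarrow> 0) at_bot"
proof (rule ccontr)
  assume "\<not> (D \<longlongrightarrow> 0) at_bot"
  from slow_peaks[OF \<kappa> D D1 D2 rho this] obtain A \<tau> where A: "0 < A" and tau: "\<forall>n. A \<le> \<bar>D (\<tau> n)\<bar>"
    and lim: "filterlim \<tau> at_bot sequentially"
    and bd: "\<forall>n s. \<bar>D (\<tau> n + s)\<bar> \<le> \<bar>D (\<tau> n)\<bar> * exp (h0/2 * \<bar>s\<bar>)"
    and D'lim: "(\<lambda>n. D' (\<tau> n) / D (\<tau> n)) \<longlonglongrightarrow> 0"
    and unif: "\<forall>R \<eta>. 0 < \<eta> \<longrightarrow> eventually (\<lambda>n. \<forall>s. \<bar>s\<bar> \<le> R \<longrightarrow> \<bar>D (\<tau> n + s) / D (\<tau> n) - 1\<bar> \<le> \<eta>) sequentially"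
    by (elim exE conjE)
  note tau = tau[rule_format] and bd = bd[rule_format] and unif = unif[rule_format]
  have D0: "D (\<tau> n) \<noteq> 0" for n using tau[of n] A by auto
  have sP: "slow P" by (rule slow_antiderivative[OF P D])
  have sQ: "slow Q" by (rule slow_antiderivative[OF Q sP])
  let ?T = "\<lambda>t r. Q (t - r) - Q t + r * P t"
  have "(\<lambda>n. \<integral>r. ?T (\<tau> n) r / D (\<tau> n) \<partial>\<mu>) \<longlonglongrightarrow> (\<integral>r. r\<^sup>2 / 2 \<partial>\<mu>)"
  proof (rule integral_dominated_convergence[where w = "\<lambda>r. (8 / h0\<^sup>2) * exp (h0 * \<bar>r\<bar>)"])
    show "AE r in \<mu>. (\<lambda>n. ?T (\<tau> n) r / D (\<tau> n)) \<longlonglongrightarrow> r\<^sup>2 / 2"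
    proof (intro AE_I2 LIMSEQ_I)
      fix r e :: real assume e: "0 < e"
      define \<eta> where "\<eta> = e / (r\<^sup>2 + 1)"
      have pos: "0 < r\<^sup>2 + 1" by (rule add_nonneg_pos) auto
      have eta: "0 < \<eta>" "\<eta> * r\<^sup>2 < e" using e pos by (auto simp: \<eta>_def field_simps)
      have "eventually (\<lambda>n. norm (?T (\<tau> n) r / D (\<tau> n) - r\<^sup>2 / 2) < e) sequentially"
        using unif[OF eta(1), of "\<bar>r\<bar>"]
      proof eventually_elim
        case (elim n)
        let ?t = "\<tau> n"
        let ?R = "\<lambda>u. Q u - (u - ?t) * P ?t - (u - ?t)\<^sup>2 / 2 * D ?t"
        have "\<bar>?R (?t - r) - ?R ?t\<bar> \<le> (\<eta> * \<bar>D ?t\<bar> * \<bar>r\<bar>) * \<bar>?t - r - ?t\<bar>"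
        proof (rule antiderivative_diff_le[where X = "\<lambda>u. P u - P ?t - (u - ?t) * D ?t"])
          show "(?R has_real_derivative P u - P ?t - (u - ?t) * D ?t) (at u)" for u
            by (auto intro!: derivative_eq_intros Q)
          show "\<bar>P v - P ?t - (v - ?t) * D ?t\<bar> \<le> \<eta> * \<bar>D ?t\<bar> * \<bar>r\<bar>" if "\<bar>v - ?t\<bar> \<le> \<bar>?t - r - ?t\<bar>" for v
            by (rule P_increment_approx[OF _ D0]) (use elim that in auto)
        qed
        moreover have "\<eta> * \<bar>D ?t\<bar> * \<bar>r\<bar> * \<bar>r\<bar> = \<eta> * r\<^sup>2 * \<bar>D ?t\<bar>"
          unfolding power2_abs[of r, symmetric] power2_eq_square by simp
        moreover have "\<eta> * r\<^sup>2 * \<bar>D ?t\<bar> < e * \<bar>D ?t\<bar>" using eta(2) D0[of n] by (intro mult_strict_right_mono) auto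
        moreover have "?R (?t - r) - ?R ?t = ?T ?t r - r\<^sup>2 / 2 * D ?t" "\<bar>?t - r - ?t\<bar> = \<bar>r\<bar>"
          by (simp_all add: algebra_simps)
        ultimately have "\<bar>?T ?t r - r\<^sup>2 / 2 * D ?t\<bar> < e * \<bar>D ?t\<bar>" by simp
        moreover have "norm (?T ?t r / D ?t - r\<^sup>2 / 2) = \<bar>?T ?t r - r\<^sup>2 / 2 * D ?t\<bar> / \<bar>D ?t\<bar>"
          using D0[of n] by (simp add: abs_divide[symmetric] diff_divide_distrib)
        ultimately show ?case using D0[of n] by (simp add: pos_divide_less_eq)
      qed
      then show "\<exists>no. \<forall>n\<ge>no. norm (?T (\<tau> n) r / D (\<tau> n) - r\<^sup>2 / 2) < e"
        by (simp add: eventually_sequentially)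
    qed
    show "AE r in \<mu>. norm (?T (\<tau> n) r / D (\<tau> n)) \<le> (8 / h0\<^sup>2) * exp (h0 * \<bar>r\<bar>)" for n
    proof (rule AE_I2)
      fix r
      let ?t = "\<tau> n"
      let ?R = "\<lambda>u. Q u - (u - ?t) * P ?t"
      have "\<bar>?R (?t - r) - ?R ?t\<bar> \<le> (\<bar>D ?t\<bar> * exp (h0/2 * \<bar>r\<bar>) * \<bar>r\<bar>) * \<bar>?t - r - ?t\<bar>"
      proof (rule antiderivative_diff_le[where X = "\<lambda>u. P u - P ?t"])
        show "(?R has_real_derivative P u - P ?t) (at u)" for u by (auto intro!: derivative_eq_intros Q)
        show "\<bar>P v - P ?t\<bar> \<le> \<bar>D ?t\<bar> * exp (h0/2 * \<bar>r\<bar>) * \<bar>r\<bar>" if "\<bar>v - ?t\<bar> \<le> \<bar>?t - r - ?t\<bar>" for v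
          by (rule P_increment_le[OF bd]) (use that in auto)
      qed
      then have "\<bar>?T ?t r\<bar> \<le> (\<bar>D ?t\<bar> * exp (h0/2 * \<bar>r\<bar>)) * r\<^sup>2"
        by (simp add: power2_eq_square mult_ac)
      also have "\<dots> \<le> \<bar>D ?t\<bar> * exp (h0/2 * \<bar>r\<bar>) * (2 * exp (h0/2 * \<bar>r\<bar>) / (h0/2)\<^sup>2)"
        using square_le_exp_divide[of "h0/2" r] h0 by (intro mult_left_mono) auto
      also have "\<dots> = \<bar>D ?t\<bar> * ((8 / h0\<^sup>2) * exp (h0 * \<bar>r\<bar>))"
      proof -
        have 1: "2 * E / (h0/2)\<^sup>2 = 8 / h0\<^sup>2 * E" for E by (simp add: power_divide)
        have 2: "d * E * (k * E) = d * (k * (E * E))" for d E k :: real by simp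
        have 3: "exp (h0/2 * \<bar>r\<bar>) * exp (h0/2 * \<bar>r\<bar>) = exp (h0 * \<bar>r\<bar>)" by (simp add: exp_add[symmetric])
        show ?thesis unfolding 1 2 3 ..
      qed
      finally show "norm (?T ?t r / D ?t) \<le> (8 / h0\<^sup>2) * exp (h0 * \<bar>r\<bar>)"
        using D0[of n] by (simp add: abs_divide pos_divide_le_eq mult.commute)
    qed
    show "(\<lambda>r. ?T (\<tau> n) r / D (\<tau> n)) \<in> borel_measurable \<mu>" for n
      by (intro borel_measurable_divide borel_measurable_add borel_measurable_diff borel_measurable_times
          borel_measurable_const borel_measurable_integrable[OF slow_shift_integrable[OF sQ]]
          borel_measurable_integrable[OF integrable_id])
  qed (auto intro!: measurable_cont exp_int continuous_intros)
  then have "(\<lambda>n. (m1 * P (\<tau> n) - J Q (\<tau> n)) / D (\<tau> n)) \<longlonglongrightarrow> m2 / 2"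
    by (simp add: Z_eq[OF sQ] m2_def)
  then have "(\<lambda>n. 1 + (m1 * P (\<tau> n) - J Q (\<tau> n)) / D (\<tau> n)) \<longlonglongrightarrow> 1 + m2 / 2"
    by (rule tendsto_add[OF tendsto_const])
  moreover have "(\<lambda>n. 1 + (m1 * P (\<tau> n) - J Q (\<tau> n)) / D (\<tau> n)) \<longlonglongrightarrow> 0"
  proof (rule Lim_null_comparison)
    have "(\<lambda>n. (D (\<tau> n) + a * P (\<tau> n) - J Q (\<tau> n)) / A) \<longlonglongrightarrow> 0 / A"
      by (intro tendsto_divide filterlim_compose[OF Z lim] tendsto_const) (use A in auto)
    then show "(\<lambda>n. norm ((D (\<tau> n) + a * P (\<tau> n) - J Q (\<tau> n)) / A)) \<longlonglongrightarrow> 0"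
      using tendsto_norm by fastforce
    have "norm (1 + (m1 * P (\<tau> n) - J Q (\<tau> n)) / D (\<tau> n)) \<le> norm ((D (\<tau> n) + a * P (\<tau> n) - J Q (\<tau> n)) / A)" for n
    proof -
      have "1 + (m1 * P (\<tau> n) - J Q (\<tau> n)) / D (\<tau> n) = (D (\<tau> n) + a * P (\<tau> n) - J Q (\<tau> n)) / D (\<tau> n)"
        using D0[of n] a by (simp add: field_simps)
      then show ?thesis using A tau[of n] by (simp add: abs_divide divide_left_mono)
    qed
    then show "eventually (\<lambda>n. norm (1 + (m1 * P (\<tau> n) - J Q (\<tau> n)) / D (\<tau> n)) \<le>
        norm ((D (\<tau> n) + a * P (\<tau> n) - J Q (\<tau> n)) / A)) sequentially" by simp
  qed
  ultimately have "1 + m2 / 2 = 0" by (rule LIMSEQ_unique)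
  then show False using m2_nonneg by simp
qed

end

lemma J_minus_const: "slow X \<Longrightarrow> J (\<lambda>t. X t - b) t = J X t" by (simp add: J_def)

text \<open>The first integral \<open>D' t + a * D t - J P t\<close> converges because its
  derivative is the forcing. A constant \<open>b\<close> in place of \<open>D\<close> contributes
  \<open>b * (a - m1)\<close> to it, which determines \<open>b\<close>; subtracting it reduces the
  claim to the case of limit 0.\<close>

lemma strict_limit:
  assumes \<kappa>: "0 < measure \<mu> UNIV" and D: "slow D" and D1: "\<And>t. (D has_real_derivative D' t) (at t)"
    and D2: "\<And>t. (D' has_real_derivative J D t - a * D' t + \<rho> t) (at t)"
    and eta: "0 < \<eta>" and rho: "\<And>t. \<bar>\<rho> t\<bar> \<le> C * exp (\<eta> * t)" and a: "a \<noteq> m1"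
  shows "\<exists>b. (D \<longlongrightarrow> b) at_bot"
proof -
  obtain P where P: "\<And>t. (P has_real_derivative D t) (at t)"
    using antiderivative_exists[OF slow_continuous[OF D]] by blast
  have "((\<lambda>t. D' t + a * D t - J P t) has_real_derivative \<rho> t) (at t)" for t
    by (rule derivative_eq_intros D1 D2 J_deriv[OF P D] refl | simp)+
  from exponential_antiderivative_limit[OF this eta rho] obtain \<beta> where
    \<beta>: "\<And>t. \<bar>D' t + a * D t - J P t - \<beta>\<bar> \<le> C / \<eta> * exp (\<eta> * t)" by blast
  define b where "b = \<beta> / (a - m1)"
  have b: "b * (a - m1) = \<beta>" using a by (simp add: b_def)
  have "((\<lambda>t. D t - b) \<longlongrightarrow> 0) at_bot"
  proof (rule tendsto_0_if_Y_tendsto_0[OF \<kappa>, where P = "\<lambda>t. P t - b * t" and D' = D' and \<rho> = \<rho> and a = a])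
    show "slow (\<lambda>t. D t - b)" by (intro slow_diff D slow_bounded[where C = "\<bar>b\<bar>"]) auto
    show "((\<lambda>t. D t - b) has_real_derivative D' t) (at t)" for t by (auto intro!: derivative_eq_intros D1)
    show "(D' has_real_derivative J (\<lambda>t. D t - b) t - a * D' t + \<rho> t) (at t)" for t
      using D2 by (simp add: J_minus_const[OF D])
    show "(\<rho> \<longlongrightarrow> 0) at_bot" by (rule tendsto_0_if_exp_bound[OF eta rho])
    show "((\<lambda>t. P t - b * t) has_real_derivative D t - b) (at t)" for t by (auto intro!: derivative_eq_intros P)
    have JP: "J (\<lambda>t. P t - b * t) t = J P t - b * m1" for t
      by (simp only: J_diff[OF slow_antiderivative[OF P D] slow_linear] J_linear)
    have "D' t + a * (D t - b) - J (\<lambda>t. P t - b * t) t = D' t + a * D t - J P t - \<beta>" for t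
      unfolding JP using b by (simp add: algebra_simps)
    then show "((\<lambda>t. D' t + a * (D t - b) - J (\<lambda>t. P t - b * t) t) \<longlongrightarrow> 0) at_bot"
      using tendsto_0_if_exp_bound[OF eta \<beta>] by (simp only:)
  qed (rule a)
  then show ?thesis using Lim_null[of D b] by blast
qed

text \<open>With coefficient \<open>m1\<close>, constants are invisible to the first integral. Its
  vanishing at minus infinity makes it exponentially small, so that it can be integrated once
  more.\<close>

lemma critical_limit:
  assumes \<kappa>: "0 < measure \<mu> UNIV" and D: "slow D" and D1: "\<And>t. (D has_real_derivative D' t) (at t)"
    and D2: "\<And>t. (D' has_real_derivative J D t - m1 * D' t + \<rho> t) (at t)"
    and eta: "0 < \<eta>" and rho: "\<And>t. \<bar>\<rho> t\<bar> \<le> C * exp (\<eta> * t)"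
    and P: "\<And>t. (P has_real_derivative D t) (at t)"
    and Y0: "((\<lambda>t. D' t + m1 * D t - J P t) \<longlongrightarrow> 0) at_bot"
  shows "\<exists>b. (D \<longlongrightarrow> b) at_bot"
proof -
  have sP: "slow P" by (rule slow_antiderivative[OF P D])
  define Y where "Y t = D' t + m1 * D t - J P t" for t
  have Y': "(Y has_real_derivative \<rho> t) (at t)" for t
    unfolding Y_def by (rule derivative_eq_intros D1 D2 J_deriv[OF P D] refl | simp)+
  from exponential_antiderivative_limit[OF this eta rho] obtain \<beta> where
    \<beta>: "\<And>t. \<bar>Y t - \<beta>\<bar> \<le> C / \<eta> * exp (\<eta> * t)" by blast
  have "(Y \<longlongrightarrow> \<beta>) at_bot" using tendsto_0_if_exp_bound[OF eta \<beta>] Lim_null by blast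
  then have "\<beta> = 0" using Y0 tendsto_unique[of at_bot Y \<beta> 0] by (simp add: Y_def[abs_def])
  then have Y: "\<And>t. \<bar>Y t\<bar> \<le> C / \<eta> * exp (\<eta> * t)" using \<beta> by simp
  obtain P2 where P2: "\<And>t. (P2 has_real_derivative P t) (at t)"
    using antiderivative_exists[OF slow_continuous[OF sP]] by blast
  have sP2: "slow P2" by (rule slow_antiderivative[OF P2 sP])
  have "((\<lambda>t. D t + m1 * P t - J P2 t) has_real_derivative Y t) (at t)" for t
    unfolding Y_def by (rule derivative_eq_intros D1 P J_deriv[OF P2 sP] refl | simp)+
  from exponential_antiderivative_limit[OF this eta Y] obtain \<beta>0 where
    \<beta>0: "\<And>t. \<bar>D t + m1 * P t - J P2 t - \<beta>0\<bar> \<le> C / \<eta> / \<eta> * exp (\<eta> * t)" by blast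
  \<comment> \<open>A constant \<open>b\<close> contributes \<open>b * (1 + m2 / 2)\<close> to the
    second integral, because the terms linear in \<open>t\<close> cancel.\<close>
  define b where "b = \<beta>0 / (1 + m2 / 2)"
  have b: "b * (1 + m2 / 2) = \<beta>0" using m2_nonneg by (simp add: b_def)
  have "((\<lambda>t. D t - b) \<longlongrightarrow> 0) at_bot"
  proof (rule tendsto_0_if_Z_tendsto_0[OF \<kappa>, where P = "\<lambda>t. P t - b * t" and D' = D' and \<rho> = \<rho> and a = m1
        and Q = "\<lambda>t. P2 t - b * t\<^sup>2 / 2"])
    show "slow (\<lambda>t. D t - b)" by (intro slow_diff D slow_bounded[where C = "\<bar>b\<bar>"]) auto
    show "((\<lambda>t. D t - b) has_real_derivative D' t) (at t)" for t by (auto intro!: derivative_eq_intros D1)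
    show "(D' has_real_derivative J (\<lambda>t. D t - b) t - m1 * D' t + \<rho> t) (at t)" for t
      using D2 by (simp add: J_minus_const[OF D])
    show "(\<rho> \<longlongrightarrow> 0) at_bot" by (rule tendsto_0_if_exp_bound[OF eta rho])
    show "((\<lambda>t. P t - b * t) has_real_derivative D t - b) (at t)" for t by (auto intro!: derivative_eq_intros P)
    show "((\<lambda>t. P2 t - b * t\<^sup>2 / 2) has_real_derivative P t - b * t) (at t)" for t by (auto intro!: derivative_eq_intros P2)
    have JP2: "J (\<lambda>t. P2 t - b * t\<^sup>2 / 2) t = J P2 t - b * (t * m1 - m2 / 2)" for t
      by (simp only: J_diff[OF sP2 slow_square] J_square)
    have "D t - b + m1 * (P t - b * t) - J (\<lambda>t. P2 t - b * t\<^sup>2 / 2) t = D t + m1 * P t - J P2 t - \<beta>0" for t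
      unfolding JP2 using b by (simp add: algebra_simps)
    then show "((\<lambda>t. D t - b + m1 * (P t - b * t) - J (\<lambda>t. P2 t - b * t\<^sup>2 / 2) t) \<longlongrightarrow> 0) at_bot"
      using tendsto_0_if_exp_bound[OF eta \<beta>0] by (simp only:)
    show "m1 = m1" ..
  qed
  then show ?thesis using Lim_null[of D b] by blast
qed

text \<open>\<open>Z\<close> is nonnegative, being \<open>D\<close> plus the averaged tangent
  remainder of a convex function, and its derivative tends to \<open>\<beta>\<close>. A positive
  limit would force \<open>Z\<close> below zero far to the left.\<close>

lemma critical_sign:
  assumes D: "slow D" "\<And>t. 0 \<le> D t" and D1: "\<And>t. (D has_real_derivative D' t) (at t)"
    and P: "\<And>t. (P has_real_derivative D t) (at t)"
    and Y: "((\<lambda>t. D' t + m1 * D t - J P t) \<longlongrightarrow> \<beta>) at_bot"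
  shows "\<beta> \<le> 0"
proof (rule ccontr)
  assume "\<not> \<beta> \<le> 0"
  then have b: "0 < \<beta>/2" by simp
  have sP: "slow P" by (rule slow_antiderivative[OF P D(1)])
  obtain P2 where P2: "\<And>t. (P2 has_real_derivative P t) (at t)"
    using antiderivative_exists[OF slow_continuous[OF sP]] by blast
  have sP2: "slow P2" by (rule slow_antiderivative[OF P2 sP])
  define Z where "Z t = D t + m1 * P t - J P2 t" for t
  have "mono P"
    by (intro monoI DERIV_nonneg_imp_nondecreasing[where f = P]) (use P D(2) in blast)+
  then have Z0: "0 \<le> Z t" for t
    using D(2)[of t] Z_eq[OF sP2, of P t] tangent_nonneg[OF P2]
    by (simp add: Z_def add_diff_eq[symmetric] integral_nonneg_AE)
  have Z': "(Z has_real_derivative D' t + m1 * D t - J P t) (at t)" for t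
    unfolding Z_def by (rule derivative_eq_intros D1 P J_deriv[OF P2 sP] refl | simp)+
  have "eventually (\<lambda>t. \<beta>/2 < D' t + m1 * D t - J P t) at_bot"
    by (rule order_tendstoD[OF Y]) (use b in simp)
  then obtain N where N: "\<And>t. t \<le> N \<Longrightarrow> \<beta>/2 < D' t + m1 * D t - J P t"
    unfolding eventually_at_bot_linorder by blast
  \<comment> \<open>Chosen so that a slope of at least \<open>\<beta>/2\<close> brings
    \<open>Z\<close> down to -1.\<close>
  define t where "t = N - (Z N + 1) / (\<beta>/2)"
  have t: "t \<le> N" using Z0[of N] b by (simp add: t_def)
  have "(\<lambda>t. Z t - \<beta>/2 * t) t \<le> (\<lambda>t. Z t - \<beta>/2 * t) N"
  proof (rule DERIV_nonneg_imp_nondecreasing[OF t])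
    fix x assume "x \<le> N"
    then show "\<exists>y. ((\<lambda>t. Z t - \<beta>/2 * t) has_real_derivative y) (at x) \<and> 0 \<le> y"
      using N[of x] by (intro exI[of _ "D' x + m1 * D x - J P x - \<beta>/2"]) (auto intro!: derivative_eq_intros Z')
  qed
  then have "Z t \<le> Z N - \<beta>/2 * (N - t)" unfolding right_diff_distrib by linarith
  also have "\<beta>/2 * (N - t) = Z N + 1" using b by (simp add: t_def)
  finally show False using Z0[of t] by simp
qed

end

text \<open>A nonzero slope anywhere would carry the tangent line, which bounds \<open>Z\<close>
  from below by convexity, beyond \<open>B\<close>.\<close>

lemma convex_bounded_imp_affine:
  fixes Z Z' S :: "real \<Rightarrow> real"
  assumes Z: "\<And>t. (Z has_real_derivative Z' t) (at t)" and Z': "\<And>t. (Z' has_real_derivative S t) (at t)"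
    and S: "\<And>t. 0 \<le> S t" and bd: "\<And>t. \<bar>Z t\<bar> \<le> B"
  shows "S t = 0"
proof -
  have mono: "Z' s \<le> Z' t" if "s \<le> t" for s t
    by (rule DERIV_nonneg_imp_nondecreasing[OF that]) (use Z' S in blast)
  have above: "Z s + Z' s * (t - s) \<le> Z t" for s t
  proof -
    have "mono Z'" using mono by (simp add: monoI)
    from tangent_nonneg[OF Z this, of s "s - t"] show ?thesis by (simp add: algebra_simps)
  qed
  have zero: "Z' s = 0" for s
  proof (rule ccontr)
    assume nz: "Z' s \<noteq> 0"
    have "Z s + Z' s * (s + (2 * B + 1) / Z' s - s) \<le> Z (s + (2 * B + 1) / Z' s)" by (rule above)
    then have "Z s + (2 * B + 1) \<le> Z (s + (2 * B + 1) / Z' s)" using nz by simp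
    then show False using bd[of s] bd[of "s + (2 * B + 1) / Z' s"] by linarith
  qed
  have "Z' = (\<lambda>_. 0)" using zero by (rule ext)
  then have "((\<lambda>_. 0) has_real_derivative S t) (at t)" using Z'[of t] by simp
  then show ?thesis using DERIV_unique[OF _ DERIV_const] by blast
qed

text \<open>For twice iterated antiderivatives \<open>P2\<close> of \<open>V\<close>, the function \<open>V + m1 * P2' - J P2\<close> is bounded, and its second
  derivative is the given nonnegative expression; a bounded convex function on the line is constant.\<close>

lemma (in exp_moments) bounded_subharmonic:
  assumes V: "\<And>t. \<bar>V t\<bar> \<le> B" and V1: "\<And>t. (V has_real_derivative V' t) (at t)"
    and V2: "\<And>t. (V' has_real_derivative V'' t) (at t)"
    and S: "\<And>t. 0 \<le> V'' t + m1 * V' t - J V t"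
  shows "V'' t + m1 * V' t - J V t = 0"
proof -
  have cont: "continuous_on UNIV V" by (rule continuous_if_deriv[OF V1])
  have sV: "slow V" by (rule slow_bounded[OF cont V])
  obtain P where P: "\<And>t. (P has_real_derivative V t) (at t)" using antiderivative_exists[OF cont] by blast
  have sP: "slow P" by (rule slow_antiderivative[OF P sV])
  obtain P2 where P2: "\<And>t. (P2 has_real_derivative P t) (at t)"
    using antiderivative_exists[OF slow_continuous[OF sP]] by blast
  have sP2: "slow P2" by (rule slow_antiderivative[OF P2 sP])
  \<comment> \<open>Boundedness of \<open>V\<close> makes the Taylor remainder at most quadratic in
    \<open>r\<close>, so the second moment bounds the nonlocal part of \<open>Z\<close>.\<close>
  have T: "\<bar>P2 (t - r) - P2 t + r * P t\<bar> \<le> B * r\<^sup>2" for t r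
  proof -
    have "\<bar>(\<lambda>u. P2 u - (u - t) * P t) (t - r) - (\<lambda>u. P2 u - (u - t) * P t) t\<bar> \<le> (B * \<bar>r\<bar>) * \<bar>t - r - t\<bar>"
    proof (rule antiderivative_diff_le[where P = "\<lambda>u. P2 u - (u - t) * P t" and X = "\<lambda>u. P u - P t"])
      show "((\<lambda>u. P2 u - (u - t) * P t) has_real_derivative P u - P t) (at u)" for u
        by (auto intro!: derivative_eq_intros P2)
      fix u assume u: "\<bar>u - t\<bar> \<le> \<bar>t - r - t\<bar>"
      have "\<bar>P u - P t\<bar> \<le> B * \<bar>u - t\<bar>" by (rule antiderivative_diff_le[OF P V])
      also have "\<dots> \<le> B * \<bar>r\<bar>" using u V[of 0] by (intro mult_left_mono) auto
      finally show "\<bar>P u - P t\<bar> \<le> B * \<bar>r\<bar>" .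
    qed
    moreover have "(B * \<bar>r\<bar>) * \<bar>t - r - t\<bar> = B * r\<^sup>2"
      unfolding power2_abs[of r, symmetric] power2_eq_square by simp
    moreover have "(\<lambda>u. P2 u - (u - t) * P t) (t - r) - (\<lambda>u. P2 u - (u - t) * P t) t
        = P2 (t - r) - P2 t + r * P t" by simp
    ultimately show ?thesis by (simp only:)
  qed
  define Z where "Z t = V t + m1 * P t - J P2 t" for t
  show ?thesis
  proof (rule convex_bounded_imp_affine[where Z = Z and Z' = "\<lambda>t. V' t + m1 * V t - J P t" and B = "B + B * m2"
        and S = "\<lambda>t. V'' t + m1 * V' t - J V t"])
    show "(Z has_real_derivative V' t + m1 * V t - J P t) (at t)" for t
      unfolding Z_def by (rule derivative_eq_intros V1 P J_deriv[OF P2 sP] refl | simp)+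
    show "((\<lambda>t. V' t + m1 * V t - J P t) has_real_derivative V'' t + m1 * V' t - J V t) (at t)" for t
      by (rule derivative_eq_intros V1 V2 J_deriv[OF P sV] refl | simp)+
    fix t
    have int: "integrable \<mu> (\<lambda>r. P2 (t - r) - P2 t + r * P t)"
      using slow_shift_integrable[OF sP2, of t] integrable_id by simp
    have "\<bar>\<integral>r. P2 (t - r) - P2 t + r * P t \<partial>\<mu>\<bar> \<le> (\<integral>r. B * r\<^sup>2 \<partial>\<mu>)"
      by (rule integral_abs_bound_integral[OF int]) (use T integrable_square in auto)
    then show "\<bar>Z t\<bar> \<le> B + B * m2"
      using V[of t] Z_eq[OF sP2, of P t] by (simp add: Z_def m2_def)
  qed (rule S)
qed

section \<open>Interpolating exponential weights\<close>

lemma integrable_exp_minus_abs: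
  assumes "0 < a" shows "integrable lborel (\<lambda>t::real. exp (- a * \<bar>t\<bar>))"
proof -
  have "set_integrable lebesgue {0..} (\<lambda>t::real. exp (- a * t))"
    by (intro nonnegative_absolutely_integrable_1 integrable_on_exp_minus_to_infinity assms) auto
  then have "set_integrable lborel {0..} (\<lambda>t::real. exp (- a * t))"
    by (simp add: set_integrable_def integrable_completion)
  then have 1: "integrable lborel (\<lambda>t::real. indicator {0..} t * exp (- a * t))" by (simp add: set_integrable_def)
  have 2: "integrable lborel (\<lambda>t::real. indicator {0..} (- t) * exp (- a * (- t)))"
    using lborel_integrable_real_affine[OF 1, of "-1" 0] by simp
  show ?thesis
  proof (rule Bochner_Integration.integrable_bound)
    show "integrable lborel (\<lambda>t. indicator {0..} t * exp (- a * t) + indicator {0..} (- t) * exp (- a * (- t)))"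
      using 1 2 by (rule Bochner_Integration.integrable_add)
  qed (auto simp: indicator_def intro!: AE_I2)
qed

lemma integral_derivative_eq_0:
  fixes F F' :: "real \<Rightarrow> real"
  assumes F: "\<And>t. (F has_real_derivative F' t) (at t)" and cont: "continuous_on UNIV F'"
    and int: "integrable lborel F'" and bot: "(F \<longlongrightarrow> 0) at_bot" and top: "(F \<longlongrightarrow> 0) at_top"
  shows "(\<integral>t. F' t \<partial>lborel) = 0"
proof -
  have "(LBINT x=-\<infinity>..\<infinity>. F' x) = 0 - 0"
  proof (rule interval_integral_FTC_integrable)
    show "(F has_vector_derivative F' x) (at x)" for x
      using F by (simp add: has_real_derivative_iff_has_vector_derivative)
    show "isCont F' x" for x using cont by (simp add: continuous_on_eq_continuous_at)
    show "set_integrable lborel (einterval (-\<infinity>) \<infinity>) F'" using int by (simp add: set_integrable_def)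
    show "((F \<circ> real_of_ereal) \<longlongrightarrow> 0) (at_right (-\<infinity>))" using bot unfolding ereal_tendsto_simps .
    show "((F \<circ> real_of_ereal) \<longlongrightarrow> 0) (at_left \<infinity>)" using top unfolding ereal_tendsto_simps .
  qed simp
  then show ?thesis by (simp add: interval_lebesgue_integral_def set_lebesgue_integral_def)
qed

lemma nn_integral_translate:
  fixes h :: "real \<Rightarrow> ennreal"
  assumes "h \<in> borel_measurable borel"
  shows "(\<integral>\<^sup>+t. h (t + r) \<partial>lborel) = (\<integral>\<^sup>+t. h t \<partial>lborel)"
  using nn_integral_real_affine[of h 1 r] assms by (simp add: add.commute)

text \<open>Moves the average from the profile to the weight. It is stated in \<open>ennreal\<close>
  so that it can be used before a moment at the new exponent is known to be finite.\<close>

lemma (in finite_borel) tonelli_shift: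
  fixes G w :: "real \<Rightarrow> ennreal"
  assumes [measurable]: "G \<in> borel_measurable borel" "w \<in> borel_measurable borel"
  shows "(\<integral>\<^sup>+t. w t * (\<integral>\<^sup>+r. G (t - r) \<partial>\<nu>) \<partial>lborel) = (\<integral>\<^sup>+t. G t * (\<integral>\<^sup>+r. w (t + r) \<partial>\<nu>) \<partial>lborel)"
proof -
  interpret P: pair_sigma_finite lborel \<nu> ..
  have "(\<integral>\<^sup>+t. w t * (\<integral>\<^sup>+r. G (t - r) \<partial>\<nu>) \<partial>lborel) = (\<integral>\<^sup>+t. (\<integral>\<^sup>+r. w t * G (t - r) \<partial>\<nu>) \<partial>lborel)"
    by (intro nn_integral_cong nn_integral_cmult[symmetric]) measurable
  also have "\<dots> = (\<integral>\<^sup>+r. (\<integral>\<^sup>+t. w t * G (t - r) \<partial>lborel) \<partial>\<nu>)"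
    by (rule P.Fubini'[symmetric]) measurable
  also have "\<dots> = (\<integral>\<^sup>+r. (\<integral>\<^sup>+t. w (t + r) * G t \<partial>lborel) \<partial>\<nu>)"
  proof (rule nn_integral_cong)
    fix r
    show "(\<integral>\<^sup>+t. w t * G (t - r) \<partial>lborel) = (\<integral>\<^sup>+t. w (t + r) * G t \<partial>lborel)"
      using nn_integral_translate[of "\<lambda>t. w t * G (t - r)" r] by simp
  qed
  also have "\<dots> = (\<integral>\<^sup>+t. (\<integral>\<^sup>+r. w (t + r) * G t \<partial>\<nu>) \<partial>lborel)"
    by (rule P.Fubini') measurable
  also have "\<dots> = (\<integral>\<^sup>+t. G t * (\<integral>\<^sup>+r. w (t + r) \<partial>\<nu>) \<partial>lborel)"
    by (intro nn_integral_cong) (subst nn_integral_multc, measurable, simp add: mult.commute)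
  finally show ?thesis .
qed

text \<open>A weight interpolating between \<open>exp (- z t)\<close> on the right and \<open>exp (- z' t) / \<eta>\<close> on the left.\<close>

definition weight_denom :: "real \<Rightarrow> real \<Rightarrow> real \<Rightarrow> real \<Rightarrow> real" where
  "weight_denom z z' \<eta> t = exp (z * t) + \<eta> * exp (z' * t)"
definition weight :: "real \<Rightarrow> real \<Rightarrow> real \<Rightarrow> real \<Rightarrow> real" where
  "weight z z' \<eta> t = 1 / weight_denom z z' \<eta> t"
text \<open>Minus the logarithmic derivative of the weight: the mean of \<open>z\<close> and
  \<open>z'\<close> under the two terms of the denominator. \<open>weight_curv\<close> is the
  corresponding mean of their squares.\<close>

definition weight_slope :: "real \<Rightarrow> real \<Rightarrow> real \<Rightarrow> real \<Rightarrow> real" where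
  "weight_slope z z' \<eta> t = (z * exp (z * t) + \<eta> * (z' * exp (z' * t))) / weight_denom z z' \<eta> t"
definition weight_curv :: "real \<Rightarrow> real \<Rightarrow> real \<Rightarrow> real \<Rightarrow> real" where
  "weight_curv z z' \<eta> t = (z\<^sup>2 * exp (z * t) + \<eta> * (z'\<^sup>2 * exp (z' * t))) / weight_denom z z' \<eta> t"

context
  fixes z z' \<eta> :: real assumes eta: "0 < \<eta>"
begin

lemma weight_denom_pos: "0 < weight_denom z z' \<eta> t" unfolding weight_denom_def using eta by (intro add_pos_pos) auto
lemma weight_pos: "0 < weight z z' \<eta> t" using weight_denom_pos by (simp add: weight_def)

lemma weight_le: "weight z z' \<eta> t \<le> exp (- z * t)" "weight z z' \<eta> t \<le> exp (- z' * t) / \<eta>"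
proof -
  have "weight z z' \<eta> t \<le> 1 / exp (z * t)" unfolding weight_def weight_denom_def using eta by (intro divide_left_mono) (auto intro!: mult_pos_pos add_pos_pos)
  then show "weight z z' \<eta> t \<le> exp (- z * t)" by (simp add: exp_minus field_simps)
  have "weight z z' \<eta> t \<le> 1 / (\<eta> * exp (z' * t))" unfolding weight_def weight_denom_def using eta by (intro divide_left_mono) (auto intro!: mult_pos_pos add_pos_pos)
  then show "weight z z' \<eta> t \<le> exp (- z' * t) / \<eta>" by (simp add: exp_minus field_simps)
qed

lemma weight_exp_le:
  assumes "z' < \<zeta>" "\<zeta> < z"
  shows "exp (\<zeta> * t) * weight z z' \<eta> t \<le> (1 + 1 / \<eta>) * exp (- min (z - \<zeta>) (\<zeta> - z') * \<bar>t\<bar>)"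
proof (cases "0 \<le> t")
  case True
  have "exp (\<zeta> * t) * weight z z' \<eta> t \<le> exp (\<zeta> * t) * exp (- z * t)" using weight_le(1) by (intro mult_left_mono) auto
  also have "\<dots> = exp (- (z - \<zeta>) * \<bar>t\<bar>)" using True by (simp add: exp_add[symmetric] algebra_simps)
  also have "\<dots> \<le> exp (- min (z - \<zeta>) (\<zeta> - z') * \<bar>t\<bar>)" unfolding exp_le_cancel_iff by (intro mult_right_mono) auto
  also have "\<dots> \<le> (1 + 1 / \<eta>) * exp (- min (z - \<zeta>) (\<zeta> - z') * \<bar>t\<bar>)" using eta by (simp add: distrib_right)
  finally show ?thesis .
next
  case False
  have "exp (\<zeta> * t) * weight z z' \<eta> t \<le> exp (\<zeta> * t) * (exp (- z' * t) / \<eta>)" using weight_le(2) by (intro mult_left_mono) auto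
  also have "\<dots> = 1 / \<eta> * exp (- (\<zeta> - z') * \<bar>t\<bar>)" using False by (simp add: exp_add[symmetric] algebra_simps)
  also have "\<dots> \<le> 1 / \<eta> * exp (- min (z - \<zeta>) (\<zeta> - z') * \<bar>t\<bar>)" using eta
    by (intro mult_left_mono iffD2[OF exp_le_cancel_iff] mult_right_mono) auto
  also have "\<dots> \<le> (1 + 1 / \<eta>) * exp (- min (z - \<zeta>) (\<zeta> - z') * \<bar>t\<bar>)" using eta by (simp add: distrib_right)
  finally show ?thesis .
qed

text \<open>The denominators are compared term by term. The bound is uniform in \<open>t\<close> and
  \<open>\<eta>\<close>, hence survives the limit of the weights.\<close>

lemma weight_shift: "min (exp (- z * r)) (exp (- z' * r)) * weight z z' \<eta> t \<le> weight z z' \<eta> (t + r)"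
proof -
  let ?m = "min (exp (- z * r)) (exp (- z' * r))"
  have "?m * exp (z * (t + r)) \<le> exp (- z * r) * exp (z * (t + r))" by (intro mult_right_mono) auto
  also have "\<dots> = exp (z * t)" by (simp add: exp_add[symmetric] algebra_simps)
  finally have 1: "?m * exp (z * (t + r)) \<le> exp (z * t)" .
  have "?m * exp (z' * (t + r)) \<le> exp (- z' * r) * exp (z' * (t + r))" by (intro mult_right_mono) auto
  also have "\<dots> = exp (z' * t)" by (simp add: exp_add[symmetric] algebra_simps)
  finally have "\<eta> * (?m * exp (z' * (t + r))) \<le> \<eta> * exp (z' * t)" using eta by simp
  with 1 have "?m * weight_denom z z' \<eta> (t + r) \<le> weight_denom z z' \<eta> t" by (simp add: weight_denom_def distrib_left mult.left_commute)
  then show ?thesis using weight_denom_pos[of t] weight_denom_pos[of "t + r"] by (simp add: weight_def field_simps)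
qed

lemma weight_slope_bounds: assumes "z' \<le> z" shows "z' \<le> weight_slope z z' \<eta> t" "weight_slope z z' \<eta> t \<le> z"
proof -
  have "z' * weight_denom z z' \<eta> t \<le> z * exp (z * t) + \<eta> * (z' * exp (z' * t))"
    using mult_right_mono[OF assms, of "exp (z * t)"] by (simp add: weight_denom_def algebra_simps)
  then show "z' \<le> weight_slope z z' \<eta> t" using weight_denom_pos[of t] by (simp add: weight_slope_def pos_le_divide_eq)
  have "z * exp (z * t) + \<eta> * (z' * exp (z' * t)) \<le> z * weight_denom z z' \<eta> t"
    using mult_right_mono[OF assms, of "\<eta> * exp (z' * t)"] eta by (simp add: weight_denom_def algebra_simps)
  then show "weight_slope z z' \<eta> t \<le> z" using weight_denom_pos[of t] by (simp add: weight_slope_def pos_divide_le_eq)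
qed

lemma weight_curv_nonneg: "0 \<le> weight_curv z z' \<eta> t"
  unfolding weight_curv_def using weight_denom_pos[of t] eta by (intro divide_nonneg_pos) auto

text \<open>The difference of curvature and squared slope is the variance of a two-point
  distribution on \<open>z\<close> and \<open>z'\<close>.\<close>

lemma weight_curv_le: "weight_curv z z' \<eta> t \<le> (weight_slope z z' \<eta> t)\<^sup>2 + (z - z')\<^sup>2"
proof -
  let ?a = "exp (z * t)" and ?b = "\<eta> * exp (z' * t)"
  have ab: "0 < ?a" "0 < ?b" using eta by auto
  have "(z\<^sup>2 * ?a + z'\<^sup>2 * ?b) * (?a + ?b) = (z * ?a + z' * ?b)\<^sup>2 + ?a * ?b * (z - z')\<^sup>2"
    by (simp add: power2_eq_square algebra_simps)
  also have "\<dots> \<le> (z * ?a + z' * ?b)\<^sup>2 + (?a + ?b)\<^sup>2 * (z - z')\<^sup>2"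
  proof (intro add_left_mono mult_right_mono)
    have "a * b \<le> (a + b)\<^sup>2" if "0 < a" "0 < b" for a b :: real
      using mult_pos_pos[OF that] zero_le_power2[of a] zero_le_power2[of b] unfolding power2_sum by linarith
    from this[OF ab] show "?a * ?b \<le> (?a + ?b)\<^sup>2" .
  qed simp
  finally have le: "(z\<^sup>2 * ?a + z'\<^sup>2 * ?b) * (?a + ?b) \<le> (z * ?a + z' * ?b)\<^sup>2 + (?a + ?b)\<^sup>2 * (z - z')\<^sup>2" .
  have "weight_curv z z' \<eta> t = (z\<^sup>2 * ?a + z'\<^sup>2 * ?b) * (?a + ?b) / (?a + ?b)\<^sup>2"
    using ab by (simp add: weight_curv_def weight_denom_def power2_eq_square mult.left_commute)
  also have "\<dots> \<le> ((z * ?a + z' * ?b)\<^sup>2 + (?a + ?b)\<^sup>2 * (z - z')\<^sup>2) / (?a + ?b)\<^sup>2"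
    using le by (rule divide_right_mono) simp
  also have "\<dots> = (weight_slope z z' \<eta> t)\<^sup>2 + (z - z')\<^sup>2"
  proof -
    have "weight_slope z z' \<eta> t = (z * ?a + z' * ?b) / (?a + ?b)" by (simp add: weight_slope_def weight_denom_def mult.left_commute)
    moreover have "(X\<^sup>2 + S\<^sup>2 * k) / S\<^sup>2 = (X / S)\<^sup>2 + k" if "0 < S" for X S k :: real
      using that by (simp add: add_divide_distrib power_divide)
    ultimately show ?thesis using add_pos_pos[OF ab] by simp
  qed
  finally show ?thesis .
qed

lemma DERIV_weight_denom: "(weight_denom z z' \<eta> has_real_derivative weight_slope z z' \<eta> t * weight_denom z z' \<eta> t) (at t)"
  unfolding weight_denom_def[abs_def] weight_slope_def using weight_denom_pos[of t]
  by (auto intro!: derivative_eq_intros simp: weight_denom_def)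

lemma DERIV_weight: "(weight z z' \<eta> has_real_derivative - weight_slope z z' \<eta> t * weight z z' \<eta> t) (at t)"
  unfolding weight_def[abs_def] using weight_denom_pos[of t]
  by (auto intro!: derivative_eq_intros DERIV_weight_denom simp: field_simps)

lemma DERIV_weight_slope: "(weight_slope z z' \<eta> has_real_derivative weight_curv z z' \<eta> t - (weight_slope z z' \<eta> t)\<^sup>2) (at t)"
proof -
  have "((\<lambda>t. (z * exp (z * t) + \<eta> * (z' * exp (z' * t))) / weight_denom z z' \<eta> t) has_real_derivative
      ((z\<^sup>2 * exp (z * t) + \<eta> * (z'\<^sup>2 * exp (z' * t))) * weight_denom z z' \<eta> t
        - (z * exp (z * t) + \<eta> * (z' * exp (z' * t))) * (weight_slope z z' \<eta> t * weight_denom z z' \<eta> t))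
       / (weight_denom z z' \<eta> t * weight_denom z z' \<eta> t)) (at t)"
    using weight_denom_pos[of t] by (auto intro!: derivative_eq_intros DERIV_weight_denom simp: power2_eq_square)
  moreover have "((z\<^sup>2 * exp (z * t) + \<eta> * (z'\<^sup>2 * exp (z' * t))) * weight_denom z z' \<eta> t
        - (z * exp (z * t) + \<eta> * (z' * exp (z' * t))) * (weight_slope z z' \<eta> t * weight_denom z z' \<eta> t))
       / (weight_denom z z' \<eta> t * weight_denom z z' \<eta> t) = weight_curv z z' \<eta> t - (weight_slope z z' \<eta> t)\<^sup>2"
    using weight_denom_pos[of t] by (simp add: weight_curv_def weight_slope_def diff_divide_distrib power2_eq_square)
  ultimately show ?thesis unfolding weight_slope_def[abs_def] by simp
qed

end

section \<open>The profile equation\<close>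

text \<open>In the application \<open>c\<close> is the speed, \<open>p\<close> and \<open>q\<close>
  are the derivatives of \<open>g\<close> and \<open>f\<close> at 0, and \<open>m\<close> is the
  infimum of f'. The Hoelder conditions are stated for increments because they are applied to
  differences of two profiles, and on every \<open>{0..M}\<close> because profiles are bounded but
  not small. \<open>f_slope\<close> expresses a lower bound on f' without derivatives.\<close>

locale wave = finite_borel \<nu> for \<nu> +
  fixes c p q m L \<alpha> :: real and f g :: "real \<Rightarrow> real"
  assumes mass: "measure \<nu> UNIV = 1"
    and f_cont: "continuous_on {0..} f" and f_0: "f 0 = 0" and f_nonneg: "\<And>s. 0 \<le> s \<Longrightarrow> 0 \<le> f s"
    and g_cont: "continuous_on {0..} g" and g_0: "g 0 = 0" and g_pos: "\<And>s. 0 < s \<Longrightarrow> 0 < g s"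
    and alpha: "0 < \<alpha>"
    and f_holder: "\<And>M. 0 < M \<Longrightarrow> \<exists>C. \<forall>s\<in>{0..M}. \<forall>r\<in>{0..M}. \<bar>f s - f r - q * (s - r)\<bar> \<le> C * max s r powr \<alpha> * \<bar>s - r\<bar>"
    and g_holder: "\<And>M. 0 < M \<Longrightarrow> \<exists>C. \<forall>s\<in>{0..M}. \<forall>r\<in>{0..M}. \<bar>g s - g r - p * (s - r)\<bar> \<le> C * max s r powr \<alpha> * \<bar>s - r\<bar>"
    and f_slope: "\<And>s r. 0 \<le> s \<Longrightarrow> 0 \<le> r \<Longrightarrow> m * (s - r)\<^sup>2 \<le> (f s - f r) * (s - r)"
    and g_lip: "\<And>s r. 0 \<le> s \<Longrightarrow> 0 \<le> r \<Longrightarrow> \<bar>g s - g r\<bar> \<le> L * \<bar>s - r\<bar>"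
    and m_le: "0 \<le> m" "m \<le> q" and qp: "q < p" and pL: "p \<le> L"
begin

lemma p_pos: "0 < p" and q_nonneg: "0 \<le> q" and L_pos: "0 < L"
  using m_le qp pL by auto

lemma g_nonneg: "0 \<le> s \<Longrightarrow> 0 \<le> g s" using g_0 g_pos[of s] by (cases "s = 0") auto

lemma g_le: "0 \<le> s \<Longrightarrow> g s \<le> L * s" using g_lip[of s 0] g_0 g_nonneg[of s] by simp

definition "N \<phi> t = (\<integral>r. g (\<phi> (t - r)) \<partial>\<nu>)" for \<phi> :: "real \<Rightarrow> real"

text \<open>The travelling wave equation, solved for the second derivative. Strict positivity is a
  separate hypothesis wherever it matters.\<close>

definition "sol \<phi> \<phi>' \<longleftrightarrow> (\<forall>t. 0 \<le> \<phi> t) \<and> (\<exists>M>0. \<forall>t. \<phi> t \<le> M) \<and> (\<phi> \<longlongrightarrow> 0) at_bot \<and>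
   (\<forall>t. (\<phi> has_real_derivative \<phi>' t) (at t)) \<and>
   (\<forall>t. (\<phi>' has_real_derivative c * \<phi>' t + f (\<phi> t) - N \<phi> t) (at t))"

lemma f_le: assumes "0 < M" shows "\<exists>K\<ge>0. \<forall>s\<in>{0..M}. f s \<le> K * s"
proof -
  obtain C where C: "\<And>s r. s \<in> {0..M} \<Longrightarrow> r \<in> {0..M} \<Longrightarrow> \<bar>f s - f r - q * (s - r)\<bar> \<le> C * max s r powr \<alpha> * \<bar>s - r\<bar>"
    using f_holder[OF assms] by metis
  have "f s \<le> (q + \<bar>C\<bar> * M powr \<alpha>) * s" if s: "s \<in> {0..M}" for s
  proof -
    have "\<bar>f s - q * s\<bar> \<le> C * s powr \<alpha> * s" using C[OF s, of 0] s assms f_0 by simp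
    also have "\<dots> \<le> \<bar>C\<bar> * M powr \<alpha> * s"
      using s alpha by (intro mult_right_mono mult_mono powr_mono2) auto
    finally show ?thesis by (simp add: distrib_right)
  qed
  moreover have "0 \<le> q + \<bar>C\<bar> * M powr \<alpha>" using q_nonneg by simp
  ultimately show ?thesis by blast
qed

lemma near_zero:
  assumes "0 < \<delta>"
  shows "\<exists>s0>0. \<forall>s\<in>{0..s0}. f s \<le> (q + \<delta>) * s \<and> (p - \<delta>) * s \<le> g s"
proof -
  obtain C1 where C1: "\<And>s r. s \<in> {0..1} \<Longrightarrow> r \<in> {0..1} \<Longrightarrow> \<bar>f s - f r - q * (s - r)\<bar> \<le> C1 * max s r powr \<alpha> * \<bar>s - r\<bar>"
    using f_holder[of 1] by (metis zero_less_one)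
  obtain C2 where C2: "\<And>s r. s \<in> {0..1} \<Longrightarrow> r \<in> {0..1} \<Longrightarrow> \<bar>g s - g r - p * (s - r)\<bar> \<le> C2 * max s r powr \<alpha> * \<bar>s - r\<bar>"
    using g_holder[of 1] by (metis zero_less_one)
  define K where "K = \<bar>C1\<bar> + \<bar>C2\<bar> + 1"
  define s0 where "s0 = min 1 ((\<delta> / K) powr (1 / \<alpha>))"
  have K: "0 < K" by (simp add: K_def)
  have s0: "0 < s0" "s0 \<le> 1" using assms K by (auto simp: s0_def)
  have small: "K * s powr \<alpha> \<le> \<delta>" if "s \<in> {0..s0}" for s
  proof -
    have "s powr \<alpha> \<le> ((\<delta> / K) powr (1 / \<alpha>)) powr \<alpha>"
      using that alpha by (intro powr_mono2) (auto simp: s0_def)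
    also have "\<dots> = \<delta> / K" using alpha assms K by (simp add: powr_powr)
    finally show ?thesis using K by (simp add: field_simps)
  qed
  have "f s \<le> (q + \<delta>) * s \<and> (p - \<delta>) * s \<le> g s" if s: "s \<in> {0..s0}" for s
  proof -
    have s1: "s \<in> {0..1}" "0 \<le> s" using s s0 by auto
    have a: "C1 * s powr \<alpha> \<le> K * s powr \<alpha>" "C2 * s powr \<alpha> \<le> K * s powr \<alpha>"
      by (auto intro!: mult_right_mono simp: K_def)
    have "\<bar>f s - q * s\<bar> \<le> C1 * s powr \<alpha> * s" using C1[OF s1(1), of 0] s1 f_0 by simp
    also have "\<dots> \<le> \<delta> * s" using a(1) small[OF s] s1 by (intro mult_right_mono) auto
    finally have 1: "\<bar>f s - q * s\<bar> \<le> \<delta> * s" .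
    have "\<bar>g s - p * s\<bar> \<le> C2 * s powr \<alpha> * s" using C2[OF s1(1), of 0] s1 g_0 by simp
    also have "\<dots> \<le> \<delta> * s" using a(2) small[OF s] s1 by (intro mult_right_mono) auto
    finally have 2: "\<bar>g s - p * s\<bar> \<le> \<delta> * s" .
    show ?thesis using 1 2 by (simp add: algebra_simps abs_le_iff)
  qed
  then show ?thesis using s0 by blast
qed

lemma continuous_on_comp_halfline:
  fixes h \<phi> :: "real \<Rightarrow> real"
  assumes "continuous_on {0..} h" "continuous_on UNIV \<phi>" "\<And>t. 0 \<le> \<phi> t"
  shows "continuous_on UNIV (\<lambda>t. h (\<phi> t))"
  by (rule continuous_on_compose2[OF assms(1,2)]) (use assms(3) in auto)

section \<open>Elementary bounds for solutions of the profile equation\<close>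

context
  fixes \<phi> \<phi>' assumes sol: "sol \<phi> \<phi>'"
begin

lemma sol_nonneg: "0 \<le> \<phi> t" using sol by (simp add: sol_def)
lemma sol_bounded: "\<exists>M>0. \<forall>t. \<phi> t \<le> M" using sol by (simp add: sol_def)
lemma sol_tendsto: "(\<phi> \<longlongrightarrow> 0) at_bot" using sol by (simp add: sol_def)
lemma sol_DERIV: "(\<phi> has_real_derivative \<phi>' t) (at t)" using sol by (simp add: sol_def)
lemma sol_DERIV2: "(\<phi>' has_real_derivative c * \<phi>' t + f (\<phi> t) - N \<phi> t) (at t)" using sol by (simp add: sol_def)
lemma sol_cont: "continuous_on UNIV \<phi>" by (rule continuous_if_deriv[OF sol_DERIV])
lemma sol_cont': "continuous_on UNIV \<phi>'" by (rule continuous_if_deriv[OF sol_DERIV2])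
lemma sol_cont_f: "continuous_on UNIV (\<lambda>t. f (\<phi> t))" by (rule continuous_on_comp_halfline[OF f_cont sol_cont sol_nonneg])
lemma sol_cont_g: "continuous_on UNIV (\<lambda>t. g (\<phi> t))" by (rule continuous_on_comp_halfline[OF g_cont sol_cont sol_nonneg])

lemma continuous_on_shift: "continuous_on UNIV h \<Longrightarrow> continuous_on UNIV (\<lambda>r. h (t - r))" for h :: "real \<Rightarrow> real" and t :: real
  by (rule continuous_on_compose2[of UNIV h UNIV "\<lambda>r. t - r"]) (auto intro!: continuous_intros)

lemma gphi_le: assumes "\<And>t. \<phi> t \<le> M" shows "norm (g (\<phi> u)) \<le> L * M"
proof -
  have "g (\<phi> u) \<le> L * \<phi> u" by (rule g_le[OF sol_nonneg])
  also have "\<dots> \<le> L * M" using L_pos assms by (intro mult_left_mono) auto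
  finally show ?thesis using g_nonneg[OF sol_nonneg, of u] by simp
qed

lemma gphi_integrable: "integrable \<nu> (\<lambda>r. g (\<phi> (t - r)))"
proof -
  obtain M where M: "\<And>t. \<phi> t \<le> M" using sol_bounded by blast
  show ?thesis
  proof (rule integrable_const_bound[where B = "L * M"])
    show "AE r in \<nu>. norm (g (\<phi> (t - r))) \<le> L * M"
      using gphi_le[OF M] by (intro AE_I2)
  qed (intro measurable_cont continuous_on_shift[OF sol_cont_g])
qed

lemma N_nonneg: "0 \<le> N \<phi> t"
  unfolding N_def using g_nonneg[OF sol_nonneg] by (intro integral_nonneg_AE) auto

lemma N_cont: "continuous_on UNIV (N \<phi>)"
proof -
  obtain M where M: "\<And>t. \<phi> t \<le> M" using sol_bounded by blast
  show ?thesis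
    unfolding continuous_on_def N_def tendsto_at_iff_sequentially comp_def
  proof (intro ballI allI impI)
    fix t X assume lim: "X \<longlonglongrightarrow> (t::real)"
    show "(\<lambda>i. \<integral>r. g (\<phi> (X i - r)) \<partial>\<nu>) \<longlonglongrightarrow> (\<integral>r. g (\<phi> (t - r)) \<partial>\<nu>)"
    proof (rule integral_dominated_convergence[where w = "\<lambda>_. L * M"])
      show "AE r in \<nu>. norm (g (\<phi> (X i - r))) \<le> L * M" for i
        using gphi_le[OF M] by (intro AE_I2)
      show "AE r in \<nu>. (\<lambda>i. g (\<phi> (X i - r))) \<longlonglongrightarrow> g (\<phi> (t - r))"
      proof (rule AE_I2)
        fix r
        have "isCont (\<lambda>t. g (\<phi> t)) (t - r)" using sol_cont_g by (simp add: continuous_on_eq_continuous_at)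
        moreover have "(\<lambda>i. X i - r) \<longlonglongrightarrow> t - r" by (intro tendsto_intros lim)
        ultimately show "(\<lambda>i. g (\<phi> (X i - r))) \<longlonglongrightarrow> g (\<phi> (t - r))" by (rule isCont_tendsto_compose)
      qed
    qed (auto intro!: measurable_cont continuous_on_shift[OF sol_cont_g])
  qed
qed

lemma N_exp_le:
  assumes "mom z" "\<And>t. \<phi> t \<le> C * exp (z * t)"
  shows "N \<phi> t \<le> L * C * lap z * exp (z * t)"
proof -
  have "N \<phi> t \<le> (\<integral>r. L * C * exp (z * t) * exp (- z * r) \<partial>\<nu>)"
    unfolding N_def
  proof (rule integral_mono[OF gphi_integrable])
    show "integrable \<nu> (\<lambda>r. L * C * exp (z * t) * exp (- z * r))" using assms(1) by (simp add: mom_def)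
    fix r
    have "g (\<phi> (t - r)) \<le> L * (C * exp (z * (t - r)))"
      using g_le[OF sol_nonneg, of "t - r"] mult_left_mono[OF assms(2)[of "t - r"], of L] L_pos by linarith
    then show "g (\<phi> (t - r)) \<le> L * C * exp (z * t) * exp (- z * r)"
      by (simp add: exp_add[symmetric] algebra_simps)
  qed
  also have "\<dots> = L * C * lap z * exp (z * t)" by (simp add: lap_def)
  finally show ?thesis .
qed

text \<open>No bound on \<open>\<phi>'\<close> is available beforehand. On a unit interval the mean
  value theorem yields a point where it is controlled by \<open>\<phi>\<close>; the function
  \<open>\<phi>' - c * \<phi>\<close>, whose derivative is the zero-order part of the equation,
  carries the bound back to \<open>t\<close>.\<close>

lemma deriv_exp_bound:
  assumes "mom z" "\<And>t. \<phi> t \<le> C * exp (z * t)"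
  shows "\<exists>C'. \<forall>t. \<bar>\<phi>' t\<bar> \<le> C' * exp (z * t)"
proof -
  obtain M where M: "0 < M" "\<And>t. \<phi> t \<le> M" using sol_bounded by blast
  obtain K where K: "0 \<le> K" "\<And>s. s \<in> {0..M} \<Longrightarrow> f s \<le> K * s" using f_le[OF M(1)] by blast
  have C: "0 \<le> C" using assms(2)[of 0] sol_nonneg[of 0] by simp
  define B where "B = K * C + L * C * lap z"
  have B: "0 \<le> B" using K(1) C L_pos lap_nonneg by (simp add: B_def)
  have src: "\<bar>f (\<phi> t) - N \<phi> t\<bar> \<le> B * exp (z * t)" for t
  proof -
    have "f (\<phi> t) \<le> K * \<phi> t" using K(2)[of "\<phi> t"] M sol_nonneg by simp
    also have "\<dots> \<le> K * (C * exp (z * t))" using K(1) assms(2) by (intro mult_left_mono) auto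
    finally have "f (\<phi> t) \<le> K * C * exp (z * t)" by simp
    then show ?thesis using N_exp_le[OF assms, of t] N_nonneg[of t] f_nonneg[OF sol_nonneg, of t]
      mult_nonneg_nonneg[OF mult_nonneg_nonneg[OF K(1) C], of "exp (z * t)"]
      mult_nonneg_nonneg[OF mult_nonneg_nonneg[OF mult_nonneg_nonneg[OF less_imp_le[OF L_pos] C] lap_nonneg[of z]], of "exp (z * t)"]
      unfolding B_def distrib_right abs_le_iff by linarith
  qed
  define E where "E = exp \<bar>z\<bar>"
  have E: "exp (z * u) \<le> E * exp (z * t)" if "t \<le> u" "u \<le> t + 1" for t u
  proof -
    have "z * (u - t) \<le> \<bar>z\<bar> * \<bar>u - t\<bar>" using abs_ge_self[of "z * (u - t)"] by (simp add: abs_mult)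
    also have "\<dots> \<le> \<bar>z\<bar> * 1" using that by (intro mult_left_mono) auto
    finally show ?thesis by (simp add: E_def exp_add[symmetric] algebra_simps)
  qed
  have "\<bar>\<phi>' t\<bar> \<le> (C * E + \<bar>c\<bar> * (C * E + C) + B * E) * exp (z * t)" for t
  proof -
    have E1: "1 \<le> E" by (simp add: E_def)
    have phi_u: "\<phi> u \<le> C * E * exp (z * t)" if "t \<le> u" "u \<le> t + 1" for u
      using assms(2)[of u] mult_left_mono[OF E[OF that] C] by (simp add: mult.assoc)
    obtain x where x: "t < x" "x < t + 1" "\<phi> (t + 1) - \<phi> t = (t + 1 - t) * \<phi>' x"
      using MVT2[of t "t + 1" \<phi> \<phi>'] sol_DERIV by auto
    have a1: "\<bar>\<phi>' x\<bar> \<le> C * E * exp (z * t)"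
    proof -
      have "C * exp (z * t) \<le> C * E * exp (z * t)" using E1 C by (simp add: mult_le_cancel_left1 mult_right_mono)
      then show ?thesis
        using x(3) phi_u[of "t + 1"] assms(2)[of t] sol_nonneg[of t] sol_nonneg[of "t + 1"] by (simp add: abs_le_iff)
    qed
    let ?y = "\<lambda>t. \<phi>' t - c * \<phi> t"
    obtain w where w: "t < w" "w < x" "?y x - ?y t = (x - t) * (f (\<phi> w) - N \<phi> w)"
    proof -
      have "(?y has_real_derivative f (\<phi> u) - N \<phi> u) (at u)" for u
        by (rule derivative_eq_intros sol_DERIV2 sol_DERIV refl | simp)+
      then show ?thesis using MVT2[of t x ?y "\<lambda>u. f (\<phi> u) - N \<phi> u"] x(1) that by blast
    qed
    have "\<bar>?y x - ?y t\<bar> \<le> 1 * (B * exp (z * w))"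
      unfolding w(3) abs_mult using x src[of w] by (intro mult_mono) auto
    also have "\<dots> \<le> B * E * exp (z * t)" using mult_left_mono[OF E[of t w] B] w x by (simp add: mult.assoc)
    finally have a2: "\<bar>?y x - ?y t\<bar> \<le> B * E * exp (z * t)" .
    have "\<bar>c * (\<phi> x - \<phi> t)\<bar> \<le> \<bar>c\<bar> * (C * E * exp (z * t) + C * exp (z * t))"
      unfolding abs_mult using phi_u[of x] assms(2)[of t] sol_nonneg[of t] sol_nonneg[of x] x C E1
      by (intro mult_left_mono) (auto simp: abs_le_iff intro: add_increasing add_increasing2)
    moreover have "\<phi>' t = \<phi>' x - (?y x - ?y t) - c * (\<phi> x - \<phi> t)" by (simp add: algebra_simps)
    ultimately have "\<bar>\<phi>' t\<bar> \<le> C * E * exp (z * t) + B * E * exp (z * t) + \<bar>c\<bar> * (C * E * exp (z * t) + C * exp (z * t))"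
      using a1 a2 by linarith
    also have "\<dots> = (C * E + \<bar>c\<bar> * (C * E + C) + B * E) * exp (z * t)" by (simp add: algebra_simps)
    finally show ?thesis .
  qed
  then show ?thesis by blast
qed

lemma exp_bound_mono:
  assumes "\<And>t. \<phi> t \<le> C * exp (z * t)" "0 \<le> y" "y \<le> z"
  shows "\<exists>C'. \<forall>t. \<phi> t \<le> C' * exp (y * t)"
proof -
  obtain M where M: "0 < M" "\<And>t. \<phi> t \<le> M" using sol_bounded by blast
  have C: "0 \<le> C" using assms(1)[of 0] sol_nonneg[of 0] by simp
  have "\<phi> t \<le> (C + M) * exp (y * t)" for t
  proof (cases "0 \<le> t")
    case True
    have "M * 1 \<le> M * exp (y * t)" using M assms True by (intro mult_left_mono) auto
    then show ?thesis using M(2)[of t] C by (simp add: distrib_right add_increasing)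
  next
    case False
    have "C * exp (z * t) \<le> C * exp (y * t)" using False assms C by (intro mult_left_mono iffD2[OF exp_le_cancel_iff] mult_right_mono_neg) auto
    then show ?thesis using assms(1)[of t] M(1) by (simp add: distrib_right add_increasing2)
  qed
  then show ?thesis by blast
qed

end

end

context wave
begin

text \<open>The integral of the factor by which a shift can at worst reduce the weight. It is finite
  as soon as some exponent between \<open>z'\<close> and \<open>z\<close> has a finite moment, and
  it exceeds any level below the transform once the two exponents are close enough.\<close>

definition "lower_lap z z' = (\<integral>r. min (exp (- z * r)) (exp (- z' * r)) \<partial>\<nu>)"

definition "weight_coeff_bound z z' = 3 * (\<bar>z\<bar> + \<bar>z'\<bar>)\<^sup>2 + (z - z')\<^sup>2 + \<bar>c\<bar> * (\<bar>z\<bar> + \<bar>z'\<bar>)" for z z' :: real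

lemma weight_coeff_le:
  assumes eta: "0 < \<eta>" and z: "z' \<le> z"
  shows "\<bar>2 * (weight_slope z z' \<eta> t)\<^sup>2 - weight_curv z z' \<eta> t - c * weight_slope z z' \<eta> t\<bar> \<le> weight_coeff_bound z z'"
proof -
  have xi_abs: "\<bar>weight_slope z z' \<eta> t\<bar> \<le> \<bar>z\<bar> + \<bar>z'\<bar>" using weight_slope_bounds[OF eta z, of t] by linarith
  have "(weight_slope z z' \<eta> t)\<^sup>2 \<le> (\<bar>z\<bar> + \<bar>z'\<bar>)\<^sup>2"
    using xi_abs abs_le_square_iff[of "weight_slope z z' \<eta> t" "\<bar>z\<bar> + \<bar>z'\<bar>"] by simp
  moreover have "\<bar>c * weight_slope z z' \<eta> t\<bar> \<le> \<bar>c\<bar> * (\<bar>z\<bar> + \<bar>z'\<bar>)" unfolding abs_mult using xi_abs by (intro mult_left_mono) auto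
  ultimately show ?thesis
    using weight_curv_nonneg[OF eta, of z z' t] weight_curv_le[OF eta, of z z' t] zero_le_power2[of "weight_slope z z' \<eta> t"]
    unfolding weight_coeff_bound_def by linarith
qed

text \<open>The equation is tested against the weight and integrated by parts twice. The factor
  \<open>2 * (\<xi> t)\<^sup>2 - h t - c * \<xi> t\<close> times \<open>w\<close> equals w'' + c *
  w'; for the pure exponential \<open>exp (- z * t)\<close> the factor would be
  \<open>z\<^sup>2 - c * z\<close>.\<close>

lemma weighted_identity:
  assumes sol: "sol \<phi> \<phi>'" and z: "z' < \<zeta>" "\<zeta> < z" and eta: "0 < \<eta>"
    and mom: "mom \<zeta>" and C: "\<And>t. \<phi> t \<le> C * exp (\<zeta> * t)"
  defines "w \<equiv> weight z z' \<eta>" and "\<xi> \<equiv> weight_slope z z' \<eta>" and "h \<equiv> weight_curv z z' \<eta>"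
  shows "integrable lborel (\<lambda>t. \<phi> t * w t)" "integrable lborel (\<lambda>t. f (\<phi> t) * w t)"
    "integrable lborel (\<lambda>t. g (\<phi> t) * w t)" "integrable lborel (\<lambda>t. N \<phi> t * w t)"
    "integrable lborel (\<lambda>t. \<phi> t * ((2 * (\<xi> t)\<^sup>2 - h t - c * \<xi> t) * w t))"
    "(\<integral>t. N \<phi> t * w t \<partial>lborel) = (\<integral>t. f (\<phi> t) * w t \<partial>lborel) -
       (\<integral>t. \<phi> t * ((2 * (\<xi> t)\<^sup>2 - h t - c * \<xi> t) * w t) \<partial>lborel)"
proof -
  obtain M where M: "0 < M" "\<And>t. \<phi> t \<le> M" using sol_bounded[OF sol] by blast
  obtain K where K: "0 \<le> K" "\<And>s. s \<in> {0..M} \<Longrightarrow> f s \<le> K * s" using f_le[OF M(1)] by blast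
  obtain C' where C': "\<And>t. \<bar>\<phi>' t\<bar> \<le> C' * exp (\<zeta> * t)" using deriv_exp_bound[OF sol mom C] by blast
  define \<epsilon> where "\<epsilon> = min (z - \<zeta>) (\<zeta> - z')"
  have eps: "0 < \<epsilon>" using z by (simp add: \<epsilon>_def)
  note nonneg = sol_nonneg[OF sol]
  have wpos: "0 < w t" for t unfolding w_def by (rule weight_pos[OF eta])
  have dw: "(w has_real_derivative - \<xi> t * w t) (at t)" for t unfolding w_def \<xi>_def by (rule DERIV_weight[OF eta])
  have dxi: "(\<xi> has_real_derivative h t - (\<xi> t)\<^sup>2) (at t)" for t unfolding \<xi>_def h_def by (rule DERIV_weight_slope[OF eta])
  have xi: "z' \<le> \<xi> t" "\<xi> t \<le> z" for t unfolding \<xi>_def using weight_slope_bounds[OF eta, of z' z] z by auto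
  have xi_abs: "\<bar>\<xi> t\<bar> \<le> \<bar>z\<bar> + \<bar>z'\<bar>" for t using xi[of t] by linarith
  have h: "0 \<le> h t" "h t \<le> (\<xi> t)\<^sup>2 + (z - z')\<^sup>2" for t
    unfolding h_def \<xi>_def using weight_curv_nonneg[OF eta] weight_curv_le[OF eta] by auto
  have cw: "continuous_on UNIV w" by (rule continuous_if_deriv[OF dw])
  have cxi: "continuous_on UNIV \<xi>" by (rule continuous_if_deriv[OF dxi])
  have ch: "continuous_on UNIV h"
    unfolding h_def weight_curv_def[abs_def] weight_denom_def using weight_denom_pos[OF eta, of z z', unfolded weight_denom_def]
    by (auto intro!: continuous_intros) (metis less_irrefl)
  have decay: "exp (\<zeta> * t) * w t \<le> (1 + 1 / \<eta>) * exp (- \<epsilon> * \<bar>t\<bar>)" for t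
    unfolding w_def \<epsilon>_def by (rule weight_exp_le[OF eta z])
  have int: "integrable lborel (\<lambda>t. X t * w t)" if X: "continuous_on UNIV X" "\<And>t. \<bar>X t\<bar> \<le> B * exp (\<zeta> * t)" for X B
  proof (rule Bochner_Integration.integrable_bound)
    show "integrable lborel (\<lambda>t. (B * (1 + 1 / \<eta>)) * exp (- \<epsilon> * \<bar>t\<bar>))" using integrable_exp_minus_abs[OF eps] by simp
    show "(\<lambda>t. X t * w t) \<in> borel_measurable lborel"
      using X(1) cw by (simp add: borel_measurable_continuous_onI continuous_on_mult)
    have B: "0 \<le> B" using X(2)[of 0] by simp
    show "AE t in lborel. norm (X t * w t) \<le> norm (B * (1 + 1 / \<eta>) * exp (- \<epsilon> * \<bar>t\<bar>))"
    proof (rule AE_I2)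
      fix t
      have "\<bar>X t\<bar> * w t \<le> B * exp (\<zeta> * t) * w t" using X(2) wpos[of t] by (intro mult_right_mono) auto
      also have "\<dots> \<le> B * ((1 + 1 / \<eta>) * exp (- \<epsilon> * \<bar>t\<bar>))" using mult_left_mono[OF decay B] by (simp add: mult.assoc)
      finally show "norm (X t * w t) \<le> norm (B * (1 + 1 / \<eta>) * exp (- \<epsilon> * \<bar>t\<bar>))"
        using wpos[of t] B eta by (simp add: abs_mult mult.assoc add_nonneg_nonneg abs_of_nonneg[of "1 + 1 / \<eta>"])
    qed
  qed
  have C0: "0 \<le> C" using C[of 0] nonneg[of 0] by simp
  have f_bd: "f (\<phi> t) \<le> K * C * exp (\<zeta> * t)" for t
  proof -
    have "f (\<phi> t) \<le> K * \<phi> t" using K(2)[of "\<phi> t"] M nonneg by simp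
    also have "\<dots> \<le> K * (C * exp (\<zeta> * t))" using K(1) C by (intro mult_left_mono) auto
    finally show ?thesis by simp
  qed
  have g_bd: "g (\<phi> t) \<le> L * C * exp (\<zeta> * t)" for t
  proof -
    have "L * \<phi> t \<le> L * (C * exp (\<zeta> * t))" by (rule mult_left_mono[OF C]) (use L_pos in simp)
    then show ?thesis using g_le[OF nonneg, of t] unfolding mult.assoc by linarith
  qed
  show int_phi: "integrable lborel (\<lambda>t. \<phi> t * w t)"
    by (rule int[OF sol_cont[OF sol]]) (use C nonneg in auto)
  show int_f: "integrable lborel (\<lambda>t. f (\<phi> t) * w t)"
    by (rule int[OF sol_cont_f[OF sol]]) (use f_bd f_nonneg[OF nonneg] in auto)
  show "integrable lborel (\<lambda>t. g (\<phi> t) * w t)"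
    by (rule int[OF sol_cont_g[OF sol]]) (use g_bd g_nonneg[OF nonneg] in auto)
  show int_N: "integrable lborel (\<lambda>t. N \<phi> t * w t)"
    by (rule int[OF N_cont[OF sol]]) (use N_exp_le[OF sol mom C] N_nonneg[OF sol] in auto)
  define B where "B = weight_coeff_bound z z'"
  have coeff: "\<bar>2 * (\<xi> t)\<^sup>2 - h t - c * \<xi> t\<bar> \<le> B" for t
    unfolding B_def \<xi>_def h_def using z by (intro weight_coeff_le[OF eta]) simp
  have "integrable lborel (\<lambda>t. (\<phi> t * (2 * (\<xi> t)\<^sup>2 - h t - c * \<xi> t)) * w t)"
  proof (rule int)
    show "continuous_on UNIV (\<lambda>t. \<phi> t * (2 * (\<xi> t)\<^sup>2 - h t - c * \<xi> t))"
      by (intro continuous_intros sol_cont[OF sol] cxi ch)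
    show "\<bar>\<phi> t * (2 * (\<xi> t)\<^sup>2 - h t - c * \<xi> t)\<bar> \<le> (C * B) * exp (\<zeta> * t)" for t
    proof -
      have "\<bar>\<phi> t * (2 * (\<xi> t)\<^sup>2 - h t - c * \<xi> t)\<bar> \<le> (C * exp (\<zeta> * t)) * B"
        unfolding abs_mult using C[of t] nonneg[of t] coeff[of t] by (intro mult_mono) auto
      then show ?thesis by (simp add: mult_ac)
    qed
  qed
  then show int_W: "integrable lborel (\<lambda>t. \<phi> t * ((2 * (\<xi> t)\<^sup>2 - h t - c * \<xi> t) * w t))"
    by (simp only: mult.assoc)
  \<comment> \<open>The boundary term \<open>\<phi>' * w - \<phi> * w' - c * \<phi> * w\<close>,
    with \<open>w' = - \<xi> * w\<close> inserted.\<close>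
  let ?F = "\<lambda>t. (\<phi>' t + \<phi> t * \<xi> t - c * \<phi> t) * w t"
  let ?F' = "\<lambda>t. f (\<phi> t) * w t - N \<phi> t * w t - \<phi> t * ((2 * (\<xi> t)\<^sup>2 - h t - c * \<xi> t) * w t)"
  have dF: "(?F has_real_derivative ?F' t) (at t)" for t
  proof -
    have "(?F has_real_derivative ((c * \<phi>' t + f (\<phi> t) - N \<phi> t) + (\<phi>' t * \<xi> t + \<phi> t * (h t - (\<xi> t)\<^sup>2)) - c * \<phi>' t) * w t
        + (\<phi>' t + \<phi> t * \<xi> t - c * \<phi> t) * (- \<xi> t * w t)) (at t)"
      by (rule derivative_eq_intros sol_DERIV[OF sol] sol_DERIV2[OF sol] dxi dw refl | simp)+
    then show ?thesis by (simp add: algebra_simps power2_eq_square)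
  qed
  have F_le: "norm (?F t) \<le> ((C' + C * (\<bar>z\<bar> + \<bar>z'\<bar>) + \<bar>c\<bar> * C) * (1 + 1 / \<eta>)) * exp (- \<epsilon> * \<bar>t\<bar>)" for t
  proof -
    have "\<bar>\<phi> t * \<xi> t\<bar> \<le> (C * exp (\<zeta> * t)) * (\<bar>z\<bar> + \<bar>z'\<bar>)"
      unfolding abs_mult using C[of t] nonneg[of t] xi_abs[of t] by (intro mult_mono) auto
    moreover have "\<bar>c * \<phi> t\<bar> \<le> \<bar>c\<bar> * (C * exp (\<zeta> * t))"
      unfolding abs_mult using C[of t] nonneg[of t] by (intro mult_left_mono) auto
    ultimately have "\<bar>\<phi>' t + \<phi> t * \<xi> t - c * \<phi> t\<bar> \<le> C' * exp (\<zeta> * t) + (C * exp (\<zeta> * t)) * (\<bar>z\<bar> + \<bar>z'\<bar>) + \<bar>c\<bar> * (C * exp (\<zeta> * t))"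
      using C'[of t] by linarith
    also have "\<dots> = (C' + C * (\<bar>z\<bar> + \<bar>z'\<bar>) + \<bar>c\<bar> * C) * exp (\<zeta> * t)" by (simp add: algebra_simps)
    finally have "\<bar>\<phi>' t + \<phi> t * \<xi> t - c * \<phi> t\<bar> * w t \<le> (C' + C * (\<bar>z\<bar> + \<bar>z'\<bar>) + \<bar>c\<bar> * C) * exp (\<zeta> * t) * w t"
      using wpos[of t] by (intro mult_right_mono) auto
    also have "\<dots> \<le> (C' + C * (\<bar>z\<bar> + \<bar>z'\<bar>) + \<bar>c\<bar> * C) * ((1 + 1 / \<eta>) * exp (- \<epsilon> * \<bar>t\<bar>))"
      unfolding mult.assoc using C0 C'[of 0] by (intro mult_left_mono decay add_nonneg_nonneg mult_nonneg_nonneg) auto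
    finally show ?thesis using wpos[of t] by (simp add: abs_mult mult.assoc)
  qed
  have lim: "((\<lambda>t::real. K * exp (- \<epsilon> * \<bar>t\<bar>)) \<longlongrightarrow> 0) F" if "filterlim (\<lambda>t. \<bar>t\<bar>) at_top F" for K F
  proof -
    have "filterlim (\<lambda>t. - \<epsilon> * \<bar>t\<bar>) at_bot F"
      using eps by (intro filterlim_tendsto_neg_mult_at_bot[OF tendsto_const _ that]) auto
    then have "((\<lambda>t. exp (- \<epsilon> * \<bar>t\<bar>)) \<longlongrightarrow> 0) F" by (rule filterlim_compose[OF exp_at_bot])
    then show ?thesis by (rule tendsto_mult_right_zero)
  qed
  have "(\<integral>t. ?F' t \<partial>lborel) = 0"
  proof (rule integral_derivative_eq_0[OF dF])
    show "continuous_on UNIV ?F'"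
      by (intro continuous_intros sol_cont[OF sol] cxi ch cw sol_cont_f[OF sol] N_cont[OF sol])
    show "integrable lborel ?F'" using int_f int_N int_W by simp
    show "(?F \<longlongrightarrow> 0) at_bot"
      by (rule Lim_null_comparison[OF always_eventually[OF allI[OF F_le]]])
         (rule lim, use filterlim_compose[OF filterlim_abs_real filterlim_uminus_at_top_at_bot] in simp)
    show "(?F \<longlongrightarrow> 0) at_top"
      by (rule Lim_null_comparison[OF always_eventually[OF allI[OF F_le]]])
         (rule lim, rule filterlim_abs_real)
  qed
  then show "(\<integral>t. N \<phi> t * w t \<partial>lborel) = (\<integral>t. f (\<phi> t) * w t \<partial>lborel) -
       (\<integral>t. \<phi> t * ((2 * (\<xi> t)\<^sup>2 - h t - c * \<xi> t) * w t) \<partial>lborel)"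
    using int_f int_N int_W by simp
qed

end

lemma fatou_bound:
  fixes u :: "nat \<Rightarrow> 'a \<Rightarrow> real"
  assumes "\<And>n. u n \<in> borel_measurable M" "\<And>n. (\<integral>\<^sup>+x. ennreal (u n x) \<partial>M) \<le> C" "\<And>x. (\<lambda>n. u n x) \<longlonglongrightarrow> v x"
  shows "(\<integral>\<^sup>+x. ennreal (v x) \<partial>M) \<le> C"
proof -
  have "(\<integral>\<^sup>+x. ennreal (v x) \<partial>M) = (\<integral>\<^sup>+x. liminf (\<lambda>n. ennreal (u n x)) \<partial>M)"
    by (intro nn_integral_cong lim_imp_Liminf[symmetric] tendsto_ennrealI assms(3)) simp
  also have "\<dots> \<le> liminf (\<lambda>n. \<integral>\<^sup>+x. ennreal (u n x) \<partial>M)"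
    by (rule nn_integral_liminf) (use assms(1) in measurable)
  also have "\<dots> \<le> C"
  proof -
    have "liminf (\<lambda>n. \<integral>\<^sup>+x. ennreal (u n x) \<partial>M) \<le> liminf (\<lambda>n::nat. C)"
      by (rule Liminf_mono) (use assms(2) in auto)
    then show ?thesis by (simp add: Liminf_const)
  qed
  finally show ?thesis .
qed

lemma weight_tendsto: "(\<lambda>n. weight z z' (1 / real (Suc n)) t) \<longlonglongrightarrow> exp (- z * t)"
proof -
  have "(\<lambda>n. 1 / (exp (z * t) + 1 / real (Suc n) * exp (z' * t))) \<longlonglongrightarrow> 1 / (exp (z * t) + 0 * exp (z' * t))"
    by (intro tendsto_intros LIMSEQ_Suc[OF lim_1_over_n]) simp
  then show ?thesis by (simp add: weight_def weight_denom_def exp_minus inverse_eq_divide)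
qed

context wave
begin

lemma min_exp_le: "z' \<le> \<zeta> \<Longrightarrow> \<zeta> \<le> z \<Longrightarrow> min (exp (- z * r)) (exp (- z' * r)) \<le> exp (- \<zeta> * r)" for z z' \<zeta> r :: real
  by (cases "0 \<le> r") (auto simp: min_le_iff_disj mult_right_mono mult_right_mono_neg)

lemma lower_lap_integrable:
  assumes "mom \<zeta>" "z' \<le> \<zeta>" "\<zeta> \<le> z"
  shows "integrable \<nu> (\<lambda>r. min (exp (- z * r)) (exp (- z' * r)))"
proof (rule Bochner_Integration.integrable_bound)
  show "integrable \<nu> (\<lambda>r. exp (- \<zeta> * r))" using assms(1) by (simp add: mom_def)
  show "AE r in \<nu>. norm (min (exp (- z * r)) (exp (- z' * r))) \<le> norm (exp (- \<zeta> * r))"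
    using min_exp_le[OF assms(2,3)] by (auto intro!: AE_I2)
qed (intro measurable_cont continuous_intros)

lemma nn_N:
  assumes sol: "sol \<phi> \<phi>'"
  shows "(\<integral>\<^sup>+r. ennreal (g (\<phi> (t - r))) \<partial>\<nu>) = ennreal (N \<phi> t)"
  unfolding N_def using g_nonneg[OF sol_nonneg[OF sol]]
  by (intro nn_integral_eq_integral gphi_integrable[OF sol]) auto

text \<open>Tonelli moves the average onto the weight, where \<open>weight_shift\<close> bounds it
  from below. A moment is needed only at the known decay exponent \<open>\<zeta>\<close>, not at
  \<open>z\<close>.\<close>

lemma weighted_conv_lower_bound:
  assumes sol: "sol \<phi> \<phi>'" and z: "z' < \<zeta>" "\<zeta> < z" and eta: "0 < \<eta>"
    and mom: "mom \<zeta>" and C: "\<And>t. \<phi> t \<le> C * exp (\<zeta> * t)" and \<kappa>: "\<kappa> \<le> lower_lap z z'" "0 \<le> \<kappa>"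
  shows "\<kappa> * (\<integral>t. g (\<phi> t) * weight z z' \<eta> t \<partial>lborel) \<le> (\<integral>t. N \<phi> t * weight z z' \<eta> t \<partial>lborel)"
proof -
  define w where "w = weight z z' \<eta>"
  note id = weighted_identity[OF sol z eta mom C, folded w_def]
  have wpos: "0 < w t" for t unfolding w_def by (rule weight_pos[OF eta])
  have cw: "continuous_on UNIV w" unfolding w_def by (rule continuous_if_deriv[OF DERIV_weight[OF eta]])
  have [measurable]: "w \<in> borel_measurable borel" "(\<lambda>t. g (\<phi> t)) \<in> borel_measurable borel"
    using cw sol_cont_g[OF sol] by (auto intro: borel_measurable_continuous_onI)
  have gn: "0 \<le> g (\<phi> t)" for t by (rule g_nonneg[OF sol_nonneg[OF sol]])
  have "ennreal (\<kappa> * (\<integral>t. g (\<phi> t) * w t \<partial>lborel)) = (\<integral>\<^sup>+t. ennreal (\<kappa> * (g (\<phi> t) * w t)) \<partial>lborel)"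
    using id(3) \<kappa>(2) gn less_imp_le[OF wpos] by (subst nn_integral_eq_integral) auto
  also have "\<dots> \<le> (\<integral>\<^sup>+t. ennreal (g (\<phi> t)) * (\<integral>\<^sup>+r. ennreal (w (t + r)) \<partial>\<nu>) \<partial>lborel)"
  proof (rule nn_integral_mono)
    fix t
    have "ennreal (\<kappa> * w t) \<le> ennreal (\<integral>r. min (exp (- z * r)) (exp (- z' * r)) * w t \<partial>\<nu>)"
      using \<kappa>(1) wpos[of t] by (intro ennreal_leI) (simp add: lower_lap_def mult_right_mono)
    also have "\<dots> = (\<integral>\<^sup>+r. ennreal (min (exp (- z * r)) (exp (- z' * r)) * w t) \<partial>\<nu>)"
      using lower_lap_integrable[OF mom, of z' z] z less_imp_le[OF wpos]
      by (intro nn_integral_eq_integral[symmetric]) auto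
    also have "\<dots> \<le> (\<integral>\<^sup>+r. ennreal (w (t + r)) \<partial>\<nu>)"
      unfolding w_def by (intro nn_integral_mono ennreal_leI weight_shift[OF eta])
    finally have "ennreal (g (\<phi> t)) * ennreal (\<kappa> * w t) \<le> ennreal (g (\<phi> t)) * (\<integral>\<^sup>+r. ennreal (w (t + r)) \<partial>\<nu>)"
      by (rule mult_left_mono) simp
    then show "ennreal (\<kappa> * (g (\<phi> t) * w t)) \<le> ennreal (g (\<phi> t)) * (\<integral>\<^sup>+r. ennreal (w (t + r)) \<partial>\<nu>)"
      using gn by (simp add: ennreal_mult'[symmetric] mult_ac)
  qed
  also have "\<dots> = (\<integral>\<^sup>+t. ennreal (w t) * (\<integral>\<^sup>+r. ennreal (g (\<phi> (t - r))) \<partial>\<nu>) \<partial>lborel)"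
    by (rule tonelli_shift[symmetric]) measurable
  also have "\<dots> = (\<integral>\<^sup>+t. ennreal (N \<phi> t * w t) \<partial>lborel)"
    using N_nonneg[OF sol] less_imp_le[OF wpos]
    by (intro nn_integral_cong) (simp add: nn_N[OF sol] ennreal_mult'[symmetric] mult.commute)
  also have "\<dots> = ennreal (\<integral>t. N \<phi> t * w t \<partial>lborel)"
    using id(4) N_nonneg[OF sol] less_imp_le[OF wpos] by (intro nn_integral_eq_integral) auto
  finally show ?thesis
    unfolding w_def[symmetric] using N_nonneg[OF sol] less_imp_le[OF wpos]
    by (subst (asm) ennreal_le_iff) (auto intro!: integral_nonneg_AE)
qed

text \<open>Hypothesis \<open>br\<close> says that the characteristic expression, diminished by the
  errors of linearisation and of the weight, stays above \<open>\<delta>\<close> for every slope the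
  weight can have. Hence the integrand has a favourable sign where \<open>\<phi>\<close> is small,
  and only a right half-line independent of \<open>\<eta>\<close> has to be paid for.\<close>

lemma weighted_integrals_bounded:
  assumes sol: "sol \<phi> \<phi>'" and z: "z' < \<zeta>" "\<zeta> < z" and z0: "0 < z"
    and mom: "mom \<zeta>" and C: "\<And>t. \<phi> t \<le> C * exp (\<zeta> * t)" and \<kappa>: "\<kappa> \<le> lower_lap z z'" "0 \<le> \<kappa>"
    and d: "0 < \<delta>"
    and br: "\<And>\<xi>. z' \<le> \<xi> \<Longrightarrow> \<xi> \<le> z \<Longrightarrow> \<delta> \<le> \<xi>\<^sup>2 - c * \<xi> - (z - z')\<^sup>2 - (q + \<delta>) + (p - \<delta>) * \<kappa>"
  shows "\<exists>C3 C4. \<forall>\<eta>>0. (\<integral>t. \<phi> t * weight z z' \<eta> t \<partial>lborel) \<le> C3 \<and> (\<integral>t. N \<phi> t * weight z z' \<eta> t \<partial>lborel) \<le> C4"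
proof -
  obtain M where M: "0 < M" "\<And>t. \<phi> t \<le> M" using sol_bounded[OF sol] by blast
  obtain K where K: "0 \<le> K" "\<And>s. s \<in> {0..M} \<Longrightarrow> f s \<le> K * s" using f_le[OF M(1)] by blast
  obtain s0 where s0: "0 < s0" "\<And>s. s \<in> {0..s0} \<Longrightarrow> f s \<le> (q + \<delta>) * s \<and> (p - \<delta>) * s \<le> g s"
    using near_zero[OF d] by blast
  have "eventually (\<lambda>t. \<phi> t < s0) at_bot" using order_tendstoD(2)[OF sol_tendsto[OF sol] s0(1)] .
  then obtain T0 where T0: "\<And>t. t \<le> T0 \<Longrightarrow> \<phi> t < s0" unfolding eventually_at_bot_linorder by blast
  define T where "T = \<bar>T0\<bar>"
  have T: "0 \<le> T" "\<And>t. t \<le> - T \<Longrightarrow> \<phi> t < s0" using T0 by (auto simp: T_def)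
  define B where "B = weight_coeff_bound z z'"
  have B: "0 \<le> B" by (simp add: B_def weight_coeff_bound_def)
  \<comment> \<open>Pays for the half-line right of \<open>- T\<close>:
    \<open>B + K + \<delta>\<close> bounds the coefficients, \<open>M\<close> the profile, and
    \<open>exp (2 * z * T)\<close> turns \<open>exp (- z * t)\<close> into
    \<open>exp (- z * \<bar>t\<bar>)\<close>.\<close>
  define C0 where "C0 = (B + K + \<delta>) * M * exp (2 * z * T)"
  have C0: "0 \<le> C0" using B K M d by (simp add: C0_def)
  note nonneg = sol_nonneg[OF sol]
  define C3 where "C3 = C0 * (\<integral>t. exp (- z * \<bar>t\<bar>) \<partial>lborel) / \<delta>"
  have main: "(\<integral>t. \<phi> t * weight z z' \<eta> t \<partial>lborel) \<le> C3 \<and> (\<integral>t. N \<phi> t * weight z z' \<eta> t \<partial>lborel) \<le> (K + B) * C3"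
    if eta: "0 < \<eta>" for \<eta>
  proof -
    define w where "w = weight z z' \<eta>"
    define \<xi> where "\<xi> = weight_slope z z' \<eta>"
    define h where "h = weight_curv z z' \<eta>"
    note id = weighted_identity[OF sol z eta mom C, folded w_def \<xi>_def h_def]
    have wpos: "0 < w t" for t unfolding w_def by (rule weight_pos[OF eta])
    have coeff: "\<bar>2 * (\<xi> t)\<^sup>2 - h t - c * \<xi> t\<bar> \<le> B" for t
      unfolding B_def \<xi>_def h_def using z by (intro weight_coeff_le[OF eta]) simp
    have tn: "\<kappa> * (\<integral>t. g (\<phi> t) * w t \<partial>lborel) \<le> (\<integral>t. N \<phi> t * w t \<partial>lborel)"
      unfolding w_def by (rule weighted_conv_lower_bound[OF sol z eta mom C \<kappa>])
    have fK: "f (\<phi> t) \<le> K * \<phi> t" for t using K(2)[of "\<phi> t"] M nonneg by simp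
    have pw: "\<delta> * (\<phi> t * w t) - C0 * exp (- z * \<bar>t\<bar>) \<le>
        \<phi> t * ((2 * (\<xi> t)\<^sup>2 - h t - c * \<xi> t) * w t) - f (\<phi> t) * w t + \<kappa> * (g (\<phi> t) * w t)" for t
    proof (cases "t \<le> - T")
      case True
      have s: "\<phi> t \<in> {0..s0}" using T(2)[OF True] nonneg by simp
      have "\<xi> t \<le> z" "z' \<le> \<xi> t" unfolding \<xi>_def using weight_slope_bounds[OF eta, of z' z] z by auto
      from br[OF this(2,1)] have "\<delta> \<le> 2 * (\<xi> t)\<^sup>2 - h t - c * \<xi> t - (q + \<delta>) + (p - \<delta>) * \<kappa>"
        using weight_curv_le[OF eta, of z z' t] unfolding \<xi>_def h_def by linarith
      then have "\<delta> * \<phi> t \<le> (2 * (\<xi> t)\<^sup>2 - h t - c * \<xi> t - (q + \<delta>) + (p - \<delta>) * \<kappa>) * \<phi> t"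
        using nonneg by (rule mult_right_mono)
      also have "\<dots> \<le> \<phi> t * (2 * (\<xi> t)\<^sup>2 - h t - c * \<xi> t) - f (\<phi> t) + \<kappa> * g (\<phi> t)"
        using s0(2)[OF s] mult_left_mono[of "(p - \<delta>) * \<phi> t" "g (\<phi> t)" \<kappa>] \<kappa>(2) by (simp add: algebra_simps)
      finally have "\<delta> * \<phi> t * w t \<le> (\<phi> t * (2 * (\<xi> t)\<^sup>2 - h t - c * \<xi> t) - f (\<phi> t) + \<kappa> * g (\<phi> t)) * w t"
        using wpos[of t] by (intro mult_right_mono) auto
      moreover have "0 \<le> C0 * exp (- z * \<bar>t\<bar>)" using C0 by simp
      ultimately show ?thesis by (simp add: algebra_simps)
    next
      case False
      have "- B \<le> 2 * (\<xi> t)\<^sup>2 - h t - c * \<xi> t" using coeff[of t] by linarith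
      then have "(- B) * \<phi> t \<le> (2 * (\<xi> t)\<^sup>2 - h t - c * \<xi> t) * \<phi> t" using nonneg by (rule mult_right_mono)
      moreover have "0 \<le> \<kappa> * g (\<phi> t)" using \<kappa>(2) g_nonneg[OF nonneg] by simp
      ultimately have a: "\<delta> * \<phi> t - (B + K + \<delta>) * \<phi> t \<le> \<phi> t * (2 * (\<xi> t)\<^sup>2 - h t - c * \<xi> t) - f (\<phi> t) + \<kappa> * g (\<phi> t)"
        using fK[of t] by (simp add: algebra_simps)
      have "exp (- z * t) \<le> exp (2 * z * T) * exp (- z * \<bar>t\<bar>)"
      proof -
        have "z * (\<bar>t\<bar> - t) \<le> z * (2 * T)" using False T(1) z0 by (intro mult_left_mono) auto
        then show ?thesis by (simp add: exp_add[symmetric] algebra_simps)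
      qed
      then have "w t \<le> exp (2 * z * T) * exp (- z * \<bar>t\<bar>)" using weight_le(1)[OF eta, of z z' t] unfolding w_def by linarith
      then have "\<phi> t * w t \<le> M * (exp (2 * z * T) * exp (- z * \<bar>t\<bar>))"
        using M nonneg wpos[of t] by (intro mult_mono) auto
      then have b: "(B + K + \<delta>) * (\<phi> t * w t) \<le> C0 * exp (- z * \<bar>t\<bar>)"
        using mult_left_mono[of "\<phi> t * w t" "M * (exp (2 * z * T) * exp (- z * \<bar>t\<bar>))" "B + K + \<delta>"] B K(1) d
        by (simp add: C0_def mult.assoc)
      have "(\<delta> * \<phi> t - (B + K + \<delta>) * \<phi> t) * w t \<le> (\<phi> t * (2 * (\<xi> t)\<^sup>2 - h t - c * \<xi> t) - f (\<phi> t) + \<kappa> * g (\<phi> t)) * w t"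
        using a wpos[of t] by (intro mult_right_mono) auto
      then show ?thesis using b by (simp add: algebra_simps)
    qed
    have int_e: "integrable lborel (\<lambda>t. exp (- z * \<bar>t\<bar>))" by (rule integrable_exp_minus_abs[OF z0])
    have "\<delta> * (\<integral>t. \<phi> t * w t \<partial>lborel) - C0 * (\<integral>t. exp (- z * \<bar>t\<bar>) \<partial>lborel)
        = (\<integral>t. \<delta> * (\<phi> t * w t) - C0 * exp (- z * \<bar>t\<bar>) \<partial>lborel)"
      using id(1) int_e by simp
    also have "\<dots> \<le> (\<integral>t. \<phi> t * ((2 * (\<xi> t)\<^sup>2 - h t - c * \<xi> t) * w t) - f (\<phi> t) * w t + \<kappa> * (g (\<phi> t) * w t) \<partial>lborel)"
      by (rule integral_mono) (use id(1,2,3,5) int_e pw in auto)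
    also have "\<dots> = (\<integral>t. \<phi> t * ((2 * (\<xi> t)\<^sup>2 - h t - c * \<xi> t) * w t) \<partial>lborel) - (\<integral>t. f (\<phi> t) * w t \<partial>lborel)
        + \<kappa> * (\<integral>t. g (\<phi> t) * w t \<partial>lborel)"
      using id(2,3,5) by simp
    also have "\<dots> \<le> 0" using tn id(6) by linarith
    finally have 1: "(\<integral>t. \<phi> t * w t \<partial>lborel) \<le> C3" using d by (simp add: C3_def pos_le_divide_eq mult.commute)
    have "(\<integral>t. N \<phi> t * w t \<partial>lborel) = (\<integral>t. f (\<phi> t) * w t - \<phi> t * ((2 * (\<xi> t)\<^sup>2 - h t - c * \<xi> t) * w t) \<partial>lborel)"
      using id(2,5,6) by simp
    also have "\<dots> \<le> (\<integral>t. (K + B) * (\<phi> t * w t) \<partial>lborel)"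
    proof (rule integral_mono)
      fix t
      have "(- (2 * (\<xi> t)\<^sup>2 - h t - c * \<xi> t)) * \<phi> t \<le> B * \<phi> t" using coeff[of t] nonneg by (intro mult_right_mono) auto
      then have "f (\<phi> t) - \<phi> t * (2 * (\<xi> t)\<^sup>2 - h t - c * \<xi> t) \<le> (K + B) * \<phi> t" using fK[of t] by (simp add: algebra_simps)
      then have "(f (\<phi> t) - \<phi> t * (2 * (\<xi> t)\<^sup>2 - h t - c * \<xi> t)) * w t \<le> (K + B) * \<phi> t * w t"
        using wpos[of t] by (intro mult_right_mono) auto
      then show "f (\<phi> t) * w t - \<phi> t * ((2 * (\<xi> t)\<^sup>2 - h t - c * \<xi> t) * w t) \<le> (K + B) * (\<phi> t * w t)"
        by (simp add: algebra_simps)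
    qed (use id(1,2,5) in auto)
    also have "\<dots> = (K + B) * (\<integral>t. \<phi> t * w t \<partial>lborel)" by simp
    also have "\<dots> \<le> (K + B) * C3" using 1 K(1) B by (intro mult_left_mono) auto
    finally show ?thesis using 1 unfolding w_def by blast
  qed
  show ?thesis
    by (intro exI[of _ C3] exI[of _ "(K + B) * C3"] allI impI main)
qed

end

section \<open>Exponential decay of profiles\<close>

text \<open>With a negative second derivative the first derivative would be negative just to the
  right of \<open>x\<close>, and the mean value theorem would produce smaller values there.\<close>

lemma local_min_second_derivative:
  fixes F F' :: "real \<Rightarrow> real"
  assumes d: "0 < d" "\<And>y. \<bar>y - x\<bar> < d \<Longrightarrow> F x \<le> F y"
    and F: "\<And>t. (F has_real_derivative F' t) (at t)" and F': "(F' has_real_derivative l) (at x)"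
  shows "F' x = 0" "0 \<le> l"
proof -
  show z: "F' x = 0" by (rule DERIV_local_min[OF F d(1)]) (use d(2) in \<open>auto simp: abs_minus_commute\<close>)
  show "0 \<le> l"
  proof (rule ccontr)
    assume "\<not> 0 \<le> l"
    then obtain e where e: "0 < e" "\<And>h. 0 < h \<Longrightarrow> h < e \<Longrightarrow> F' (x + h) < F' x"
      using DERIV_neg_dec_right[OF F'] by auto
    define y where "y = x + min d e / 2"
    have y: "x < y" "y - x < d" "y - x < e" using d e by (auto simp: y_def)
    obtain w where w: "x < w" "w < y" "F y - F x = (y - x) * F' w" using MVT2[of x y F F'] F y by auto
    have "F' w < 0" using e(2)[of "w - x"] w y z by simp
    then have "F y - F x < 0" using w y by (simp add: mult_pos_neg)
    then show False using d(2)[of y] y by simp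
  qed
qed

lemma lborel_antiderivative_le:
  fixes X :: "real \<Rightarrow> real"
  assumes Q: "\<And>t. (Q has_real_derivative X t) (at t)" and X: "continuous_on UNIV X" "\<And>t. 0 \<le> X t"
    and int: "integrable lborel X" and st: "s \<le> t"
  shows "Q t - Q s \<le> (\<integral>x. X x \<partial>lborel)"
proof -
  have "(\<integral>x. X x * indicator {s..t} x \<partial>lborel) = Q t - Q s"
    by (rule integral_FTC_Icc_real[OF st]) (use Q X(1) in \<open>auto simp: continuous_on_eq_continuous_at\<close>)
  moreover have "(\<integral>x. X x * indicator {s..t} x \<partial>lborel) \<le> (\<integral>x. X x \<partial>lborel)"
  proof (rule integral_mono[OF _ int])
    show "integrable lborel (\<lambda>x. X x * indicator {s..t} x)" by (intro integrable_real_mult_indicator int) simp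
    show "X x * indicator {s..t} x \<le> X x" for x using X(2)[of x] by (simp add: indicator_def)
  qed
  ultimately show ?thesis by simp
qed

context wave
begin

text \<open>A positive profile decaying like \<open>exp (\<zeta> * t)\<close> where the characteristic function is positive decays faster: the
  weighted integrals stay bounded as the weight tends to \<open>exp (- z * t)\<close>, which also makes the moment at \<open>z\<close> finite,
  and \<open>\<phi>\<^sup>2 = 2 \<integral> \<phi> \<phi>'\<close> turns the integral bound into a pointwise one. No analytic continuation is needed.\<close>

lemma decay_gain:
  assumes sol: "sol \<phi> \<phi>'" and pos: "\<And>t. 0 < \<phi> t" and z: "z' < \<zeta>" "\<zeta> < z" and z0: "0 \<le> \<zeta>"
    and mom: "mom \<zeta>" and C: "\<And>t. \<phi> t \<le> C * exp (\<zeta> * t)" and \<kappa>: "\<kappa> \<le> lower_lap z z'" "0 \<le> \<kappa>"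
    and d: "0 < \<delta>"
    and br: "\<And>\<xi>. z' \<le> \<xi> \<Longrightarrow> \<xi> \<le> z \<Longrightarrow> \<delta> \<le> \<xi>\<^sup>2 - c * \<xi> - (z - z')\<^sup>2 - (q + \<delta>) + (p - \<delta>) * \<kappa>"
  shows "mom z" "\<exists>C'. \<forall>t. \<phi> t \<le> C' * exp ((\<zeta> + z) / 2 * t)"
proof -
  have zp: "0 < z" using z z0 by linarith
  obtain C3 C4 where C3: "\<And>\<eta>. 0 < \<eta> \<Longrightarrow> (\<integral>t. \<phi> t * weight z z' \<eta> t \<partial>lborel) \<le> C3"
    and C4: "\<And>\<eta>. 0 < \<eta> \<Longrightarrow> (\<integral>t. N \<phi> t * weight z z' \<eta> t \<partial>lborel) \<le> C4"
    using weighted_integrals_bounded[OF sol z zp mom C \<kappa> d br] by metis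
  define \<eta> where "\<eta> n = 1 / real (Suc n)" for n
  have eta: "0 < \<eta> n" for n by (simp add: \<eta>_def)
  have wpos: "0 \<le> weight z z' (\<eta> n) t" for n t by (rule less_imp_le[OF weight_pos[OF eta]])
  note id = weighted_identity[OF sol z eta mom C]
  have lim: "(\<lambda>n. weight z z' (\<eta> n) t) \<longlonglongrightarrow> exp (- z * t)" for t unfolding \<eta>_def by (rule weight_tendsto)
  have nnphi: "(\<integral>\<^sup>+t. ennreal (\<phi> t * exp (- z * t)) \<partial>lborel) \<le> ennreal C3"
  proof (rule fatou_bound)
    show "(\<lambda>t. \<phi> t * weight z z' (\<eta> n) t) \<in> borel_measurable lborel" for n using id(1)[of n] by simp
    show "(\<lambda>n. \<phi> t * weight z z' (\<eta> n) t) \<longlonglongrightarrow> \<phi> t * exp (- z * t)" for t by (intro tendsto_intros lim)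
    show "(\<integral>\<^sup>+t. ennreal (\<phi> t * weight z z' (\<eta> n) t) \<partial>lborel) \<le> ennreal C3" for n
      using id(1)[of n] sol_nonneg[OF sol] wpos C3[OF eta]
      by (subst nn_integral_eq_integral) (auto intro!: ennreal_leI)
  qed
  have nnN: "(\<integral>\<^sup>+t. ennreal (N \<phi> t * exp (- z * t)) \<partial>lborel) \<le> ennreal C4"
  proof (rule fatou_bound)
    show "(\<lambda>t. N \<phi> t * weight z z' (\<eta> n) t) \<in> borel_measurable lborel" for n using id(4)[of n] by simp
    show "(\<lambda>n. N \<phi> t * weight z z' (\<eta> n) t) \<longlonglongrightarrow> N \<phi> t * exp (- z * t)" for t by (intro tendsto_intros lim)
    show "(\<integral>\<^sup>+t. ennreal (N \<phi> t * weight z z' (\<eta> n) t) \<partial>lborel) \<le> ennreal C4" for n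
      using id(4)[of n] N_nonneg[OF sol] wpos C4[OF eta]
      by (subst nn_integral_eq_integral) (auto intro!: ennreal_leI)
  qed
  have [measurable]: "(\<lambda>t. g (\<phi> t)) \<in> borel_measurable borel"
    using sol_cont_g[OF sol] by (auto intro: borel_measurable_continuous_onI)
  have gpos: "0 < g (\<phi> t)" for t using g_pos pos by blast
  let ?I = "\<integral>\<^sup>+t. ennreal (g (\<phi> t) * exp (- z * t)) \<partial>lborel"
  let ?k = "\<integral>\<^sup>+r. ennreal (exp (- z * r)) \<partial>\<nu>"
  have "(\<integral>\<^sup>+t. ennreal (N \<phi> t * exp (- z * t)) \<partial>lborel)
      = (\<integral>\<^sup>+t. ennreal (exp (- z * t)) * (\<integral>\<^sup>+r. ennreal (g (\<phi> (t - r))) \<partial>\<nu>) \<partial>lborel)"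
    by (intro nn_integral_cong) (simp add: nn_N[OF sol] ennreal_mult'' N_nonneg[OF sol] mult.commute)
  also have "\<dots> = (\<integral>\<^sup>+t. ennreal (g (\<phi> t)) * (\<integral>\<^sup>+r. ennreal (exp (- z * (t + r))) \<partial>\<nu>) \<partial>lborel)"
    by (rule tonelli_shift) measurable
  also have "\<dots> = (\<integral>\<^sup>+t. ennreal (g (\<phi> t) * exp (- z * t)) * ?k \<partial>lborel)"
  proof (rule nn_integral_cong)
    fix t
    have "(\<integral>\<^sup>+r. ennreal (exp (- z * (t + r))) \<partial>\<nu>) = (\<integral>\<^sup>+r. ennreal (exp (- z * t)) * ennreal (exp (- z * r)) \<partial>\<nu>)"
      by (intro nn_integral_cong) (simp add: ennreal_mult'[symmetric] exp_add[symmetric] algebra_simps)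
    also have "\<dots> = ennreal (exp (- z * t)) * ?k" by (rule nn_integral_cmult) (auto intro!: borel_measurable_nu)
    finally show "ennreal (g (\<phi> t)) * (\<integral>\<^sup>+r. ennreal (exp (- z * (t + r))) \<partial>\<nu>) = ennreal (g (\<phi> t) * exp (- z * t)) * ?k"
      using gpos[of t] by (simp add: ennreal_mult' mult.assoc)
  qed
  also have "\<dots> = ?I * ?k" by (rule nn_integral_multc) measurable
  \<comment> \<open>The double integral is a product. Its first factor is positive since
    \<open>\<phi>\<close> is, so a finite product forces the second factor, the moment at
    \<open>z\<close>, to be finite.\<close>
  finally have Ik: "?I * ?k \<le> ennreal C4" using nnN by simp
  have "?I \<noteq> 0"
  proof
    assume "?I = 0"
    then have "AE t in lborel. ennreal (g (\<phi> t) * exp (- z * t)) = 0"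
      by (subst (asm) nn_integral_0_iff_AE) auto
    moreover have "ennreal (g (\<phi> t) * exp (- z * t)) \<noteq> 0" for t using gpos[of t] by (simp add: ennreal_eq_0_iff not_le)
    ultimately have "AE t::real in lborel. False" by simp
    then have "emeasure lborel (space (lborel :: real measure)) = 0" by (simp add: AE_iff_measurable[OF _ refl])
    then show False by simp
  qed
  then have "?k \<noteq> \<infinity>" using Ik by (auto simp: ennreal_mult_eq_top_iff top_unique)
  then show momz: "mom z"
    unfolding mom_def by (intro integrableI_bounded borel_measurable_nu) (auto simp: top.not_eq_extremum)
  have int: "integrable lborel (\<lambda>t. \<phi> t * exp (- z * t))"
  proof (rule integrableI_bounded)
    show "(\<lambda>t. \<phi> t * exp (- z * t)) \<in> borel_measurable lborel"
      using sol_cont[OF sol] by (auto intro!: borel_measurable_continuous_onI continuous_intros)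
    show "(\<integral>\<^sup>+t. ennreal (norm (\<phi> t * exp (- z * t))) \<partial>lborel) < \<infinity>"
      using nnphi pos by (auto simp: abs_mult abs_of_pos intro: le_less_trans)
  qed
  obtain C1 where C1: "\<And>t. \<bar>\<phi>' t\<bar> \<le> C1 * exp (\<zeta> * t)" using deriv_exp_bound[OF sol mom C] by blast
  have C1n: "0 \<le> C1" using C1[of 0] by simp
  have cont: "continuous_on UNIV (\<lambda>t. \<phi> t * exp (- z * t))" by (intro continuous_intros sol_cont[OF sol])
  obtain Q where Q: "\<And>t. (Q has_real_derivative \<phi> t * exp (- z * t)) (at t)"
    using antiderivative_exists[OF cont] by blast
  define \<Lambda> where "\<Lambda> = (\<integral>t. \<phi> t * exp (- z * t) \<partial>lborel)"
  have Lam: "0 \<le> \<Lambda>" unfolding \<Lambda>_def using less_imp_le[OF pos] by (intro integral_nonneg_AE) auto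
  \<comment> \<open>Decay of the derivative at \<open>\<zeta>\<close> and integrability at
    \<open>z\<close> together give the exponent \<open>\<zeta> + z\<close> for the square; this is
    why the gain stops at the midpoint.\<close>
  have sq: "(\<phi> T)\<^sup>2 \<le> (\<phi> s)\<^sup>2 + 2 * C1 * exp ((\<zeta> + z) * T) * \<Lambda>" if st: "s \<le> T" for s T
  proof -
    let ?A = "2 * C1 * exp ((\<zeta> + z) * T)"
    let ?G = "\<lambda>u. (\<phi> u)\<^sup>2 - ?A * Q u"
    have "?G T \<le> ?G s"
    proof (rule DERIV_nonpos_imp_nonincreasing[OF st])
      fix u assume u: "u \<le> T"
      have "(?G has_real_derivative 2 * \<phi> u * \<phi>' u - ?A * (\<phi> u * exp (- z * u))) (at u)"
        by (auto intro!: derivative_eq_intros sol_DERIV[OF sol] Q)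
      moreover have "2 * \<phi> u * \<phi>' u - ?A * (\<phi> u * exp (- z * u)) \<le> 0"
      proof -
        have "(\<zeta> + z) * u \<le> (\<zeta> + z) * T" using u zp z0 by (intro mult_left_mono) auto
        then have "exp (\<zeta> * u) \<le> exp ((\<zeta> + z) * T) * exp (- z * u)" by (simp add: exp_add[symmetric] algebra_simps)
        from mult_left_mono[OF this C1n] have "\<phi>' u \<le> C1 * exp ((\<zeta> + z) * T) * exp (- z * u)"
          using C1[of u] unfolding mult.assoc by linarith
        from mult_left_mono[OF this, of "2 * \<phi> u"] show ?thesis using pos[of u] by (simp add: mult_ac)
      qed
      ultimately show "\<exists>y. (?G has_real_derivative y) (at u) \<and> y \<le> 0" by blast
    qed
    then have "(\<phi> T)\<^sup>2 \<le> (\<phi> s)\<^sup>2 + ?A * (Q T - Q s)" by (simp add: algebra_simps)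
    also have "?A * (Q T - Q s) \<le> ?A * \<Lambda>"
      unfolding \<Lambda>_def using C1n pos by (intro mult_left_mono lborel_antiderivative_le[OF Q cont _ int st]) (auto intro: less_imp_le)
    finally show ?thesis by simp
  qed
  have "\<phi> T \<le> sqrt (2 * C1 * \<Lambda>) * exp ((\<zeta> + z) / 2 * T)" for T
  proof -
    have "(\<phi> T)\<^sup>2 \<le> 0\<^sup>2 + 2 * C1 * exp ((\<zeta> + z) * T) * \<Lambda>"
    proof (rule tendsto_lowerbound)
      show "((\<lambda>s. (\<phi> s)\<^sup>2 + 2 * C1 * exp ((\<zeta> + z) * T) * \<Lambda>) \<longlongrightarrow> 0\<^sup>2 + 2 * C1 * exp ((\<zeta> + z) * T) * \<Lambda>) at_bot"
        by (intro tendsto_intros sol_tendsto[OF sol])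
      show "eventually (\<lambda>s. (\<phi> T)\<^sup>2 \<le> (\<phi> s)\<^sup>2 + 2 * C1 * exp ((\<zeta> + z) * T) * \<Lambda>) at_bot"
        using sq unfolding eventually_at_bot_linorder by blast
    qed simp
    also have "\<dots> = (sqrt (2 * C1 * \<Lambda>) * exp ((\<zeta> + z) / 2 * T))\<^sup>2"
      using C1n Lam by (simp add: power_mult_distrib exp_double[symmetric] mult_ac)
    finally show ?thesis by (rule power2_le_imp_le) (use C1n Lam in simp)
  qed
  then show "\<exists>C'. \<forall>t. \<phi> t \<le> C' * exp ((\<zeta> + z) / 2 * t)" by blast
qed

end

context wave
begin

definition "chi0 z = z\<^sup>2 - c * z - q + p * lap z"

text \<open>Fatou's lemma as the two exponents merge. The transform may be infinite at
  \<open>\<sigma>\<close>, which is why a threshold \<open>\<kappa>\<close> replaces a convergence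
  statement.\<close>

lemma lower_lap_liminf:
  assumes \<kappa>: "0 \<le> \<kappa>" "ennreal \<kappa> < (\<integral>\<^sup>+r. ennreal (exp (- \<sigma> * r)) \<partial>\<nu>)"
    and h: "h \<longlonglongrightarrow> 0" and mom: "\<And>n. \<exists>y. mom y \<and> \<sigma> - h n \<le> y \<and> y \<le> \<sigma> + h n"
  shows "eventually (\<lambda>n. \<kappa> \<le> lower_lap (\<sigma> + h n) (\<sigma> - h n)) sequentially"
proof -
  let ?u = "\<lambda>n r. min (exp (- (\<sigma> + h n) * r)) (exp (- (\<sigma> - h n) * r))"
  have "(\<integral>\<^sup>+r. ennreal (exp (- \<sigma> * r)) \<partial>\<nu>) = (\<integral>\<^sup>+r. liminf (\<lambda>n. ennreal (?u n r)) \<partial>\<nu>)"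
  proof (intro nn_integral_cong lim_imp_Liminf[symmetric] tendsto_ennrealI)
    fix r
    have "(\<lambda>n. ?u n r) \<longlonglongrightarrow> min (exp (- (\<sigma> + 0) * r)) (exp (- (\<sigma> - 0) * r))"
      by (intro tendsto_intros tendsto_min h)
    then show "(\<lambda>n. ?u n r) \<longlonglongrightarrow> exp (- \<sigma> * r)" by simp
  qed simp
  also have "\<dots> \<le> liminf (\<lambda>n. \<integral>\<^sup>+r. ennreal (?u n r) \<partial>\<nu>)"
    by (rule nn_integral_liminf) (auto intro!: borel_measurable_nu)
  finally have "ennreal \<kappa> < liminf (\<lambda>n. \<integral>\<^sup>+r. ennreal (?u n r) \<partial>\<nu>)" using \<kappa>(2) by simp
  then have "eventually (\<lambda>n. ennreal \<kappa> < (\<integral>\<^sup>+r. ennreal (?u n r) \<partial>\<nu>)) sequentially" by (rule less_LiminfD)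
  then show ?thesis
  proof eventually_elim
    case (elim n)
    obtain y where y: "mom y" "\<sigma> - h n \<le> y" "y \<le> \<sigma> + h n" using mom by blast
    have "(\<integral>\<^sup>+r. ennreal (?u n r) \<partial>\<nu>) = ennreal (lower_lap (\<sigma> + h n) (\<sigma> - h n))"
      unfolding lower_lap_def by (intro nn_integral_eq_integral lower_lap_integrable[OF y]) auto
    then have "ennreal \<kappa> < ennreal (lower_lap (\<sigma> + h n) (\<sigma> - h n))" using elim by simp
    then show ?case by (simp add: ennreal_less_iff \<kappa>(1))
  qed
qed

lemma measure_pos: "0 < measure \<nu> UNIV" by (simp add: mass)

text \<open>Treats an infinite moment and a finite one with positive \<open>chi0\<close> alike: in
  both cases a finite level strictly below the transform already makes the characteristic expression
  positive.\<close>

lemma mass_threshold: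
  assumes "\<not> mom \<sigma> \<or> 0 < chi0 \<sigma>"
  shows "\<exists>\<kappa>\<ge>0. ennreal \<kappa> < (\<integral>\<^sup>+r. ennreal (exp (- \<sigma> * r)) \<partial>\<nu>) \<and> 0 < \<sigma>\<^sup>2 - c * \<sigma> - q + p * \<kappa>"
proof (cases "mom \<sigma>")
  case True
  then have x: "0 < chi0 \<sigma>" using assms by simp
  have k: "0 < lap \<sigma>" by (rule lap_pos[OF True measure_pos])
  define \<kappa> where "\<kappa> = max 0 (lap \<sigma> - chi0 \<sigma> / (2 * p))"
  have "0 < chi0 \<sigma> / (2 * p)" using x p_pos by simp
  then have k1: "0 \<le> \<kappa>" "\<kappa> < lap \<sigma>" using k by (auto simp: \<kappa>_def)
  have "p * (lap \<sigma> - chi0 \<sigma> / (2 * p)) \<le> p * \<kappa>" using p_pos by (intro mult_left_mono) (auto simp: \<kappa>_def)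
  then have "p * lap \<sigma> - chi0 \<sigma> / 2 \<le> p * \<kappa>" using p_pos by (simp add: right_diff_distrib)
  moreover have "chi0 \<sigma> = \<sigma>\<^sup>2 - c * \<sigma> - q + p * lap \<sigma>" by (rule chi0_def)
  ultimately have "0 < \<sigma>\<^sup>2 - c * \<sigma> - q + p * \<kappa>" using x by linarith
  moreover have "(\<integral>\<^sup>+r. ennreal (exp (- \<sigma> * r)) \<partial>\<nu>) = ennreal (lap \<sigma>)"
    using True unfolding lap_def mom_def by (intro nn_integral_eq_integral) auto
  ultimately show ?thesis using k1 by (intro exI[of _ \<kappa>]) (auto simp: ennreal_less_iff)
next
  case False
  define \<kappa> where "\<kappa> = (\<bar>\<sigma>\<^sup>2 - c * \<sigma> - q\<bar> + 1) / p"
  have "(\<integral>\<^sup>+r. ennreal (exp (- \<sigma> * r)) \<partial>\<nu>) = \<infinity>"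
  proof (rule ccontr)
    assume "(\<integral>\<^sup>+r. ennreal (exp (- \<sigma> * r)) \<partial>\<nu>) \<noteq> \<infinity>"
    then have "mom \<sigma>" unfolding mom_def by (intro integrableI_bounded borel_measurable_nu) (auto simp: top.not_eq_extremum)
    then show False using False by simp
  qed
  moreover have "0 \<le> \<kappa>" "0 < \<sigma>\<^sup>2 - c * \<sigma> - q + p * \<kappa>" using p_pos by (auto simp: \<kappa>_def)
  ultimately show ?thesis by (intro exI[of _ \<kappa>]) auto
qed

section \<open>The exponents at which a positive profile decays\<close>

context
  fixes \<phi> \<phi>' assumes sol: "sol \<phi> \<phi>'" and pos: "\<And>t. 0 < \<phi> t"
begin

definition "decays z \<longleftrightarrow> mom z \<and> (\<exists>C. \<forall>t. \<phi> t \<le> C * exp (z * t))"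

lemma decays_0: "decays 0"
  using sol_bounded[OF sol] mom_0 by (auto simp: decays_def)

lemma decays_down: assumes "decays z" "0 \<le> y" "y \<le> z" shows "decays y"
proof -
  obtain C where "\<And>t. \<phi> t \<le> C * exp (z * t)" using assms(1) by (auto simp: decays_def)
  from exp_bound_mono[OF sol this assms(2,3)] show ?thesis
    using mom_between[OF mom_0 _ assms(2,3)] assms(1) by (auto simp: decays_def)
qed

text \<open>Openness at a limiting exponent: decay is known only strictly below
  \<open>\<sigma>\<close>, and \<open>decay_gain\<close>, applied on a small window around
  \<open>\<sigma>\<close>, pushes it past \<open>\<sigma>\<close>.\<close>

lemma decays_step:
  assumes s: "0 \<le> \<sigma>" and chi: "\<not> mom \<sigma> \<or> 0 < chi0 \<sigma>" and below: "\<And>y. 0 \<le> y \<Longrightarrow> y < \<sigma> \<Longrightarrow> decays y"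
  shows "\<exists>y>\<sigma>. decays y"
proof -
  obtain \<kappa> where k: "0 \<le> \<kappa>" "ennreal \<kappa> < (\<integral>\<^sup>+r. ennreal (exp (- \<sigma> * r)) \<partial>\<nu>)"
    and x: "0 < \<sigma>\<^sup>2 - c * \<sigma> - q + p * \<kappa>" using mass_threshold[OF chi] by blast
  define x0 where "x0 = \<sigma>\<^sup>2 - c * \<sigma> - q + p * \<kappa>"
  define h where "h n = 1 / real (Suc n)" for n
  have hpos: "0 < h n" "h n \<le> 1" for n by (auto simp: h_def)
  have hlim: "h \<longlonglongrightarrow> 0" unfolding h_def by (rule LIMSEQ_Suc[OF lim_1_over_n])
  have near: "\<exists>y. decays y \<and> 0 \<le> y \<and> \<sigma> - e < y \<and> y \<le> \<sigma>" if "0 < e" for e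
  proof (cases "\<sigma> = 0")
    case True then show ?thesis using decays_0 that by (intro exI[of _ 0]) auto
  next
    case False
    then have "decays (max (\<sigma> / 2) (\<sigma> - e / 2))" using s that by (intro below) auto
    then show ?thesis using s that False by (intro exI[of _ "max (\<sigma> / 2) (\<sigma> - e / 2)"]) auto
  qed
  have mom_near: "\<exists>y. mom y \<and> \<sigma> - 2 * h n \<le> y \<and> y \<le> \<sigma> + 2 * h n" for n
  proof -
    obtain y where y: "decays y" "\<sigma> - h n < y" "y \<le> \<sigma>" using near[OF hpos(1)] by blast
    have "mom y" using y(1) by (simp add: decays_def)
    moreover have "\<sigma> - 2 * h n \<le> y" "y \<le> \<sigma> + 2 * h n" using y hpos(1)[of n] by linarith+
    ultimately show ?thesis by blast
  qed
  have h2: "(\<lambda>n. 2 * h n) \<longlonglongrightarrow> 0" using tendsto_mult_right_zero[OF hlim, of 2] by simp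
  have ev1: "eventually (\<lambda>n. \<kappa> \<le> lower_lap (\<sigma> + 2 * h n) (\<sigma> - 2 * h n)) sequentially"
    by (rule lower_lap_liminf[OF k h2 mom_near])
  \<comment> \<open>Three losses, \<open>\<delta>\<close> from \<open>q + \<delta>\<close>,
    \<open>\<delta> * \<kappa>\<close> from \<open>p - \<delta>\<close>, and the margin
    \<open>\<delta>\<close> itself, use up half of \<open>x0\<close>.\<close>
  define \<delta> where "\<delta> = x0 / (2 * (2 + \<kappa>))"
  have x0: "0 < x0" using x by (simp add: x0_def)
  have d: "0 < \<delta>" using x0 k(1) by (simp add: \<delta>_def)
  have d2: "\<delta> * (2 + \<kappa>) = x0 / 2" using k(1) by (simp add: \<delta>_def field_simps)
  \<comment> \<open>Error per unit of \<open>e\<close>: \<open>4 * \<sigma> + 4\<close> from the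
    change of \<open>\<xi>\<^sup>2\<close>, 16 from the squared width of the window,
    \<open>2 * \<bar>c\<bar>\<close> from the linear term.\<close>
  define A where "A = 4 * \<sigma> + 20 + 2 * \<bar>c\<bar>"
  have "(\<lambda>n. h n * A) \<longlonglongrightarrow> 0" by (rule tendsto_mult_left_zero[OF hlim])
  then have ev2: "eventually (\<lambda>n. h n * A < x0 / 2) sequentially"
    using x0 by (intro order_tendstoD) auto
  obtain n where n: "\<kappa> \<le> lower_lap (\<sigma> + 2 * h n) (\<sigma> - 2 * h n)" "h n * A < x0 / 2"
    using eventually_happens[OF eventually_conj[OF ev1 ev2]] by auto
  define e where "e = h n"
  have e: "0 < e" "e \<le> 1" "e * A < x0 / 2" using hpos n by (auto simp: e_def)
  \<comment> \<open>The window reaches \<open>2 * e\<close> beyond \<open>\<sigma>\<close> while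
    \<open>\<zeta>\<close> lies less than \<open>e\<close> below it, so the midpoint of
    \<open>\<zeta>\<close> and \<open>\<sigma> + 2 * e\<close> exceeds
    \<open>\<sigma>\<close>.\<close>
  obtain \<zeta> where ze: "decays \<zeta>" "0 \<le> \<zeta>" "\<sigma> - e < \<zeta>" "\<zeta> \<le> \<sigma>" using near[OF e(1)] by blast
  obtain C where C: "\<And>t. \<phi> t \<le> C * exp (\<zeta> * t)" and mz: "mom \<zeta>" using ze(1) by (auto simp: decays_def)
  have br: "\<delta> \<le> \<xi>\<^sup>2 - c * \<xi> - (\<sigma> + 2 * e - (\<sigma> - 2 * e))\<^sup>2 - (q + \<delta>) + (p - \<delta>) * \<kappa>"
    if xi: "\<sigma> - 2 * e \<le> \<xi>" "\<xi> \<le> \<sigma> + 2 * e" for \<xi>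
  proof -
    have a: "\<bar>\<xi> - \<sigma>\<bar> \<le> 2 * e" using xi by linarith
    have "\<bar>\<xi>\<^sup>2 - \<sigma>\<^sup>2\<bar> = \<bar>\<xi> - \<sigma>\<bar> * \<bar>\<xi> + \<sigma>\<bar>" by (simp add: power2_eq_square abs_mult[symmetric] algebra_simps)
    also have "\<dots> \<le> (2 * e) * (2 * \<sigma> + 2)" using a xi e s by (intro mult_mono) auto
    finally have b: "\<sigma>\<^sup>2 - (2 * e) * (2 * \<sigma> + 2) \<le> \<xi>\<^sup>2" by linarith
    have "\<bar>c * (\<xi> - \<sigma>)\<bar> \<le> \<bar>c\<bar> * (2 * e)" unfolding abs_mult by (rule mult_left_mono[OF a]) simp
    then have cc: "c * \<xi> \<le> c * \<sigma> + \<bar>c\<bar> * (2 * e)" by (simp add: right_diff_distrib abs_le_iff)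
    have "e * e \<le> e * 1" using e by (intro mult_left_mono) auto
    then have sq: "(\<sigma> + 2 * e - (\<sigma> - 2 * e))\<^sup>2 \<le> 16 * e" by (simp add: power2_eq_square)
    have "x0 - e * A - \<delta> * (1 + \<kappa>) \<le> \<xi>\<^sup>2 - c * \<xi> - (\<sigma> + 2 * e - (\<sigma> - 2 * e))\<^sup>2 - (q + \<delta>) + (p - \<delta>) * \<kappa>"
      using b cc sq unfolding x0_def A_def by (simp add: algebra_simps)
    moreover have "\<delta> * (1 + \<kappa>) + \<delta> = x0 / 2" using d2 by (simp add: algebra_simps)
    ultimately show ?thesis using e(3) by linarith
  qed
  have zz: "\<sigma> - 2 * e < \<zeta>" "\<zeta> < \<sigma> + 2 * e" using ze e by linarith+
  have k': "\<kappa> \<le> lower_lap (\<sigma> + 2 * e) (\<sigma> - 2 * e)" using n(1) by (simp add: e_def)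
  note G = decay_gain[OF sol pos zz ze(2) mz C k' k(1) d br]
  have "mom ((\<zeta> + (\<sigma> + 2 * e)) / 2)" by (rule mom_between[OF mz G(1)]) (use zz in auto)
  then have "decays ((\<zeta> + (\<sigma> + 2 * e)) / 2)" using G(2) by (simp add: decays_def)
  moreover have "\<sigma> < (\<zeta> + (\<sigma> + 2 * e)) / 2" using ze e by simp
  ultimately show ?thesis by blast
qed

text \<open>Connectedness: the supremum of the exponents of decay cannot stop below
  \<open>z0\<close>, since \<open>decays_step\<close> passes beyond it.\<close>

lemma decays_below:
  assumes chi: "\<And>z. 0 \<le> z \<Longrightarrow> z < z0 \<Longrightarrow> \<not> mom z \<or> 0 < chi0 z" and z: "0 \<le> z" "z < z0"
  shows "decays z"
proof (rule ccontr)
  assume not: "\<not> decays z"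
  define S where "S = {y. 0 \<le> y \<and> decays y}"
  have ub: "y < z" if "y \<in> S" for y using decays_down[of y z] not z that by (force simp: S_def)
  have bdd: "bdd_above S" using ub by (intro bdd_aboveI[of _ z]) (auto intro: less_imp_le)
  have 0: "0 \<in> S" using decays_0 by (simp add: S_def)
  define \<sigma> where "\<sigma> = Sup S"
  have s: "0 \<le> \<sigma>" unfolding \<sigma>_def by (rule cSup_upper[OF 0 bdd])
  have "\<sigma> \<le> z" unfolding \<sigma>_def using 0 ub by (intro cSup_least) (auto intro: less_imp_le)
  then have sz: "\<sigma> < z0" using z by simp
  have "decays y" if y: "0 \<le> y" "y < \<sigma>" for y
  proof -
    obtain x where "x \<in> S" "y < x" using y(2) less_cSup_iff[OF _ bdd, of y] 0 unfolding \<sigma>_def by blast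
    then show ?thesis using decays_down[of x y] y by (auto simp: S_def)
  qed
  from decays_step[OF s chi[OF s sz] this] obtain y where y: "\<sigma> < y" "decays y" by blast
  then have "y \<in> S" using s by (simp add: S_def)
  then have "y \<le> \<sigma>" unfolding \<sigma>_def by (rule cSup_upper[OF _ bdd])
  then show False using y by simp
qed

text \<open>A barrier from below. Since the birth term is nonnegative, at a negative minimum of the
  difference the equation would give \<open>\<mu>\<^sup>2 \<le> c * \<mu> + K\<close>, which the
  choice of \<open>\<mu>\<close> excludes.\<close>

lemma exp_lower_bound: "\<exists>\<mu>>0. \<forall>t\<le>0. \<phi> 0 * exp (\<mu> * t) \<le> \<phi> t"
proof -
  obtain M where M: "0 < M" "\<And>t. \<phi> t \<le> M" using sol_bounded[OF sol] by blast
  obtain K where K: "0 \<le> K" "\<And>s. s \<in> {0..M} \<Longrightarrow> f s \<le> K * s" using f_le[OF M(1)] by blast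
  define \<mu> where "\<mu> = \<bar>c\<bar> + K + 1"
  have mu: "0 < \<mu>" "1 \<le> \<mu>" using K by (auto simp: \<mu>_def)
  have key: "K + c * \<mu> < \<mu>\<^sup>2"
  proof -
    have "c * \<mu> \<le> \<bar>c\<bar> * \<mu>" using mu by (intro mult_right_mono) auto
    moreover have "K + 1 \<le> (K + 1) * \<mu>" using mult_left_mono[OF mu(2), of "K + 1"] K(1) by simp
    moreover have "\<mu>\<^sup>2 = \<bar>c\<bar> * \<mu> + (K + 1) * \<mu>" by (simp add: power2_eq_square \<mu>_def distrib_right)
    ultimately show ?thesis by linarith
  qed
  define F where "F t = \<phi> t - \<phi> 0 * exp (\<mu> * t)" for t
  define F' where "F' t = \<phi>' t - \<phi> 0 * \<mu> * exp (\<mu> * t)" for t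
  have dF: "(F has_real_derivative F' t) (at t)" for t
    unfolding F_def F'_def by (auto intro!: derivative_eq_intros sol_DERIV[OF sol])
  have dF': "(F' has_real_derivative c * \<phi>' t + f (\<phi> t) - N \<phi> t - \<phi> 0 * \<mu>\<^sup>2 * exp (\<mu> * t)) (at t)" for t
    unfolding F'_def by (auto intro!: derivative_eq_intros sol_DERIV2[OF sol] simp: power2_eq_square)
  have "0 \<le> F t" if t: "t \<le> 0" for t
  proof (rule ccontr)
    assume "\<not> 0 \<le> F t"
    then have neg: "F t < 0" by simp
    have "((\<lambda>t. \<phi> t - \<phi> 0 * exp (\<mu> * t)) \<longlongrightarrow> 0 - 0) at_bot"
      by (intro tendsto_diff sol_tendsto[OF sol] exp_tendsto_0_at_bot mu)
    then have "(F \<longlongrightarrow> 0) at_bot" unfolding F_def[abs_def] by simp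
    from order_tendstoD(1)[OF this neg] obtain R where R: "\<And>s. s \<le> R \<Longrightarrow> F t < F s"
      unfolding eventually_at_bot_linorder by blast
    let ?S = "{min R t..0}"
    have "\<exists>x\<in>?S. \<forall>y\<in>?S. F x \<le> F y"
      using t continuous_if_deriv[OF dF] by (intro continuous_attains_inf) (auto intro: continuous_on_subset)
    then obtain x where x: "x \<in> ?S" "\<And>y. y \<in> ?S \<Longrightarrow> F x \<le> F y" by blast
    have xt: "F x \<le> F t" using x(2)[of t] t by simp
    have "F 0 = 0" by (simp add: F_def)
    then have x0: "x < 0" using xt neg x(1) by (cases "x = 0") auto
    have glob: "F x \<le> F y" if "y \<le> 0" for y
      using x(2)[of y] R[of y] xt that by (cases "y \<le> R") (auto intro: less_imp_le order_trans)
    have loc: "F x \<le> F y" if "\<bar>y - x\<bar> < - x" for y using that by (intro glob) linarith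
    have z: "F' x = 0" and nn: "0 \<le> c * \<phi>' x + f (\<phi> x) - N \<phi> x - \<phi> 0 * \<mu>\<^sup>2 * exp (\<mu> * x)"
      using local_min_second_derivative[of "- x" x F F', OF _ loc dF dF'[of x]] x0 by simp_all
    have "\<phi>' x = \<phi> 0 * \<mu> * exp (\<mu> * x)" using z by (simp add: F'_def)
    moreover have "f (\<phi> x) \<le> K * (\<phi> 0 * exp (\<mu> * x))"
    proof -
      have "f (\<phi> x) \<le> K * \<phi> x" using K(2)[of "\<phi> x"] M sol_nonneg[OF sol] by simp
      also have "\<dots> \<le> K * (\<phi> 0 * exp (\<mu> * x))" using xt neg K(1) by (intro mult_left_mono) (auto simp: F_def)
      finally show ?thesis .
    qed
    ultimately have "0 \<le> (c * \<mu> + K - \<mu>\<^sup>2) * (\<phi> 0 * exp (\<mu> * x))"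
      using nn N_nonneg[OF sol, of x] by (simp add: algebra_simps)
    moreover have "0 < \<phi> 0 * exp (\<mu> * x)" using pos by simp
    ultimately have "0 \<le> c * \<mu> + K - \<mu>\<^sup>2" by (simp add: zero_le_mult_iff)
    then show False using key by simp
  qed
  then show ?thesis using mu by (intro exI[of _ \<mu>]) (auto simp: F_def)
qed

lemma characteristic_nonpos: "\<exists>z>0. mom z \<and> chi0 z \<le> 0"
proof (rule ccontr)
  assume no: "\<not> (\<exists>z>0. mom z \<and> chi0 z \<le> 0)"
  have "chi0 0 = p - q" by (simp add: chi0_def lap_0 mass)
  then have chi: "\<not> mom z \<or> 0 < chi0 z" if "0 \<le> z" for z using no that qp by (cases "z = 0") (auto simp: not_le)
  obtain \<mu> where mu: "0 < \<mu>" "\<And>t. t \<le> 0 \<Longrightarrow> \<phi> 0 * exp (\<mu> * t) \<le> \<phi> t" using exp_lower_bound by blast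
  have "decays (\<mu> + 1)" by (rule decays_below[of "\<mu> + 2"]) (use chi mu in auto)
  then obtain C where C: "\<And>t. \<phi> t \<le> C * exp ((\<mu> + 1) * t)" by (auto simp: decays_def)
  have "C * exp (1 * t) \<ge> \<phi> 0" if "t \<le> 0" for t
  proof -
    have "\<phi> 0 * exp (\<mu> * t) \<le> (C * exp t) * exp (\<mu> * t)"
      using mu(2)[OF that] C[of t] by (simp add: exp_add[symmetric] algebra_simps)
    then show ?thesis by simp
  qed
  then have "eventually (\<lambda>t. \<phi> 0 \<le> C * exp (1 * t)) at_bot" unfolding eventually_at_bot_linorder by blast
  moreover have "((\<lambda>t. C * exp (1 * t)) \<longlongrightarrow> 0) at_bot" by (rule exp_tendsto_0_at_bot) simp
  ultimately have "\<phi> 0 \<le> 0" by (intro tendsto_lowerbound[of _ 0 at_bot "\<phi> 0"]) auto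
  then show False using pos[of 0] by simp
qed

end

end

section \<open>Differences of two profiles\<close>

lemma filterlim_shift_at_bot: "filterlim (\<lambda>t::real. t + s) at_bot at_bot" for s :: real
  unfolding filterlim_at_bot eventually_at_bot_linorder
proof
  fix Z :: real
  have "\<forall>t\<le>Z - s. t + s \<le> Z" by auto
  then show "\<exists>N. \<forall>t\<le>N. t + s \<le> Z" ..
qed

lemma exp_interpolate:
  fixes X :: "real \<Rightarrow> real"
  assumes "\<And>t. X t \<le> M" "\<And>t. X t \<le> C * exp (y * t)" "0 \<le> M" "0 \<le> C" "0 \<le> \<theta>" "\<theta> \<le> y"
  shows "X t \<le> (C + M) * exp (\<theta> * t)"
proof (cases "0 \<le> t")
  case True
  have "M * 1 \<le> M * exp (\<theta> * t)" using assms True by (intro mult_left_mono) auto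
  then show ?thesis using assms(1)[of t] assms(4) by (simp add: distrib_right add_increasing)
next
  case False
  have "C * exp (y * t) \<le> C * exp (\<theta> * t)"
    using False assms by (intro mult_left_mono iffD2[OF exp_le_cancel_iff] mult_right_mono_neg) auto
  then show ?thesis using assms(2)[of t] assms(3) by (simp add: distrib_right add_increasing2)
qed

section \<open>Exponential change of measure and the linearisation error\<close>

context finite_borel
begin

text \<open>The Esscher transform of \<open>\<nu>\<close>, scaled by \<open>k\<close>. Dividing
  functions by \<open>exp (z * t)\<close> turns \<open>k\<close> times the convolution with
  \<open>\<nu>\<close> into convolution with this measure. The factor \<open>k\<close> is
  \<open>p\<close> for the linearisation and \<open>L\<close> for the Lipschitz bound.\<close>

definition "tilt k z = density \<nu> (\<lambda>r. ennreal (k * exp (- z * r)))" for k z :: real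

lemma tilt_integral:
  assumes "0 \<le> k" "continuous_on UNIV X"
  shows "(\<integral>r. X r \<partial>tilt k z) = (\<integral>r. k * exp (- z * r) * X r \<partial>\<nu>)"
  unfolding tilt_def using assms
  by (subst integral_density) (auto intro!: measurable_cont continuous_intros)

lemma tilt_integrable:
  assumes "0 \<le> k" "continuous_on UNIV X"
  shows "integrable (tilt k z) X \<longleftrightarrow> integrable \<nu> (\<lambda>r. k * exp (- z * r) * X r)"
  unfolding tilt_def using assms
  by (subst integrable_density) (auto intro!: measurable_cont continuous_intros)

lemma tilt_exp_moments:
  assumes "mom (z - h)" "mom (z + h)" "0 < h" "0 \<le> k"
  shows "exp_moments (tilt k z) h"
proof -
  have mz: "mom z" by (rule mom_between[OF assms(1,2)]) (use assms(3) in auto)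
  have "emeasure (tilt k z) UNIV = (\<integral>\<^sup>+r. ennreal (k * exp (- z * r)) \<partial>\<nu>)"
    unfolding tilt_def by (subst emeasure_density) (auto intro!: borel_measurable_nu simp: sets_nu)
  also have "\<dots> = ennreal (\<integral>r. k * exp (- z * r) \<partial>\<nu>)"
    using mz assms(4) by (intro nn_integral_eq_integral) (auto simp: mom_def)
  finally have fin: "emeasure (tilt k z) UNIV \<noteq> \<infinity>" by simp
  interpret T: finite_measure "tilt k z"
    by (rule finite_measureI) (use fin in \<open>simp add: tilt_def\<close>)
  interpret T: finite_borel "tilt k z"
    by standard (simp add: tilt_def sets_nu)
  show ?thesis
  proof
    have "continuous_on UNIV (\<lambda>r::real. exp (h * \<bar>r\<bar>))" by (intro continuous_intros)
    then show "integrable (tilt k z) (\<lambda>r. exp (h * \<bar>r\<bar>))"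
      using exp_moment[OF assms(1,2)] assms(4) by (simp add: tilt_integrable mult.assoc)
  qed (rule assms(3))
qed

lemma tilt_measure:
  assumes "0 \<le> k" "mom z"
  shows "measure (tilt k z) UNIV = k * lap z"
proof -
  have "emeasure (tilt k z) UNIV = (\<integral>\<^sup>+r. ennreal (k * exp (- z * r)) \<partial>\<nu>)"
    unfolding tilt_def by (subst emeasure_density) (auto intro!: borel_measurable_nu simp: sets_nu)
  also have "\<dots> = ennreal (\<integral>r. k * exp (- z * r) \<partial>\<nu>)"
    using assms by (intro nn_integral_eq_integral) (auto simp: mom_def)
  finally show ?thesis using assms(1) by (simp add: measure_def lap_def)
qed

end

context wave
begin

text \<open>The error in replacing \<open>f\<close> and \<open>g\<close> by their linearisations at 0 in the equation for \<open>\<phi> - \<psi>\<close>. Taking \<open>\<psi> = 0\<close>,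
  which also satisfies \<open>sol\<close>, covers a single profile.\<close>

definition "rem \<phi> \<psi> t = (f (\<phi> t) - f (\<psi> t) - q * (\<phi> t - \<psi> t)) -
    (\<integral>r. g (\<phi> (t - r)) - g (\<psi> (t - r)) - p * (\<phi> (t - r) - \<psi> (t - r)) \<partial>\<nu>)" for \<phi> \<psi> :: "real \<Rightarrow> real"

lemma sol_zero: "sol (\<lambda>_. 0) (\<lambda>_. 0)"
  by (auto simp: sol_def N_def f_0 g_0 intro!: exI[of _ 1])

lemma sol_shift: assumes "sol \<phi> \<phi>'" shows "sol (\<lambda>t. \<phi> (t + s)) (\<lambda>t. \<phi>' (t + s))"
proof -
  have sh: "((\<lambda>t. F (t + s)) has_real_derivative F' (t + s)) (at t)"
    if "\<And>t. (F has_real_derivative F' t) (at t)" for F F' :: "real \<Rightarrow> real" and t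
    using DERIV_compose_diff[OF that, of "- s" t] by simp
  have "((\<lambda>t. \<phi> (t + s)) \<longlongrightarrow> 0) at_bot"
    by (rule filterlim_compose[OF sol_tendsto[OF assms] filterlim_shift_at_bot])
  moreover have "N (\<lambda>t. \<phi> (t + s)) t = N \<phi> (t + s)" for t
    by (simp add: N_def algebra_simps)
  ultimately show ?thesis
    using sol_nonneg[OF assms] sol_bounded[OF assms] sh[OF sol_DERIV[OF assms]] sh[OF sol_DERIV2[OF assms]]
    by (auto simp: sol_def)
qed

lemma sol_shift_integrable:
  assumes "sol \<phi> \<phi>'" shows "integrable \<nu> (\<lambda>r. \<phi> (t - r))"
proof -
  obtain M where "0 < M" "\<And>t. \<phi> t \<le> M" using sol_bounded[OF assms] by blast
  then show ?thesis using sol_nonneg[OF assms]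
    by (intro integrable_const_bound[where B = M] measurable_cont continuous_on_shift[OF assms] sol_cont[OF assms]) auto
qed

lemma diff_DERIV2:
  assumes "sol \<phi> \<phi>'" "sol \<psi> \<psi>'"
  shows "((\<lambda>t. \<phi>' t - \<psi>' t) has_real_derivative
     c * (\<phi>' t - \<psi>' t) + q * (\<phi> t - \<psi> t) - p * (\<integral>r. \<phi> (t - r) - \<psi> (t - r) \<partial>\<nu>) + rem \<phi> \<psi> t) (at t)"
proof -
  have "rem \<phi> \<psi> t = (f (\<phi> t) - f (\<psi> t) - q * (\<phi> t - \<psi> t)) - (N \<phi> t - N \<psi> t - p * (\<integral>r. \<phi> (t - r) - \<psi> (t - r) \<partial>\<nu>))"
    using gphi_integrable[OF assms(1)] gphi_integrable[OF assms(2)] sol_shift_integrable[OF assms(1)] sol_shift_integrable[OF assms(2)]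
    by (simp add: rem_def N_def)
  then have eq: "c * \<phi>' t + f (\<phi> t) - N \<phi> t - (c * \<psi>' t + f (\<psi> t) - N \<psi> t) =
      c * (\<phi>' t - \<psi>' t) + q * (\<phi> t - \<psi> t) - p * (\<integral>r. \<phi> (t - r) - \<psi> (t - r) \<partial>\<nu>) + rem \<phi> \<psi> t"
    unfolding right_diff_distrib by linarith
  show ?thesis
    using DERIV_diff[OF sol_DERIV2[OF assms(1), of t] sol_DERIV2[OF assms(2), of t]] unfolding eq .
qed

text \<open>The difference of the profiles is kept as a factor instead of being replaced by an
  exponential, so that the barrier argument can insert its own bound for it. The gain
  \<open>exp (\<theta> * t)\<close> comes from the Hoelder exponent together with the decay of the
  larger profile.\<close>

lemma rem_bound:
  assumes s1: "sol \<phi> \<phi>'" and s2: "sol \<psi> \<psi>'" and z: "0 \<le> z"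
    and C1: "\<And>t. \<phi> t \<le> C * exp (z * t)" and C2: "\<And>t. \<psi> t \<le> C * exp (z * t)"
    and th: "0 \<le> \<theta>" "\<theta> \<le> \<alpha> * z" and mom: "mom (\<theta> + z)"
  shows "\<exists>R\<ge>0. \<forall>t. \<bar>rem \<phi> \<psi> t\<bar> \<le> R * (exp (\<theta> * t) * \<bar>\<phi> t - \<psi> t\<bar> + (\<integral>r. exp (\<theta> * (t - r)) * \<bar>\<phi> (t - r) - \<psi> (t - r)\<bar> \<partial>\<nu>))"
    and "\<And>t. integrable \<nu> (\<lambda>r. exp (\<theta> * (t - r)) * \<bar>\<phi> (t - r) - \<psi> (t - r)\<bar>)"
proof -
  obtain M1 where M1: "0 < M1" "\<And>t. \<phi> t \<le> M1" using sol_bounded[OF s1] by blast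
  obtain M2 where M2: "0 < M2" "\<And>t. \<psi> t \<le> M2" using sol_bounded[OF s2] by blast
  define M where "M = max M1 M2"
  have M: "0 < M" "\<And>t. \<phi> t \<le> M" "\<And>t. \<psi> t \<le> M" using M1 M2 by (auto simp: M_def le_max_iff_disj)
  have mem: "\<phi> t \<in> {0..M}" "\<psi> t \<in> {0..M}" for t using M sol_nonneg[OF s1] sol_nonneg[OF s2] by auto
  obtain Cf where Cf: "\<And>s r. s \<in> {0..M} \<Longrightarrow> r \<in> {0..M} \<Longrightarrow> \<bar>f s - f r - q * (s - r)\<bar> \<le> Cf * max s r powr \<alpha> * \<bar>s - r\<bar>"
    using f_holder[OF M(1)] by metis
  obtain Cg where Cg: "\<And>s r. s \<in> {0..M} \<Longrightarrow> r \<in> {0..M} \<Longrightarrow> \<bar>g s - g r - p * (s - r)\<bar> \<le> Cg * max s r powr \<alpha> * \<bar>s - r\<bar>"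
    using g_holder[OF M(1)] by metis
  have C: "0 \<le> C" using C1[of 0] mem(1)[of 0] by simp
  define E where "E = C powr \<alpha> + M powr \<alpha>"
  have E: "max (\<phi> t) (\<psi> t) powr \<alpha> \<le> E * exp (\<theta> * t)" for t
    unfolding E_def
  proof (rule exp_interpolate[where y = "\<alpha> * z"])
    fix t
    show "max (\<phi> t) (\<psi> t) powr \<alpha> \<le> M powr \<alpha>" using mem[of t] alpha by (intro powr_mono2) auto
    have "max (\<phi> t) (\<psi> t) powr \<alpha> \<le> (C * exp (z * t)) powr \<alpha>"
      using mem[of t] alpha C1[of t] C2[of t] by (intro powr_mono2) auto
    also have "\<dots> = C powr \<alpha> * exp (\<alpha> * z * t)" using C by (simp add: powr_mult exp_powr_real mult_ac)
    finally show "max (\<phi> t) (\<psi> t) powr \<alpha> \<le> C powr \<alpha> * exp (\<alpha> * z * t)" .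
  qed (use th in auto)
  define R where "R = (\<bar>Cf\<bar> + \<bar>Cg\<bar>) * E"
  have E0: "0 \<le> E" by (simp add: E_def)
  have R0: "0 \<le> R" using E0 by (simp add: R_def)
  have le: "K * max (\<phi> t) (\<psi> t) powr \<alpha> * \<bar>\<phi> t - \<psi> t\<bar> \<le> R * (exp (\<theta> * t) * \<bar>\<phi> t - \<psi> t\<bar>)"
    if K: "K \<le> \<bar>Cf\<bar> + \<bar>Cg\<bar>" for K t
  proof -
    have "K * max (\<phi> t) (\<psi> t) powr \<alpha> \<le> (\<bar>Cf\<bar> + \<bar>Cg\<bar>) * (E * exp (\<theta> * t))"
      using K E[of t] by (intro mult_mono) auto
    from mult_right_mono[OF this, of "\<bar>\<phi> t - \<psi> t\<bar>"] show ?thesis by (simp add: R_def mult.assoc)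
  qed
  have f_le: "\<bar>f (\<phi> t) - f (\<psi> t) - q * (\<phi> t - \<psi> t)\<bar> \<le> R * (exp (\<theta> * t) * \<bar>\<phi> t - \<psi> t\<bar>)" for t
    using Cf[OF mem(1)[of t] mem(2)[of t]] le[of Cf t] by linarith
  have g_le: "\<bar>g (\<phi> t) - g (\<psi> t) - p * (\<phi> t - \<psi> t)\<bar> \<le> R * (exp (\<theta> * t) * \<bar>\<phi> t - \<psi> t\<bar>)" for t
    using Cg[OF mem(1)[of t] mem(2)[of t]] le[of Cg t] by linarith
  show int: "integrable \<nu> (\<lambda>r. exp (\<theta> * (t - r)) * \<bar>\<phi> (t - r) - \<psi> (t - r)\<bar>)" for t
  proof (rule Bochner_Integration.integrable_bound)
    show "integrable \<nu> (\<lambda>r. (C * exp ((\<theta> + z) * t)) * exp (- (\<theta> + z) * r))" using mom by (simp add: mom_def)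
    show "(\<lambda>r. exp (\<theta> * (t - r)) * \<bar>\<phi> (t - r) - \<psi> (t - r)\<bar>) \<in> borel_measurable \<nu>"
      by (intro measurable_cont continuous_intros continuous_on_shift[OF s1 sol_cont[OF s1]] continuous_on_shift[OF s2 sol_cont[OF s2]])
    show "AE r in \<nu>. norm (exp (\<theta> * (t - r)) * \<bar>\<phi> (t - r) - \<psi> (t - r)\<bar>) \<le> norm ((C * exp ((\<theta> + z) * t)) * exp (- (\<theta> + z) * r))"
    proof (rule AE_I2)
      fix r
      have "\<bar>\<phi> (t - r) - \<psi> (t - r)\<bar> \<le> C * exp (z * (t - r))"
        using C1[of "t - r"] C2[of "t - r"] mem[of "t - r"] by auto
      then have "exp (\<theta> * (t - r)) * \<bar>\<phi> (t - r) - \<psi> (t - r)\<bar> \<le> exp (\<theta> * (t - r)) * (C * exp (z * (t - r)))"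
        by (intro mult_left_mono) auto
      also have "\<dots> = (C * exp ((\<theta> + z) * t)) * exp (- (\<theta> + z) * r)" by (simp add: exp_add[symmetric] algebra_simps)
      finally show "norm (exp (\<theta> * (t - r)) * \<bar>\<phi> (t - r) - \<psi> (t - r)\<bar>) \<le> norm ((C * exp ((\<theta> + z) * t)) * exp (- (\<theta> + z) * r))"
        using C by simp
    qed
  qed
  have "\<bar>rem \<phi> \<psi> t\<bar> \<le> R * (exp (\<theta> * t) * \<bar>\<phi> t - \<psi> t\<bar> + (\<integral>r. exp (\<theta> * (t - r)) * \<bar>\<phi> (t - r) - \<psi> (t - r)\<bar> \<partial>\<nu>))" for t
  proof -
    have "\<bar>\<integral>r. g (\<phi> (t - r)) - g (\<psi> (t - r)) - p * (\<phi> (t - r) - \<psi> (t - r)) \<partial>\<nu>\<bar>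
        \<le> (\<integral>r. R * (exp (\<theta> * (t - r)) * \<bar>\<phi> (t - r) - \<psi> (t - r)\<bar>) \<partial>\<nu>)"
    proof (rule integral_abs_bound_integral)
      show "integrable \<nu> (\<lambda>r. g (\<phi> (t - r)) - g (\<psi> (t - r)) - p * (\<phi> (t - r) - \<psi> (t - r)))"
        using gphi_integrable[OF s1] gphi_integrable[OF s2] sol_shift_integrable[OF s1] sol_shift_integrable[OF s2] by simp
    qed (use int g_le in auto)
    then show ?thesis using f_le[of t] by (simp add: rem_def distrib_left)
  qed
  then show "\<exists>R\<ge>0. \<forall>t. \<bar>rem \<phi> \<psi> t\<bar> \<le> R * (exp (\<theta> * t) * \<bar>\<phi> t - \<psi> t\<bar> + (\<integral>r. exp (\<theta> * (t - r)) * \<bar>\<phi> (t - r) - \<psi> (t - r)\<bar> \<partial>\<nu>))"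
    using R0 by blast
qed

lemma rem_exp_bound:
  assumes s1: "sol \<phi> \<phi>'" and s2: "sol \<psi> \<psi>'" and z: "0 \<le> z"
    and C1: "\<And>t. \<phi> t \<le> C * exp (z * t)" and C2: "\<And>t. \<psi> t \<le> C * exp (z * t)"
    and th: "0 \<le> \<theta>" "\<theta> \<le> \<alpha> * z" and mom: "mom (\<theta> + z)"
  shows "\<exists>R. \<forall>t. \<bar>rem \<phi> \<psi> t\<bar> \<le> R * exp ((\<theta> + z) * t)"
proof -
  obtain R where R: "0 \<le> R" "\<And>t. \<bar>rem \<phi> \<psi> t\<bar> \<le> R * (exp (\<theta> * t) * \<bar>\<phi> t - \<psi> t\<bar> + (\<integral>r. exp (\<theta> * (t - r)) * \<bar>\<phi> (t - r) - \<psi> (t - r)\<bar> \<partial>\<nu>))"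
    using rem_bound(1)[OF assms] by blast
  have d: "exp (\<theta> * t) * \<bar>\<phi> t - \<psi> t\<bar> \<le> C * exp ((\<theta> + z) * t)" for t
  proof -
    have "\<bar>\<phi> t - \<psi> t\<bar> \<le> C * exp (z * t)" using C1[of t] C2[of t] sol_nonneg[OF s1, of t] sol_nonneg[OF s2, of t] by auto
    then have "exp (\<theta> * t) * \<bar>\<phi> t - \<psi> t\<bar> \<le> exp (\<theta> * t) * (C * exp (z * t))" by (intro mult_left_mono) auto
    then show ?thesis by (simp add: exp_add[symmetric] algebra_simps)
  qed
  have "\<bar>rem \<phi> \<psi> t\<bar> \<le> (R * (C + C * lap (\<theta> + z))) * exp ((\<theta> + z) * t)" for t
  proof -
    have "(\<integral>r. exp (\<theta> * (t - r)) * \<bar>\<phi> (t - r) - \<psi> (t - r)\<bar> \<partial>\<nu>) \<le> (\<integral>r. C * exp ((\<theta> + z) * t) * exp (- (\<theta> + z) * r) \<partial>\<nu>)"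
    proof (rule integral_mono[OF rem_bound(2)[OF assms]])
      show "integrable \<nu> (\<lambda>r. C * exp ((\<theta> + z) * t) * exp (- (\<theta> + z) * r))" using mom by (simp add: mom_def)
      show "exp (\<theta> * (t - r)) * \<bar>\<phi> (t - r) - \<psi> (t - r)\<bar> \<le> C * exp ((\<theta> + z) * t) * exp (- (\<theta> + z) * r)" for r
        using d[of "t - r"] by (simp add: exp_add[symmetric] algebra_simps)
    qed
    also have "\<dots> = C * exp ((\<theta> + z) * t) * lap (\<theta> + z)" by (simp add: lap_def)
    finally have "exp (\<theta> * t) * \<bar>\<phi> t - \<psi> t\<bar> + (\<integral>r. exp (\<theta> * (t - r)) * \<bar>\<phi> (t - r) - \<psi> (t - r)\<bar> \<partial>\<nu>)
        \<le> (C + C * lap (\<theta> + z)) * exp ((\<theta> + z) * t)" using d[of t] by (simp add: algebra_simps)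
    from mult_left_mono[OF this R(1)] R(2)[of t] show ?thesis by (simp add: mult.assoc)
  qed
  then show ?thesis by blast
qed

end

lemma (in finite_borel) tilt_first_moment:
  assumes "0 \<le> k" shows "(\<integral>r. r \<partial>tilt k z) = k * (\<integral>r. r * exp (- z * r) \<partial>\<nu>)"
proof -
  have "(\<integral>r. r \<partial>tilt k z) = (\<integral>r. k * exp (- z * r) * r \<partial>\<nu>)" by (rule tilt_integral[OF assms]) (intro continuous_intros)
  also have "\<dots> = (\<integral>r. k * (r * exp (- z * r)) \<partial>\<nu>)" by (intro Bochner_Integration.integral_cong) auto
  finally show ?thesis by simp
qed

context wave
begin

text \<open>The square of the bounded ratio \<open>(\<phi> - \<psi>) * exp (- lam * t)\<close> is subharmonic for the walk with increments
  distributed as \<open>tilt L lam\<close>; the criticality of \<open>lam\<close> cancels its drift.\<close>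

lemma bounded_ratio_imp_eq:
  assumes s1: "sol \<phi> \<phi>'" and s2: "sol \<psi> \<psi>'"
    and mom: "mom (lam - h)" "mom (lam + h)" and h: "0 < h" and lam: "0 < lam"
    and chiL: "lam\<^sup>2 - c * lam - m + L * lap lam \<le> 0"
    and crit: "2 * lam - c = L * (\<integral>r. r * exp (- lam * r) \<partial>\<nu>)"
    and bd: "\<And>t. \<bar>\<phi> t - \<psi> t\<bar> \<le> C * exp (lam * t)"
  shows "\<phi> t = \<psi> t"
proof -
  have L0: "0 \<le> L" using L_pos by simp
  interpret T: exp_moments "tilt L lam" h by (rule tilt_exp_moments[OF mom h L0])
  have mlam: "mom lam" by (rule mom_between[OF mom]) (use h in auto)
  have m1: "T.m1 = 2 * lam - c"
    unfolding T.m1_def tilt_first_moment[OF L0] using crit by simp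
  have \<kappa>: "measure (tilt L lam) UNIV = L * lap lam" by (rule tilt_measure[OF L0 mlam])
  define d where "d t = \<phi> t - \<psi> t" for t
  define d' where "d' t = \<phi>' t - \<psi>' t" for t
  define F where "F t = f (\<phi> t) - f (\<psi> t)" for t
  define G where "G t = N \<phi> t - N \<psi> t" for t
  have dd: "(d has_real_derivative d' t) (at t)" for t
    unfolding d_def[abs_def] d'_def by (intro DERIV_diff sol_DERIV[OF s1] sol_DERIV[OF s2])
  have dd': "(d' has_real_derivative c * d' t + F t - G t) (at t)" for t
    using DERIV_diff[OF sol_DERIV2[OF s1, of t] sol_DERIV2[OF s2, of t]]
    unfolding d'_def[abs_def] F_def G_def by (simp add: algebra_simps)
  define w where "w t = d t * exp (- lam * t)" for t
  define w' where "w' t = (d' t - lam * d t) * exp (- lam * t)" for t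
  define w'' where "w'' t = (F t - G t - (lam\<^sup>2 - c * lam) * d t) * exp (- lam * t) - (2 * lam - c) * w' t" for t
  have dw: "(w has_real_derivative w' t) (at t)" for t
    unfolding w_def[abs_def] w'_def by (auto intro!: derivative_eq_intros dd simp: algebra_simps)
  have dw': "(w' has_real_derivative w'' t) (at t)" for t
  proof -
    have "(w' has_real_derivative (c * d' t + F t - G t - lam * d' t) * exp (- lam * t)
        + (d' t - lam * d t) * (exp (- lam * t) * - lam)) (at t)"
      unfolding w'_def[abs_def] by (rule derivative_eq_intros dd dd' refl | simp)+
    moreover have "(c * d' t + F t - G t - lam * d' t) * exp (- lam * t) + (d' t - lam * d t) * (exp (- lam * t) * - lam) = w'' t"
      unfolding w''_def w'_def by (simp add: algebra_simps power2_eq_square)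
    ultimately show ?thesis by simp
  qed
  have w_bd: "\<bar>w t\<bar> \<le> C" for t
  proof -
    have "\<bar>d t\<bar> * exp (- lam * t) \<le> C * exp (lam * t) * exp (- lam * t)"
      using bd[of t] by (intro mult_right_mono) (auto simp: d_def)
    then show ?thesis by (simp add: w_def abs_mult mult.assoc exp_add[symmetric])
  qed
  have d_w: "d t = w t * exp (lam * t)" for t by (simp add: w_def mult.assoc exp_add[symmetric])
  define V where "V t = (w t)\<^sup>2" for t
  have dV: "(V has_real_derivative 2 * w t * w' t) (at t)" for t
    unfolding V_def[abs_def] by (auto intro!: derivative_eq_intros dw)
  have dV': "((\<lambda>t. 2 * w t * w' t) has_real_derivative 2 * (w' t)\<^sup>2 + 2 * w t * w'' t) (at t)" for t
    by (auto intro!: derivative_eq_intros dw dw' simp: power2_eq_square)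
  have V_bd: "\<bar>V t\<bar> \<le> C\<^sup>2" for t using power_mono[OF w_bd[of t], of 2] by (simp add: V_def)
  have sV: "slow V" by (rule slow_bounded[OF continuous_if_deriv[OF dV] V_bd])
  have intV: "integrable \<nu> (\<lambda>r. L * exp (- lam * r) * V (t - r))" for t
    using T.slow_shift_integrable[OF sV, of t]
    by (subst (asm) tilt_integrable[OF L0 continuous_on_shift[OF s1 continuous_if_deriv[OF dV]]])
  \<comment> \<open>By 2xy \<le> x^2 + y^2 the nonlocal term splits into a local part of mass
    \<open>L * lap lam\<close> and an average of \<open>V\<close>.\<close>
  have G_le: "2 * w t * exp (- lam * t) * G t \<le> L * lap lam * V t + (\<integral>r. V (t - r) \<partial>tilt L lam)" for t
  proof -
    have "2 * w t * exp (- lam * t) * G t = (\<integral>r. 2 * w t * exp (- lam * t) * (g (\<phi> (t - r)) - g (\<psi> (t - r))) \<partial>\<nu>)"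
      using gphi_integrable[OF s1] gphi_integrable[OF s2] by (simp add: G_def N_def)
    also have "\<dots> \<le> (\<integral>r. L * exp (- lam * r) * V t + L * exp (- lam * r) * V (t - r) \<partial>\<nu>)"
    proof (rule integral_mono)
      show "integrable \<nu> (\<lambda>r. 2 * w t * exp (- lam * t) * (g (\<phi> (t - r)) - g (\<psi> (t - r))))"
        using gphi_integrable[OF s1] gphi_integrable[OF s2] by simp
      show "integrable \<nu> (\<lambda>r. L * exp (- lam * r) * V t + L * exp (- lam * r) * V (t - r))"
        using mlam intV by (simp add: mom_def)
      fix r
      have "\<bar>g (\<phi> (t - r)) - g (\<psi> (t - r))\<bar> \<le> L * \<bar>d (t - r)\<bar>"
        using g_lip[OF sol_nonneg[OF s1] sol_nonneg[OF s2]] by (simp add: d_def)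
      then have "2 * \<bar>w t\<bar> * exp (- lam * t) * \<bar>g (\<phi> (t - r)) - g (\<psi> (t - r))\<bar> \<le> 2 * \<bar>w t\<bar> * exp (- lam * t) * (L * \<bar>d (t - r)\<bar>)"
        by (intro mult_left_mono) auto
      also have "\<dots> = L * exp (- lam * r) * (2 * \<bar>w t\<bar> * \<bar>w (t - r)\<bar>)"
      proof -
        have "exp (- lam * t) * exp (lam * (t - r)) = exp (- lam * r)" by (simp add: exp_add[symmetric] algebra_simps)
        then show ?thesis by (simp add: d_w abs_mult mult_ac)
      qed
      also have "\<dots> \<le> L * exp (- lam * r) * (V t + V (t - r))"
        using sum_squares_bound[of "\<bar>w t\<bar>" "\<bar>w (t - r)\<bar>"] L0 by (intro mult_left_mono) (auto simp: V_def)
      finally have "2 * \<bar>w t\<bar> * exp (- lam * t) * \<bar>g (\<phi> (t - r)) - g (\<psi> (t - r))\<bar> \<le> L * exp (- lam * r) * (V t + V (t - r))" .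
      moreover have "2 * w t * exp (- lam * t) * (g (\<phi> (t - r)) - g (\<psi> (t - r))) \<le> 2 * \<bar>w t\<bar> * exp (- lam * t) * \<bar>g (\<phi> (t - r)) - g (\<psi> (t - r))\<bar>"
        using abs_ge_self[of "2 * w t * exp (- lam * t) * (g (\<phi> (t - r)) - g (\<psi> (t - r)))"] by (simp add: abs_mult)
      ultimately show "2 * w t * exp (- lam * t) * (g (\<phi> (t - r)) - g (\<psi> (t - r))) \<le> L * exp (- lam * r) * V t + L * exp (- lam * r) * V (t - r)"
        unfolding distrib_left by linarith
    qed
    also have "\<dots> = L * lap lam * V t + (\<integral>r. L * exp (- lam * r) * V (t - r) \<partial>\<nu>)"
      using mlam intV by (simp add: mom_def lap_def)
    also have "(\<integral>r. L * exp (- lam * r) * V (t - r) \<partial>\<nu>) = (\<integral>r. V (t - r) \<partial>tilt L lam)"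
      by (rule tilt_integral[OF L0 continuous_on_shift[OF s1 continuous_if_deriv[OF dV]], symmetric])
    finally show ?thesis .
  qed
  \<comment> \<open>\<open>chiL\<close> absorbs the zero-order terms and a full
    \<open>2 * (w' t)\<^sup>2\<close> is left over, so equality in the subharmonic inequality will
    force \<open>w' = 0\<close>.\<close>
  have S_ge: "2 * (w' t)\<^sup>2 \<le> 2 * (w' t)\<^sup>2 + 2 * w t * w'' t + T.m1 * (2 * w t * w' t) - T.J V t" for t
  proof -
    have "m * (d t)\<^sup>2 \<le> F t * d t" unfolding F_def d_def by (rule f_slope[OF sol_nonneg[OF s1] sol_nonneg[OF s2]])
    then have "m * (d t)\<^sup>2 * (exp (- lam * t))\<^sup>2 \<le> F t * d t * (exp (- lam * t))\<^sup>2" by (intro mult_right_mono) auto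
    then have Fm: "m * V t \<le> w t * exp (- lam * t) * F t"
      by (simp add: V_def w_def power_mult_distrib power2_eq_square mult_ac)
    have "0 \<le> V t" by (simp add: V_def)
    then have "(lam\<^sup>2 - c * lam - m + L * lap lam) * V t \<le> 0" using chiL by (rule mult_nonpos_nonneg[rotated])
    moreover have "2 * w t * w'' t + T.m1 * (2 * w t * w' t) = 2 * (w t * exp (- lam * t) * F t) - 2 * w t * exp (- lam * t) * G t - 2 * (lam\<^sup>2 - c * lam) * V t"
      unfolding w''_def m1 V_def by (simp add: w_def algebra_simps power2_eq_square)
    ultimately show ?thesis
      using Fm G_le[of t] T.J_eq[OF sV, of t] \<kappa> by (simp add: algebra_simps)
  qed
  have "2 * (w' t)\<^sup>2 + 2 * w t * w'' t + T.m1 * (2 * w t * w' t) - T.J V t = 0" for t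
  proof (rule T.bounded_subharmonic[OF V_bd dV dV'])
    show "0 \<le> 2 * (w' t)\<^sup>2 + 2 * w t * w'' t + T.m1 * (2 * w t * w' t) - T.J V t" for t
      using S_ge[of t] zero_le_power2[of "w' t"] by linarith
  qed
  then have "w' t = 0" for t using S_ge[of t] zero_le_power2[of "w' t"] by simp
  then have const: "w t = w 0" for t using dw by (intro DERIV_isconst_all) (auto simp: allI)
  obtain M1 where M1: "\<And>t. \<phi> t \<le> M1" using sol_bounded[OF s1] by blast
  obtain M2 where M2: "\<And>t. \<psi> t \<le> M2" using sol_bounded[OF s2] by blast
  have d_bd: "\<bar>d t\<bar> \<le> max M1 M2" for t
    using M1[of t] M2[of t] sol_nonneg[OF s1, of t] sol_nonneg[OF s2, of t] by (auto simp: d_def abs_le_iff le_max_iff_disj)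
  have "w 0 = 0"
  proof (rule ccontr)
    assume nz: "w 0 \<noteq> 0"
    \<comment> \<open>At this point a constant nonzero \<open>w\<close> would make the difference
      exceed its bound, as exp x \<ge> 1 + x.\<close>
    define s where "s = max M1 M2 / \<bar>w 0\<bar> / lam"
    have "\<bar>w 0\<bar> * (1 + lam * s) \<le> \<bar>w 0\<bar> * exp (lam * s)"
      using exp_ge_add_one_self[of "lam * s"] by (intro mult_left_mono) auto
    also have "\<dots> = \<bar>d s\<bar>" using const[of s] by (simp add: d_w abs_mult)
    also have "\<dots> \<le> max M1 M2" by (rule d_bd)
    finally show False using nz lam by (simp add: s_def distrib_left)
  qed
  then show ?thesis using const[of t] d_w[of t] by (simp add: d_def)
qed

text \<open>In the gap between the two characteristic roots exponentials are strict supersolutions, so \<open>\<phi> - \<psi> = o(exp (lam1 * t))\<close>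
  is compared with \<open>A * exp (lam * t) + \<epsilon> * (exp (lam1 * t) + exp (lam2 * t))\<close>; the last term makes the small one
  strict.\<close>

lemma barrier:
  assumes s1: "sol \<phi> \<phi>'" and s2: "sol \<psi> \<psi>'"
    and z: "0 < z" and C1: "\<And>t. \<phi> t \<le> C * exp (z * t)" and C2: "\<And>t. \<psi> t \<le> C * exp (z * t)" "z \<le> lam1"
    and lam: "lam1 < lam" and root: "chi0 lam1 = 0" and neg: "\<And>y. lam1 < y \<Longrightarrow> y \<le> lam \<Longrightarrow> chi0 y < 0"
    and mom: "mom (lam + h)" and h: "0 < h"
    and lim: "((\<lambda>t. (\<phi> t - \<psi> t) * exp (- lam1 * t)) \<longlongrightarrow> 0) at_bot"
  shows "\<exists>C. \<forall>t. \<bar>\<phi> t - \<psi> t\<bar> \<le> C * exp (lam * t)"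
proof -
  \<comment> \<open>Limited by the Hoelder gain, by the moments available beyond \<open>lam\<close>,
    and by the width of the gap.\<close>
  define \<theta> where "\<theta> = min (\<alpha> * z) (min h (lam - lam1))"
  have th: "0 < \<theta>" "\<theta> \<le> \<alpha> * z" "\<theta> \<le> h" "\<theta> \<le> lam - lam1" using alpha z h lam by (auto simp: \<theta>_def)
  \<comment> \<open>Only half of \<open>\<theta>\<close> beyond the root: the remainder generated by
    \<open>exp (lam1 * t)\<close> has rate \<open>lam1 + \<theta>\<close>, smaller than
    \<open>exp (lam2 * t)\<close> by the factor \<open>exp (\<theta>/2 * t)\<close>.\<close>
  define lam2 where "lam2 = lam1 + \<theta> / 2"
  have l2: "lam1 < lam2" "lam2 \<le> lam" using th by (auto simp: lam2_def)
  have momy: "mom y" if "0 \<le> y" "y \<le> lam + h" for y by (rule mom_between[OF mom_0 mom that])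
  have m: "mom (\<theta> + z)" "mom (lam + \<theta>)" "mom (lam1 + \<theta>)" "mom (lam2 + \<theta>)" "mom lam" "mom lam1" "mom lam2"
    using th l2 z C2(2) lam by (auto intro!: momy simp: lam2_def)
  obtain R where R0: "0 \<le> R" and R: "\<And>t. \<bar>rem \<phi> \<psi> t\<bar> \<le> R * (exp (\<theta> * t) * \<bar>\<phi> t - \<psi> t\<bar> + (\<integral>r. exp (\<theta> * (t - r)) * \<bar>\<phi> (t - r) - \<psi> (t - r)\<bar> \<partial>\<nu>))"
    using rem_bound(1)[OF s1 s2 less_imp_le[OF z] C1 C2(1) less_imp_le[OF th(1)] th(2) m(1)] by blast
  note Rint = rem_bound(2)[OF s1 s2 less_imp_le[OF z] C1 C2(1) less_imp_le[OF th(1)] th(2) m(1)]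
  define k where "k y = R * (1 + lap (y + \<theta>))" for y
  have "((\<lambda>t. k lam * exp (\<theta> * t)) \<longlongrightarrow> 0) at_bot" by (rule exp_tendsto_0_at_bot[OF th(1)])
  from order_tendstoD(2)[OF this, of "- chi0 lam"] have ev1: "eventually (\<lambda>t. k lam * exp (\<theta> * t) < - chi0 lam) at_bot"
    using neg[of lam] lam by simp
  have "((\<lambda>t. k lam1 * exp (\<theta>/2 * t) + k lam2 * exp (\<theta> * t)) \<longlongrightarrow> 0 + 0) at_bot"
    by (intro tendsto_add exp_tendsto_0_at_bot) (use th in auto)
  from order_tendstoD(2)[OF this, of "- chi0 lam2"] have ev2: "eventually (\<lambda>t. k lam1 * exp (\<theta>/2 * t) + k lam2 * exp (\<theta> * t) < - chi0 lam2) at_bot"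
    using neg[of lam2] l2 by simp
  obtain T where T: "\<And>t. t \<le> T \<Longrightarrow> k lam * exp (\<theta> * t) < - chi0 lam \<and> k lam1 * exp (\<theta>/2 * t) + k lam2 * exp (\<theta> * t) < - chi0 lam2"
    using eventually_conj[OF ev1 ev2] unfolding eventually_at_bot_linorder by blast
  define d where "d t = \<phi> t - \<psi> t" for t
  define d' where "d' t = \<phi>' t - \<psi>' t" for t
  have dd: "(d has_real_derivative d' t) (at t)" for t
    unfolding d_def[abs_def] d'_def by (intro DERIV_diff sol_DERIV[OF s1] sol_DERIV[OF s2])
  have dd': "(d' has_real_derivative c * d' t + q * d t - p * (\<integral>r. d (t - r) \<partial>\<nu>) + rem \<phi> \<psi> t) (at t)" for t
    unfolding d_def d'_def[abs_def] by (rule diff_DERIV2[OF s1 s2])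
  have cd: "continuous_on UNIV d" by (rule continuous_if_deriv[OF dd])
  obtain M1 where M1: "0 < M1" "\<And>t. \<phi> t \<le> M1" using sol_bounded[OF s1] by blast
  obtain M2 where M2: "0 < M2" "\<And>t. \<psi> t \<le> M2" using sol_bounded[OF s2] by blast
  define M0 where "M0 = max M1 M2"
  have M0: "0 < M0" "\<bar>d t\<bar> \<le> M0" for t
    using M1(1) M1(2)[of t] M2(2)[of t] sol_nonneg[OF s1, of t] sol_nonneg[OF s2, of t]
    by (auto simp: M0_def d_def abs_le_iff le_max_iff_disj)
  have l1: "0 < lam1" using z C2(2) by linarith
  then have lpos: "0 < lam" using lam by linarith
  \<comment> \<open>Makes \<open>A * exp (lam * t)\<close> at least \<open>M0\<close> from
    \<open>T\<close> on, so the bound can fail only left of \<open>T\<close>, where the remainder is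
    small.\<close>
  define A where "A = M0 * exp (- lam * T)"
  have A: "0 < A" using M0 by (simp add: A_def)
  have right: "\<bar>d t\<bar> \<le> A * exp (lam * t)" if "T \<le> t" for t
  proof -
    have "M0 * 1 \<le> M0 * exp (lam * (t - T))" using that lpos M0 by (intro mult_left_mono) auto
    also have "\<dots> = A * exp (lam * t)" by (simp add: A_def exp_add[symmetric] algebra_simps)
    finally show ?thesis using M0(2)[of t] by linarith
  qed
  have eps: "\<bar>d t\<bar> \<le> A * exp (lam * t) + \<epsilon> * (exp (lam1 * t) + exp (lam2 * t))" if e: "0 < \<epsilon>" for \<epsilon> t
  proof (rule ccontr)
    define B where "B t = A * exp (lam * t) + \<epsilon> * (exp (lam1 * t) + exp (lam2 * t))" for t
    define B' where "B' t = A * (lam * exp (lam * t)) + \<epsilon> * (lam1 * exp (lam1 * t) + lam2 * exp (lam2 * t))" for t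
    define B'' where "B'' t = A * (lam\<^sup>2 * exp (lam * t)) + \<epsilon> * (lam1\<^sup>2 * exp (lam1 * t) + lam2\<^sup>2 * exp (lam2 * t))" for t
    assume "\<not> \<bar>d t\<bar> \<le> A * exp (lam * t) + \<epsilon> * (exp (lam1 * t) + exp (lam2 * t))"
    then have viol: "B t < \<bar>d t\<bar>" by (simp add: B_def)
    have Bpos: "0 < B t" for t unfolding B_def using A e by (intro add_pos_pos mult_pos_pos) auto
    have dB: "(B has_real_derivative B' t) (at t)" for t
      unfolding B_def[abs_def] B'_def by (auto intro!: derivative_eq_intros)
    have dB': "(B' has_real_derivative B'' t) (at t)" for t
      unfolding B'_def[abs_def] B''_def by (auto intro!: derivative_eq_intros simp: power2_eq_square)
    define r where "r t = \<bar>d t\<bar> / B t" for t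
    have rt: "1 < r t" using viol Bpos[of t] by (simp add: r_def pos_less_divide_eq)
    have rT: "r s \<le> 1" if "T \<le> s" for s
    proof -
      have "0 \<le> \<epsilon> * (exp (lam1 * s) + exp (lam2 * s))" using e by (intro mult_nonneg_nonneg add_nonneg_nonneg) auto
      then have "\<bar>d s\<bar> \<le> B s" using right[OF that] unfolding B_def by linarith
      then show ?thesis using Bpos[of s] by (simp add: r_def pos_divide_le_eq)
    qed
    have "((\<lambda>t. \<bar>(\<phi> t - \<psi> t) * exp (- lam1 * t)\<bar>) \<longlongrightarrow> \<bar>0\<bar>) at_bot" by (rule tendsto_rabs[OF lim])
    from order_tendstoD(2)[OF this, of \<epsilon>] obtain T' where T': "\<And>s. s \<le> T' \<Longrightarrow> \<bar>d s * exp (- lam1 * s)\<bar> < \<epsilon>"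
      using e unfolding eventually_at_bot_linorder d_def by auto
    have rT': "r s \<le> 1" if "s \<le> T'" for s
    proof -
      have "\<bar>d s\<bar> * exp (- lam1 * s) * exp (lam1 * s) \<le> \<epsilon> * exp (lam1 * s)"
        using T'[OF that] by (intro mult_right_mono) (auto simp: abs_mult)
      then have "\<bar>d s\<bar> \<le> \<epsilon> * exp (lam1 * s)" by (simp add: mult.assoc exp_add[symmetric])
      also have "\<dots> \<le> B s" unfolding B_def using A e by (simp add: distrib_left)
      finally show ?thesis using Bpos[of s] by (simp add: r_def pos_divide_le_eq)
    qed
    have cr: "continuous_on UNIV r" unfolding r_def[abs_def]
    proof (intro continuous_on_divide continuous_on_rabs cd continuous_if_deriv[OF dB] ballI)
      show "B s \<noteq> 0" for s using Bpos[of s] by simp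
    qed
    have small: "r s \<le> r t" if s: "max \<bar>T\<bar> \<bar>T'\<bar> < \<bar>s\<bar>" for s
    proof (cases "0 \<le> s")
      case True
      then have "T \<le> s" using s by linarith
      then show ?thesis using rT[of s] rt by linarith
    next
      case False
      then have "s \<le> T'" using s by linarith
      then show ?thesis using rT'[of s] rt by linarith
    qed
    \<comment> \<open>The quotient exceeds 1 somewhere, but neither right of \<open>T\<close> nor
      far to the left; so it attains its maximum, at a point left of \<open>T\<close>.\<close>
    obtain x where x: "\<And>y. r y \<le> r x" using attains_max_if_small_at_infinity[of r "max \<bar>T\<bar> \<bar>T'\<bar>" t] cr small by blast
    define mm where "mm = r x"
    have mm: "1 < mm" using x[of t] rt by (simp add: mm_def)
    have xT: "x < T" using rT[of x] mm by (force simp: mm_def)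
    have dom: "\<bar>d y\<bar> \<le> mm * B y" for y using x[of y] Bpos[of y] by (simp add: mm_def r_def pos_divide_le_eq)
    have touch: "\<bar>d x\<bar> = mm * B x" using Bpos[of x] by (simp add: mm_def r_def)
    \<comment> \<open>The sign of \<open>d\<close> at the touching point reduces the two-sided
      comparison to a single inequality.\<close>
    define s where "s = sgn (d x)"
    have s: "\<bar>s\<bar> \<le> 1" "s * d x = \<bar>d x\<bar>" by (auto simp: s_def sgn_if)
    have sd: "s * d y \<le> \<bar>d y\<bar>" for y
    proof -
      have "s * d y \<le> \<bar>s\<bar> * \<bar>d y\<bar>" using abs_ge_self[of "s * d y"] by (simp add: abs_mult)
      also have "\<dots> \<le> 1 * \<bar>d y\<bar>" using s(1) by (intro mult_right_mono) auto
      finally show ?thesis by simp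
    qed
    let ?F = "\<lambda>t. mm * B t - s * d t" and ?F' = "\<lambda>t. mm * B' t - s * d' t"
    have F: "(?F has_real_derivative ?F' t) (at t)" for t by (intro DERIV_diff DERIV_cmult dB dd)
    have F': "(?F' has_real_derivative mm * B'' x - s * (c * d' x + q * d x - p * (\<integral>r. d (x - r) \<partial>\<nu>) + rem \<phi> \<psi> x)) (at x)"
      by (intro DERIV_diff DERIV_cmult dB' dd')
    have loc: "?F x \<le> ?F y" for y using dom[of y] sd[of y] touch s(2) by simp
    have F'x: "?F' x = 0" and F''x: "0 \<le> mm * B'' x - s * (c * d' x + q * d x - p * (\<integral>r. d (x - r) \<partial>\<nu>) + rem \<phi> \<psi> x)"
      using local_min_second_derivative[OF zero_less_one loc F F'] by auto
    have exp_int: "integrable \<nu> (\<lambda>r. exp (y * (t - r)))" "(\<integral>r. exp (y * (t - r)) \<partial>\<nu>) = lap y * exp (y * t)" if "mom y" for y t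
    proof -
      have eq: "exp (y * (t - r)) = exp (y * t) * exp (- y * r)" for r by (simp add: exp_add[symmetric] algebra_simps)
      show "integrable \<nu> (\<lambda>r. exp (y * (t - r)))" unfolding eq using that by (simp add: mom_def)
      show "(\<integral>r. exp (y * (t - r)) \<partial>\<nu>) = lap y * exp (y * t)" unfolding eq by (simp add: lap_def)
    qed
    have intB: "integrable \<nu> (\<lambda>r. B (x - r))" unfolding B_def using exp_int(1) m by simp
    have B_conv: "(\<integral>r. B (x - r) \<partial>\<nu>) = A * (lap lam * exp (lam * x)) + \<epsilon> * (lap lam1 * exp (lam1 * x) + lap lam2 * exp (lam2 * x))"
      unfolding B_def using exp_int m by simp
    have int_d: "integrable \<nu> (\<lambda>r. d (x - r))"
      unfolding d_def using sol_shift_integrable[OF s1] sol_shift_integrable[OF s2] by simp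
    have conv_le: "s * (\<integral>r. d (x - r) \<partial>\<nu>) \<le> mm * (\<integral>r. B (x - r) \<partial>\<nu>)"
    proof -
      have "(\<integral>r. s * d (x - r) \<partial>\<nu>) \<le> (\<integral>r. mm * B (x - r) \<partial>\<nu>)"
        by (rule integral_mono) (use int_d intB order_trans[OF sd dom] in auto)
      then show ?thesis using int_d intB by simp
    qed
    define PB where "PB = A * (k lam * exp ((lam + \<theta>) * x)) + \<epsilon> * (k lam1 * exp ((lam1 + \<theta>) * x) + k lam2 * exp ((lam2 + \<theta>) * x))"
    have Bth: "exp (\<theta> * u) * B u = A * exp ((lam + \<theta>) * u) + \<epsilon> * (exp ((lam1 + \<theta>) * u) + exp ((lam2 + \<theta>) * u))" for u
      unfolding B_def by (simp add: exp_add[symmetric] algebra_simps)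
    have rem_le: "\<bar>rem \<phi> \<psi> x\<bar> \<le> mm * PB"
    proof -
      have "exp (\<theta> * u) * \<bar>d u\<bar> \<le> mm * (A * exp ((lam + \<theta>) * u) + \<epsilon> * (exp ((lam1 + \<theta>) * u) + exp ((lam2 + \<theta>) * u)))" for u
        using mult_left_mono[OF dom[of u], of "exp (\<theta> * u)"] Bth[of u] by (simp add: mult.left_commute)
      note dle = this
      have "(\<integral>r. exp (\<theta> * (x - r)) * \<bar>d (x - r)\<bar> \<partial>\<nu>) \<le>
         (\<integral>r. mm * (A * exp ((lam + \<theta>) * (x - r)) + \<epsilon> * (exp ((lam1 + \<theta>) * (x - r)) + exp ((lam2 + \<theta>) * (x - r)))) \<partial>\<nu>)"
        by (rule integral_mono) (use Rint[of x] dle exp_int(1) m in \<open>auto simp: d_def\<close>)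
      also have "\<dots> = mm * (A * (lap (lam + \<theta>) * exp ((lam + \<theta>) * x)) + \<epsilon> * (lap (lam1 + \<theta>) * exp ((lam1 + \<theta>) * x) + lap (lam2 + \<theta>) * exp ((lam2 + \<theta>) * x)))"
        using exp_int m by simp
      finally have "exp (\<theta> * x) * \<bar>d x\<bar> + (\<integral>r. exp (\<theta> * (x - r)) * \<bar>d (x - r)\<bar> \<partial>\<nu>) \<le>
          mm * (A * ((1 + lap (lam + \<theta>)) * exp ((lam + \<theta>) * x)) + \<epsilon> * ((1 + lap (lam1 + \<theta>)) * exp ((lam1 + \<theta>) * x) + (1 + lap (lam2 + \<theta>)) * exp ((lam2 + \<theta>) * x)))"
        using dle[of x] by (simp add: algebra_simps)
      from mult_left_mono[OF this R0] R[of x] show ?thesis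
        unfolding PB_def k_def d_def by (simp add: algebra_simps)
    qed
    have "s * rem \<phi> \<psi> x \<ge> - (mm * PB)"
    proof -
      have "\<bar>s * rem \<phi> \<psi> x\<bar> \<le> 1 * \<bar>rem \<phi> \<psi> x\<bar>" unfolding abs_mult using s(1) by (intro mult_right_mono) auto
      then show ?thesis using rem_le by linarith
    qed
    moreover have "mm * B'' x - s * (c * d' x + q * d x - p * (\<integral>r. d (x - r) \<partial>\<nu>) + rem \<phi> \<psi> x)
        = mm * (B'' x - c * B' x - q * B x) + p * (s * (\<integral>r. d (x - r) \<partial>\<nu>)) - s * rem \<phi> \<psi> x"
    proof -
      have "s * d' x = mm * B' x" "s * d x = mm * B x" using F'x touch s(2) by auto
      moreover have "s * (c * d' x + q * d x - p * (\<integral>r. d (x - r) \<partial>\<nu>) + rem \<phi> \<psi> x)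
          = c * (s * d' x) + q * (s * d x) - p * (s * (\<integral>r. d (x - r) \<partial>\<nu>)) + s * rem \<phi> \<psi> x"
        by (simp add: algebra_simps)
      ultimately show ?thesis by (simp add: algebra_simps)
    qed
    moreover have "p * (s * (\<integral>r. d (x - r) \<partial>\<nu>)) \<le> p * (mm * (\<integral>r. B (x - r) \<partial>\<nu>))"
      using conv_le p_pos by (intro mult_left_mono) auto
    ultimately have "0 \<le> mm * (B'' x - c * B' x - q * B x) + p * (mm * (\<integral>r. B (x - r) \<partial>\<nu>)) + mm * PB"
      using F''x by linarith
    also have "\<dots> = mm * (A * ((chi0 lam + k lam * exp (\<theta> * x)) * exp (lam * x))
        + \<epsilon> * (chi0 lam1 * exp (lam1 * x) + (chi0 lam2 + (k lam1 * exp (\<theta>/2 * x) + k lam2 * exp (\<theta> * x))) * exp (lam2 * x)))"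
    proof -
      have e1: "exp ((lam + \<theta>) * x) = exp (\<theta> * x) * exp (lam * x)" by (simp add: exp_add[symmetric] algebra_simps)
      have e2: "exp ((lam1 + \<theta>) * x) = exp (\<theta>/2 * x) * exp (lam2 * x)" by (simp add: exp_add[symmetric] lam2_def algebra_simps)
      have e3: "exp ((lam2 + \<theta>) * x) = exp (\<theta> * x) * exp (lam2 * x)" by (simp add: exp_add[symmetric] algebra_simps)
      show ?thesis unfolding B_conv PB_def e1 e2 e3 unfolding B_def B'_def B''_def chi0_def by (simp add: algebra_simps)
    qed
    \<comment> \<open>The root contributes nothing through \<open>chi0 lam1 = 0\<close>; the
      strictly negative \<open>chi0 lam2\<close> absorbs the remainder that the \<open>lam1\<close>
      term creates.\<close>
    also have "\<dots> < 0"
    proof -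
      have "(chi0 lam + k lam * exp (\<theta> * x)) * exp (lam * x) < 0"
        using T[of x] xT by (intro mult_neg_pos) auto
      then have 1: "A * ((chi0 lam + k lam * exp (\<theta> * x)) * exp (lam * x)) < 0" by (rule mult_pos_neg[OF A])
      have "(chi0 lam2 + (k lam1 * exp (\<theta>/2 * x) + k lam2 * exp (\<theta> * x))) * exp (lam2 * x) < 0"
        using T[of x] xT by (intro mult_neg_pos) auto
      from mult_pos_neg[OF e this] 1 have "A * ((chi0 lam + k lam * exp (\<theta> * x)) * exp (lam * x))
        + \<epsilon> * (chi0 lam1 * exp (lam1 * x) + (chi0 lam2 + (k lam1 * exp (\<theta>/2 * x) + k lam2 * exp (\<theta> * x))) * exp (lam2 * x)) < 0"
        unfolding root by simp
      then show ?thesis using mm by (intro mult_pos_neg) auto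
    qed
    finally show False by simp
  qed
  have "\<bar>d t\<bar> \<le> A * exp (lam * t)" for t
  proof (rule field_le_epsilon)
    fix e :: real assume e: "0 < e"
    let ?b = "exp (lam1 * t) + exp (lam2 * t)"
    have b: "0 < ?b" by (intro add_pos_pos) auto
    from eps[of "e / ?b" t] e b show "\<bar>d t\<bar> \<le> A * exp (lam * t) + e" by simp
  qed
  then show ?thesis unfolding d_def by blast
qed

end

lemma common_exp_bound:
  fixes X Y :: "real \<Rightarrow> real" and z :: real
  assumes "\<exists>A. \<forall>t. X t \<le> A * exp (z * t)" "\<exists>B. \<forall>t. Y t \<le> B * exp (z * t)"
  obtains C where "\<And>t. X t \<le> C * exp (z * t)" "\<And>t. Y t \<le> C * exp (z * t)"
proof -
  obtain A B where A: "\<And>t. X t \<le> A * exp (z * t)" and B: "\<And>t. Y t \<le> B * exp (z * t)" using assms by blast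
  have "A * exp (z * t) \<le> max A B * exp (z * t)" "B * exp (z * t) \<le> max A B * exp (z * t)" for t
    by (rule mult_right_mono, simp, simp)+
  then show ?thesis by (intro that[of "max A B"] order_trans[OF A] order_trans[OF B])
qed

section \<open>Ratios of profiles to a characteristic exponential\<close>

context wave
begin

text \<open>Using the exponent \<open>max 0 (lam - e)\<close> instead of \<open>lam\<close> costs a
  factor of at most \<open>exp (e * \<bar>t\<bar>)\<close>. Decay at \<open>lam\<close> itself is
  not assumed.\<close>

lemma slow_ratio:
  assumes s1: "sol \<phi> \<phi>'" and s2: "sol \<psi> \<psi>'" and lam: "0 < lam"
    and g1: "\<And>z. 0 \<le> z \<Longrightarrow> z < lam \<Longrightarrow> \<exists>C. \<forall>t. \<phi> t \<le> C * exp (z * t)"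
    and g2: "\<And>z. 0 \<le> z \<Longrightarrow> z < lam \<Longrightarrow> \<exists>C. \<forall>t. \<psi> t \<le> C * exp (z * t)"
  shows "slow (\<lambda>t. (\<phi> t - \<psi> t) * exp (- lam * t))"
  unfolding slow_def
proof (intro conjI allI impI)
  show "continuous_on UNIV (\<lambda>t. (\<phi> t - \<psi> t) * exp (- lam * t))"
    by (intro continuous_intros sol_cont[OF s1] sol_cont[OF s2])
  fix e :: real assume e: "0 < e"
  define z where "z = max 0 (lam - e)"
  have z: "0 \<le> z" "z < lam" "lam - z \<le> e" using e lam by (auto simp: z_def)
  obtain A where A: "\<And>t. \<phi> t \<le> A * exp (z * t)" using g1[OF z(1,2)] by blast
  obtain B where B: "\<And>t. \<psi> t \<le> B * exp (z * t)" using g2[OF z(1,2)] by blast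
  have AB: "0 \<le> A" "0 \<le> B" using A[of 0] B[of 0] sol_nonneg[OF s1, of 0] sol_nonneg[OF s2, of 0] by auto
  have "\<bar>(\<phi> t - \<psi> t) * exp (- lam * t)\<bar> \<le> (A + B) * exp (e * \<bar>t\<bar>)" for t
  proof -
    have "\<bar>\<phi> t - \<psi> t\<bar> \<le> \<phi> t + \<psi> t" using sol_nonneg[OF s1, of t] sol_nonneg[OF s2, of t] by auto
    also have "\<dots> \<le> (A + B) * exp (z * t)" using A[of t] B[of t] by (simp add: distrib_right)
    finally have "\<bar>\<phi> t - \<psi> t\<bar> * exp (- lam * t) \<le> (A + B) * exp (z * t) * exp (- lam * t)"
      by (intro mult_right_mono) auto
    also have "\<dots> = (A + B) * exp (- ((lam - z) * t))" by (simp add: exp_add[symmetric] algebra_simps)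
    also have "\<dots> \<le> (A + B) * exp (e * \<bar>t\<bar>)"
    proof (intro mult_left_mono iffD2[OF exp_le_cancel_iff])
      have "- ((lam - z) * t) \<le> (lam - z) * \<bar>t\<bar>" using abs_ge_self[of "- ((lam - z) * t)"] z by (simp add: abs_mult)
      also have "\<dots> \<le> e * \<bar>t\<bar>" using z by (intro mult_right_mono) auto
      finally show "- ((lam - z) * t) \<le> e * \<bar>t\<bar>" .
    qed (use AB in auto)
    finally show ?thesis by (simp add: abs_mult)
  qed
  then show "\<exists>C. \<forall>t. \<bar>(\<phi> t - \<psi> t) * exp (- lam * t)\<bar> \<le> C * exp (e * \<bar>t\<bar>)" by blast
qed

text \<open>The remainder beats \<open>exp (lam * t)\<close> although the profiles are not known to
  be bounded by it: the Hoelder gain at a slightly smaller exponent outweighs the loss.\<close>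

lemma rem_ratio:
  assumes s1: "sol \<phi> \<phi>'" and s2: "sol \<psi> \<psi>'" and lam: "0 < lam"
    and g1: "\<And>z. 0 \<le> z \<Longrightarrow> z < lam \<Longrightarrow> \<exists>C. \<forall>t. \<phi> t \<le> C * exp (z * t)"
    and g2: "\<And>z. 0 \<le> z \<Longrightarrow> z < lam \<Longrightarrow> \<exists>C. \<forall>t. \<psi> t \<le> C * exp (z * t)"
    and mom: "mom (lam + h)" and h: "0 < h"
  shows "\<exists>R \<eta>. 0 < \<eta> \<and> (\<forall>t. \<bar>rem \<phi> \<psi> t * exp (- lam * t)\<bar> \<le> R * exp (\<eta> * t))"
proof -
  \<comment> \<open>Starting from \<open>lam - \<eta>\<close>, reaching \<open>lam + \<eta>\<close>
    takes a gain of \<open>2 * \<eta>\<close>, of which \<open>\<alpha> * (lam - \<eta>)\<close> is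
    available; solving for \<open>\<eta>\<close> gives the second entry.\<close>
  define \<eta> where "\<eta> = min h (\<alpha> * lam / (2 + \<alpha>))"
  have eta: "0 < \<eta>" "\<eta> \<le> h" using h lam alpha by (auto simp: \<eta>_def)
  have "\<eta> \<le> \<alpha> * lam / (2 + \<alpha>)" by (simp add: \<eta>_def)
  then have th: "2 * \<eta> \<le> \<alpha> * (lam - \<eta>)" using alpha by (simp add: pos_le_divide_eq algebra_simps)
  have "0 < \<alpha> * (lam - \<eta>)" using th eta by linarith
  then have zp: "0 \<le> lam - \<eta>" "lam - \<eta> < lam" using alpha eta by (auto simp: zero_less_mult_iff)
  obtain A where A': "\<And>t. \<phi> t \<le> A * exp ((lam - \<eta>) * t)" and B': "\<And>t. \<psi> t \<le> A * exp ((lam - \<eta>) * t)"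
    using common_exp_bound[OF g1[OF zp] g2[OF zp]] by blast
  have sum: "2 * \<eta> + (lam - \<eta>) = lam + \<eta>" by simp
  have "mom (2 * \<eta> + (lam - \<eta>))" unfolding sum by (rule mom_between[OF mom_0 mom]) (use lam eta in auto)
  from rem_exp_bound[OF s1 s2 zp(1) A' B' _ th this] eta obtain R where
    R: "\<And>t. \<bar>rem \<phi> \<psi> t\<bar> \<le> R * exp ((lam + \<eta>) * t)" unfolding sum by auto
  have "\<bar>rem \<phi> \<psi> t * exp (- lam * t)\<bar> \<le> R * exp (\<eta> * t)" for t
  proof -
    have "\<bar>rem \<phi> \<psi> t\<bar> * exp (- lam * t) \<le> R * exp ((lam + \<eta>) * t) * exp (- lam * t)"
      using R by (intro mult_right_mono) auto
    also have "\<dots> = R * exp (\<eta> * t)" by (simp add: exp_add[symmetric] algebra_simps)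
    finally show ?thesis by (simp add: abs_mult)
  qed
  then show ?thesis using eta by blast
qed

lemma ratio_DERIV:
  assumes s1: "sol \<phi> \<phi>'" and s2: "sol \<psi> \<psi>'"
  shows "((\<lambda>t. (\<phi> t - \<psi> t) * exp (- lam * t)) has_real_derivative
      (\<phi>' t - \<psi>' t - lam * (\<phi> t - \<psi> t)) * exp (- lam * t)) (at t)"
  by (auto intro!: derivative_eq_intros sol_DERIV[OF s1] sol_DERIV[OF s2] simp: algebra_simps)

text \<open>At a root, \<open>q - lam\<^sup>2 + c * lam\<close> equals the total mass
  \<open>p * lap lam\<close> of the tilted measure, so the zero-order term and the convolution
  combine into \<open>J\<close>.\<close>

lemma ratio_DERIV2:
  assumes s1: "sol \<phi> \<phi>'" and s2: "sol \<psi> \<psi>'" and root: "chi0 lam = 0" and mlam: "mom lam"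
    and T: "exp_moments (tilt p lam) h" and slow: "slow (\<lambda>t. (\<phi> t - \<psi> t) * exp (- lam * t))"
  shows "((\<lambda>t. (\<phi>' t - \<psi>' t - lam * (\<phi> t - \<psi> t)) * exp (- lam * t)) has_real_derivative
      exp_moments.J (tilt p lam) (\<lambda>t. (\<phi> t - \<psi> t) * exp (- lam * t)) t
      - (2 * lam - c) * ((\<phi>' t - \<psi>' t - lam * (\<phi> t - \<psi> t)) * exp (- lam * t))
      + rem \<phi> \<psi> t * exp (- lam * t)) (at t)"
proof -
  interpret T: exp_moments "tilt p lam" h by (rule T)
  have p0: "0 \<le> p" using p_pos by simp
  let ?w = "\<lambda>t. (\<phi> t - \<psi> t) * exp (- lam * t)"
  let ?c = "\<integral>r. \<phi> (t - r) - \<psi> (t - r) \<partial>\<nu>"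
  have cw: "continuous_on UNIV ?w" by (rule slow_continuous[OF slow])
  have "(\<integral>r. ?w (t - r) \<partial>tilt p lam) = (\<integral>r. p * exp (- lam * r) * ?w (t - r) \<partial>\<nu>)"
    by (rule tilt_integral[OF p0 continuous_on_shift[OF s1 cw]])
  also have "\<dots> = (\<integral>r. (p * exp (- lam * t)) * (\<phi> (t - r) - \<psi> (t - r)) \<partial>\<nu>)"
  proof (intro Bochner_Integration.integral_cong refl)
    fix r
    have "exp (- lam * r) * exp (- lam * (t - r)) = exp (- lam * t)" by (simp add: exp_add[symmetric] algebra_simps)
    then show "p * exp (- lam * r) * ?w (t - r) = (p * exp (- lam * t)) * (\<phi> (t - r) - \<psi> (t - r))"
      by (simp add: mult_ac)
  qed
  also have "\<dots> = p * exp (- lam * t) * ?c" by simp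
  finally have conv: "(\<integral>r. ?w (t - r) \<partial>tilt p lam) = p * exp (- lam * t) * ?c" .
  have "T.J ?w t = p * lap lam * ?w t - p * exp (- lam * t) * ?c"
    unfolding T.J_eq[OF slow] tilt_measure[OF p0 mlam] conv ..
  moreover have "p * lap lam = q - lam\<^sup>2 + c * lam" using root unfolding chi0_def by linarith
  ultimately have J: "T.J ?w t = (q - lam\<^sup>2 + c * lam) * ?w t - p * exp (- lam * t) * ?c" by simp
  have "((\<lambda>t. (\<phi>' t - \<psi>' t - lam * (\<phi> t - \<psi> t)) * exp (- lam * t)) has_real_derivative
     ((c * (\<phi>' t - \<psi>' t) + q * (\<phi> t - \<psi> t) - p * ?c + rem \<phi> \<psi> t) - lam * (\<phi>' t - \<psi>' t)) * exp (- lam * t)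
      + (\<phi>' t - \<psi>' t - lam * (\<phi> t - \<psi> t)) * (exp (- lam * t) * - lam)) (at t)"
    by (rule derivative_eq_intros diff_DERIV2[OF s1 s2] sol_DERIV[OF s1] sol_DERIV[OF s2] refl | simp)+
  moreover have "((c * (\<phi>' t - \<psi>' t) + q * (\<phi> t - \<psi> t) - p * ?c + rem \<phi> \<psi> t) - lam * (\<phi>' t - \<psi>' t)) * exp (- lam * t)
      + (\<phi>' t - \<psi>' t - lam * (\<phi> t - \<psi> t)) * (exp (- lam * t) * - lam)
     = T.J ?w t - (2 * lam - c) * ((\<phi>' t - \<psi>' t - lam * (\<phi> t - \<psi> t)) * exp (- lam * t)) + rem \<phi> \<psi> t * exp (- lam * t)"
    unfolding J by (simp add: algebra_simps power2_eq_square)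
  ultimately show ?thesis by simp
qed

text \<open>The limit controls the ratio far to the left; elsewhere boundedness of the profiles
  suffices, since \<open>lam\<close> is positive.\<close>

lemma bounded_ratio:
  assumes s1: "sol \<phi> \<phi>'" and s2: "sol \<psi> \<psi>'" and lam: "0 < lam"
    and lim: "((\<lambda>t. (\<phi> t - \<psi> t) * exp (- lam * t)) \<longlongrightarrow> b) at_bot"
  shows "\<exists>C. \<forall>t. \<bar>\<phi> t - \<psi> t\<bar> \<le> C * exp (lam * t)"
proof -
  have "((\<lambda>t. \<bar>(\<phi> t - \<psi> t) * exp (- lam * t)\<bar>) \<longlongrightarrow> \<bar>b\<bar>) at_bot" by (rule tendsto_rabs[OF lim])
  from order_tendstoD(2)[OF this, of "\<bar>b\<bar> + 1"] obtain T where
    T: "\<And>t. t \<le> T \<Longrightarrow> \<bar>(\<phi> t - \<psi> t) * exp (- lam * t)\<bar> < \<bar>b\<bar> + 1"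
    unfolding eventually_at_bot_linorder by auto
  obtain M1 where M1: "0 < M1" "\<And>t. \<phi> t \<le> M1" using sol_bounded[OF s1] by blast
  obtain M2 where M2: "0 < M2" "\<And>t. \<psi> t \<le> M2" using sol_bounded[OF s2] by blast
  have d: "\<bar>\<phi> t - \<psi> t\<bar> \<le> M1 + M2" for t
    using M1(1) M1(2)[of t] M2(1) M2(2)[of t] sol_nonneg[OF s1, of t] sol_nonneg[OF s2, of t] by (simp add: abs_le_iff)
  have "\<bar>\<phi> t - \<psi> t\<bar> \<le> ((\<bar>b\<bar> + 1) + (M1 + M2) * exp (- lam * T)) * exp (lam * t)" for t
  proof (cases "t \<le> T")
    case True
    have "\<bar>\<phi> t - \<psi> t\<bar> * exp (- lam * t) * exp (lam * t) \<le> (\<bar>b\<bar> + 1) * exp (lam * t)"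
      using T[OF True] by (intro mult_right_mono) (auto simp: abs_mult)
    then have "\<bar>\<phi> t - \<psi> t\<bar> \<le> (\<bar>b\<bar> + 1) * exp (lam * t)" by (simp add: mult.assoc exp_add[symmetric])
    moreover have "0 \<le> (M1 + M2) * exp (- lam * T) * exp (lam * t)" using M1 M2 by simp
    ultimately show ?thesis by (simp add: distrib_right)
  next
    case False
    have "(M1 + M2) * 1 \<le> (M1 + M2) * exp (lam * (t - T))" using False lam M1 M2 by (intro mult_left_mono) auto
    also have "\<dots> = (M1 + M2) * exp (- lam * T) * exp (lam * t)" by (simp add: exp_add[symmetric] algebra_simps)
    finally have "\<bar>\<phi> t - \<psi> t\<bar> \<le> (M1 + M2) * exp (- lam * T) * exp (lam * t)" using d[of t] by simp
    moreover have "0 \<le> (\<bar>b\<bar> + 1) * exp (lam * t)" by simp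
    ultimately show ?thesis unfolding distrib_right[of "\<bar>b\<bar> + 1"] by linarith
  qed
  then show ?thesis by blast
qed

lemma shift_ratio: "\<psi> (t + s) * exp (- lam * t) = exp (lam * s) * (\<psi> (t + s) * exp (- lam * (t + s)))" for \<psi> :: "real \<Rightarrow> real" and lam s t :: real
  by (simp add: exp_add[symmetric] algebra_simps)

text \<open>\<open>slope\<close> says that the derivative of \<open>chi0\<close> at
  \<open>lam\<close> is not zero, which is the condition \<open>a \<noteq> m1\<close> for the tilted
  measure. The zero solution serves as the second profile.\<close>

lemma strict_ratio_limit:
  assumes s1: "sol \<phi> \<phi>'" and lam: "0 < lam" and root: "chi0 lam = 0"
    and mom: "mom (lam - h)" "mom (lam + h)" and h: "0 < h"
    and g1: "\<And>z. 0 \<le> z \<Longrightarrow> z < lam \<Longrightarrow> \<exists>C. \<forall>t. \<phi> t \<le> C * exp (z * t)"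
    and slope: "2 * lam - c \<noteq> p * (\<integral>r. r * exp (- lam * r) \<partial>\<nu>)"
  shows "\<exists>b. ((\<lambda>t. \<phi> t * exp (- lam * t)) \<longlongrightarrow> b) at_bot"
proof -
  have p0: "0 \<le> p" using p_pos by simp
  have mlam: "mom lam" by (rule mom_between[OF mom]) (use h in auto)
  have T: "exp_moments (tilt p lam) h" by (rule tilt_exp_moments[OF mom h p0])
  interpret T: exp_moments "tilt p lam" h by (rule T)
  have g2: "\<And>z. 0 \<le> z \<Longrightarrow> z < lam \<Longrightarrow> \<exists>C. \<forall>t. (\<lambda>_. 0) t \<le> C * exp (z * t)" by (intro exI[of _ 0]) auto
  have slow: "slow (\<lambda>t. (\<phi> t - 0) * exp (- lam * t))" by (rule slow_ratio[OF s1 sol_zero lam g1 g2])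
  obtain R \<eta> where eta: "0 < \<eta>" and R: "\<And>t. \<bar>rem \<phi> (\<lambda>_. 0) t * exp (- lam * t)\<bar> \<le> R * exp (\<eta> * t)"
    using rem_ratio[OF s1 sol_zero lam g1 g2 mom(2) h] by blast
  have "\<exists>b. ((\<lambda>t. (\<phi> t - 0) * exp (- lam * t)) \<longlongrightarrow> b) at_bot"
  proof (rule T.strict_limit[OF _ slow ratio_DERIV[OF s1 sol_zero] ratio_DERIV2[OF s1 sol_zero root mlam T slow] eta R])
    show "0 < measure (tilt p lam) UNIV"
      unfolding tilt_measure[OF p0 mlam] using p_pos lap_pos[OF mlam measure_pos] by simp
    show "2 * lam - c \<noteq> T.m1" using slope by (simp add: T.m1_def tilt_first_moment[OF p0])
  qed
  then show ?thesis by simp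
qed

text \<open>The subharmonic comparison works at \<open>lam\<close>, while the asymptotics live at
  the smaller root \<open>l1\<close>; the barrier bridges the gap once the coefficients of
  \<open>exp (l1 * t)\<close> agree.\<close>

lemma unique_strict:
  assumes s1: "sol \<phi> \<phi>'" and s2: "sol \<psi> \<psi>'" and p1: "\<And>t. 0 < \<phi> t" and p2: "\<And>t. 0 < \<psi> t"
    and mom: "mom (lam - h)" "mom (lam + h)" and h: "0 < h" and lam: "0 < lam"
    and chiL: "lam\<^sup>2 - c * lam - m + L * lap lam \<le> 0"
    and crit: "2 * lam - c = L * (\<integral>r. r * exp (- lam * r) \<partial>\<nu>)"
    and neg: "chi0 lam < 0"
  shows "\<exists>s. \<forall>t. \<psi> t = \<phi> (t + s)"
proof -
  have mlam: "mom lam" by (rule mom_between[OF mom]) (use h in auto)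
  have "continuous_on {0..lam} chi0"
    unfolding chi0_def[abs_def] by (intro continuous_intros continuous_on_lap mom_0 mlam)
  moreover have chi00: "0 < chi0 0" using qp by (simp add: chi0_def lap_0 mass)
  ultimately obtain l1 where l1: "0 \<le> l1" "l1 \<le> lam" "chi0 l1 = 0"
    using IVT2'[of chi0 lam 0 0] neg lam by auto
  have l1': "0 < l1" "l1 < lam" using l1 chi00 neg by (auto simp: less_le)
  define e where "e = min l1 (lam - l1)"
  have e: "0 < e" using l1' by (simp add: e_def)
  have momy: "mom y" if "0 \<le> y" "y \<le> lam + h" for y by (rule mom_between[OF mom_0 mom(2) that])
  have me: "mom (l1 - e)" "mom (l1 + e)" using l1' h by (auto intro!: momy simp: e_def)
  have ml1: "mom l1" using l1' h by (intro momy) auto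
  \<comment> \<open>The derivative of \<open>chi0\<close> at \<open>l1\<close>. It is negative
    because \<open>chi0\<close> is convex, vanishes at \<open>l1\<close> and is negative at
    \<open>lam\<close>.\<close>
  define sl where "sl = 2 * l1 - c - p * (\<integral>r. r * exp (- l1 * r) \<partial>\<nu>)"
  have tangent: "(y - l1)\<^sup>2 + sl * (y - l1) \<le> chi0 y" if "mom y" for y
  proof -
    have "p * (lap l1 - (y - l1) * (\<integral>r. r * exp (- l1 * r) \<partial>\<nu>)) \<le> p * lap y"
      using lap_tangent[OF that ml1 first_moment[OF me e]] p_pos by (intro mult_left_mono) auto
    then show ?thesis using l1(3) by (simp add: chi0_def sl_def power2_eq_square algebra_simps)
  qed
  have "(lam - l1)\<^sup>2 + sl * (lam - l1) < 0" using tangent[OF mlam] neg by linarith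
  then have "sl * (lam - l1) < 0" using zero_le_power2[of "lam - l1"] by linarith
  then have sl: "sl < 0" using l1' by (simp add: mult_less_0_iff)
  have pos_below: "\<not> mom y \<or> 0 < chi0 y" if "0 \<le> y" "y < l1" for y
  proof -
    have my: "mom y" using that l1' h by (intro momy) auto
    have "0 < sl * (y - l1)" using sl that by (intro mult_neg_neg) auto
    then show ?thesis using tangent[OF my] zero_le_power2[of "y - l1"] by linarith
  qed
  have neg_above: "chi0 y < 0" if y: "l1 < y" "y \<le> lam" for y
  proof -
    define D where "D = (\<integral>r. r * exp (- y * r) \<partial>\<nu>)"
    have my: "mom y" using y l1' h by (intro momy) auto
    have ey: "0 < min y h" "mom (y - min y h)" "mom (y + min y h)" using y l1' h by (auto intro!: momy)
    note tl = lap_tangent[OF _ my first_moment[OF ey(2,3,1)], folded D_def]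
    \<comment> \<open>The slope of \<open>chi0\<close> at \<open>y\<close>. If it is nonnegative,
      the tangent at \<open>y\<close> bounds \<open>chi0 y\<close> by the value at
      \<open>lam\<close>, otherwise by the value at \<open>l1\<close>.\<close>
    define S where "S = 2 * y - c - p * D"
    have t1: "(l1 - y)\<^sup>2 + S * (l1 - y) + chi0 y \<le> chi0 l1" "(lam - y)\<^sup>2 + S * (lam - y) + chi0 y \<le> chi0 lam"
      using mult_left_mono[OF tl[OF ml1], of p] mult_left_mono[OF tl[OF mlam], of p] p_pos
      by (simp_all add: chi0_def S_def power2_eq_square algebra_simps)
    show ?thesis
    proof (cases "S \<ge> 0")
      case True
      then have "0 \<le> S * (lam - y)" using y by (intro mult_nonneg_nonneg) auto
      then show ?thesis using t1(2) neg zero_le_power2[of "lam - y"] by linarith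
    next
      case False
      then have "0 < S * (l1 - y)" using y by (intro mult_neg_neg) auto
      then show ?thesis using t1(1) l1(3) zero_le_power2[of "l1 - y"] by linarith
    qed
  qed
  have g: "\<exists>C. \<forall>t. X t \<le> C * exp (z * t)" if "sol X X'" "\<And>t. 0 < X t" "0 \<le> z" "z < l1" for X X' z
    using decays_below[OF that(1,2) pos_below that(3,4)] by (simp add: decays_def[OF that(1,2)])
  have slope: "2 * l1 - c \<noteq> p * (\<integral>r. r * exp (- l1 * r) \<partial>\<nu>)" using sl by (simp add: sl_def)
  have bar: "\<exists>C. \<forall>t. \<bar>X t - Y t\<bar> \<le> C * exp (lam * t)"
    if X: "sol X X'" and Y: "sol Y Y'" and gX: "\<And>z. 0 \<le> z \<Longrightarrow> z < l1 \<Longrightarrow> \<exists>C. \<forall>t. X t \<le> C * exp (z * t)"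
      and gY: "\<And>z. 0 \<le> z \<Longrightarrow> z < l1 \<Longrightarrow> \<exists>C. \<forall>t. Y t \<le> C * exp (z * t)"
      and lim: "((\<lambda>t. (X t - Y t) * exp (- l1 * t)) \<longlongrightarrow> 0) at_bot" for X X' Y Y'
  proof -
    have z: "0 \<le> l1 / 2" "l1 / 2 < l1" using l1' by auto
    obtain A where A': "\<And>t. X t \<le> A * exp (l1 / 2 * t)" and B': "\<And>t. Y t \<le> A * exp (l1 / 2 * t)"
      using common_exp_bound[OF gX[OF z] gY[OF z]] by blast
    show ?thesis
      by (rule barrier[OF X Y _ A' B' _ l1'(2) l1(3) neg_above mom(2) h lim]) (use l1' in auto)
  qed
  have lim_pos: "\<exists>b>0. ((\<lambda>t. X t * exp (- l1 * t)) \<longlongrightarrow> b) at_bot" if X: "sol X X'" and pX: "\<And>t. 0 < X t" for X X'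
  proof -
    obtain b where b: "((\<lambda>t. X t * exp (- l1 * t)) \<longlongrightarrow> b) at_bot"
      using strict_ratio_limit[OF X l1'(1) l1(3) me e g[OF X pX] slope] by blast
    have "0 \<le> b" by (rule tendsto_lowerbound[OF b]) (use less_imp_le[OF pX] in \<open>auto intro!: always_eventually\<close>)
    \<comment> \<open>With a vanishing coefficient the barrier applies to the pair formed by the
      profile and 0.\<close>
    moreover have "b \<noteq> 0"
    proof
      assume "b = 0"
      then have 0: "((\<lambda>t. (X t - 0) * exp (- l1 * t)) \<longlongrightarrow> 0) at_bot" using b by simp
      have gz: "\<And>z. 0 \<le> z \<Longrightarrow> z < l1 \<Longrightarrow> \<exists>C. \<forall>t. (\<lambda>_. 0) t \<le> C * exp (z * t)" by (intro exI[of _ 0]) auto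
      from bar[OF X sol_zero g[OF X pX] gz 0] obtain C where "\<And>t. \<bar>X t - 0\<bar> \<le> C * exp (lam * t)" by blast
      from bounded_ratio_imp_eq[OF X sol_zero mom h lam chiL crit this] pX show False by (metis less_irrefl)
    qed
    ultimately show ?thesis using b by (intro exI[of _ b]) auto
  qed
  obtain b1 where b1: "0 < b1" "((\<lambda>t. \<phi> t * exp (- l1 * t)) \<longlongrightarrow> b1) at_bot" using lim_pos[OF s1 p1] by blast
  obtain b2 where b2: "0 < b2" "((\<lambda>t. \<psi> t * exp (- l1 * t)) \<longlongrightarrow> b2) at_bot" using lim_pos[OF s2 p2] by blast
  \<comment> \<open>Translation by \<open>s\<close> multiplies the coefficient of
    \<open>exp (l1 * t)\<close> by \<open>exp (l1 * s)\<close>.\<close>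
  define s where "s = ln (b2 / b1) / l1"
  have es: "exp (l1 * s) * b1 = b2" using l1' b1 b2 by (simp add: s_def)
  note ss = sol_shift[OF s1, of s]
  have "((\<lambda>t. exp (l1 * s) * (\<phi> (t + s) * exp (- l1 * (t + s)))) \<longlongrightarrow> exp (l1 * s) * b1) at_bot"
    by (intro tendsto_mult tendsto_const filterlim_compose[OF b1(2) filterlim_shift_at_bot])
  then have "((\<lambda>t. \<phi> (t + s) * exp (- l1 * t)) \<longlongrightarrow> b2) at_bot" unfolding shift_ratio[of \<phi>] es .
  from tendsto_diff[OF b2(2) this] have lim0: "((\<lambda>t. (\<psi> t - \<phi> (t + s)) * exp (- l1 * t)) \<longlongrightarrow> 0) at_bot"
    by (simp add: left_diff_distrib)
  obtain C where C: "\<And>t. \<bar>\<psi> t - \<phi> (t + s)\<bar> \<le> C * exp (lam * t)"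
    using bar[OF s2 ss g[OF s2 p2] g[OF ss p1] lim0] by blast
  from bounded_ratio_imp_eq[OF s2 ss mom h lam chiL crit C] show ?thesis by blast
qed

end

context wave
begin

text \<open>At a double root, \<open>\<beta> = 0\<close> would make \<open>\<phi> * exp (- lam * t)\<close> bounded, which is excluded by comparison with 0. A
  translation multiplies \<open>\<beta>\<close> by a positive factor, hence can equalise two negative values.\<close>

lemma unique_critical:
  assumes s1: "sol \<phi> \<phi>'" and s2: "sol \<psi> \<psi>'" and p1: "\<And>t. 0 < \<phi> t" and p2: "\<And>t. 0 < \<psi> t"
    and mom: "mom (lam - h)" "mom (lam + h)" and h: "0 < h" and lam: "0 < lam"
    and chiL: "lam\<^sup>2 - c * lam - m + L * lap lam \<le> 0"
    and crit: "2 * lam - c = L * (\<integral>r. r * exp (- lam * r) \<partial>\<nu>)"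
    and root: "chi0 lam = 0" and critp: "2 * lam - c = p * (\<integral>r. r * exp (- lam * r) \<partial>\<nu>)"
  shows "\<exists>s. \<forall>t. \<psi> t = \<phi> (t + s)"
proof -
  have p0: "0 \<le> p" using p_pos by simp
  have mlam: "mom lam" by (rule mom_between[OF mom]) (use h in auto)
  have T: "exp_moments (tilt p lam) h" by (rule tilt_exp_moments[OF mom h p0])
  interpret T: exp_moments "tilt p lam" h by (rule T)
  have m1: "T.m1 = 2 * lam - c" using critp by (simp add: T.m1_def tilt_first_moment[OF p0])
  have \<kappa>: "0 < measure (tilt p lam) UNIV"
    unfolding tilt_measure[OF p0 mlam] using p_pos lap_pos[OF mlam measure_pos] by simp
  \<comment> \<open>At a double root the tangent is horizontal and the quadratic term alone gives
    \<open>(y - lam)\<^sup>2 \<le> chi0 y\<close>.\<close>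
  have pos_below: "\<not> mom y \<or> 0 < chi0 y" if "0 \<le> y" "y < lam" for y
  proof -
    have my: "mom y" using mom_between[OF mom_0 mlam that(1)] that by simp
    have "p * (lap lam - (y - lam) * (\<integral>r. r * exp (- lam * r) \<partial>\<nu>)) \<le> p * lap y"
      using lap_tangent[OF my mlam first_moment[OF mom h]] p_pos by (intro mult_left_mono) auto
    moreover have "p * ((y - lam) * (\<integral>r. r * exp (- lam * r) \<partial>\<nu>)) = (y - lam) * (2 * lam - c)" unfolding critp by simp
    ultimately have "p * lap lam - (y - lam) * (2 * lam - c) \<le> p * lap y" by (simp add: right_diff_distrib)
    then have "(y - lam)\<^sup>2 \<le> chi0 y" using root by (simp add: chi0_def power2_eq_square algebra_simps)
    moreover have "0 < (y - lam)\<^sup>2" using that by simp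
    ultimately show ?thesis by linarith
  qed
  have g: "\<exists>C. \<forall>t. X t \<le> C * exp (z * t)" if "sol X X'" "\<And>t. 0 < X t" "0 \<le> z" "z < lam" for X X' z
    using decays_below[OF that(1,2) pos_below that(3,4)] by (simp add: decays_def[OF that(1,2)])
  have gz: "\<And>z. 0 \<le> z \<Longrightarrow> z < lam \<Longrightarrow> \<exists>C. \<forall>t. (\<lambda>_. 0) t \<le> C * exp (z * t)" by (intro exI[of _ 0]) auto
  let ?w = "\<lambda>X t. X t * exp (- lam * t)"
  let ?w' = "\<lambda>X X' t. (X' t - lam * X t) * exp (- lam * t)"
  have slow: "slow (?w X)" if "sol X X'" "\<And>t. 0 < X t" for X X'
    using slow_ratio[OF that(1) sol_zero lam g[OF that] gz] by simp
  have dw: "(?w X has_real_derivative ?w' X X' t) (at t)" if "sol X X'" for X X' t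
    using ratio_DERIV[OF that sol_zero, of lam t] by simp
  have Ylim: "\<exists>P \<beta>. \<beta> < 0 \<and> (\<forall>t. (P has_real_derivative ?w X t) (at t)) \<and>
      ((\<lambda>t. ?w' X X' t + T.m1 * ?w X t - T.J P t) \<longlongrightarrow> \<beta>) at_bot"
    if X: "sol X X'" and pX: "\<And>t. 0 < X t" for X X'
  proof -
    have sl: "slow (\<lambda>t. (X t - 0) * exp (- lam * t))" using slow[OF X pX] by simp
    obtain R \<eta> where eta: "0 < \<eta>" and R: "\<And>t. \<bar>rem X (\<lambda>_. 0) t * exp (- lam * t)\<bar> \<le> R * exp (\<eta> * t)"
      using rem_ratio[OF X sol_zero lam g[OF X pX] gz mom(2) h] by blast
    have dw': "(?w' X X' has_real_derivative T.J (?w X) t - T.m1 * ?w' X X' t + rem X (\<lambda>_. 0) t * exp (- lam * t)) (at t)" for t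
      using ratio_DERIV2[OF X sol_zero root mlam T sl, of t] by (simp add: m1)
    obtain P where P: "\<And>t. (P has_real_derivative ?w X t) (at t)"
      using antiderivative_exists[OF slow_continuous[OF slow[OF X pX]]] by blast
    have "((\<lambda>t. ?w' X X' t + T.m1 * ?w X t - T.J P t) has_real_derivative rem X (\<lambda>_. 0) t * exp (- lam * t)) (at t)" for t
    proof -
      have "((\<lambda>t. ?w' X X' t + T.m1 * ?w X t - T.J P t) has_real_derivative
         (T.J (?w X) t - T.m1 * ?w' X X' t + rem X (\<lambda>_. 0) t * exp (- lam * t)) + T.m1 * ?w' X X' t - T.J (?w X) t) (at t)"
        by (intro DERIV_diff DERIV_add DERIV_cmult dw' dw[OF X] T.J_deriv[OF P slow[OF X pX]])
      then show ?thesis by simp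
    qed
    from exponential_antiderivative_limit[OF this eta R] obtain \<beta> where
      "\<And>t. \<bar>?w' X X' t + T.m1 * ?w X t - T.J P t - \<beta>\<bar> \<le> R / \<eta> * exp (\<eta> * t)" by blast
    from tendsto_0_if_exp_bound[OF eta this]
    have lim: "((\<lambda>t. ?w' X X' t + T.m1 * ?w X t - T.J P t) \<longlongrightarrow> \<beta>) at_bot" by (rule Lim_null[THEN iffD2])
    have "\<beta> \<le> 0"
      by (rule T.critical_sign[OF slow[OF X pX] _ dw[OF X] P lim]) (use less_imp_le[OF pX] in simp)
    moreover have "\<beta> \<noteq> 0"
    proof
      assume "\<beta> = 0"
      from T.critical_limit[OF \<kappa> slow[OF X pX] dw[OF X] dw' eta R P lim[unfolded this]]
      obtain b where "((\<lambda>t. (X t - 0) * exp (- lam * t)) \<longlongrightarrow> b) at_bot" by auto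
      from bounded_ratio[OF X sol_zero lam this] obtain C where "\<And>t. \<bar>X t - 0\<bar> \<le> C * exp (lam * t)" by blast
      from bounded_ratio_imp_eq[OF X sol_zero mom h lam chiL crit this] pX show False by (metis less_irrefl)
    qed
    ultimately show ?thesis using P lim by (intro exI[of _ P] exI[of _ \<beta>]) auto
  qed
  obtain P1 \<beta>1 where b1: "\<beta>1 < 0" and P1: "\<And>t. (P1 has_real_derivative ?w \<phi> t) (at t)"
    and Y1: "((\<lambda>t. ?w' \<phi> \<phi>' t + T.m1 * ?w \<phi> t - T.J P1 t) \<longlongrightarrow> \<beta>1) at_bot" using Ylim[OF s1 p1] by blast
  obtain P2 \<beta>2 where b2: "\<beta>2 < 0" and P2: "\<And>t. (P2 has_real_derivative ?w \<psi> t) (at t)"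
    and Y2: "((\<lambda>t. ?w' \<psi> \<psi>' t + T.m1 * ?w \<psi> t - T.J P2 t) \<longlongrightarrow> \<beta>2) at_bot" using Ylim[OF s2 p2] by blast
  define s where "s = ln (\<beta>2 / \<beta>1) / lam"
  define k where "k = exp (lam * s)"
  have kb: "k * \<beta>1 = \<beta>2" using lam b1 b2 by (simp add: s_def k_def divide_neg_neg)
  note ss = sol_shift[OF s1, of s]
  let ?X = "\<lambda>t. \<phi> (t + s)" and ?X' = "\<lambda>t. \<phi>' (t + s)"
  have sX: "slow (?w ?X)" by (rule slow[OF ss p1])
  have kP: "((\<lambda>t. k * P1 (t + s)) has_real_derivative ?w ?X t) (at t)" for t
  proof -
    have "((\<lambda>t. k * P1 (t - (- s))) has_real_derivative k * ?w \<phi> (t - (- s))) (at t)"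
      by (rule DERIV_cmult[OF DERIV_compose_diff[OF P1]])
    then show ?thesis unfolding k_def shift_ratio[of \<phi> t s lam] by simp
  qed
  have skP: "slow (\<lambda>t. k * P1 (t + s))" by (rule slow_antiderivative[OF kP sX])
  have sP2: "slow P2" by (rule slow_antiderivative[OF P2 slow[OF s2 p2]])
  have JkP: "T.J (\<lambda>t. k * P1 (t + s)) t = k * T.J P1 (t + s)" for t
  proof -
    have "T.J (\<lambda>t. k * P1 (t + s)) t = (\<integral>r. k * (P1 (t + s) - P1 (t + s - r)) \<partial>tilt p lam)"
      unfolding T.J_def by (intro Bochner_Integration.integral_cong refl) (simp add: algebra_simps)
    then show ?thesis by (simp add: T.J_def)
  qed
  define D where "D t = (\<psi> t - ?X t) * exp (- lam * t)" for t
  define D' where "D' t = (\<psi>' t - ?X' t - lam * (\<psi> t - ?X t)) * exp (- lam * t)" for t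
  define PD where "PD t = P2 t - k * P1 (t + s)" for t
  have slD: "slow D" unfolding D_def[abs_def] by (rule slow_ratio[OF s2 ss lam g[OF s2 p2] g[OF ss p1]])
  obtain R \<eta> where eta: "0 < \<eta>" and R: "\<And>t. \<bar>rem \<psi> ?X t * exp (- lam * t)\<bar> \<le> R * exp (\<eta> * t)"
    using rem_ratio[OF s2 ss lam g[OF s2 p2] g[OF ss p1] mom(2) h] by blast
  have dD: "(D has_real_derivative D' t) (at t)" for t unfolding D_def[abs_def] D'_def by (rule ratio_DERIV[OF s2 ss])
  have dD': "(D' has_real_derivative T.J D t - T.m1 * D' t + rem \<psi> ?X t * exp (- lam * t)) (at t)" for t
    unfolding D_def[abs_def] D'_def[abs_def] m1 by (rule ratio_DERIV2[OF s2 ss root mlam T slD[unfolded D_def[abs_def]]])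
  have dPD: "(PD has_real_derivative D t) (at t)" for t
    unfolding PD_def[abs_def] D_def using DERIV_diff[OF P2 kP] by (simp add: left_diff_distrib)
  \<comment> \<open>The first integral is linear and compatible with translations. Matching the
    limits therefore makes the first integral of the difference vanish at minus infinity, as
    \<open>critical_limit\<close> requires.\<close>
  have Y_eq: "D' t + T.m1 * D t - T.J PD t = (?w' \<psi> \<psi>' t + T.m1 * ?w \<psi> t - T.J P2 t)
      - k * (?w' \<phi> \<phi>' (t + s) + T.m1 * ?w \<phi> (t + s) - T.J P1 (t + s))" for t
  proof -
    have J: "T.J PD t = T.J P2 t - k * T.J P1 (t + s)"
      unfolding PD_def[abs_def] T.J_diff[OF sP2 skP] JkP ..
    have e: "exp (- lam * t) = k * exp (- lam * (t + s))" by (simp add: k_def exp_add[symmetric] algebra_simps)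
    show ?thesis unfolding J D_def D'_def e by (simp add: algebra_simps)
  qed
  have "((\<lambda>t. (?w' \<psi> \<psi>' t + T.m1 * ?w \<psi> t - T.J P2 t)
      - k * (?w' \<phi> \<phi>' (t + s) + T.m1 * ?w \<phi> (t + s) - T.J P1 (t + s))) \<longlongrightarrow> \<beta>2 - k * \<beta>1) at_bot"
    by (intro tendsto_diff Y2 tendsto_mult tendsto_const filterlim_compose[OF Y1 filterlim_shift_at_bot])
  then have "((\<lambda>t. D' t + T.m1 * D t - T.J PD t) \<longlongrightarrow> 0) at_bot" unfolding Y_eq kb by simp
  from T.critical_limit[OF \<kappa> slD dD dD' eta R dPD this]
  obtain b where "((\<lambda>t. (\<psi> t - ?X t) * exp (- lam * t)) \<longlongrightarrow> b) at_bot" unfolding D_def by blast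
  from bounded_ratio[OF s2 ss lam this] obtain C where C: "\<And>t. \<bar>\<psi> t - ?X t\<bar> \<le> C * exp (lam * t)" by blast
  from bounded_ratio_imp_eq[OF s2 ss mom h lam chiL crit C] show ?thesis by blast
qed

text \<open>The function \<open>X\<close> is positive at both ends of \<open>{0..y}\<close> and
  nonpositive at \<open>z\<close>, so its minimum is interior and critical, with moments on both
  sides. If \<open>chi0\<close> is not negative there, the nonnegative quantities
  \<open>q - m\<close> and \<open>(L - p) * lap lam\<close> must vanish; then \<open>L = p\<close>,
  and the critical point of \<open>X\<close> is a double root of \<open>chi0\<close>.\<close>

lemma unique_profile:
  assumes s1: "sol \<phi> \<phi>'" and s2: "sol \<psi> \<psi>'" and p1: "\<And>t. 0 < \<phi> t" and p2: "\<And>t. 0 < \<psi> t"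
    and z: "0 < z" "mom z" "z\<^sup>2 - c * z - m + L * lap z \<le> 0"
    and y: "z < y" "mom y" "0 < y\<^sup>2 - c * y - m + L * lap y"
  shows "\<exists>s. \<forall>t. \<psi> t = \<phi> (t + s)"
proof -
  define X where "X = (\<lambda>z. z\<^sup>2 - c * z - m + L * lap z)"
  have "continuous_on {0..y} X"
    unfolding X_def by (intro continuous_intros continuous_on_lap mom_0 y(2))
  then have "\<exists>x\<in>{0..y}. \<forall>v\<in>{0..y}. X x \<le> X v" using z y by (intro continuous_attains_inf) auto
  then obtain lam where lam: "lam \<in> {0..y}" and min: "\<And>v. v \<in> {0..y} \<Longrightarrow> X lam \<le> X v" by blast
  have X0: "0 < X 0" using m_le qp pL by (simp add: X_def lap_0 mass)
  have Xz: "X z \<le> 0" "0 < X y" using z y by (auto simp: X_def)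
  have Xlam: "X lam \<le> 0" using min[of z] Xz z y by auto
  have l: "0 < lam" "lam < y" using lam Xlam X0 Xz by (auto simp: less_le)
  define h where "h = min lam (y - lam)"
  have h: "0 < h" using l by (simp add: h_def)
  have momh: "mom (lam - h)" "mom (lam + h)"
    by (rule mom_between[OF mom_0 y(2)], use l in \<open>auto simp: h_def\<close>)+
  have mlam: "mom lam" by (rule mom_between[OF mom_0 y(2)]) (use l in auto)
  have "(X has_real_derivative 2 * lam - c - L * (\<integral>r. r * exp (- lam * r) \<partial>\<nu>)) (at lam)"
    unfolding X_def by (auto intro!: derivative_eq_intros DERIV_lap[OF momh h])
  from DERIV_local_min[OF this h] have crit: "2 * lam - c = L * (\<integral>r. r * exp (- lam * r) \<partial>\<nu>)"
    using min l by (auto simp: h_def abs_less_iff)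
  have chiL: "lam\<^sup>2 - c * lam - m + L * lap lam \<le> 0" using Xlam by (simp add: X_def)
  have k: "0 < lap lam" by (rule lap_pos[OF mlam measure_pos])
  have diff: "lam\<^sup>2 - c * lam - m + L * lap lam = chi0 lam + (q - m) + (L - p) * lap lam"
    by (simp add: chi0_def algebra_simps)
  have nn: "0 \<le> (L - p) * lap lam" using pL k by simp
  show ?thesis
  proof (cases "chi0 lam < 0")
    case True
    then show ?thesis by (rule unique_strict[OF s1 s2 p1 p2 momh h l(1) chiL crit])
  next
    case False
    then have root: "chi0 lam = 0" and "(L - p) * lap lam = 0" using chiL diff nn m_le by linarith+
    then have "L = p" using k by simp
    then show ?thesis using unique_critical[OF s1 s2 p1 p2 momh h l(1) chiL crit root] crit by simp
  qed
qed

end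

section \<open>The kernel and the minimal speeds\<close>

locale kernel =
  fixes K :: "real \<Rightarrow> real \<Rightarrow> real"
  assumes wave_kernel: "wave_kernel K"
begin

definition kernel_density :: "real \<times> real \<Rightarrow> real" where
  "kernel_density x = indicator {0..} (fst x) * K (fst x) (snd x)"

lemma kernel_density_integrable: "integrable lborel kernel_density"
proof -
  have "(\<lambda>x. indicator ({0..} \<times> UNIV) x *\<^sub>R (case x of (s, w) \<Rightarrow> K s w)) = kernel_density"
    by (auto simp: kernel_density_def indicator_def)
  then show ?thesis using wave_kernel by (simp add: wave_kernel_def set_integrable_def)
qed

lemma kernel_density_measurable [measurable]: "kernel_density \<in> borel_measurable borel"
  using borel_measurable_integrable[OF kernel_density_integrable] by simp

lemma kernel_density_nonneg: "AE x in lborel. 0 \<le> kernel_density x"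
proof -
  have "AE x in lborel. (case x of (s, w) \<Rightarrow> 0 \<le> s \<longrightarrow> 0 \<le> K s w)" using wave_kernel by (simp add: wave_kernel_def)
  then show ?thesis by eventually_elim (auto simp: kernel_density_def indicator_def)
qed

text \<open>A probability measure on the plane. \<open>ennreal\<close> discards negative values of
  the density, which occur on a null set only.\<close>

definition M :: "(real \<times> real) measure" where "M = density lborel (\<lambda>x. ennreal (kernel_density x))"

lemma sets_M [measurable_cong, simp]: "sets M = sets borel" by (simp add: M_def)
lemma space_M [simp]: "space M = UNIV" by (simp add: M_def)

lemma exponent_measurable: "(\<lambda>x::real \<times> real. c * fst x + snd x) \<in> borel_measurable borel"
  by (intro borel_measurable_continuous_onI continuous_intros)

lemma exp_measurable: "(\<lambda>x::real \<times> real. ennreal (exp (- z * (c * fst x + snd x)))) \<in> borel_measurable borel"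
  by (intro measurable_compose[OF _ measurable_ennreal] borel_measurable_continuous_onI continuous_intros)

lemma measurable_M: "f \<in> measurable borel N \<Longrightarrow> f \<in> measurable M N"
  by (simp add: measurable_cong_sets[OF sets_M refl])

lemma iterated_integral:
  assumes [measurable]: "h \<in> borel_measurable borel" and h: "\<And>x. \<bar>h x\<bar> \<le> C"
  shows "(LBINT s:{0..}. (LBINT w. K s w * h (s, w))) = (\<integral>x. h x \<partial>M)"
proof -
  have int: "integrable (lborel \<Otimes>\<^sub>M lborel) (\<lambda>x. kernel_density x * h x)"
    unfolding lborel_prod
  proof (rule Bochner_Integration.integrable_bound)
    show "integrable lborel (\<lambda>x. C * kernel_density x)" using kernel_density_integrable by simp
    have C: "0 \<le> C" using h[of undefined] by linarith
    show "AE x in lborel. norm (kernel_density x * h x) \<le> norm (C * kernel_density x)"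
      using mult_right_mono[OF h abs_ge_zero, of _ "kernel_density _"] C by (auto simp: abs_mult mult.commute)
  qed measurable
  have "(LBINT s:{0..}. (LBINT w. K s w * h (s, w))) = (\<integral>s. (\<integral>w. kernel_density (s, w) * h (s, w) \<partial>lborel) \<partial>lborel)"
    unfolding set_lebesgue_integral_def by (intro Bochner_Integration.integral_cong) (auto simp: kernel_density_def indicator_def)
  also have "\<dots> = (\<integral>x. kernel_density x * h x \<partial>(lborel \<Otimes>\<^sub>M lborel))" by (rule lborel_pair.integral_fst'[OF int])
  also have "\<dots> = (\<integral>x. h x \<partial>M)"
    unfolding lborel_prod M_def using kernel_density_nonneg by (subst integral_density) auto
  finally show ?thesis .
qed

lemma emeasure_M: "emeasure M UNIV = 1"
proof -
  have "(\<integral>x. (1::real) \<partial>M) = (\<integral>x. kernel_density x *\<^sub>R 1 \<partial>lborel)"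
    unfolding M_def using kernel_density_nonneg by (intro integral_density) auto
  moreover have "(LBINT s:{0..}. (LBINT w. K s w * 1)) = (\<integral>x. 1 \<partial>M)"
    using iterated_integral[of "\<lambda>_. 1" 1] by simp
  ultimately have "(\<integral>x. kernel_density x \<partial>lborel) = 1" using wave_kernel by (simp add: wave_kernel_def)
  then have "(\<integral>\<^sup>+x. ennreal (kernel_density x) \<partial>lborel) = 1"
    using nn_integral_eq_integral[OF kernel_density_integrable kernel_density_nonneg] by simp
  then show ?thesis by (simp add: M_def emeasure_density)
qed

lemma AE_M_fst: "AE x in M. 0 \<le> fst x"
  unfolding M_def
proof (subst AE_density)
  show "AE x in lborel. 0 < ennreal (kernel_density x) \<longrightarrow> 0 \<le> fst x" by (auto simp: kernel_density_def indicator_def)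
qed measurable

text \<open>Valued in \<open>ennreal\<close> so that divergence is visible, whereas
  \<open>lap\<close> would return 0.\<close>

definition "E c z = (\<integral>\<^sup>+x. ennreal (exp (- z * (c * fst x + snd x))) \<partial>M)" for c z :: real

lemma E_iterated:
  "(\<integral>\<^sup>+s\<in>{0..}. (\<integral>\<^sup>+w. ennreal (K s w * exp (- z * (c * s + w))) \<partial>lborel) \<partial>lborel) = E c z"
proof -
  have "(\<integral>\<^sup>+s\<in>{0..}. (\<integral>\<^sup>+w. ennreal (K s w * exp (- z * (c * s + w))) \<partial>lborel) \<partial>lborel)
      = (\<integral>\<^sup>+s. (\<integral>\<^sup>+w. ennreal (kernel_density (s, w)) * ennreal (exp (- z * (c * s + w))) \<partial>lborel) \<partial>lborel)"
    by (intro nn_integral_cong) (auto simp: kernel_density_def indicator_def ennreal_mult'')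
  also have "\<dots> = (\<integral>\<^sup>+x. ennreal (kernel_density x) * ennreal (exp (- z * (c * fst x + snd x))) \<partial>(lborel \<Otimes>\<^sub>M lborel))"
  proof -
    have "(\<lambda>x. ennreal (kernel_density x) * ennreal (exp (- z * (c * fst x + snd x)))) \<in> borel_measurable (lborel \<Otimes>\<^sub>M lborel)"
      using exp_measurable[of z c] measurable_compose[OF kernel_density_measurable measurable_ennreal]
      by (simp add: lborel_prod borel_measurable_times)
    from lborel.nn_integral_fst[OF this] show ?thesis by (simp only: fst_conv snd_conv)
  qed
  also have "\<dots> = E c z"
    unfolding E_def M_def lborel_prod using exp_measurable[of z c] by (subst nn_integral_density) auto
  finally show ?thesis .
qed

text \<open>The law of the displacement seen in the moving frame: delay \<open>s\<close> and
  distance \<open>w\<close> sample the profile \<open>c * s + w\<close> behind the current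
  point.\<close>

definition "\<nu> c = distr M borel (\<lambda>x. c * fst x + snd x)" for c :: real

lemma finite_borel_nu: "finite_borel (\<nu> c)"
proof -
  have "emeasure (\<nu> c) (space (\<nu> c)) = 1" by (simp add: \<nu>_def emeasure_distr[OF measurable_M[OF exponent_measurable]] emeasure_M)
  then interpret finite_measure "\<nu> c" by (intro finite_measureI) simp
  show ?thesis by standard (simp add: \<nu>_def)
qed

lemma mass_nu: "measure (\<nu> c) UNIV = 1"
  by (simp add: measure_def \<nu>_def emeasure_distr[OF measurable_M[OF exponent_measurable]] emeasure_M)

lemma E_nu: "E c z = (\<integral>\<^sup>+r. ennreal (exp (- z * r)) \<partial>\<nu> c)"
  unfolding E_def \<nu>_def by (subst nn_integral_distr[OF measurable_M[OF exponent_measurable]]) auto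

lemma mom_iff: "finite_borel.mom (\<nu> c) z \<longleftrightarrow> E c z < \<infinity>"
proof -
  interpret finite_borel "\<nu> c" by (rule finite_borel_nu)
  have "(\<lambda>r. exp (- z * r)) \<in> borel_measurable (\<nu> c)" by (intro measurable_cont continuous_intros)
  then show ?thesis unfolding mom_def E_nu by (simp add: integrable_iff_bounded)
qed

lemma E_lap: assumes "E c z < \<infinity>" shows "E c z = ennreal (finite_borel.lap (\<nu> c) z)"
proof -
  interpret finite_borel "\<nu> c" by (rule finite_borel_nu)
  show ?thesis using assms[folded mom_iff] unfolding E_nu lap_def mom_def by (intro nn_integral_eq_integral) auto
qed

section \<open>Characteristic functions and minimal speeds\<close>

lemma char_fun_eq:
  "char_fun a b K z c = ereal (z\<^sup>2 - c * z - a) + ereal b * enn2ereal (E c z)"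
  by (simp only: char_fun_def E_iterated)

lemma char_fun_finite:
  assumes "E c z < \<infinity>"
  shows "char_fun a b K z c = ereal (z\<^sup>2 - c * z - a + b * finite_borel.lap (\<nu> c) z)"
  using finite_borel.lap_nonneg[OF finite_borel_nu]
  unfolding char_fun_eq E_lap[OF assms] by (simp add: enn2ereal_ennreal)

lemma char_fun_infinite:
  assumes "\<not> E c z < \<infinity>" "0 < b"
  shows "char_fun a b K z c = \<infinity>"
  using assms unfolding char_fun_eq by (simp add: top.not_eq_extremum[symmetric])

text \<open>Unlike vanishing, nonpositivity is monotone in the speed and closed under limits; as far
  as existence of a positive \<open>z\<close> is concerned, the two are equivalent when
  \<open>a < b\<close>.\<close>

definition "nonpos a b c z \<longleftrightarrow> E c z < \<infinity> \<and> z\<^sup>2 - c * z - a + b * finite_borel.lap (\<nu> c) z \<le> 0"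

lemma nonpos_iff: "0 < b \<Longrightarrow> nonpos a b c z \<longleftrightarrow> char_fun a b K z c \<le> 0"
  using char_fun_finite[of c z a b] char_fun_infinite[of c z b a] by (cases "E c z < \<infinity>") (auto simp: nonpos_def)

text \<open>An upper bound on the moment in \<open>ennreal\<close> includes its finiteness and is
  preserved by Fatou's lemma.\<close>

lemma nonpos_bound:
  assumes "0 < b"
  shows "nonpos a b c z \<longleftrightarrow> 0 \<le> a - z\<^sup>2 + c * z \<and> E c z \<le> ennreal ((a - z\<^sup>2 + c * z) / b)"
proof
  assume n: "nonpos a b c z"
  then have le: "b * finite_borel.lap (\<nu> c) z \<le> a - z\<^sup>2 + c * z" by (simp add: nonpos_def)
  moreover have "0 \<le> b * finite_borel.lap (\<nu> c) z" using assms finite_borel.lap_nonneg[OF finite_borel_nu] by simp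
  moreover have "finite_borel.lap (\<nu> c) z \<le> (a - z\<^sup>2 + c * z) / b" using le assms by (simp add: pos_le_divide_eq mult.commute)
  ultimately show "0 \<le> a - z\<^sup>2 + c * z \<and> E c z \<le> ennreal ((a - z\<^sup>2 + c * z) / b)"
    using n E_lap[of c z] by (auto simp: nonpos_def intro: ennreal_leI)
next
  assume r: "0 \<le> a - z\<^sup>2 + c * z \<and> E c z \<le> ennreal ((a - z\<^sup>2 + c * z) / b)"
  then have fin: "E c z < \<infinity>" by (auto intro: le_less_trans)
  have "ennreal (finite_borel.lap (\<nu> c) z) \<le> ennreal ((a - z\<^sup>2 + c * z) / b)" using r E_lap[OF fin] by simp
  then have "finite_borel.lap (\<nu> c) z \<le> (a - z\<^sup>2 + c * z) / b" using r assms by (subst (asm) ennreal_le_iff) auto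
  then show "nonpos a b c z" using fin assms by (simp add: nonpos_def pos_le_divide_eq mult.commute)
qed

text \<open>The function equals \<open>b - a > 0\<close> at 0 and is continuous up to any point with
  a finite moment, so the intermediate value theorem turns a nonpositive value into a root.\<close>

lemma root_iff:
  assumes ab: "a < b" "0 < b"
  shows "(\<exists>z>0. char_fun a b K z c = 0) \<longleftrightarrow> (\<exists>z>0. nonpos a b c z)"
proof
  assume "\<exists>z>0. char_fun a b K z c = 0"
  then show "\<exists>z>0. nonpos a b c z" using nonpos_iff[OF ab(2)] by fastforce
next
  interpret finite_borel "\<nu> c" by (rule finite_borel_nu)
  assume "\<exists>z>0. nonpos a b c z"
  then obtain z where z: "0 < z" "nonpos a b c z" by blast
  then have mz: "mom z" by (simp add: mom_iff nonpos_def)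
  define X where "X = (\<lambda>z. z\<^sup>2 - c * z - a + b * lap z)"
  have "continuous_on {0..z} X" unfolding X_def by (intro continuous_intros continuous_on_lap mom_0 mz)
  moreover have X0: "0 < X 0" using ab by (simp add: X_def lap_0 mass_nu)
  moreover have "X z \<le> 0" using z by (simp add: nonpos_def X_def)
  ultimately obtain y where y: "0 \<le> y" "y \<le> z" "X y = 0" using IVT2'[of X z 0 0] z by auto
  have "0 < y" using y X0 by (cases "y = 0") auto
  moreover have "E c y < \<infinity>" using mom_between[OF mom_0 mz y(1,2)] by (simp add: mom_iff)
  then have "char_fun a b K y c = 0" using y(3) by (simp add: char_fun_finite X_def zero_ereal_def)
  ultimately show "\<exists>z>0. char_fun a b K z c = 0" by blast
qed

text \<open>Delays are nonnegative almost everywhere under \<open>M\<close>, so a larger speed only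
  decreases the exponential.\<close>

lemma E_antimono: assumes "c \<le> c'" "0 \<le> z" shows "E c' z \<le> E c z"
  unfolding E_def
proof (rule nn_integral_mono_AE)
  show "AE x in M. ennreal (exp (- z * (c' * fst x + snd x))) \<le> ennreal (exp (- z * (c * fst x + snd x)))"
    using AE_M_fst
  proof eventually_elim
    case (elim x)
    have "z * (c * fst x) \<le> z * (c' * fst x)" using assms elim by (intro mult_left_mono mult_right_mono) auto
    then show ?case by (simp add: algebra_simps)
  qed
qed

lemma nonpos_mono:
  assumes b: "0 < b" and n: "nonpos a b c z" and c: "c \<le> c'" and z: "0 < z"
  shows "nonpos a b c' z"
proof -
  have "c * z \<le> c' * z" using c z by (intro mult_right_mono) auto
  then have le: "a - z\<^sup>2 + c * z \<le> a - z\<^sup>2 + c' * z" by simp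
  have r: "0 \<le> a - z\<^sup>2 + c * z" "E c z \<le> ennreal ((a - z\<^sup>2 + c * z) / b)"
    using n unfolding nonpos_bound[OF b] by auto
  have "E c' z \<le> E c z" using E_antimono[OF c] z by simp
  also have "\<dots> \<le> ennreal ((a - z\<^sup>2 + c' * z) / b)"
    using r(2) le b by (intro order_trans[OF r(2)] ennreal_leI divide_right_mono) auto
  finally show ?thesis unfolding nonpos_bound[OF b] using r(1) le by linarith
qed

lemma fatou_E:
  assumes z: "z \<longlonglongrightarrow> z0" and c: "c \<longlonglongrightarrow> c0" and E: "\<And>n. E (c n) (z n) \<le> ennreal (y n)" and y: "y \<longlonglongrightarrow> y0"
  shows "E c0 z0 \<le> ennreal y0"
proof -
  have "E c0 z0 = (\<integral>\<^sup>+x. liminf (\<lambda>n. ennreal (exp (- z n * (c n * fst x + snd x)))) \<partial>M)"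
    unfolding E_def by (intro nn_integral_cong lim_imp_Liminf[symmetric] tendsto_ennrealI tendsto_intros z c) simp
  also have "\<dots> \<le> liminf (\<lambda>n. E (c n) (z n))"
    unfolding E_def by (intro nn_integral_liminf measurable_M exp_measurable)
  also have "\<dots> \<le> liminf (\<lambda>n. ennreal (y n))" by (rule Liminf_mono) (use E in auto)
  also have "\<dots> = ennreal y0" by (intro lim_imp_Liminf tendsto_ennrealI y) simp
  finally show ?thesis .
qed

text \<open>At 0 the moment is 1 and the function equals \<open>b - a > 0\<close>, so Fatou's lemma
  excludes points accumulating there. Monotonicity in the speed reduces all \<open>c \<le> C\<close>
  to \<open>C\<close>.\<close>

lemma nonpos_away_from_0:
  assumes ab: "0 \<le> a" "a < b"
  shows "\<exists>\<delta>>0. \<forall>c\<le>C. \<forall>z>0. nonpos a b c z \<longrightarrow> \<delta> \<le> z"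
proof (rule ccontr)
  assume no: "\<not> ?thesis"
  have b: "0 < b" using ab by simp
  have "\<exists>z>0. z < 1 / real (Suc n) \<and> nonpos a b C z" for n
  proof -
    have "\<not> (\<forall>c\<le>C. \<forall>z>0. nonpos a b c z \<longrightarrow> 1 / real (Suc n) \<le> z)"
      using no by (metis of_nat_0_less_iff zero_less_Suc zero_less_divide_1_iff)
    then obtain c z where "c \<le> C" "0 < z" "nonpos a b c z" "z < 1 / real (Suc n)" by (auto simp: not_le)
    then show ?thesis using nonpos_mono[OF b] by blast
  qed
  then obtain z where z: "\<And>n. 0 < z n" "\<And>n. z n < 1 / real (Suc n)" "\<And>n. nonpos a b C (z n)" by metis
  have lim: "z \<longlonglongrightarrow> 0"
  proof (rule tendsto_sandwich[OF _ _ tendsto_const LIMSEQ_Suc[OF lim_1_over_n]])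
    show "eventually (\<lambda>n. 0 \<le> z n) sequentially" using z(1) by (auto intro!: always_eventually less_imp_le)
    show "eventually (\<lambda>n. z n \<le> 1 / real (Suc n)) sequentially" using z(2) by (auto intro!: always_eventually less_imp_le)
  qed
  have "(\<lambda>n. (a - (z n)\<^sup>2 + C * z n) / b) \<longlonglongrightarrow> (a - 0\<^sup>2 + C * 0) / b"
    using b by (intro tendsto_intros lim) auto
  moreover have "E C (z n) \<le> ennreal ((a - (z n)\<^sup>2 + C * z n) / b)" for n using z(3) unfolding nonpos_bound[OF b] by blast
  ultimately have "E C 0 \<le> ennreal ((a - 0\<^sup>2 + C * 0) / b)" by (intro fatou_E[OF lim tendsto_const])
  moreover have "E C 0 = 1" by (simp add: E_def emeasure_M)
  ultimately have "ennreal 1 \<le> ennreal (a / b)" by simp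
  then have "1 \<le> a / b" using ab by (subst (asm) ennreal_le_iff) auto
  then show False using ab by simp
qed

text \<open>The set of speeds is nonempty, because a large speed works at \<open>z0\<close>; bounded
  below, because the points stay away from 0 and \<open>c * z\<close> cannot be too negative; and
  closed, because the points stay in a compact interval where Fatou's lemma passes to the
  limit.\<close>

lemma least_speed:
  assumes ab: "0 \<le> a" "a < b" and fin: "0 < z0" "E 0 z0 < \<infinity>"
  shows "\<exists>z>0. nonpos a b (min_root_speed (char_fun a b K)) z"
    and "0 < z \<Longrightarrow> nonpos a b c z \<Longrightarrow> min_root_speed (char_fun a b K) \<le> c"
proof -
  have b: "0 < b" using ab by simp
  define S where "S = {c. \<exists>z>0. nonpos a b c z}"
  have up: "c' \<in> S" if "c \<in> S" "c \<le> c'" for c c' using that nonpos_mono[OF b] by (auto simp: S_def)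
  have ne: "S \<noteq> {}"
  proof -
    define k where "k = finite_borel.lap (\<nu> 0) z0"
    have k: "0 \<le> k" "E 0 z0 = ennreal k" using finite_borel.lap_nonneg[OF finite_borel_nu] E_lap[OF fin(2)] by (auto simp: k_def)
    \<comment> \<open>Balances \<open>c * z0 = z0\<^sup>2 + b * k\<close>, which makes the function
      at \<open>z0\<close> at most \<open>- a\<close>.\<close>
    define c where "c = (z0\<^sup>2 + b * k) / z0"
    have c: "0 \<le> c" "c * z0 = z0\<^sup>2 + b * k" using k b fin by (auto simp: c_def)
    have "E c z0 \<le> E 0 z0" using E_antimono[OF c(1)] fin by simp
    also have "\<dots> \<le> ennreal ((a - z0\<^sup>2 + c * z0) / b)"
      unfolding k(2) c(2) using ab b by (intro ennreal_leI) (simp add: field_simps)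
    finally have "nonpos a b c z0" unfolding nonpos_bound[OF b] using c(2) k b ab by simp
    then show ?thesis using fin by (auto simp: S_def)
  qed
  have bdd: "bdd_below S"
  proof -
    obtain \<delta> where d: "0 < \<delta>" "\<And>c z. c \<le> 0 \<Longrightarrow> 0 < z \<Longrightarrow> nonpos a b c z \<Longrightarrow> \<delta> \<le> z"
      using nonpos_away_from_0[OF ab, of 0] by blast
    have "- a / \<delta> \<le> c" if cS: "c \<in> S" for c
    proof (rule ccontr)
      assume "\<not> - a / \<delta> \<le> c"
      then have c: "c < - a / \<delta>" by simp
      have "- a / \<delta> \<le> 0" using ab d by simp
      then have c0: "c \<le> 0" using c by linarith
      obtain z where z: "0 < z" "nonpos a b c z" using cS unfolding S_def by blast
      have "c * z \<le> c * \<delta>" using d(2)[OF c0 z] c0 by (intro mult_left_mono_neg)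
      also have "\<dots> < - a" using c d(1) by (simp only: pos_less_divide_eq)
      finally have "a - z\<^sup>2 + c * z < 0" using zero_le_power2[of z] by linarith
      then show False using z(2) unfolding nonpos_bound[OF b] by simp
    qed
    then show ?thesis by (rule bdd_belowI)
  qed
  define c0 where "c0 = Inf S"
  have lower: "c0 \<le> c" if "c \<in> S" for c unfolding c0_def by (rule cInf_lower[OF that bdd])
  have c0S: "c0 \<in> S"
  proof -
    obtain \<delta> where d: "0 < \<delta>" "\<And>c z. c \<le> c0 + 1 \<Longrightarrow> 0 < z \<Longrightarrow> nonpos a b c z \<Longrightarrow> \<delta> \<le> z"
      using nonpos_away_from_0[OF ab, of "c0 + 1"] by blast
    define cc where "cc n = c0 + 1 / real (Suc n)" for n
    have cc: "cc n \<in> S" for n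
    proof -
      have "c0 < cc n" by (simp add: cc_def)
      then obtain c where "c \<in> S" "c < cc n" using cInf_less_iff[OF ne bdd, of "cc n"] unfolding c0_def by blast
      then show ?thesis using up by auto
    qed
    have cc1: "cc n \<le> c0 + 1" for n by (simp add: cc_def)
    have "(\<lambda>n. c0 + 1 / real (Suc n)) \<longlonglongrightarrow> c0 + 0" by (intro tendsto_intros LIMSEQ_Suc[OF lim_1_over_n])
    then have cclim: "cc \<longlonglongrightarrow> c0" by (simp add: cc_def[abs_def])
    have "\<forall>n. \<exists>z. 0 < z \<and> nonpos a b (cc n) z" using cc unfolding S_def by blast
    from choice[OF this] obtain z where "\<forall>n. 0 < z n \<and> nonpos a b (cc n) (z n)" ..
    then have z: "0 < z n" "nonpos a b (cc n) (z n)" for n by blast+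
    \<comment> \<open>Nonpositivity requires \<open>z\<^sup>2 \<le> a + c * z\<close>, which fails
      beyond this value for the speeds in question.\<close>
    define Z where "Z = \<bar>c0\<bar> + 1 + a + 1"
    have zZ: "z n \<in> {\<delta>..Z}" for n
    proof -
      have dz: "\<delta> \<le> z n" by (rule d(2)[OF cc1 z])
      have "z n \<le> Z"
      proof (rule ccontr)
        assume "\<not> z n \<le> Z"
        then have zz: "Z < z n" by simp
        have "0 \<le> a - (z n)\<^sup>2 + cc n * z n" using z(2)[of n] unfolding nonpos_bound[OF b] by simp
        moreover have "cc n * z n \<le> (\<bar>c0\<bar> + 1) * z n" using z(1)[of n] cc1[of n] by (intro mult_right_mono) auto
        moreover have "Z * z n < (z n)\<^sup>2" using zz z(1)[of n] by (simp add: power2_eq_square)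
        moreover have "Z * z n = (\<bar>c0\<bar> + 1) * z n + (a + 1) * z n" by (simp add: Z_def distrib_right)
        moreover have "a + 1 \<le> z n" using zz by (simp add: Z_def)
        then have "(a + 1) * 1 \<le> (a + 1) * z n" using ab by (intro mult_left_mono) auto
        ultimately show False by simp
      qed
      then show ?thesis using dz by simp
    qed
    obtain z1 r where z1: "z1 \<in> {\<delta>..Z}" and r: "strict_mono r" and lim: "(z \<circ> r) \<longlonglongrightarrow> z1"
      using compact_imp_seq_compact[OF compact_Icc, of \<delta> Z] zZ unfolding seq_compact_def by metis
    have clim: "(cc \<circ> r) \<longlonglongrightarrow> c0" by (rule LIMSEQ_subseq_LIMSEQ[OF cclim r])
    have ylim: "(\<lambda>n. a - ((z \<circ> r) n)\<^sup>2 + (cc \<circ> r) n * (z \<circ> r) n) \<longlonglongrightarrow> a - z1\<^sup>2 + c0 * z1"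
      by (intro tendsto_intros lim clim)
    have nz: "nonpos a b ((cc \<circ> r) n) ((z \<circ> r) n)" for n using z(2) by simp
    have "0 \<le> a - z1\<^sup>2 + c0 * z1"
      by (rule LIMSEQ_le_const[OF ylim]) (use nz in \<open>auto simp: nonpos_bound[OF b]\<close>)
    moreover have "E c0 z1 \<le> ennreal ((a - z1\<^sup>2 + c0 * z1) / b)"
    proof (rule fatou_E[OF lim clim])
      show "(\<lambda>n. (a - ((z \<circ> r) n)\<^sup>2 + (cc \<circ> r) n * (z \<circ> r) n) / b) \<longlonglongrightarrow> (a - z1\<^sup>2 + c0 * z1) / b"
        using b by (intro tendsto_divide ylim tendsto_const) auto
    qed (use nz in \<open>auto simp: nonpos_bound[OF b]\<close>)
    ultimately have "nonpos a b c0 z1" unfolding nonpos_bound[OF b] by simp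
    moreover have "0 < z1" using z1 d(1) by simp
    ultimately show ?thesis unfolding S_def by blast
  qed
  have "min_root_speed (char_fun a b K) = c0"
    unfolding min_root_speed_def root_iff[OF ab(2) b]
    by (rule Least_equality) (use c0S lower in \<open>auto simp: S_def\<close>)
  then show "\<exists>z>0. nonpos a b (min_root_speed (char_fun a b K)) z"
    and "0 < z \<Longrightarrow> nonpos a b c z \<Longrightarrow> min_root_speed (char_fun a b K) \<le> c"
    using c0S lower by (auto simp: S_def)
qed

end

section \<open>Uniqueness and nonexistence of semi-wavefronts\<close>

lemma has_derivative_hderiv:
  "f differentiable (at s within {0..}) \<Longrightarrow> (f has_real_derivative hderiv f s) (at s within {0..})"
  by (simp add: hderiv_def vector_derivative_works has_real_derivative_iff_has_vector_derivative)

lemma halfline_mvt: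
  fixes h D :: "real \<Rightarrow> real"
  assumes s: "0 \<le> s" "s < r" and D: "\<And>x. x \<in> {s..r} \<Longrightarrow> (h has_real_derivative D x) (at x within {0..})"
  obtains x where "x \<in> {s<..<r}" "h r - h s = D x * (r - s)"
proof -
  have "(h has_derivative (\<lambda>v. D x * v)) (at x within {s..r})" if "s \<le> x" "x \<le> r" for x
    using has_field_derivative_subset[OF D, of x "{s..r}"] that s by (auto simp: has_field_derivative_def)
  from mvt_simple[OF s(2) this] show ?thesis using that by blast
qed

lemma halfline_quotient:
  assumes "(h has_real_derivative d) (at s within {0..})" "0 \<le> s"
  shows "((\<lambda>r. (h r - h s) / (r - s)) \<longlongrightarrow> d) (at s within {0..})" "at s within {0..} \<noteq> bot"
proof -
  show "((\<lambda>r. (h r - h s) / (r - s)) \<longlongrightarrow> d) (at s within {0..})" using assms by (simp add: has_field_derivative_iff)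
  have "at s within {s..} \<le> at s within {0..}" using assms(2) by (intro at_le) auto
  moreover have "at s within {s..} \<noteq> bot" by (simp add: at_within_Ici_at_right)
  ultimately show "at s within {0..} \<noteq> bot" by (metis le_bot)
qed

text \<open>Below \<open>\<delta>\<close> the mean value theorem is combined with the Hoelder bound
  on the derivative. Otherwise the larger argument is at least \<open>\<delta>\<close>, so its power
  is bounded below and the Lipschitz bound suffices.\<close>

lemma holder_increment:
  assumes h: "C1_holder_near_0 \<alpha> h" and alpha: "0 < \<alpha>"
    and lip: "\<And>s r. s \<in> {0..M} \<Longrightarrow> r \<in> {0..M} \<Longrightarrow> \<bar>h s - h r\<bar> \<le> B * \<bar>s - r\<bar>"
  shows "\<exists>C. \<forall>s\<in>{0..M}. \<forall>r\<in>{0..M}. \<bar>h s - h r - hderiv h 0 * (s - r)\<bar> \<le> C * max s r powr \<alpha> * \<bar>s - r\<bar>"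
proof -
  obtain \<delta> C0 where d: "0 < \<delta>" and diff: "\<And>s. s \<in> {0..<\<delta>} \<Longrightarrow> h differentiable (at s within {0..})"
    and C0: "\<And>s r. s \<in> {0..<\<delta>} \<Longrightarrow> r \<in> {0..<\<delta>} \<Longrightarrow> \<bar>hderiv h s - hderiv h r\<bar> \<le> C0 * \<bar>s - r\<bar> powr \<alpha>"
    using h unfolding C1_holder_near_0_def by metis
  define A where "A = \<bar>hderiv h 0\<bar>"
  define C where "C = \<bar>C0\<bar> + (\<bar>B\<bar> + A) / \<delta> powr \<alpha>"
  have C: "\<bar>C0\<bar> \<le> C" "(\<bar>B\<bar> + A) / \<delta> powr \<alpha> \<le> C" by (auto simp: C_def A_def)
  have main: "\<bar>h r - h s - hderiv h 0 * (r - s)\<bar> \<le> C * r powr \<alpha> * \<bar>r - s\<bar>"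
    if s: "0 \<le> s" "s < r" "r \<le> M" for s r
  proof (cases "r < \<delta>")
    case True
    obtain x where x: "x \<in> {s<..<r}" "h r - h s = hderiv h x * (r - s)"
      using halfline_mvt[OF s(1,2), of h "hderiv h"] has_derivative_hderiv[OF diff] s True by auto
    have "\<bar>hderiv h x - hderiv h 0\<bar> \<le> C0 * \<bar>x - 0\<bar> powr \<alpha>" using x s True d by (intro C0) auto
    also have "\<dots> \<le> \<bar>C0\<bar> * r powr \<alpha>" using x s alpha by (intro mult_mono powr_mono2) auto
    also have "\<dots> \<le> C * r powr \<alpha>" using C(1) by (rule mult_right_mono) simp
    finally have "\<bar>hderiv h x - hderiv h 0\<bar> * \<bar>r - s\<bar> \<le> C * r powr \<alpha> * \<bar>r - s\<bar>" by (rule mult_right_mono) simp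
    then show ?thesis using x(2) by (simp add: abs_mult[symmetric] left_diff_distrib)
  next
    case False
    have "\<bar>h r - h s\<bar> \<le> B * \<bar>r - s\<bar>" using s by (intro lip) auto
    also have "\<dots> \<le> \<bar>B\<bar> * \<bar>r - s\<bar>" by (intro mult_right_mono) auto
    finally have "\<bar>h r - h s - hderiv h 0 * (r - s)\<bar> \<le> (\<bar>B\<bar> + A) * \<bar>r - s\<bar>"
      using abs_triangle_ineq4[of "h r - h s" "hderiv h 0 * (r - s)"] by (simp add: A_def abs_mult distrib_right)
    moreover have "\<bar>B\<bar> + A \<le> C * r powr \<alpha>"
    proof -
      have "(\<bar>B\<bar> + A) / \<delta> powr \<alpha> * \<delta> powr \<alpha> \<le> C * r powr \<alpha>"
        using C(2) False d alpha by (intro mult_mono powr_mono2) (auto simp: C_def A_def)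
      then show ?thesis using d by simp
    qed
    then have "(\<bar>B\<bar> + A) * \<bar>r - s\<bar> \<le> C * r powr \<alpha> * \<bar>r - s\<bar>" by (rule mult_right_mono) simp
    ultimately show ?thesis by linarith
  qed
  have "\<bar>h s - h r - hderiv h 0 * (s - r)\<bar> \<le> C * max s r powr \<alpha> * \<bar>s - r\<bar>" if "s \<in> {0..M}" "r \<in> {0..M}" for s r
  proof (cases s r rule: linorder_cases)
    case less
    have "\<bar>h s - h r - hderiv h 0 * (s - r)\<bar> = \<bar>h r - h s - hderiv h 0 * (r - s)\<bar>"
      by (subst abs_minus_cancel[symmetric]) (simp add: algebra_simps)
    then show ?thesis using main[of s r] that less by (simp add: abs_minus_commute)
  next
    case greater
    then show ?thesis using main[of r s] that by simp
  qed simp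
  then show ?thesis by blast
qed

lemma H2_facts:
  assumes "H2 f g"
  shows "\<And>s. 0 \<le> s \<Longrightarrow> (f has_real_derivative hderiv f s) (at s within {0..})"
    and "\<And>s. 0 \<le> s \<Longrightarrow> 0 \<le> hderiv f s"
    and "0 \<le> (INF s\<in>{0..}. hderiv f s)" and "\<And>s. 0 \<le> s \<Longrightarrow> (INF s\<in>{0..}. hderiv f s) \<le> hderiv f s"
    and "continuous_on {0..} f"
proof -
  show D: "(f has_real_derivative hderiv f s) (at s within {0..})" if "0 \<le> s" for s
    using assms that by (intro has_derivative_hderiv) (auto simp: H2_def differentiable_on_def)
  show nn: "0 \<le> hderiv f s" if "0 \<le> s" for s
  proof (rule tendsto_lowerbound[OF halfline_quotient(1)[OF D[OF that] that] _ halfline_quotient(2)[OF D[OF that] that]])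
    have "0 \<le> (f r - f s) / (r - s)" if r: "r \<in> {0..}" "r \<noteq> s" for r
    proof (cases "r < s")
      case True
      then have "f r < f s" using assms r \<open>0 \<le> s\<close> by (auto simp: H2_def strict_mono_on_def)
      then show ?thesis using True by (simp add: divide_nonpos_neg)
    next
      case False
      then have "f s < f r" using assms r \<open>0 \<le> s\<close> by (auto simp: H2_def strict_mono_on_def)
      then show ?thesis using False by simp
    qed
    then show "eventually (\<lambda>r. 0 \<le> (f r - f s) / (r - s)) (at s within {0..})"
      by (auto simp: eventually_at_filter)
  qed
  have bdd: "bdd_below (hderiv f ` {0..})" using nn by (intro bdd_belowI[of _ 0]) auto
  show "0 \<le> (INF s\<in>{0..}. hderiv f s)" by (rule cINF_greatest) (use nn in auto)
  show "(INF s\<in>{0..}. hderiv f s) \<le> hderiv f s" if "0 \<le> s" for s by (rule cINF_lower[OF bdd]) (use that in simp)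
  show "continuous_on {0..} f" using D by (intro DERIV_continuous_on) auto
qed

lemma wave_interpretation:
  assumes K: "wave_kernel K" and "H1 g" and "H2 f g" and "H3 f g"
    and lip: "\<And>s r. 0 \<le> s \<Longrightarrow> 0 \<le> r \<Longrightarrow> \<bar>g s - g r\<bar> \<le> L * \<bar>s - r\<bar>"
  obtains \<alpha> where "\<And>c. wave (kernel.\<nu> K c) (hderiv g 0) (hderiv f 0) (INF s\<in>{0..}. hderiv f s) L \<alpha> f g"
proof -
  interpret kernel K by standard (rule K)
  note F = H2_facts[OF \<open>H2 f g\<close>]
  obtain \<alpha> where al: "0 < \<alpha>" "C1_holder_near_0 \<alpha> f" "C1_holder_near_0 \<alpha> g" using \<open>H3 f g\<close> by (auto simp: H3_def)
  have "wave (\<nu> c) (hderiv g 0) (hderiv f 0) (INF s\<in>{0..}. hderiv f s) L \<alpha> f g" for c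
  proof -
    interpret finite_borel "\<nu> c" by (rule finite_borel_nu)
    show ?thesis
    proof
      show "measure (\<nu> c) UNIV = 1" by (rule mass_nu)
      show "continuous_on {0..} f" by (rule F(5))
      show "f 0 = 0" "\<And>s. 0 \<le> s \<Longrightarrow> 0 \<le> f s" using \<open>H2 f g\<close> by (auto simp: H2_def)
      show "continuous_on {0..} g" "g 0 = 0" "\<And>s. 0 < s \<Longrightarrow> 0 < g s" using \<open>H1 g\<close> by (auto simp: H1_def)
      show "0 < \<alpha>" by (rule al)
      show "\<exists>C. \<forall>s\<in>{0..M}. \<forall>r\<in>{0..M}. \<bar>f s - f r - hderiv f 0 * (s - r)\<bar> \<le> C * max s r powr \<alpha> * \<bar>s - r\<bar>"
        if M: "0 < M" for M
      proof -
        have "compact (hderiv f ` {0..M})"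
          using \<open>H2 f g\<close> by (intro compact_continuous_image compact_Icc) (auto simp: H2_def intro: continuous_on_subset)
        then have "bounded (hderiv f ` {0..M})" by (rule compact_imp_bounded)
        then obtain B where "\<forall>x\<in>{0..M}. \<bar>hderiv f x\<bar> \<le> B" by (auto simp: bounded_iff)
        then have B: "\<And>x. x \<in> {0..M} \<Longrightarrow> \<bar>hderiv f x\<bar> \<le> B" by blast
        have lt: "\<bar>f r - f s\<bar> \<le> B * \<bar>r - s\<bar>" if s: "0 \<le> s" "s < r" "r \<le> M" for s r
        proof -
          obtain x where x: "x \<in> {s<..<r}" "f r - f s = hderiv f x * (r - s)"
            using halfline_mvt[OF s(1,2), of f "hderiv f"] F(1) s by auto
          have "\<bar>hderiv f x\<bar> \<le> B" using x s by (intro B) auto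
          then show ?thesis unfolding x(2) abs_mult by (rule mult_right_mono) simp
        qed
        have "\<bar>f s - f r\<bar> \<le> B * \<bar>s - r\<bar>" if "s \<in> {0..M}" "r \<in> {0..M}" for s r
          using lt[of s r] lt[of r s] that by (cases s r rule: linorder_cases) (auto simp: abs_minus_commute)
        from holder_increment[OF al(2,1) this] show ?thesis .
      qed
      show "\<exists>C. \<forall>s\<in>{0..M}. \<forall>r\<in>{0..M}. \<bar>g s - g r - hderiv g 0 * (s - r)\<bar> \<le> C * max s r powr \<alpha> * \<bar>s - r\<bar>" for M
        by (rule holder_increment[OF al(3,1), where B = L]) (use lip in auto)
      have slope: "(INF s\<in>{0..}. hderiv f s) * (r - s)\<^sup>2 \<le> (f r - f s) * (r - s)" if s: "0 \<le> s" "s < r" for s r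
      proof -
        obtain x where x: "x \<in> {s<..<r}" "f r - f s = hderiv f x * (r - s)"
          using halfline_mvt[OF s(1,2), of f "hderiv f"] F(1) s by auto
        have "(INF s\<in>{0..}. hderiv f s) * (r - s)\<^sup>2 \<le> hderiv f x * (r - s)\<^sup>2"
          using x s by (intro mult_right_mono F(4)) auto
        then show ?thesis unfolding x(2) by (simp add: power2_eq_square mult.assoc)
      qed
      show "(INF s\<in>{0..}. hderiv f s) * (s - r)\<^sup>2 \<le> (f s - f r) * (s - r)" if "0 \<le> s" "0 \<le> r" for s r
      proof (cases s r rule: linorder_cases)
        case less
        have "(s - r)\<^sup>2 = (r - s)\<^sup>2" "(f s - f r) * (s - r) = (f r - f s) * (r - s)" by (simp_all add: power2_commute algebra_simps)
        then show ?thesis using slope[OF that(1) less] by simp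
      next
        case greater then show ?thesis using slope[OF that(2) greater] by simp
      qed simp
      show "\<And>s r. 0 \<le> s \<Longrightarrow> 0 \<le> r \<Longrightarrow> \<bar>g s - g r\<bar> \<le> L * \<bar>s - r\<bar>" by (rule lip)
      show "0 \<le> (INF s\<in>{0..}. hderiv f s)" "(INF s\<in>{0..}. hderiv f s) \<le> hderiv f 0" using F(3) F(4)[of 0] by auto
      show "hderiv f 0 < hderiv g 0" using \<open>H2 f g\<close> by (simp add: H2_def)
      have Dg: "(g has_real_derivative hderiv g 0) (at 0 within {0..})"
        using \<open>H1 g\<close> by (intro has_derivative_hderiv) (simp add: H1_def)
      show "hderiv g 0 \<le> L"
      proof (rule tendsto_upperbound[OF halfline_quotient(1)[OF Dg] _ halfline_quotient(2)[OF Dg]])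
        have "(g r - g 0) / (r - 0) \<le> L" if "0 \<le> r" "r \<noteq> 0" for r
          using lip[of r 0] that by (simp add: divide_le_eq)
        then show "eventually (\<lambda>r. (g r - g 0) / (r - 0) \<le> L) (at 0 within {0..})"
          by (auto simp: eventually_at_filter)
      qed auto
    qed
  qed
  then show ?thesis by (rule that)
qed

text \<open>For small \<open>a\<close> the function \<open>cosh (a * y)\<close> is a strict
  supersolution. It outgrows the bounded \<open>e\<close>, so the quotient attains its maximum, and
  the equation at that point rules out a positive value.\<close>

lemma bounded_solution_zero:
  fixes e e' e'' :: "real \<Rightarrow> real"
  assumes D: "0 < D" and \<gamma>: "0 < \<gamma>" and bd: "\<And>x. \<bar>e x\<bar> \<le> B"
    and d1: "\<And>x. (e has_real_derivative e' x) (at x)" and d2: "\<And>x. (e' has_real_derivative e'' x) (at x)"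
    and eq: "\<And>x. D * e'' x = c * e' x + \<gamma> * e x"
  shows "e x = 0"
proof (rule ccontr)
  assume nz: "e x \<noteq> 0"
  \<comment> \<open>The second entry gives
    \<open>(D + \<bar>c\<bar>) * a \<le> \<gamma> / 2\<close>, and \<open>a \<le> 1\<close> allows
    \<open>a\<^sup>2\<close> to be replaced by \<open>a\<close>.\<close>
  define a where "a = min 1 (\<gamma> / (2 * (D + \<bar>c\<bar>)))"
  have a: "0 < a" "a \<le> 1" using D \<gamma> by (auto simp: a_def)
  have small: "D * a\<^sup>2 + \<bar>c\<bar> * a < \<gamma>"
  proof -
    have "a * a \<le> a * 1" using a by (intro mult_left_mono) auto
    then have "D * a\<^sup>2 \<le> D * a" using D by (intro mult_left_mono) (auto simp: power2_eq_square)
    then have "D * a\<^sup>2 + \<bar>c\<bar> * a \<le> (D + \<bar>c\<bar>) * a" by (simp add: distrib_right)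
    also have "\<dots> \<le> (D + \<bar>c\<bar>) * (\<gamma> / (2 * (D + \<bar>c\<bar>)))" using D by (intro mult_left_mono) (auto simp: a_def)
    also have "\<dots> = \<gamma> / 2" using D by (simp add: field_simps)
    finally show ?thesis using \<gamma> by linarith
  qed
  define r where "r y = \<bar>e y\<bar> / cosh (a * y)" for y
  have cr: "continuous_on UNIV r" unfolding r_def[abs_def]
    by (intro continuous_intros continuous_if_deriv[OF d1]) auto
  have rx: "0 < r x" using nz by (simp add: r_def)
  have inf: "r y \<le> r x" if y: "2 * B / (a * r x) < \<bar>y\<bar>" for y
  proof -
    have "1 + a * \<bar>y\<bar> \<le> exp (a * \<bar>y\<bar>)" by (rule exp_ge_add_one_self)
    also have "\<dots> \<le> 2 * cosh (a * y)" using exp_abs_le_cosh[of "a * y"] a by (simp add: abs_mult)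
    finally have "a * \<bar>y\<bar> / 2 \<le> cosh (a * y)" by simp
    moreover have "B < r x * (a * \<bar>y\<bar> / 2)" using y a rx by (simp add: pos_divide_less_eq mult_ac)
    ultimately have "B \<le> r x * cosh (a * y)" using rx by (smt (verit) mult_left_mono)
    then have "\<bar>e y\<bar> \<le> r x * cosh (a * y)" using bd[of y] by linarith
    then show ?thesis by (simp add: r_def[of y] pos_divide_le_eq)
  qed
  obtain w where w: "\<And>y. r y \<le> r w" using attains_max_if_small_at_infinity[OF cr inf] by blast
  define m where "m = r w"
  have m: "0 < m" using w[of x] rx by (simp add: m_def)
  define s where "s = sgn (e w)"
  have s: "s * e w = \<bar>e w\<bar>" "\<bar>s\<bar> \<le> 1" by (auto simp: s_def sgn_if)
  have touch: "s * e w = m * cosh (a * w)" using s by (simp add: m_def r_def)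
  have loc: "m * cosh (a * w) - s * e w \<le> m * cosh (a * y) - s * e y" for y
  proof -
    have "s * e y \<le> \<bar>s\<bar> * \<bar>e y\<bar>" using abs_ge_self[of "s * e y"] by (simp add: abs_mult)
    also have "\<dots> \<le> 1 * \<bar>e y\<bar>" using s(2) by (intro mult_right_mono) auto
    also have "\<bar>e y\<bar> = r y * cosh (a * y)" by (simp add: r_def)
    also have "1 * \<dots> \<le> m * cosh (a * y)" using w[of y] by (simp add: m_def)
    finally show ?thesis using touch by simp
  qed
  have F: "((\<lambda>y. m * cosh (a * y) - s * e y) has_real_derivative m * (a * sinh (a * y)) - s * e' y) (at y)" for y
    by (auto intro!: derivative_eq_intros d1)
  have F': "((\<lambda>y. m * (a * sinh (a * y)) - s * e' y) has_real_derivative m * (a\<^sup>2 * cosh (a * w)) - s * e'' w) (at w)"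
    by (auto intro!: derivative_eq_intros d2 simp: power2_eq_square)
  note min = local_min_second_derivative[OF zero_less_one loc F F']
  have "D * (s * e'' w) = s * (D * e'' w)" by simp
  also have "\<dots> = c * (s * e' w) + \<gamma> * (s * e w)" unfolding eq by (simp add: algebra_simps)
  also have "\<dots> = c * (m * (a * sinh (a * w))) + \<gamma> * (m * cosh (a * w))" using min(1) touch by simp
  finally have "D * (s * e'' w) = c * (m * (a * sinh (a * w))) + \<gamma> * (m * cosh (a * w))" .
  moreover have "D * (s * e'' w) \<le> D * (m * (a\<^sup>2 * cosh (a * w)))" using min(2) D by (intro mult_left_mono) auto
  moreover have "- (c * (m * (a * sinh (a * w)))) \<le> \<bar>c\<bar> * (m * (a * cosh (a * w)))"
  proof -
    have "- (c * (m * (a * sinh (a * w)))) \<le> \<bar>c\<bar> * (m * (a * \<bar>sinh (a * w)\<bar>))"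
      using abs_ge_minus_self[of "c * (m * (a * sinh (a * w)))"] m a by (simp add: abs_mult)
    also have "\<dots> \<le> \<bar>c\<bar> * (m * (a * cosh (a * w)))" using m a by (intro mult_left_mono abs_sinh_le_cosh) auto
    finally show ?thesis .
  qed
  ultimately have "\<gamma> * (m * cosh (a * w)) \<le> (D * a\<^sup>2 + \<bar>c\<bar> * a) * (m * cosh (a * w))" by (simp add: algebra_simps)
  moreover have "(D * a\<^sup>2 + \<bar>c\<bar> * a) * (m * cosh (a * w)) < \<gamma> * (m * cosh (a * w))"
    using m by (intro mult_strict_right_mono[OF small]) simp
  ultimately show False by linarith
qed

section \<open>From the system to the profile equations; consequences of blow-up\<close>

context kernel
begin

lemma nonlocal_birth_eq:
  assumes g: "continuous_on {0..} g" and \<phi>: "continuous_on UNIV \<phi>" "\<And>x. 0 < \<phi> x" "bounded (range \<phi>)"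
  shows "nonlocal_birth K g (\<lambda>t x. \<phi> (x + c * t)) 0 x = (\<integral>r. g (\<phi> (x - r)) \<partial>\<nu> c)"
proof -
  define h where "h y = g (\<phi> (x - (c * fst y + snd y)))" for y :: "real \<times> real"
  have cg: "continuous_on UNIV (\<lambda>t. g (\<phi> t))"
    by (rule continuous_on_compose2[OF g \<phi>(1)]) (use \<phi>(2) in \<open>auto intro: less_imp_le\<close>)
  have "continuous_on UNIV h" unfolding h_def
    by (rule continuous_on_compose2[OF cg, of UNIV "\<lambda>y. x - (c * fst y + snd y)"]) (auto intro!: continuous_intros)
  then have meas: "h \<in> borel_measurable borel" by (rule borel_measurable_continuous_onI)
  obtain B where B: "\<And>t. \<bar>\<phi> t\<bar> \<le> B" using \<phi>(3) by (auto simp: bounded_iff)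
  have "bounded (g ` {0..B})"
    using g by (intro compact_imp_bounded compact_continuous_image compact_Icc) (auto intro: continuous_on_subset)
  then obtain C where "\<forall>s\<in>{0..B}. \<bar>g s\<bar> \<le> C" by (auto simp: bounded_iff)
  then have C: "\<And>s. s \<in> {0..B} \<Longrightarrow> \<bar>g s\<bar> \<le> C" by blast
  have "\<phi> t \<in> {0..B}" for t using B[of t] \<phi>(2)[of t] by simp
  then have hC: "\<bar>h y\<bar> \<le> C" for y unfolding h_def by (intro C)
  have "nonlocal_birth K g (\<lambda>t x. \<phi> (x + c * t)) 0 x = (LBINT s:{0..}. (LBINT w. K s w * h (s, w)))"
    by (simp add: nonlocal_birth_def h_def algebra_simps)
  also have "\<dots> = (\<integral>y. h y \<partial>M)" by (rule iterated_integral[OF meas hC])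
  also have "\<dots> = (\<integral>r. g (\<phi> (x - r)) \<partial>\<nu> c)"
  proof -
    have "continuous_on UNIV (\<lambda>r. g (\<phi> (x - r)))"
      by (rule continuous_on_compose2[OF cg, of UNIV "\<lambda>r. x - r"]) (auto intro!: continuous_intros)
    then have "(\<lambda>r. g (\<phi> (x - r))) \<in> borel_measurable borel" by (rule borel_measurable_continuous_onI)
    then show ?thesis unfolding \<nu>_def h_def by (subst integral_distr[OF measurable_M[OF exponent_measurable]]) auto
  qed
  finally show ?thesis .
qed

text \<open>The system is evaluated at time 0, where the profiles and their space derivatives can be
  read off directly. The chain rule and uniqueness of derivatives give u_t = c * u_x, also for c =
  0.\<close>

lemma profile_equations:
  assumes wf: "semi_wavefront \<gamma> D K f g c \<phi> \<psi>" and g: "continuous_on {0..} g"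
  defines "N \<equiv> \<lambda>x. \<integral>r. g (\<phi> (x - r)) \<partial>\<nu> c"
  obtains \<phi>' \<psi>' \<psi>'' where "\<And>x. (\<phi> has_real_derivative \<phi>' x) (at x)"
    "\<And>x. (\<phi>' has_real_derivative c * \<phi>' x + f (\<phi> x) - N x) (at x)"
    "\<And>x. (\<psi> has_real_derivative \<psi>' x) (at x)" "\<And>x. (\<psi>' has_real_derivative \<psi>'' x) (at x)"
    "\<And>x. D * \<psi>'' x = c * \<psi>' x + \<gamma> * \<psi> x - g (\<phi> x) + N x"
proof -
  have prof: "semi_wave_profile \<phi>" and sys: "solves_system \<gamma> D K f g (\<lambda>t x. \<phi> (x + c * t)) (\<lambda>t x. \<psi> (x + c * t))"
    using wf by (auto simp: semi_wavefront_def)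
  obtain u_t u_x u_xx v_t v_x v_xx where S: "\<And>t x.
        ((\<lambda>t. \<phi> (x + c * t)) has_real_derivative u_t t x) (at t) \<and>
        ((\<lambda>x. \<phi> (x + c * t)) has_real_derivative u_x t x) (at x) \<and>
        ((\<lambda>x. u_x t x) has_real_derivative u_xx t x) (at x) \<and>
        ((\<lambda>t. \<psi> (x + c * t)) has_real_derivative v_t t x) (at t) \<and>
        ((\<lambda>x. \<psi> (x + c * t)) has_real_derivative v_x t x) (at x) \<and>
        ((\<lambda>x. v_x t x) has_real_derivative v_xx t x) (at x) \<and>
        u_t t x = u_xx t x - f (\<phi> (x + c * t)) + nonlocal_birth K g (\<lambda>t x. \<phi> (x + c * t)) t x \<and>
        v_t t x = D * v_xx t x - \<gamma> * \<psi> (x + c * t) + g (\<phi> (x + c * t)) - nonlocal_birth K g (\<lambda>t x. \<phi> (x + c * t)) t x"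
    using sys unfolding solves_system_def by blast
  have N: "nonlocal_birth K g (\<lambda>t x. \<phi> (x + c * t)) 0 x = N x" for x
    unfolding N_def using prof by (intro nonlocal_birth_eq[OF g]) (auto simp: semi_wave_profile_def)
  have d\<phi>: "(\<phi> has_real_derivative u_x 0 x) (at x)" and d\<psi>: "(\<psi> has_real_derivative v_x 0 x) (at x)" for x
    using S[of x 0] by simp_all
  have chain: "d = c * e" if "(F has_real_derivative e) (at x)" "((\<lambda>t. F (x + c * t)) has_real_derivative d) (at 0)" for F d e and x :: real
  proof -
    have "((\<lambda>t. F (x + c * t)) has_real_derivative e * c) (at 0)"
      by (rule DERIV_chain2[where g = "\<lambda>t. x + c * t"]) (use that(1) in \<open>auto intro!: derivative_eq_intros\<close>)
    from DERIV_unique[OF that(2) this] show ?thesis by simp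
  qed
  have ut: "u_t 0 x = c * u_x 0 x" and vt: "v_t 0 x = c * v_x 0 x" for x
    using chain[OF d\<phi>] chain[OF d\<psi>] S[of x 0] by blast+
  have eq1: "u_xx 0 x = c * u_x 0 x + f (\<phi> x) - N x" for x using S[of x 0] ut[of x] N[of x] by simp
  have eq2: "D * v_xx 0 x = c * v_x 0 x + \<gamma> * \<psi> x - g (\<phi> x) + N x" for x using S[of x 0] vt[of x] N[of x] by simp
  show ?thesis
  proof (rule that[of "u_x 0" "v_x 0" "v_xx 0"])
    show "(u_x 0 has_real_derivative c * u_x 0 x + f (\<phi> x) - N x) (at x)" for x
      unfolding eq1[symmetric] using S[of x 0] by simp
    show "(v_x 0 has_real_derivative v_xx 0 x) (at x)" for x using S[of x 0] by simp
  qed (rule d\<phi> d\<psi> eq2)+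
qed

text \<open>A finite moment at \<open>z\<close> bounds the function on [0, z], so the blow-up point
  lies beyond \<open>z\<close>. Just left of that point the function is positive while the moments
  are still finite.\<close>

lemma blow_up_beyond:
  assumes bl: "blows_up (char_fun a b K) c" and b: "0 < b" and z: "0 < z" "E c z < \<infinity>"
  shows "\<exists>y>z. E c y < \<infinity> \<and> 0 < y\<^sup>2 - c * y - a + b * finite_borel.lap (\<nu> c) y"
proof -
  interpret finite_borel "\<nu> c" by (rule finite_borel_nu)
  obtain G :: ereal where G: "0 < G" "\<And>z. 0 \<le> z \<Longrightarrow> ereal z < G \<Longrightarrow> char_fun a b K z c < \<infinity>"
    and lim: "((\<lambda>z. char_fun a b K (real_of_ereal z) c) \<longlongrightarrow> \<infinity>) (at_left G)"
    using bl by (auto simp: blows_up_def)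
  have fin: "E c y < \<infinity>" if "0 \<le> y" "ereal y < G" for y using G(2)[OF that] char_fun_infinite[of c y b a] b by auto
  have large: "\<exists>y. max 0 x < y \<and> ereal y < G \<and> ereal r < char_fun a b K y c" if x: "ereal x < G" for x r
  proof -
    have "eventually (\<lambda>z. ereal r < char_fun a b K (real_of_ereal z) c) (at_left G)"
      using lim unfolding tendsto_PInfty by blast
    then have "\<exists>l<G. \<forall>y>l. y < G \<longrightarrow> ereal r < char_fun a b K (real_of_ereal y) c"
      by (subst (asm) eventually_at_left[OF G(1)])
    then obtain l where l: "l < G" "\<forall>y>l. y < G \<longrightarrow> ereal r < char_fun a b K (real_of_ereal y) c" by (elim exE conjE)
    have "max l (max 0 (ereal x)) < G" using l(1) G(1) x by simp
    from dense[OF this] obtain y where y: "max l (max 0 (ereal x)) < y" "y < G" by blast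
    have "0 < y" using y(1) by simp
    moreover have "y \<noteq> \<infinity>" using y(2) by auto
    ultimately obtain y' where y': "y = ereal y'" by (cases y) simp_all
    have "ereal r < char_fun a b K y' c" using l(2)[rule_format, of y] y unfolding y' by simp
    moreover have "max 0 x < y'" using y(1) unfolding y' by (simp add: zero_ereal_def)
    ultimately show ?thesis using y(2) unfolding y' by blast
  qed
  have mz: "mom z" using z by (simp add: mom_iff)
  have "ereal z < G"
  proof (rule ccontr)
    assume "\<not> ereal z < G"
    then have Gz: "G \<le> ereal z" by simp
    \<comment> \<open>The level is an upper bound for the function on [0, z], since
      \<open>lap\<close> is at most the sum of its values at 0 and \<open>z\<close> there.\<close>
    obtain y where y: "max 0 0 < y" "ereal y < G" "ereal (z\<^sup>2 + \<bar>c\<bar> * z + \<bar>a\<bar> + b * (lap 0 + lap z)) < char_fun a b K y c"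
      using large[of 0] G(1) by (auto simp: zero_ereal_def)
    have yz: "y < z" using y(2) Gz by (metis ereal_less_ereal_Ex less_le_trans less_ereal.simps(1))
    have my: "mom y" using y fin[of y] by (simp add: mom_iff)
    have "lap y \<le> (\<integral>r. exp (- 0 * r) + exp (- z * r) \<partial>\<nu> c)"
      unfolding lap_def by (rule integral_mono) (use my mz mom_0 exp_between[of 0 y z] y yz in \<open>auto simp: mom_def\<close>)
    also have "\<dots> = lap 0 + lap z" using mz mom_0 unfolding lap_def mom_def by (rule Bochner_Integration.integral_add[rotated])
    finally have "b * lap y \<le> b * (lap 0 + lap z)" using b by simp
    moreover have "y\<^sup>2 \<le> z\<^sup>2" using y yz by (intro power_mono) auto
    moreover have "- (c * y) \<le> \<bar>c\<bar> * z"
    proof -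
      have "- (c * y) \<le> \<bar>c\<bar> * y" using abs_ge_minus_self[of "c * y"] y by (simp add: abs_mult)
      also have "\<dots> \<le> \<bar>c\<bar> * z" using yz by (intro mult_left_mono) auto
      finally show ?thesis .
    qed
    moreover have "- a \<le> \<bar>a\<bar>" by simp
    ultimately have "y\<^sup>2 - c * y - a + b * lap y \<le> z\<^sup>2 + \<bar>c\<bar> * z + \<bar>a\<bar> + b * (lap 0 + lap z)" by linarith
    then show False using y(3) fin[of y] y by (simp add: char_fun_finite)
  qed
  from large[OF this, of 0] obtain y where y: "max 0 z < y" "ereal y < G" "ereal 0 < char_fun a b K y c" by blast
  then have "E c y < \<infinity>" using fin[of y] by simp
  then show ?thesis using y by (intro exI[of _ y]) (simp add: char_fun_finite)
qed

lemma blow_up_finite: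
  assumes bl: "blows_up (char_fun a b K) c" and b: "0 < b"
  shows "\<exists>z>0. E c z < \<infinity>"
proof -
  obtain G :: ereal where G: "0 < G" "\<And>z. 0 \<le> z \<Longrightarrow> ereal z < G \<Longrightarrow> char_fun a b K z c < \<infinity>"
    using bl by (auto simp: blows_up_def)
  obtain y where y: "0 < y" "y < G" using dense[OF G(1)] by blast
  then obtain z where "y = ereal z" by (cases y) auto
  then have "0 < z" "char_fun a b K z c < \<infinity>" using y G(2)[of z] by auto
  then show ?thesis using char_fun_infinite[of c z b a] b by (intro exI[of _ z]) auto
qed

end

theorem theorem5p3:
  fixes \<gamma> D L :: real and K :: "real \<Rightarrow> real \<Rightarrow> real" and f g :: "real \<Rightarrow> real"
  assumes "0 < \<gamma>" and "0 < D"
    and "wave_kernel K"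
    and "H1 g" and "H2 f g" and "H3 f g"
    and "\<And>c. blows_up (chi_0 K f g) c"
    and "0 < L"
    and "\<And>s\<^sub>1 s\<^sub>2. 0 \<le> s\<^sub>1 \<Longrightarrow> 0 \<le> s\<^sub>2 \<Longrightarrow> \<bar>g s\<^sub>1 - g s\<^sub>2\<bar> \<le> L * \<bar>s\<^sub>1 - s\<^sub>2\<bar>"
  shows "(\<forall>c. admissible_speed \<gamma> D K f g c \<and> min_root_speed (chi_L K f L) \<le> c \<longrightarrow>
              unique_mod_translation \<gamma> D K f g c) \<and>
         (\<forall>c. c < min_root_speed (chi_0 K f g) \<longrightarrow>
              \<not> (\<exists>\<phi> \<psi>. semi_wavefront \<gamma> D K f g c \<phi> \<psi>))"
proof -
  interpret kernel K by standard (rule assms(3))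
  define p q m where "p = hderiv g 0" and "q = hderiv f 0" and "m = (INF s\<in>{0..}. hderiv f s)"
  obtain \<alpha> where W: "\<And>c. wave (\<nu> c) p q m L \<alpha> f g"
    using wave_interpretation[OF assms(3-6,9)] unfolding p_def q_def m_def by blast
  \<comment> \<open>Speed 0 serves to extract facts about \<open>f\<close>, \<open>g\<close> and the
    constants that do not involve the speed.\<close>
  interpret W0: wave "\<nu> 0" 0 p q m L \<alpha> f g by (rule W)
  note const = W0.m_le W0.qp W0.pL W0.p_pos W0.q_nonneg W0.L_pos
  have chi0: "chi_0 K f g = char_fun q p K" by (simp add: chi_0_def p_def q_def)
  have chiL: "chi_L K f L = char_fun m L K" by (simp add: chi_L_def m_def)
  note blow = assms(7)[unfolded chi0]
  \<comment> \<open>A finite exponential moment at speed 0 ensures that some speed has a root, so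
    both minimal speeds exist.\<close>
  obtain z0 where z0: "0 < z0" "E 0 z0 < \<infinity>" using blow_up_finite[OF blow const(5)] by blast
  have gc: "continuous_on {0..} g" by (rule W0.g_cont)
  have sol: "\<exists>\<phi>' \<psi>' \<psi>''. wave.sol (\<nu> c) c f g \<phi> \<phi>' \<and> (\<forall>x. (\<psi> has_real_derivative \<psi>' x) (at x)) \<and>
      (\<forall>x. (\<psi>' has_real_derivative \<psi>'' x) (at x)) \<and>
      (\<forall>x. D * \<psi>'' x = c * \<psi>' x + \<gamma> * \<psi> x - g (\<phi> x) + wave.N (\<nu> c) g \<phi> x)"
    if wf: "semi_wavefront \<gamma> D K f g c \<phi> \<psi>" for c \<phi> \<psi>
  proof -
    interpret W: wave "\<nu> c" c p q m L \<alpha> f g by (rule W)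
    have prof: "semi_wave_profile \<phi>" using wf by (simp add: semi_wavefront_def)
    obtain \<phi>' \<psi>' \<psi>'' where eqs: "\<And>x. (\<phi> has_real_derivative \<phi>' x) (at x)"
      "\<And>x. (\<phi>' has_real_derivative c * \<phi>' x + f (\<phi> x) - W.N \<phi> x) (at x)"
      "\<And>x. (\<psi> has_real_derivative \<psi>' x) (at x)" "\<And>x. (\<psi>' has_real_derivative \<psi>'' x) (at x)"
      "\<And>x. D * \<psi>'' x = c * \<psi>' x + \<gamma> * \<psi> x - g (\<phi> x) + W.N \<phi> x"
      using profile_equations[OF wf gc] unfolding W.N_def by blast
    obtain B where B: "\<And>x. \<bar>\<phi> x\<bar> \<le> B" using prof by (auto simp: semi_wave_profile_def bounded_iff)
    have "\<phi> x \<le> \<bar>B\<bar> + 1" for x using B[of x] by linarith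
    then have "W.sol \<phi> \<phi>'"
      unfolding W.sol_def using prof eqs(1,2)
      by (auto simp: semi_wave_profile_def intro: less_imp_le intro!: exI[of _ "\<bar>B\<bar> + 1"])
    then show ?thesis using eqs(3-5) by blast
  qed
  have pos: "0 < \<phi> x" if "semi_wavefront \<gamma> D K f g c \<phi> \<psi>" for c \<phi> \<psi> x
    using that by (simp add: semi_wavefront_def semi_wave_profile_def)
  show ?thesis
  proof (intro conjI allI impI)
    fix c assume c: "admissible_speed \<gamma> D K f g c \<and> min_root_speed (chi_L K f L) \<le> c"
    interpret W: wave "\<nu> c" c p q m L \<alpha> f g by (rule W)
    have mL: "m < L" using const by linarith
    obtain z where z: "0 < z" "nonpos m L (min_root_speed (chi_L K f L)) z"
      using least_speed(1)[OF const(1) mL z0] unfolding chiL by blast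
    then have np: "nonpos m L c z" using nonpos_mono[OF const(7) z(2) _ z(1)] c by simp
    then have Ez: "E c z < \<infinity>" by (simp add: nonpos_def)
    obtain y where y: "z < y" "E c y < \<infinity>" "0 < y\<^sup>2 - c * y - q + p * W.lap y"
      using blow_up_beyond[OF blow const(5) z(1) Ez] by blast
    \<comment> \<open>\<open>chi_L\<close> dominates \<open>chi_0\<close>, so the blow-up assumed
      for \<open>chi_0\<close> also provides a point where \<open>chi_L\<close> is positive.\<close>
    have "p * W.lap y \<le> L * W.lap y" using const W.lap_nonneg by (intro mult_right_mono) auto
    then have yL: "0 < y\<^sup>2 - c * y - m + L * W.lap y" using y(3) const by linarith
    have momz: "W.mom z" "W.mom y" using Ez y by (simp_all add: mom_iff)
    have zL: "z\<^sup>2 - c * z - m + L * W.lap z \<le> 0" using np by (simp add: nonpos_def)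
    show "unique_mod_translation \<gamma> D K f g c"
      unfolding unique_mod_translation_def
    proof (intro allI impI)
      fix \<phi>1 \<psi>1 \<phi>2 \<psi>2
      assume wf: "semi_wavefront \<gamma> D K f g c \<phi>1 \<psi>1 \<and> semi_wavefront \<gamma> D K f g c \<phi>2 \<psi>2"
      then have w1: "semi_wavefront \<gamma> D K f g c \<phi>1 \<psi>1" and w2: "semi_wavefront \<gamma> D K f g c \<phi>2 \<psi>2" by auto
      obtain a1 b1 d1 where 1: "W.sol \<phi>1 a1" "\<And>x. (\<psi>1 has_real_derivative b1 x) (at x)"
        "\<And>x. (b1 has_real_derivative d1 x) (at x)"
        "\<And>x. D * d1 x = c * b1 x + \<gamma> * \<psi>1 x - g (\<phi>1 x) + W.N \<phi>1 x" using sol[OF w1] by blast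
      obtain a2 b2 d2 where 2: "W.sol \<phi>2 a2" "\<And>x. (\<psi>2 has_real_derivative b2 x) (at x)"
        "\<And>x. (b2 has_real_derivative d2 x) (at x)"
        "\<And>x. D * d2 x = c * b2 x + \<gamma> * \<psi>2 x - g (\<phi>2 x) + W.N \<phi>2 x" using sol[OF w2] by blast
      obtain h where h: "\<And>x. \<phi>2 x = \<phi>1 (x + h)"
        using W.unique_profile[OF 1(1) 2(1) pos[OF w1] pos[OF w2] z(1) momz(1) zL y(1) momz(2) yL] by blast
      have Nh: "W.N \<phi>2 x = W.N \<phi>1 (x + h)" for x by (simp add: W.N_def h algebra_simps)
      obtain B1 where B1: "\<And>x. \<bar>\<psi>1 x\<bar> \<le> B1" using w1 by (auto simp: semi_wavefront_def semi_wave_profile_def bounded_iff)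
      obtain B2 where B2: "\<And>x. \<bar>\<psi>2 x\<bar> \<le> B2" using w2 by (auto simp: semi_wavefront_def semi_wave_profile_def bounded_iff)
      \<comment> \<open>Once the first components agree, the sources in the equations for the second
        ones coincide, and the difference is a bounded solution of the homogeneous linear
        equation.\<close>
      have "\<psi>2 x - \<psi>1 (x + h) = 0" for x
      proof (rule bounded_solution_zero[OF assms(2,1), where e = "\<lambda>x. \<psi>2 x - \<psi>1 (x + h)" and B = "B1 + B2" and e' = "\<lambda>x. b2 x - b1 (x + h)"
          and e'' = "\<lambda>x. d2 x - d1 (x + h)" and c = c])
        show "\<bar>\<psi>2 x - \<psi>1 (x + h)\<bar> \<le> B1 + B2" for x using B1[of "x + h"] B2[of x] by linarith
        show "((\<lambda>x. \<psi>2 x - \<psi>1 (x + h)) has_real_derivative b2 x - b1 (x + h)) (at x)" for x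
          using DERIV_diff[OF 2(2) DERIV_compose_diff[OF 1(2), of "- h"]] by simp
        show "((\<lambda>x. b2 x - b1 (x + h)) has_real_derivative d2 x - d1 (x + h)) (at x)" for x
          using DERIV_diff[OF 2(3) DERIV_compose_diff[OF 1(3), of "- h"]] by simp
        show "D * (d2 x - d1 (x + h)) = c * (b2 x - b1 (x + h)) + \<gamma> * (\<psi>2 x - \<psi>1 (x + h))" for x
          using 1(4)[of "x + h"] 2(4)[of x] h[of x] Nh[of x] by (simp add: right_diff_distrib)
      qed
      then show "\<exists>h. \<forall>x. \<phi>2 x = \<phi>1 (x + h) \<and> \<psi>2 x = \<psi>1 (x + h)" using h by auto
    qed
  next
    fix c assume c: "c < min_root_speed (chi_0 K f g)"
    show "\<not> (\<exists>\<phi> \<psi>. semi_wavefront \<gamma> D K f g c \<phi> \<psi>)"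
    proof
      assume "\<exists>\<phi> \<psi>. semi_wavefront \<gamma> D K f g c \<phi> \<psi>"
      then obtain \<phi> \<psi> where wf: "semi_wavefront \<gamma> D K f g c \<phi> \<psi>" by blast
      interpret W: wave "\<nu> c" c p q m L \<alpha> f g by (rule W)
      obtain \<phi>' where "W.sol \<phi> \<phi>'" using sol[OF wf] by blast
      from W.characteristic_nonpos[OF this pos[OF wf]] obtain z where z: "0 < z" "W.mom z" "W.chi0 z \<le> 0" by blast
      then have "nonpos q p c z" by (simp add: nonpos_def mom_iff W.chi0_def)
      from least_speed(2)[OF const(6,3) z0 z(1) this] c show False unfolding chi0 by simp
    qed
  qed
qed

end
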